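(* Let $\rho\in\mathcal M^\flat$ and let $x_\star=\sup\{y\in[0,1]\colon\rho([y,1])>0\}$. Suppose $\mathfrak z(\rho)=\mathfrak z_c$, where $\mathfrak z_c=\frac1b$. Then there are functions $\tau,\mathcal T\colon(1-x_\star,\infty)\to(0,\infty)$ and $\varTheta\colon[0,\infty)\to[0,\infty)$ such that the following holds: (1) If $\rho'\in\mathcal M^\flat$ and $\rho_\alpha=\alpha\rho'+(1-\alpha)\rho$ satisfies $\mathfrak z(\rho_\alpha)<\mathfrak z_c$ for all $\alpha\in(0,1]$, then for all $v>1-x_\star$, $$\mathbb E_{\rho_\alpha}\bigl(|\mathcal A^{(v)}|\bigr)=\frac{\tau(v)}{\mathfrak z_c-\mathfrak z(\rho_\alpha)}\bigl[1+o(1)\bigr],\qquad\alpha\downarrow0.$$ (2) For all $v\ge0$, $$\mathbb P_\rho\bigl(|\mathcal A^{(v)}|\ge n\bigr)=\frac{\varTheta(v)}{n^{1/2}}\bigl[1+o(1)\bigr],\qquad n\to\infty,$$ where $\varTheta(v)>0$ for $v>1-x_\star$. (3) If $\rho'\in\mathcal M^\flat$ and $\rho_\alpha=\alpha\rho'+(1-\alpha)\rho$ satisfies $\mathfrak z(\rho_\alpha)>\mathfrak z_c$ for all $\alpha\in(0,1]$, then for all $v>1-x_\star$, $$\mathbb P_{\rho_\alpha}\bigl(|\mathcal A^{(v)}|=\infty\bigr)=\bigl(\mathfrak z(\rho_\alpha)-\mathfrak z_c\bigr)\,\mathcal T(v)\bigl[1+o(1)\bigr],\qquad\alpha\downarr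ow0.$$
   Context: Let $b>1$ be an integer and let $\mathbb T_b$ be the $b$-nary rooted tree: the sites of layer $k\ge0$ are the sequences $\sigma=(\sigma_1,\dots,\sigma_k)\in\{1,\dots,b\}^k$; write $|\sigma|=k$; the root $\varnothing$ is the empty sequence; for $|\sigma|=k\ge1$ the mother of $\sigma$ is $m(\sigma)=(\sigma_1,\dots,\sigma_{k-1})$. For a Borel probability measure $\rho$ on $[0,1]$ let $\boldsymbol X=(X_\sigma)_{\sigma\in\mathbb T_b}$ be i.i.d. with law $\rho$, with joint law $\mathbb P_\rho=\rho^{\mathbb T_b}$ and expectation $\mathbb E_\rho$. Avalanche process. For $v\in[0,\infty)$ put $X^{(v)}_\varnothing(0)=X_\varnothing+v$ and $X^{(v)}_\sigma(0)=X_\sigma$ for $\sigma\ne\varnothing$, and for $t=0,1,2,\dots$ $$X^{(v)}_\sigma(t+1)=\begin{cases} X^{(v)}_\sigma(t)+\frac1bX^{(v)}_{m(\sigma)}(t),&\text{if }|\sigma|=t+1\text{ and }X^{(v)}_{m(\sigma)}(t)\ge1,\\ 0,&\text{if }|\sigma|=t\text{ and }X^{(v)}_\sigma(t)\ge1,\\ X^{(v)}_\sigma(t),&\text{otherwise.}\end{cases}$$ The avalanche set is $\mathcal A^{(v)}=\bigcup_{t\ge0}\{\sigma\colon X^{(v)}_\sigma(t)=0,\ X^{(v)}_\sigma(s)\ne0\text{ for some }s<t\}$, and $|\mathcal A^{(v)}|$ is its (possibly infinite) cardinality. $\mathcal M^\flat$ is the set of Borel probability measures $\rho$ on $[0,1]$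 that are absolutely continuous with respect to Lebesgue measure with a density $\phi_\rho$ satisfying $\|\phi_\rho\|_\infty<\infty$ (essential supremum norm), and that satisfy $\rho([1-\frac1b,1])>0$. The functional $\mathfrak z$. Let $X_1,X_2,\dots$ be i.i.d. with law $\rho$ under $\mathbb P$. For $\theta\ge0$ let $Q_0^{(\theta)}=\theta$ and $Q_n^{(\theta)}=X_n+\frac{X_{n-1}}b+\dots+\frac{X_1}{b^{n-1}}+\frac{\theta}{b^n}$ for $n\ge1$, and $Z_n(\theta)=\mathbb P(Q_k^{(\theta)}\ge1,\ k=0,\dots,n)$. Then $\mathfrak z(\rho)=\lim_{n\to\infty}Z_n(\theta)^{1/n}$ for $\theta\ge1$; this limit exists and does not depend on $\theta\ge1$. *)

theory Defs
  imports "HOL-Probability.Probability" "HOL-Library.Landau_Symbols"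
begin

section \<open>The tree and the avalanche process\<close>

text \<open>A site is the list of its labels; the root is \<open>[]\<close> and the mother of \<open>\<sigma>\<close> is
  \<^term>\<open>butlast \<sigma>\<close>.\<close>

definition tree :: "nat \<Rightarrow> nat list set" where
  "tree b = {\<sigma>. set \<sigma> \<subseteq> {1..b}}"

definition tree_law :: "nat \<Rightarrow> real measure \<Rightarrow> (nat list \<Rightarrow> real) measure" where
  "tree_law b \<rho> = PiM (tree b) (\<lambda>_. \<rho>)"

primrec avalanche_process ::
  "nat \<Rightarrow> real \<Rightarrow> (nat list \<Rightarrow> real) \<Rightarrow> nat \<Rightarrow> nat list \<Rightarrow> real" where
  "avalanche_process b v x 0 = (\<lambda>\<sigma>. if \<sigma> = [] then x [] + v else x \<sigma>)"
| "avalanche_process b v x (Suc t) = (\<lambda>\<sigma>.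
     if length \<sigma> = t + 1 \<and> avalanche_process b v x t (butlast \<sigma>) \<ge> 1
       then avalanche_process b v x t \<sigma> + 1 / real b * avalanche_process b v x t (butlast \<sigma>)
     else if length \<sigma> = t \<and> avalanche_process b v x t \<sigma> \<ge> 1
       then 0
     else avalanche_process b v x t \<sigma>)"

definition avalanche_set :: "nat \<Rightarrow> real \<Rightarrow> (nat list \<Rightarrow> real) \<Rightarrow> nat list set" where
  "avalanche_set b v x =
     (\<Union>t. {\<sigma> \<in> tree b. avalanche_process b v x t \<sigma> = 0 \<and>
                        (\<exists>s<t. avalanche_process b v x s \<sigma> \<noteq> 0)})"

text \<open>The cardinality is taken in \<^typ>\<open>ennreal\<close> via counting measure, so that an infinite
  avalanche has size \<open>\<infinity>\<close> (\<^const>\<open>card\<close> would give \<open>0\<close>).\<close>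

definition avalanche_size :: "nat \<Rightarrow> real \<Rightarrow> (nat list \<Rightarrow> real) \<Rightarrow> ennreal" where
  "avalanche_size b v x = emeasure (count_space UNIV) (avalanche_set b v x)"


section \<open>Single-site laws\<close>

text \<open>Laws on \<open>[0,1]\<close> are Borel measures on the real line that give \<open>[0,1]\<close> full mass.\<close>

definition M_flat :: "nat \<Rightarrow> real measure set" where
  "M_flat b = {\<rho>. prob_space \<rho> \<and> sets \<rho> = sets borel \<and> emeasure \<rho> {0..1} = 1 \<and>
     (\<exists>\<phi> :: real \<Rightarrow> ennreal. \<phi> \<in> borel_measurable lborel \<and> \<rho> = density lborel \<phi> \<and>
        esssup lborel \<phi> < \<infinity>) \<and>
     measure \<rho> {1 - 1 / real b..1} > 0}"

definition x_star :: "real measure \<Rightarrow> real" where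
  "x_star \<rho> = Sup {y \<in> {0..1}. measure \<rho> {y..1} > 0}"

definition mixture :: "real \<Rightarrow> real measure \<Rightarrow> real measure \<Rightarrow> real measure" where
  "mixture \<alpha> \<rho>' \<rho> = measure_of UNIV (sets borel)
     (\<lambda>A. ennreal \<alpha> * emeasure \<rho>' A + ennreal (1 - \<alpha>) * emeasure \<rho> A)"

lemma sets_mixture [simp]: "sets (mixture \<alpha> \<rho>' \<rho>) = sets borel"
  unfolding mixture_def by (metis sets.sets_measure_of_eq space_borel)

lemma emeasure_mixture:
  assumes "sets \<rho>' = sets borel" "sets \<rho> = sets borel" "A \<in> sets borel"
  shows "emeasure (mixture \<alpha> \<rho>' \<rho>) A =
           ennreal \<alpha> * emeasure \<rho>' A + ennreal (1 - \<alpha>) * emeasure \<rho> A"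
proof (rule emeasure_measure_of[OF mixture_def])
  show "sets borel \<subseteq> Pow (UNIV :: real set)" by simp
  show "A \<in> sets (mixture \<alpha> \<rho>' \<rho>)" using assms by simp
  show "positive (sets (mixture \<alpha> \<rho>' \<rho>))
          (\<lambda>A. ennreal \<alpha> * emeasure \<rho>' A + ennreal (1 - \<alpha>) * emeasure \<rho> A)"
    by (simp add: positive_def)
  show "countably_additive (sets (mixture \<alpha> \<rho>' \<rho>))
          (\<lambda>A. ennreal \<alpha> * emeasure \<rho>' A + ennreal (1 - \<alpha>) * emeasure \<rho> A)"
  proof (rule countably_additiveI)
    fix A :: "nat \<Rightarrow> real set"
    assume A: "range A \<subseteq> sets (mixture \<alpha> \<rho>' \<rho>)" "disjoint_family A"
    then have "(\<Sum>i. emeasure \<rho>' (A i)) = emeasure \<rho>' (\<Union>i. A i)"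
      and "(\<Sum>i. emeasure \<rho> (A i)) = emeasure \<rho> (\<Union>i. A i)"
      using assms by (auto intro!: suminf_emeasure)
    then show "(\<Sum>i. ennreal \<alpha> * emeasure \<rho>' (A i) + ennreal (1 - \<alpha>) * emeasure \<rho> (A i)) =
        ennreal \<alpha> * emeasure \<rho>' (\<Union>i. A i) + ennreal (1 - \<alpha>) * emeasure \<rho> (\<Union>i. A i)"
      by (simp add: suminf_add[symmetric])
  qed
qed


section \<open>The functional \<open>\<zz>\<close>\<close>

text \<open>The sequence \<open>x\<close> is indexed from 1, as in
  \<open>Q\<^sub>n = X\<^sub>n + X\<^sub>n\<^sub>-\<^sub>1/b + \<dots> + X\<^sub>1/b\<^sup>n\<^sup>-\<^sup>1 + \<theta>/b\<^sup>n\<close>.\<close>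

definition Q_proc :: "nat \<Rightarrow> real \<Rightarrow> nat \<Rightarrow> (nat \<Rightarrow> real) \<Rightarrow> real" where
  "Q_proc b \<theta> n x = (\<Sum>k=1..n. x k / real b ^ (n - k)) + \<theta> / real b ^ n"

definition Z_prob :: "nat \<Rightarrow> real measure \<Rightarrow> nat \<Rightarrow> real \<Rightarrow> real" where
  "Z_prob b \<rho> n \<theta> = \<P>(x in PiM {1..} (\<lambda>_. \<rho>). \<forall>k\<in>{0..n}. Q_proc b \<theta> k x \<ge> 1)"

text \<open>The description encodes that the limit is the same for all \<open>\<theta> \<ge> 1\<close>.\<close>

definition zz :: "nat \<Rightarrow> real measure \<Rightarrow> real" where
  "zz b \<rho> = (THE z. \<forall>\<theta>\<ge>1. (\<lambda>n. root n (Z_prob b \<rho> n \<theta>)) \<longlonglongrightarrow> z)"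

definition zz_crit :: "nat \<Rightarrow> real" where
  "zz_crit b = 1 / real b"

end

theory Submission
  imports Defs "HOL-Real_Asymp.Real_Asymp"
begin

text \<open>A child of a toppled site of value \<open>\<theta>\<close> has value \<open>X + \<theta> / b\<close>, and it topples iff this is at least 1, so the
  avalanche is a multitype branching process with type space \<open>{1..B}\<close>, \<open>B = max 2 (1 + v)\<close>, driven by the positive
  operator \<open>K f \<theta> = E[f (X + \<theta> / b); X + \<theta> / b \<ge> 1]\<close>.  The operator satisfies a Harnack inequality and a minorization,
  both uniform along the mixtures: the survival probabilities of the walk contract, and two steps have a continuous
  density.  Hence \<open>K\<close> has an eigenvalue \<open>\<Lambda> = \<zz>(\<rho>)\<close>, a positive eigenfunction \<open>h\<close> and a left eigenfunctional \<open>\<nu>\<close>,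
  with a spectral gap, and all of these depend continuously on \<open>\<rho>\<close>.

  The mean size is \<open>\<Sum>j. b\<^sup>j K (K\<^sup>j 1) (b v)\<close>, which is asymptotic to \<open>K h (b v) / (1 - b \<Lambda>)\<close> as \<open>b \<Lambda> \<rightarrow> 1\<close>.
  The survival probability and the generating function of the size both lead to an equation
  \<open>u = 1 - s (1 - K u)\<^sup>b\<close>.  A small solution is close to \<open>n h\<close> with \<open>n = \<nu> u\<close>, and applying \<open>\<nu>\<close> to the second-order
  expansion of the equation gives \<open>(1 - s) + (b \<Lambda> - 1) n = c n\<^sup>2 (1 + o(1))\<close>.  For \<open>s = 1\<close> this determines the
  survival probability; for \<open>b \<Lambda> = 1\<close> it gives \<open>n \<sim> sqrt ((1 - s) / c)\<close> as \<open>s \<rightarrow> 1\<close>, from which Karamata's theorem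
  recovers the tail of the size, because the tail probabilities are monotone.\<close>

section \<open>Positive kernels with a Doeblin and a Harnack condition\<close>

text \<open>The kernel \<open>K\<close> loses mass, so Doeblin's contraction is applied not to it
  but to expectations conditioned on survival. Conditioning reweights by
  \<open>survival K n\<close>; the Harnack constant \<open>C\<close>, which does not depend on
  \<open>n\<close>, keeps the minorization effective under this reweighting. Every spectral object
  is then a limit with a rate depending only on \<open>C\<close>, \<epsilon> and \<open>m\<close>,
  and continuity in the law follows by fixing a time and comparing finitely many steps. All laws
  must share these constants: the mixture weight is kept at most 1/2, so that the mixture dominates
  half of the critical law and inherits its minorization. The near-critical expansion is done once,
  for a family indexed by an arbitrary filter: with index \<alpha> and a moving kernel for survival,
  with index \<open>s\<close> and a fixed kernel for the generating function. The amount
  \<open>v\<close> added at the root enters only through a final application of \<open>K\<close> at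
  \<open>b v\<close>, because \<open>X + v = X + (b v) / b\<close>; this point may lie outside the
  type space, so \<open>K f\<close> is controlled at every real point.\<close>

definition bfun :: "'a measure \<Rightarrow> ('a \<Rightarrow> real) set" where
  "bfun M = {f \<in> borel_measurable M. \<exists>C. \<forall>x\<in>space M. \<bar>f x\<bar> \<le> C}"

lemma bfunI: "f \<in> borel_measurable M \<Longrightarrow> (\<And>x. x \<in> space M \<Longrightarrow> \<bar>f x\<bar> \<le> C) \<Longrightarrow> f \<in> bfun M"
  by (auto simp: bfun_def)

lemma bfun_measurable: "f \<in> bfun M \<Longrightarrow> f \<in> borel_measurable M"
  by (simp add: bfun_def)

lemma bfun_bound:
  assumes "f \<in> bfun M"
  obtains c where "0 \<le> c" "\<And>x. x \<in> space M \<Longrightarrow> \<bar>f x\<bar> \<le> c"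
proof -
  obtain c where "\<And>x. x \<in> space M \<Longrightarrow> \<bar>f x\<bar> \<le> c"
    using assms by (auto simp: bfun_def)
  then show ?thesis
    by (intro that[of "max 0 c"]) (auto intro: max.coboundedI2)
qed

lemma bfun_const [simp]: "(\<lambda>_. c) \<in> bfun M"
  by (auto simp: bfun_def)

lemma bfun_add [intro]: "f \<in> bfun M \<Longrightarrow> g \<in> bfun M \<Longrightarrow> (\<lambda>x. f x + g x) \<in> bfun M"
proof -
  assume f: "f \<in> bfun M" and g: "g \<in> bfun M"
  obtain c where "\<And>x. x \<in> space M \<Longrightarrow> \<bar>f x\<bar> \<le> c" using bfun_bound[OF f] by metis
  moreover obtain d where "\<And>x. x \<in> space M \<Longrightarrow> \<bar>g x\<bar> \<le> d" using bfun_bound[OF g] by metis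
  ultimately show ?thesis
    using bfun_measurable[OF f] bfun_measurable[OF g]
    by (intro bfunI[where C = "c + d"] borel_measurable_add)
       (auto intro: order_trans[OF abs_triangle_ineq] add_mono)
qed

lemma bfun_mult [intro]: "f \<in> bfun M \<Longrightarrow> g \<in> bfun M \<Longrightarrow> (\<lambda>x. f x * g x) \<in> bfun M"
proof -
  assume f: "f \<in> bfun M" and g: "g \<in> bfun M"
  obtain c where "0 \<le> c" "\<And>x. x \<in> space M \<Longrightarrow> \<bar>f x\<bar> \<le> c" using bfun_bound[OF f] by metis
  moreover obtain d where "\<And>x. x \<in> space M \<Longrightarrow> \<bar>g x\<bar> \<le> d" using bfun_bound[OF g] by metis
  ultimately show ?thesis
    using bfun_measurable[OF f] bfun_measurable[OF g]
    by (intro bfunI[where C = "c * d"] borel_measurable_times) (auto simp: abs_mult intro!: mult_mono)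
qed

lemma bfun_scale [intro]: "f \<in> bfun M \<Longrightarrow> (\<lambda>x. c * f x) \<in> bfun M"
  using bfun_mult[of "\<lambda>_. c" M f] by simp

lemma bfun_diff [intro]: "f \<in> bfun M \<Longrightarrow> g \<in> bfun M \<Longrightarrow> (\<lambda>x. f x - g x) \<in> bfun M"
  using bfun_add[of f M "\<lambda>x. -1 * g x"] bfun_scale[of g M "-1"] by simp

lemma bfun_power [intro]: "f \<in> bfun M \<Longrightarrow> (\<lambda>x. f x ^ n) \<in> bfun M"
  by (induction n) auto

lemma bfun_lim:
  assumes "\<And>n. f n \<in> bfun M" "\<And>x. x \<in> space M \<Longrightarrow> (\<lambda>n. f n x) \<longlonglongrightarrow> g x"
    and "\<And>n x. x \<in> space M \<Longrightarrow> \<bar>f n x\<bar> \<le> C"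
  shows "g \<in> bfun M"
proof (rule bfunI)
  show "g \<in> borel_measurable M"
    by (rule borel_measurable_LIMSEQ_metric[OF bfun_measurable[OF assms(1)] assms(2)])
  show "\<bar>g x\<bar> \<le> C" if "x \<in> space M" for x
    using assms(3)[OF that] by (intro LIMSEQ_le_const2[OF tendsto_rabs[OF assms(2)[OF that]]]) auto
qed

text \<open>The constants \<open>p\<close>, \<open>C\<close>, \<epsilon>, \<open>m\<close> and the
  functional \<eta> are parameters, so that a whole family of kernels can share them; \<eta> plays
  the part of the minorizing probability measure. \<open>K_mono\<close> and \<open>K_one_le\<close>
  are required at every point, also off \<open>space M\<close>, because the kernel is later
  evaluated at points outside the type space.\<close>

locale doeblin_kernel =
  fixes M :: "'a measure" and K :: "('a \<Rightarrow> real) \<Rightarrow> 'a \<Rightarrow> real"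
    and p C \<epsilon> :: real and m :: nat and \<eta> :: "('a \<Rightarrow> real) \<Rightarrow> real" and x\<^sub>0 :: 'a
  assumes K_bfun [intro]: "f \<in> bfun M \<Longrightarrow> K f \<in> bfun M"
    and K_add: "f \<in> bfun M \<Longrightarrow> g \<in> bfun M \<Longrightarrow> K (\<lambda>x. f x + g x) = (\<lambda>x. K f x + K g x)"
    and K_scale: "f \<in> bfun M \<Longrightarrow> K (\<lambda>x. c * f x) = (\<lambda>x. c * K f x)"
    and K_mono: "f \<in> bfun M \<Longrightarrow> g \<in> bfun M \<Longrightarrow> (\<And>x. x \<in> space M \<Longrightarrow> f x \<le> g x) \<Longrightarrow> K f x \<le> K g x"
    and K_one_le: "K (\<lambda>_. 1) x \<le> 1"
    and K_one_ge: "x \<in> space M \<Longrightarrow> p \<le> K (\<lambda>_. 1) x"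
    and p_pos: "0 < p"
    and harnack: "x \<in> space M \<Longrightarrow> y \<in> space M \<Longrightarrow> (K ^^ n) (\<lambda>_. 1) x \<le> C * (K ^^ n) (\<lambda>_. 1) y"
    and minorization: "f \<in> bfun M \<Longrightarrow> (\<And>x. x \<in> space M \<Longrightarrow> 0 \<le> f x) \<Longrightarrow> x \<in> space M \<Longrightarrow>
          \<epsilon> * \<eta> f \<le> (K ^^ m) f x"
    and \<epsilon>_pos: "0 < \<epsilon>" and m_pos: "0 < m"
    and \<eta>_add: "f \<in> bfun M \<Longrightarrow> g \<in> bfun M \<Longrightarrow> \<eta> (\<lambda>x. f x + g x) = \<eta> f + \<eta> g"
    and \<eta>_scale: "f \<in> bfun M \<Longrightarrow> \<eta> (\<lambda>x. c * f x) = c * \<eta> f"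
    and \<eta>_mono: "f \<in> bfun M \<Longrightarrow> g \<in> bfun M \<Longrightarrow> (\<And>x. x \<in> space M \<Longrightarrow> f x \<le> g x) \<Longrightarrow> \<eta> f \<le> \<eta> g"
    and \<eta>_one: "\<eta> (\<lambda>_. 1) = 1"
    and x\<^sub>0 [simp]: "x\<^sub>0 \<in> space M"

definition survival :: "(('a \<Rightarrow> real) \<Rightarrow> 'a \<Rightarrow> real) \<Rightarrow> nat \<Rightarrow> 'a \<Rightarrow> real" where
  "survival K n = (K ^^ n) (\<lambda>_. 1)"

text \<open>Expectation of \<open>f\<close> after \<open>n\<close> steps, conditioned on surviving
  these \<open>n\<close> steps.\<close>

definition cond_exp :: "(('a \<Rightarrow> real) \<Rightarrow> 'a \<Rightarrow> real) \<Rightarrow> nat \<Rightarrow> ('a \<Rightarrow> real) \<Rightarrow> 'a \<Rightarrow> real" where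
  "cond_exp K n f x = (K ^^ n) f x / survival K n x"

text \<open>The quasi-stationary distribution as a functional, obtained as a Yaglom limit. The start
  \<open>x\<^sub>0\<close> is a mere choice: \<open>r_rate\<close> gives the same limit from every
  point of the space.\<close>

definition qsd :: "(('a \<Rightarrow> real) \<Rightarrow> 'a \<Rightarrow> real) \<Rightarrow> 'a \<Rightarrow> ('a \<Rightarrow> real) \<Rightarrow> real" where
  "qsd K x\<^sub>0 f = lim (\<lambda>n. cond_exp K n f x\<^sub>0)"

text \<open>The chance that a quasi-stationary particle survives one more step.\<close>

definition eigval :: "(('a \<Rightarrow> real) \<Rightarrow> 'a \<Rightarrow> real) \<Rightarrow> 'a \<Rightarrow> real" where
  "eigval K x\<^sub>0 = qsd K x\<^sub>0 (K (\<lambda>_. 1))"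

text \<open>With this normalization \<open>qsd\<close> of the eigenfunction is 1, since
  \<open>qsd\<close> of \<open>survival K n\<close> is the \<open>n\<close>-th power of the
  eigenvalue and the convergence is uniform. So \<open>qsd u\<close> is the coefficient of
  \<open>u\<close> along the eigenfunction.\<close>

definition eigfun :: "(('a \<Rightarrow> real) \<Rightarrow> 'a \<Rightarrow> real) \<Rightarrow> 'a \<Rightarrow> 'a \<Rightarrow> real" where
  "eigfun K x\<^sub>0 x = lim (\<lambda>n. survival K n x / eigval K x\<^sub>0 ^ n)"

context doeblin_kernel
begin

abbreviation "Z \<equiv> survival K"
abbreviation "r \<equiv> cond_exp K"
abbreviation "\<nu> \<equiv> qsd K x\<^sub>0"
abbreviation "\<Lambda> \<equiv> eigval K x\<^sub>0"
abbreviation "h \<equiv> eigfun K x\<^sub>0"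

lemma K_diff: "f \<in> bfun M \<Longrightarrow> g \<in> bfun M \<Longrightarrow> K (\<lambda>x. f x - g x) = (\<lambda>x. K f x - K g x)"
  using K_add[of f "\<lambda>x. -1 * g x"] K_scale[of g "-1"] bfun_scale[of g M "-1"] by simp

lemma Kn_bfun [intro]: "f \<in> bfun M \<Longrightarrow> (K ^^ n) f \<in> bfun M"
  by (induction n) auto

lemma Kn_add: "f \<in> bfun M \<Longrightarrow> g \<in> bfun M \<Longrightarrow> (K ^^ n) (\<lambda>x. f x + g x) = (\<lambda>x. (K ^^ n) f x + (K ^^ n) g x)"
  by (induction n) (auto simp: K_add Kn_bfun)

lemma Kn_diff: "f \<in> bfun M \<Longrightarrow> g \<in> bfun M \<Longrightarrow> (K ^^ n) (\<lambda>x. f x - g x) = (\<lambda>x. (K ^^ n) f x - (K ^^ n) g x)"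
  by (induction n) (auto simp: K_diff Kn_bfun)

lemma Kn_scale: "f \<in> bfun M \<Longrightarrow> (K ^^ n) (\<lambda>x. c * f x) = (\<lambda>x. c * (K ^^ n) f x)"
  by (induction n) (auto simp: K_scale Kn_bfun)

lemma Kn_mono:
  assumes "f \<in> bfun M" "g \<in> bfun M" "\<And>x. x \<in> space M \<Longrightarrow> f x \<le> g x" "x \<in> space M"
  shows "(K ^^ n) f x \<le> (K ^^ n) g x"
  using assms(4)
proof (induction n arbitrary: x)
  case (Suc n)
  show ?case using Suc.IH assms by (auto intro!: K_mono)
qed (use assms in auto)

lemma Kn_const: "(K ^^ n) (\<lambda>_. c) x = c * Z n x"
  using Kn_scale[of "\<lambda>_. 1" n c] by (simp add: survival_def)

lemma K_const: "K (\<lambda>_. c) x = c * K (\<lambda>_. 1) x"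
  using K_scale[of "\<lambda>_. 1" c] by simp

lemma Z_bfun [simp, intro]: "Z n \<in> bfun M"
  unfolding survival_def by auto

lemma Z_Suc: "Z (Suc n) = K (Z n)"
  by (simp add: survival_def)

lemma Z_0 [simp]: "Z 0 x = 1"
  by (simp add: survival_def)

lemma Kn_Z: "(K ^^ n) (Z k) = Z (n + k)"
  by (simp add: survival_def funpow_add)

text \<open>By Harnack \<open>Z n\<close> is at least the constant \<open>Z n x / C\<close>, and one
  step applied to a constant keeps at least the fraction \<open>p\<close> of it.\<close>

lemma Z_pos [simp]: "x \<in> space M \<Longrightarrow> 0 < Z n x"
proof (induction n arbitrary: x)
  case (Suc n)
  have C: "Z n x \<le> C * Z n y" if "y \<in> space M" for y
    using harnack[OF Suc.prems that] by (simp add: survival_def)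
  have Cp: "0 < C"
    using C[OF Suc.prems] Suc.IH[OF Suc.prems] by (metis less_le_trans zero_less_mult_pos2)
  have "p * (Z n x / C) \<le> (Z n x / C) * K (\<lambda>_. 1) x"
    using K_one_ge[OF Suc.prems] Suc.IH[OF Suc.prems] Cp by (simp add: mult.commute divide_right_mono)
  also have "\<dots> = K (\<lambda>_. Z n x / C) x"
    by (rule K_const[symmetric])
  also have "\<dots> \<le> K (Z n) x"
    using C Cp by (intro K_mono) (auto simp: field_simps)
  finally have "p * (Z n x / C) \<le> K (Z n) x" .
  moreover have "0 < p * (Z n x / C)"
    using p_pos Suc.IH[OF Suc.prems] Cp by simp
  ultimately show ?case by (simp add: Z_Suc)
qed (simp add: survival_def)

lemma Z_nz [simp]: "x \<in> space M \<Longrightarrow> Z n x \<noteq> 0"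
  using Z_pos[of x n] by force

lemma Z_harnack: "x \<in> space M \<Longrightarrow> y \<in> space M \<Longrightarrow> Z n x \<le> C * Z n y"
  unfolding survival_def by (rule harnack)

lemma C_ge_1: "1 \<le> C"
  using Z_harnack[OF x\<^sub>0 x\<^sub>0, of 0] by simp

lemma Z_decreasing: "x \<in> space M \<Longrightarrow> Z (n + k) x \<le> Z n x"
proof -
  have le1: "Z k y \<le> 1" if "y \<in> space M" for y
    using that
  proof (induction k arbitrary: y)
    case (Suc k)
    have "K (Z k) y \<le> K (\<lambda>_. 1) y"
      using Suc by (intro K_mono) auto
    then show ?case using K_one_le[of y] by (simp add: Z_Suc)
  qed simp
  assume "x \<in> space M"
  then have "(K ^^ n) (Z k) x \<le> (K ^^ n) (\<lambda>_. 1) x"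
    using le1 by (intro Kn_mono) auto
  then show ?thesis by (simp add: Kn_Z) (simp add: survival_def)
qed

lemma Z_le_1: "x \<in> space M \<Longrightarrow> Z n x \<le> 1"
  using Z_decreasing[of x 0 n] by simp

text \<open>\<open>r (n + k) f x\<close> is an average of the values of \<open>r n f\<close>, with
  weights proportional to \<open>Z n\<close> transported by \<open>K ^^ k\<close>; so bounds valid
  at time \<open>n\<close> persist.\<close>

lemma r_between:
  assumes f: "f \<in> bfun M" and le: "\<And>x. x \<in> space M \<Longrightarrow> a \<le> r n f x \<and> r n f x \<le> A" and x: "x \<in> space M"
  shows "a \<le> r (n + k) f x" "r (n + k) f x \<le> A"
proof -
  have *: "(K ^^ (n + k)) f x = (K ^^ k) ((K ^^ n) f) x"
    by (subst add.commute) (simp add: funpow_add)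
  have bd: "a * Z n y \<le> (K ^^ n) f y" "(K ^^ n) f y \<le> A * Z n y" if "y \<in> space M" for y
    using le[OF that] Z_pos[OF that, of n] by (auto simp: cond_exp_def field_simps)
  have "(K ^^ k) (\<lambda>y. a * Z n y) x \<le> (K ^^ k) ((K ^^ n) f) x"
    using bd f x by (intro Kn_mono) auto
  then show "a \<le> r (n + k) f x"
    using x by (simp add: cond_exp_def * Kn_scale Kn_Z add.commute[of k] pos_le_divide_eq)
  have "(K ^^ k) ((K ^^ n) f) x \<le> (K ^^ k) (\<lambda>y. A * Z n y) x"
    using bd f x by (intro Kn_mono) auto
  then show "r (n + k) f x \<le> A"
    using x by (simp add: cond_exp_def * Kn_scale Kn_Z add.commute[of k] pos_divide_le_eq)
qed

section \<open>Contraction of the conditioned expectations\<close>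

definition q :: real where "q = 1 - \<epsilon> / C\<^sup>2"

lemma q_less_1: "q < 1"
  using \<epsilon>_pos C_ge_1 by (simp add: q_def)

lemma q_nonneg: "0 \<le> q"
proof -
  have "\<epsilon> * 1 \<le> Z m x\<^sub>0"
    using minorization[of "\<lambda>_. 1" x\<^sub>0] by (simp add: \<eta>_one survival_def)
  also have "\<dots> \<le> 1" by (simp add: Z_le_1)
  also have "\<dots> \<le> C\<^sup>2" using C_ge_1 by simp
  finally show ?thesis using C_ge_1 by (simp add: q_def)
qed

text \<open>The minorization is applied to both gaps, \<open>r n f - a\<close> and
  \<open>A - r n f\<close>, each weighted by \<open>Z n\<close>. Which of them gains is unknown, but
  the two gains add up to a multiple of \<open>\<eta> (Z n)\<close>. One factor \<open>C\<close> in
  \<open>q\<close> is lost in comparing \<open>Z (n + m)\<close> with the value of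
  \<open>Z n\<close> at \<open>x\<^sub>0\<close>, the other in bounding \<open>\<eta> (Z n)\<close>
  from below by that value.\<close>

lemma r_contraction:
  assumes f: "f \<in> bfun M" and le: "\<And>x. x \<in> space M \<Longrightarrow> a \<le> r n f x \<and> r n f x \<le> A"
  shows "\<exists>a' A'. A' - a' \<le> q * (A - a) \<and> (\<forall>x\<in>space M. a' \<le> r (n + m) f x \<and> r (n + m) f x \<le> A')"
proof -
  define g\<^sub>1 where "g\<^sub>1 = (\<lambda>x. (K ^^ n) f x - a * Z n x)"
  define g\<^sub>2 where "g\<^sub>2 = (\<lambda>x. A * Z n x - (K ^^ n) f x)"
  have g [simp]: "g\<^sub>1 \<in> bfun M" "g\<^sub>2 \<in> bfun M"
    unfolding g\<^sub>1_def g\<^sub>2_def by (intro bfun_diff bfun_scale Kn_bfun Z_bfun f)+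
  have nn: "0 \<le> g\<^sub>1 y" "0 \<le> g\<^sub>2 y" if "y \<in> space M" for y
    using le[OF that] Z_pos[OF that, of n] by (auto simp: g\<^sub>1_def g\<^sub>2_def cond_exp_def field_simps)
  have \<eta>0: "\<eta> (\<lambda>_. 0) = 0"
    using \<eta>_scale[of "\<lambda>_. 0" 0] by simp
  have \<eta>nn: "0 \<le> \<eta> g\<^sub>1" "0 \<le> \<eta> g\<^sub>2"
    using \<eta>_mono[of "\<lambda>_. 0" g\<^sub>1] \<eta>_mono[of "\<lambda>_. 0" g\<^sub>2] nn by (auto simp: \<eta>0)
  \<comment> \<open>A bound for \<open>Z (n + m)\<close> at every point, which serves as common
    denominator.\<close>
  define D where "D = C * Z n x\<^sub>0"
  have D: "0 < D" using C_ge_1 by (simp add: D_def)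
  have ZD: "Z (n + m) x \<le> D" if "x \<in> space M" for x
    using Z_decreasing[OF that, of n m] Z_harnack[OF that x\<^sub>0, of n] by (simp add: D_def)
  have Kf: "(K ^^ (n + m)) f = (K ^^ m) ((K ^^ n) f)"
    by (subst add.commute) (simp add: funpow_add)
  have lower: "a + \<epsilon> * \<eta> g\<^sub>1 / D \<le> r (n + m) f x" and upper: "r (n + m) f x \<le> A - \<epsilon> * \<eta> g\<^sub>2 / D"
    if x: "x \<in> space M" for x
  proof -
    have Zp: "0 < Z (n + m) x" using x by simp
    have "(K ^^ m) g\<^sub>1 x = (K ^^ (n + m)) f x - a * Z (n + m) x"
      unfolding Kf using f by (simp add: g\<^sub>1_def Kn_diff Kn_scale Kn_Z Kn_bfun bfun_scale add.commute)
    then have "r (n + m) f x = a + (K ^^ m) g\<^sub>1 x / Z (n + m) x"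
      using Zp by (simp add: cond_exp_def field_simps)
    moreover have "\<epsilon> * \<eta> g\<^sub>1 / D \<le> (K ^^ m) g\<^sub>1 x / Z (n + m) x"
    proof -
      have "\<epsilon> * \<eta> g\<^sub>1 / D \<le> \<epsilon> * \<eta> g\<^sub>1 / Z (n + m) x"
        using ZD[OF x] Zp \<epsilon>_pos \<eta>nn by (intro divide_left_mono) auto
      also have "\<dots> \<le> (K ^^ m) g\<^sub>1 x / Z (n + m) x"
        using minorization[OF g(1) nn(1) x] Zp by (simp add: divide_right_mono)
      finally show ?thesis .
    qed
    ultimately show "a + \<epsilon> * \<eta> g\<^sub>1 / D \<le> r (n + m) f x" by simp
    have "(K ^^ m) g\<^sub>2 x = A * Z (n + m) x - (K ^^ (n + m)) f x"
      unfolding Kf using f by (simp add: g\<^sub>2_def Kn_diff Kn_scale Kn_Z Kn_bfun bfun_scale add.commute)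
    then have "r (n + m) f x = A - (K ^^ m) g\<^sub>2 x / Z (n + m) x"
      using Zp by (simp add: cond_exp_def field_simps)
    moreover have "\<epsilon> * \<eta> g\<^sub>2 / D \<le> (K ^^ m) g\<^sub>2 x / Z (n + m) x"
    proof -
      have "\<epsilon> * \<eta> g\<^sub>2 / D \<le> \<epsilon> * \<eta> g\<^sub>2 / Z (n + m) x"
        using ZD[OF x] Zp \<epsilon>_pos \<eta>nn by (intro divide_left_mono) auto
      also have "\<dots> \<le> (K ^^ m) g\<^sub>2 x / Z (n + m) x"
        using minorization[OF g(2) nn(2) x] Zp by (simp add: divide_right_mono)
      finally show ?thesis .
    qed
    ultimately show "r (n + m) f x \<le> A - \<epsilon> * \<eta> g\<^sub>2 / D" by simp
  qed
  have aA: "a \<le> A" using le[OF x\<^sub>0] by simp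
  have "\<eta> g\<^sub>1 + \<eta> g\<^sub>2 = \<eta> (\<lambda>x. g\<^sub>1 x + g\<^sub>2 x)"
    by (simp add: \<eta>_add)
  also have "\<dots> = \<eta> (\<lambda>x. (A - a) * Z n x)"
    by (auto simp: g\<^sub>1_def g\<^sub>2_def algebra_simps)
  also have "\<dots> = (A - a) * \<eta> (Z n)" by (simp add: \<eta>_scale)
  finally have sum: "\<eta> g\<^sub>1 + \<eta> g\<^sub>2 = (A - a) * \<eta> (Z n)" .
  have "Z n x\<^sub>0 / C = \<eta> (\<lambda>_. Z n x\<^sub>0 / C)"
    using \<eta>_scale[of "\<lambda>_. 1" "Z n x\<^sub>0 / C"] by (simp add: \<eta>_one)
  also have "\<dots> \<le> \<eta> (Z n)"
    using Z_harnack[OF x\<^sub>0, of _ n] C_ge_1 by (intro \<eta>_mono) (auto simp: field_simps)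
  finally have \<eta>Z: "Z n x\<^sub>0 / C \<le> \<eta> (Z n)" .
  have "(A - a) * (\<epsilon> / C\<^sup>2) = \<epsilon> / D * ((A - a) * (Z n x\<^sub>0 / C))"
    using C_ge_1 Z_pos[OF x\<^sub>0, of n] by (simp add: D_def field_simps power2_eq_square)
  also have "\<dots> \<le> \<epsilon> / D * ((A - a) * \<eta> (Z n))"
    using \<eta>Z aA D \<epsilon>_pos by (intro mult_left_mono) auto
  also have "\<dots> = \<epsilon> * \<eta> g\<^sub>1 / D + \<epsilon> * \<eta> g\<^sub>2 / D"
    by (simp add: sum[symmetric] add_divide_distrib distrib_left)
  finally have "(A - \<epsilon> * \<eta> g\<^sub>2 / D) - (a + \<epsilon> * \<eta> g\<^sub>1 / D) \<le> q * (A - a)"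
    by (simp add: q_def algebra_simps)
  then show ?thesis using lower upper by blast
qed

text \<open>The contraction acts once per block of \<open>m\<close> steps. The rate involves only
  \<open>C\<close>, \<epsilon> and \<open>m\<close>, so kernels with the same constants have the
  same \<open>e\<close>.\<close>

definition e :: "nat \<Rightarrow> real" where "e n = q ^ (n div m)"

lemma e_nonneg: "0 \<le> e n"
  by (simp add: e_def q_nonneg)

lemma e_tendsto_0: "e \<longlonglongrightarrow> 0"
proof -
  have "filterlim (\<lambda>n. n div m) at_top sequentially"
    unfolding filterlim_at_top
  proof (intro allI eventually_sequentiallyI)
    show "k \<le> n div m" if "k * m \<le> n" for k n
      using div_le_mono[OF that, of m] m_pos by simp
  qed
  then show ?thesis
    unfolding e_def
    by (rule filterlim_compose[OF LIMSEQ_realpow_zero[OF q_nonneg q_less_1]])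
qed

text \<open>One interval serves all times from \<open>n\<close> on and all starting points; this
  yields both the Cauchy property and the error bound for the limit. The induction runs over blocks
  of \<open>m\<close> steps, and \<open>r_between\<close> absorbs the remainder
  \<open>n mod m\<close>.\<close>

lemma r_oscillation:
  assumes f: "f \<in> bfun M" and c: "\<And>x. x \<in> space M \<Longrightarrow> \<bar>f x\<bar> \<le> c"
  shows "\<exists>a A. A - a \<le> 2 * c * e n \<and> (\<forall>k. \<forall>x\<in>space M. a \<le> r (n + k) f x \<and> r (n + k) f x \<le> A)"
proof -
  have r0: "r 0 f x = f x" for x
    by (simp add: cond_exp_def)
  have "\<exists>a A. A - a \<le> 2 * c * q ^ j \<and> (\<forall>x\<in>space M. a \<le> r (j * m) f x \<and> r (j * m) f x \<le> A)" for j
  proof (induction j)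
    case 0
    then show ?case using c by (intro exI[of _ "-c"] exI[of _ c]) (auto simp: r0 abs_le_iff minus_le_iff)
  next
    case (Suc j)
    then obtain a A where aA: "A - a \<le> 2 * c * q ^ j" "\<And>x. x \<in> space M \<Longrightarrow> a \<le> r (j * m) f x \<and> r (j * m) f x \<le> A"
      by blast
    from r_contraction[OF f aA(2)] obtain a' A' where
      *: "A' - a' \<le> q * (A - a)" "\<forall>x\<in>space M. a' \<le> r (j * m + m) f x \<and> r (j * m + m) f x \<le> A'" by blast
    have "q * (A - a) \<le> q * (2 * c * q ^ j)"
      using aA(1) q_nonneg by (rule mult_left_mono)
    then show ?case using * by (intro exI[of _ a'] exI[of _ A']) (auto simp: add.commute algebra_simps)
  qed
  from this[of "n div m"] obtain a A where aA: "A - a \<le> 2 * c * q ^ (n div m)"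
     "\<And>x. x \<in> space M \<Longrightarrow> a \<le> r (n div m * m) f x \<and> r (n div m * m) f x \<le> A" by blast
  have "a \<le> r (n + k) f x \<and> r (n + k) f x \<le> A" if "x \<in> space M" for k x
    using r_between[OF f aA(2) that, of "n mod m + k"] by (simp add: add.assoc[symmetric])
  then show ?thesis using aA(1) by (auto simp: e_def)
qed

lemma r_tendsto: "f \<in> bfun M \<Longrightarrow> (\<lambda>n. r n f x\<^sub>0) \<longlonglongrightarrow> \<nu> f"
proof -
  assume f: "f \<in> bfun M"
  obtain c where c: "0 \<le> c" "\<And>x. x \<in> space M \<Longrightarrow> \<bar>f x\<bar> \<le> c" using bfun_bound[OF f] by metis
  have "Cauchy (\<lambda>n. r n f x\<^sub>0)"
  proof (rule metric_CauchyI)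
    fix d :: real assume "0 < d"
    have "(\<lambda>n. 2 * c * e n) \<longlonglongrightarrow> 0"
      using tendsto_mult_right_zero[OF e_tendsto_0] by blast
    from order_tendstoD(2)[OF this \<open>0 < d\<close>] obtain N where N: "2 * c * e N < d"
      by (auto simp: eventually_sequentially)
    from r_oscillation[OF f c(2), of N] obtain a A where
      aA: "A - a \<le> 2 * c * e N" "\<And>k. a \<le> r (N + k) f x\<^sub>0 \<and> r (N + k) f x\<^sub>0 \<le> A" by force
    have "dist (r i f x\<^sub>0) (r j f x\<^sub>0) < d" if "i \<ge> N" "j \<ge> N" for i j
      using aA(1) aA(2)[of "i - N"] aA(2)[of "j - N"] that N by (simp add: dist_real_def abs_if)
    then show "\<exists>N. \<forall>m\<ge>N. \<forall>n\<ge>N. dist (r m f x\<^sub>0) (r n f x\<^sub>0) < d" by blast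
  qed
  then show ?thesis
    unfolding qsd_def by (simp add: Cauchy_convergent_iff convergent_LIMSEQ_iff)
qed

lemma r_rate:
  assumes f: "f \<in> bfun M" and c: "\<And>x. x \<in> space M \<Longrightarrow> \<bar>f x\<bar> \<le> c" and x: "x \<in> space M"
  shows "\<bar>r n f x - \<nu> f\<bar> \<le> 2 * c * e n"
proof -
  from r_oscillation[OF f c, of n] obtain a A where
      aA: "A - a \<le> 2 * c * e n" "\<And>k y. y \<in> space M \<Longrightarrow> a \<le> r (n + k) f y \<and> r (n + k) f y \<le> A" by blast
  have lim: "(\<lambda>k. r (n + k) f x\<^sub>0) \<longlonglongrightarrow> \<nu> f"
    using LIMSEQ_ignore_initial_segment[OF r_tendsto[OF f], of n] by (simp add: add.commute)
  have "a \<le> \<nu> f" "\<nu> f \<le> A"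
    using LIMSEQ_le_const[OF lim] LIMSEQ_le_const2[OF lim] aA(2)[OF x\<^sub>0] by blast+
  then show ?thesis using aA(1) aA(2)[OF x, of 0] by (simp add: abs_if)
qed

section \<open>The quasi-stationary functional as a left eigenfunctional\<close>

lemma \<nu>_add: "f \<in> bfun M \<Longrightarrow> g \<in> bfun M \<Longrightarrow> \<nu> (\<lambda>x. f x + g x) = \<nu> f + \<nu> g"
  using tendsto_add[OF r_tendsto[of f] r_tendsto[of g]] r_tendsto[of "\<lambda>x. f x + g x"]
  by (auto simp: cond_exp_def Kn_add add_divide_distrib bfun_add intro: LIMSEQ_unique)

lemma \<nu>_scale: "f \<in> bfun M \<Longrightarrow> \<nu> (\<lambda>x. c * f x) = c * \<nu> f"
  using tendsto_mult_left[OF r_tendsto[of f], of c] r_tendsto[of "\<lambda>x. c * f x"]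
  by (auto simp: cond_exp_def Kn_scale bfun_scale intro: LIMSEQ_unique)

lemma \<nu>_diff: "f \<in> bfun M \<Longrightarrow> g \<in> bfun M \<Longrightarrow> \<nu> (\<lambda>x. f x - g x) = \<nu> f - \<nu> g"
  using \<nu>_add[of f "\<lambda>x. -1 * g x"] \<nu>_scale[of g "-1"] bfun_scale[of g M "-1"] by simp

lemma \<nu>_mono:
  assumes "f \<in> bfun M" "g \<in> bfun M" "\<And>x. x \<in> space M \<Longrightarrow> f x \<le> g x"
  shows "\<nu> f \<le> \<nu> g"
  using assms
  by (intro LIMSEQ_le[OF r_tendsto r_tendsto])
     (auto simp: cond_exp_def intro!: exI[of _ 0] divide_right_mono Kn_mono less_imp_le[OF Z_pos])

lemma \<nu>_const: "\<nu> (\<lambda>_. c) = c"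
proof -
  have "r n (\<lambda>_. c) x\<^sub>0 = c" for n
    by (simp add: cond_exp_def Kn_const)
  then show ?thesis using r_tendsto[of "\<lambda>_. c"] by (simp add: LIMSEQ_const_iff)
qed

lemma \<nu>_abs_le:
  assumes "f \<in> bfun M" "\<And>x. x \<in> space M \<Longrightarrow> \<bar>f x\<bar> \<le> c"
  shows "\<bar>\<nu> f\<bar> \<le> c"
  using \<nu>_mono[of f "\<lambda>_. c"] \<nu>_mono[of "\<lambda>_. -c" f] assms by (auto simp: \<nu>_const abs_le_iff minus_le_iff)

text \<open>Passage to the limit in \<open>r n (K f) = r (Suc n) f * r n (K 1)\<close> at
  \<open>x\<^sub>0\<close>, where the last factor is the ratio of two consecutive survival
  probabilities.\<close>

lemma \<nu>_K: "f \<in> bfun M \<Longrightarrow> \<nu> (K f) = \<Lambda> * \<nu> f"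
proof -
  assume f: "f \<in> bfun M"
  have "(\<lambda>n. r (Suc n) f x\<^sub>0 * r n (K (\<lambda>_. 1)) x\<^sub>0) \<longlonglongrightarrow> \<nu> f * \<Lambda>"
    unfolding eigval_def using f
    by (intro tendsto_mult r_tendsto K_bfun LIMSEQ_Suc[OF r_tendsto]) auto
  also have "(\<lambda>n. r (Suc n) f x\<^sub>0 * r n (K (\<lambda>_. 1)) x\<^sub>0) = (\<lambda>n. r n (K f) x\<^sub>0)"
  proof
    fix n
    have "(K ^^ n) (K (\<lambda>_. 1)) x\<^sub>0 = Z (Suc n) x\<^sub>0"
      by (simp add: survival_def funpow_swap1)
    then show "r (Suc n) f x\<^sub>0 * r n (K (\<lambda>_. 1)) x\<^sub>0 = r n (K f) x\<^sub>0"
      by (simp add: cond_exp_def funpow_swap1)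
  qed
  finally have "(\<lambda>n. r n (K f) x\<^sub>0) \<longlonglongrightarrow> \<nu> f * \<Lambda>" .
  from LIMSEQ_unique[OF r_tendsto[OF K_bfun[OF f]] this] show ?thesis by (simp add: mult.commute)
qed

lemma \<nu>_Z: "\<nu> (Z n) = \<Lambda> ^ n"
proof (induction n)
  case 0
  have "Z 0 = (\<lambda>_. 1)" by (simp add: survival_def)
  then show ?case by (simp add: \<nu>_const)
qed (simp add: Z_Suc \<nu>_K)

lemma \<Lambda>_ge_p: "p \<le> \<Lambda>"
  using \<nu>_mono[of "\<lambda>_. p" "K (\<lambda>_. 1)"] K_one_ge K_bfun[OF bfun_const, of 1] by (simp add: \<nu>_const eigval_def)

lemma \<Lambda>_pos [simp]: "0 < \<Lambda>"
  using \<Lambda>_ge_p p_pos by simp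

lemma \<Lambda>_nonneg [simp]: "0 \<le> \<Lambda>"
  using \<Lambda>_pos by linarith

lemma \<Lambda>_nz [simp]: "\<Lambda> \<noteq> 0"
  using \<Lambda>_pos by linarith

section \<open>The eigenfunction and the spectral gap\<close>

lemma Z_le_\<Lambda>: "x \<in> space M \<Longrightarrow> Z n x \<le> C * \<Lambda> ^ n"
proof -
  assume x: "x \<in> space M"
  have "\<nu> (\<lambda>_. Z n x) \<le> \<nu> (\<lambda>y. C * Z n y)"
    using x by (intro \<nu>_mono) (auto intro: Z_harnack)
  then show ?thesis by (simp add: \<nu>_const \<nu>_scale \<nu>_Z)
qed

lemma \<Lambda>_le_Z: "x \<in> space M \<Longrightarrow> \<Lambda> ^ n \<le> C * Z n x"
proof -
  assume x: "x \<in> space M"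
  have "\<nu> (Z n) \<le> \<nu> (\<lambda>_. C * Z n x)"
    using x by (intro \<nu>_mono) (auto intro: Z_harnack)
  then show ?thesis by (simp add: \<nu>_const \<nu>_Z)
qed

text \<open>\<open>r_rate\<close> is used with \<open>f = Z k\<close>. Its supremum is at most
  \<open>C * \<Lambda> ^ k\<close>, so after division by \<open>\<Lambda> ^ k\<close> the bound no
  longer depends on \<open>k\<close>.\<close>

lemma w_cauchy:
  assumes x: "x \<in> space M"
  shows "\<bar>Z (n + k) x / \<Lambda> ^ (n + k) - Z n x / \<Lambda> ^ n\<bar> \<le> 2 * C\<^sup>2 * e n"
proof -
  have "\<bar>r n (Z k) x - \<nu> (Z k)\<bar> \<le> 2 * (C * \<Lambda> ^ k) * e n"
    using x by (intro r_rate) (auto intro: Z_le_\<Lambda> simp: abs_of_pos)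
  then have 1: "\<bar>Z (n + k) x / Z n x - \<Lambda> ^ k\<bar> \<le> 2 * (C * \<Lambda> ^ k) * e n"
    by (simp add: cond_exp_def Kn_Z \<nu>_Z)
  have "Z (n + k) x / \<Lambda> ^ (n + k) - Z n x / \<Lambda> ^ n = (Z n x / \<Lambda> ^ n) * ((Z (n + k) x / Z n x - \<Lambda> ^ k) / \<Lambda> ^ k)"
    using x by (simp add: field_simps power_add)
  also have "\<bar>\<dots>\<bar> = (Z n x / \<Lambda> ^ n) * (\<bar>Z (n + k) x / Z n x - \<Lambda> ^ k\<bar> / \<Lambda> ^ k)"
    using x by (simp add: abs_mult abs_of_pos)
  also have "\<dots> \<le> C * (2 * (C * \<Lambda> ^ k) * e n / \<Lambda> ^ k)"
    using x Z_le_\<Lambda>[OF x, of n] C_ge_1 1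
    by (intro mult_mono divide_right_mono) (auto intro!: divide_nonneg_nonneg mult_nonneg_nonneg simp: field_simps e_nonneg)
  also have "\<dots> = 2 * C\<^sup>2 * e n"
    by (simp add: power2_eq_square)
  finally show ?thesis .
qed

lemma h_tendsto: "x \<in> space M \<Longrightarrow> (\<lambda>n. Z n x / \<Lambda> ^ n) \<longlonglongrightarrow> h x"
proof -
  assume x: "x \<in> space M"
  have "Cauchy (\<lambda>n. Z n x / \<Lambda> ^ n)"
  proof (rule metric_CauchyI)
    fix d :: real assume "0 < d"
    have "(\<lambda>n. 2 * C\<^sup>2 * e n) \<longlonglongrightarrow> 0"
      using tendsto_mult_right_zero[OF e_tendsto_0] by blast
    from order_tendstoD(2)[OF this half_gt_zero[OF \<open>0 < d\<close>]] obtain N where N: "2 * C\<^sup>2 * e N < d / 2"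
      by (auto simp: eventually_sequentially)
    have "dist (Z i x / \<Lambda> ^ i) (Z j x / \<Lambda> ^ j) < d" if "i \<ge> N" "j \<ge> N" for i j
      using w_cauchy[OF x, of N "i - N"] w_cauchy[OF x, of N "j - N"] that N
      by (simp add: dist_real_def abs_le_iff abs_less_iff)
    then show "\<exists>N. \<forall>m\<ge>N. \<forall>n\<ge>N. dist (Z m x / \<Lambda> ^ m) (Z n x / \<Lambda> ^ n) < d" by blast
  qed
  then show ?thesis
    unfolding eigfun_def by (simp add: Cauchy_convergent_iff convergent_LIMSEQ_iff)
qed

lemma h_rate:
  assumes x: "x \<in> space M"
  shows "\<bar>Z n x / \<Lambda> ^ n - h x\<bar> \<le> 2 * C\<^sup>2 * e n"
proof -
  have "(\<lambda>k. \<bar>Z (n + k) x / \<Lambda> ^ (n + k) - Z n x / \<Lambda> ^ n\<bar>) \<longlonglongrightarrow> \<bar>h x - Z n x / \<Lambda> ^ n\<bar>"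
    using LIMSEQ_ignore_initial_segment[OF h_tendsto[OF x], of n]
    by (intro tendsto_intros) (simp add: add.commute)
  from LIMSEQ_le_const2[OF this] show ?thesis
    using w_cauchy[OF x] by (simp add: abs_minus_commute)
qed

lemma w_bounds: "x \<in> space M \<Longrightarrow> 1 / C \<le> Z n x / \<Lambda> ^ n" "x \<in> space M \<Longrightarrow> Z n x / \<Lambda> ^ n \<le> C"
  using Z_le_\<Lambda>[of x n] \<Lambda>_le_Z[of x n] C_ge_1 by (auto simp: field_simps)

lemma h_bounds: "x \<in> space M \<Longrightarrow> 1 / C \<le> h x" "x \<in> space M \<Longrightarrow> h x \<le> C"
  using LIMSEQ_le_const[OF h_tendsto] LIMSEQ_le_const2[OF h_tendsto] w_bounds by blast+

lemma h_pos: "x \<in> space M \<Longrightarrow> 0 < h x"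
  using h_bounds(1)[of x] C_ge_1 by (smt (verit) divide_pos_pos)

lemma h_bfun [simp, intro]: "h \<in> bfun M"
proof (rule bfun_lim)
  show "(\<lambda>x. Z n x / \<Lambda> ^ n) \<in> bfun M" for n
    using bfun_scale[OF Z_bfun, of "1 / \<Lambda> ^ n" n] by simp
  show "\<bar>Z n x / \<Lambda> ^ n\<bar> \<le> C" if "x \<in> space M" for n x
    using w_bounds[OF that, of n] Z_pos[OF that, of n] by (simp add: abs_of_pos)
qed (rule h_tendsto)

text \<open>\<open>K\<close> contracts the supremum norm by \<open>K_one_le\<close>. The hypothesis
  concerns the space only, while the conclusion holds at every point.\<close>

lemma K_close:
  assumes "f \<in> bfun M" "g \<in> bfun M" "\<And>x. x \<in> space M \<Longrightarrow> \<bar>f x - g x\<bar> \<le> c"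
  shows "\<bar>K f x - K g x\<bar> \<le> c"
proof -
  have c: "0 \<le> c" using assms(3)[OF x\<^sub>0] by linarith
  have "K (\<lambda>x. f x - g x) x \<le> K (\<lambda>_. c) x"
    using assms by (intro K_mono) (auto dest: abs_le_D1)
  moreover have "K (\<lambda>_. -c) x \<le> K (\<lambda>x. f x - g x) x"
    using assms by (intro K_mono bfun_diff bfun_const) (force simp: abs_le_iff)+
  moreover have "c * K (\<lambda>_. 1) x \<le> c" using c K_one_le[of x] by (simp add: mult_left_le)
  ultimately show ?thesis
    using assms by (simp add: K_diff K_const[of c] K_const[of "-c"] abs_le_iff)
qed

lemma K_w_tendsto: "(\<lambda>n. K (Z n) x / \<Lambda> ^ n) \<longlonglongrightarrow> K h x"
proof -
  have lim: "(\<lambda>n. 2 * C\<^sup>2 * e n) \<longlonglongrightarrow> 0"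
    using tendsto_mult_right_zero[OF e_tendsto_0] by blast
  have bd: "\<bar>K (Z n) x / \<Lambda> ^ n - K h x\<bar> \<le> 2 * C\<^sup>2 * e n" for n
  proof -
    have "\<bar>K (\<lambda>x. (1 / \<Lambda> ^ n) * Z n x) x - K h x\<bar> \<le> 2 * C\<^sup>2 * e n"
      using h_rate by (intro K_close bfun_scale) auto
    moreover have "K (\<lambda>x. (1 / \<Lambda> ^ n) * Z n x) x = (1 / \<Lambda> ^ n) * K (Z n) x"
      by (rule fun_cong[OF K_scale[OF Z_bfun]])
    ultimately show ?thesis by (simp only: times_divide_eq_left mult_1)
  qed
  have "(\<lambda>n. K (Z n) x / \<Lambda> ^ n - K h x) \<longlonglongrightarrow> 0"
    by (rule Lim_null_comparison[OF _ lim]) (simp only: real_norm_def bd eventually_True)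
  then show ?thesis by (simp add: LIM_zero_iff)
qed

lemma K_h: "x \<in> space M \<Longrightarrow> K h x = \<Lambda> * h x"
proof -
  assume x: "x \<in> space M"
  have "(\<lambda>n. \<Lambda> * (Z (Suc n) x / \<Lambda> ^ Suc n)) \<longlonglongrightarrow> \<Lambda> * h x"
    by (intro tendsto_mult_left LIMSEQ_Suc h_tendsto x)
  then show ?thesis
    using K_w_tendsto[of x] by (simp add: Z_Suc LIMSEQ_unique)
qed

text \<open>The spectral gap: the rescaled powers converge to the rank-one operator
  \<open>\<nu> f * h\<close>. The error splits into that of the conditioned expectation and that of
  the rescaled survival probability.\<close>

lemma Kn_rate:
  assumes f: "f \<in> bfun M" and c: "\<And>x. x \<in> space M \<Longrightarrow> \<bar>f x\<bar> \<le> c" and x: "x \<in> space M"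
  shows "\<bar>(K ^^ n) f x / \<Lambda> ^ n - \<nu> f * h x\<bar> \<le> 4 * C\<^sup>2 * c * e n"
proof -
  have c0: "0 \<le> c" using c[OF x] by linarith
  define w where "w = Z n x / \<Lambda> ^ n"
  have w: "0 \<le> w" "w \<le> C" using w_bounds[OF x, of n] less_imp_le[OF Z_pos[OF x, of n]] by (auto simp: w_def)
  have "(K ^^ n) f x / \<Lambda> ^ n - \<nu> f * h x = w * (r n f x - \<nu> f) + \<nu> f * (w - h x)"
    using x by (simp add: w_def cond_exp_def field_simps)
  also have "\<bar>\<dots>\<bar> \<le> w * \<bar>r n f x - \<nu> f\<bar> + \<bar>\<nu> f\<bar> * \<bar>w - h x\<bar>"
    using w by (intro order_trans[OF abs_triangle_ineq]) (simp add: abs_mult)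
  also have "\<dots> \<le> C * (2 * c * e n) + c * (2 * C\<^sup>2 * e n)"
    using w c0 C_ge_1 e_nonneg[of n] r_rate[OF f c x, of n] \<nu>_abs_le[OF f c] h_rate[OF x, of n]
    by (intro add_mono mult_mono) (auto simp: w_def)
  also have "\<dots> \<le> C\<^sup>2 * (2 * c * e n) + c * (2 * C\<^sup>2 * e n)"
    using C_ge_1 c0 e_nonneg[of n] by (intro add_mono mult_right_mono) (auto simp: power2_eq_square)
  also have "\<dots> = 4 * C\<^sup>2 * c * e n" by simp
  finally show ?thesis .
qed

text \<open>An approximate solution of \<open>K u = \<Lambda> u\<close> is close to a multiple of
  \<open>h\<close>: telescoping costs at most \<open>C * \<omega>\<close> per step, after which the
  spectral gap acts. The number \<open>n\<close> of steps is left free; it is first taken large to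
  make \<open>e n\<close> small, and then \<open>\<omega>\<close> has to be small compared with
  \<open>1 / n\<close>.\<close>

lemma near_eigenfunction:
  assumes u: "u \<in> bfun M" "\<And>x. x \<in> space M \<Longrightarrow> \<bar>u x\<bar> \<le> U"
    and \<omega>: "\<And>x. x \<in> space M \<Longrightarrow> \<bar>u x - K u x / \<Lambda>\<bar> \<le> \<omega>" and x: "x \<in> space M"
  shows "\<bar>u x - \<nu> u * h x\<bar> \<le> 4 * C\<^sup>2 * U * e n + real n * C * \<omega>"
proof -
  have \<omega>0: "0 \<le> \<omega>" using \<omega>[OF x] by linarith
  define g where "g = (\<lambda>x. u x - (1 / \<Lambda>) * K u x)"
  have g: "g \<in> bfun M" unfolding g_def by (intro bfun_diff bfun_scale K_bfun u)
  have step: "\<bar>(K ^^ j) u x / \<Lambda> ^ j - (K ^^ Suc j) u x / \<Lambda> ^ Suc j\<bar> \<le> C * \<omega>" for j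
  proof -
    have "(K ^^ j) g x = (K ^^ j) u x - (1 / \<Lambda>) * (K ^^ j) (K u) x"
      using u by (simp add: g_def Kn_diff Kn_scale bfun_scale K_bfun del: times_divide_eq_left)
    moreover have "(K ^^ Suc j) u x = (K ^^ j) (K u) x"
      by (simp add: funpow_swap1)
    ultimately have "(K ^^ j) u x / \<Lambda> ^ j - (K ^^ Suc j) u x / \<Lambda> ^ Suc j = (K ^^ j) g x / \<Lambda> ^ j"
      by (simp add: diff_divide_distrib del: funpow.simps)
    also have "\<bar>\<dots>\<bar> = \<bar>(K ^^ j) g x\<bar> / \<Lambda> ^ j" by (simp add: abs_of_pos)
    also have "\<dots> \<le> \<omega> * Z j x / \<Lambda> ^ j"
    proof (rule divide_right_mono)
      have "\<bar>g y\<bar> \<le> \<omega>" if "y \<in> space M" for y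
        using \<omega>[OF that] by (simp add: g_def)
      then have "(K ^^ j) g x \<le> (K ^^ j) (\<lambda>_. \<omega>) x" "(K ^^ j) (\<lambda>_. -\<omega>) x \<le> (K ^^ j) g x"
        by (auto intro!: Kn_mono g x simp: abs_le_iff minus_le_iff)
      then show "\<bar>(K ^^ j) g x\<bar> \<le> \<omega> * Z j x" by (simp add: Kn_const abs_le_iff)
    qed simp
    also have "\<dots> \<le> C * \<omega>"
      using mult_left_mono[OF w_bounds(2)[OF x, of j] \<omega>0] by (simp add: mult.commute)
    finally show ?thesis .
  qed
  have tele: "\<bar>u x - (K ^^ n) u x / \<Lambda> ^ n\<bar> \<le> real n * C * \<omega>" for n
  proof (induction n)
    case (Suc n)
    then show ?case using step[of n] by (simp add: algebra_simps del: funpow.simps power_Suc)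
  qed simp
  show ?thesis using tele[of n] Kn_rate[OF u x, of n] by linarith
qed

end

section \<open>Perturbation near criticality\<close>

text \<open>Bonferroni bounds for the chance that none of \<open>b\<close> independent children
  topples. Each is proved by induction on \<open>b\<close>, the second using the first and the third
  using the second. The cubic constant is crude: \<open>b ^ 3\<close> is taken because its increment
  exceeds the \<open>y * (y - 1) / 2\<close> that one step requires.\<close>

lemma one_minus_power_bounds:
  fixes x :: real
  assumes "0 \<le> x" "x \<le> 1"
  shows "1 - real b * x \<le> (1 - x) ^ b"
    and "(1 - x) ^ b \<le> 1 - real b * x + (real b * (real b - 1) / 2) * x\<^sup>2"
    and "1 - real b * x + (real b * (real b - 1) / 2) * x\<^sup>2 - real b ^ 3 * x ^ 3 \<le> (1 - x) ^ b"
proof -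
  show 1: "1 - real b * x \<le> (1 - x) ^ b" for b
    using Bernoulli_inequality[of "-x" b] assms by simp
  show 2: "(1 - x) ^ b \<le> 1 - real b * x + (real b * (real b - 1) / 2) * x\<^sup>2" for b
  proof (induction b)
    case (Suc b)
    have "(1 - x) ^ Suc b \<le> (1 - x) ^ b - x * (1 - real b * x)"
      using mult_left_mono[OF 1[of b], of x] assms by (simp add: algebra_simps)
    also have "\<dots> \<le> 1 - real (Suc b) * x + (real (Suc b) * (real (Suc b) - 1) / 2) * x\<^sup>2"
      using Suc by (simp add: algebra_simps power2_eq_square add_divide_distrib diff_divide_distrib)
    finally show ?case .
  qed simp
  show "1 - real b * x + (real b * (real b - 1) / 2) * x\<^sup>2 - real b ^ 3 * x ^ 3 \<le> (1 - x) ^ b" for b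
  proof (induction b)
    case (Suc b)
    define y where "y = real b"
    have y: "0 \<le> y" by (simp add: y_def)
    have 3: "(1 - x) ^ Suc b = (1 - x) ^ b - x * (1 - x) ^ b"
      by (simp add: algebra_simps)
    have "x * (1 - x) ^ b \<le> x * (1 - y * x + (y * (y - 1) / 2) * x\<^sup>2)"
      using mult_left_mono[OF 2[of b], of x] assms by (simp add: y_def)
    with Suc 3 have "(1 - x) ^ Suc b \<ge> 1 - y * x + (y * (y - 1) / 2) * x\<^sup>2 - y ^ 3 * x ^ 3
        - x * (1 - y * x + (y * (y - 1) / 2) * x\<^sup>2)"
      by (simp add: y_def)
    also have "1 - y * x + (y * (y - 1) / 2) * x\<^sup>2 - y ^ 3 * x ^ 3 - x * (1 - y * x + (y * (y - 1) / 2) * x\<^sup>2)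
       = 1 - (y + 1) * x + ((y + 1) * y / 2) * x\<^sup>2 - (y ^ 3 + y * (y - 1) / 2) * x ^ 3"
      by (simp add: field_simps power2_eq_square power3_eq_cube)
    finally have "1 - (y + 1) * x + ((y + 1) * y / 2) * x\<^sup>2 - (y ^ 3 + y * (y - 1) / 2) * x ^ 3 \<le> (1 - x) ^ Suc b" .
    moreover have "(y ^ 3 + y * (y - 1) / 2) * x ^ 3 \<le> (y + 1) ^ 3 * x ^ 3"
    proof (rule mult_right_mono)
      have "(y + 1) ^ 3 - (y ^ 3 + y * (y - 1) / 2) = 5/2 * y\<^sup>2 + 7/2 * y + 1"
        by (simp add: field_simps power2_eq_square power3_eq_cube)
      moreover have "0 \<le> 5/2 * y\<^sup>2 + 7/2 * y + 1" using y by simp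
      ultimately show "y ^ 3 + y * (y - 1) / 2 \<le> (y + 1) ^ 3" by linarith
    qed (use assms in simp)
    ultimately show ?case by (simp add: y_def algebra_simps)
  qed simp
qed

text \<open>Convergence to \<open>K\<^sub>0\<close> in operator norm, with common Doeblin and
  Harnack constants, along an arbitrary filter. A constant family is allowed and is used when only
  the argument of the generating function moves. \<open>close\<close> is stated at every point, also
  off \<open>space M\<close>.\<close>

locale doeblin_family = K\<^sub>0: doeblin_kernel M K\<^sub>0 p C \<epsilon> m \<eta> x\<^sub>0
  for M :: "'a measure" and K\<^sub>0 p C \<epsilon> m \<eta> x\<^sub>0 +
  fixes K :: "'i \<Rightarrow> ('a \<Rightarrow> real) \<Rightarrow> 'a \<Rightarrow> real" and F :: "'i filter" and \<kappa> :: "'i \<Rightarrow> real"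
  assumes fam: "eventually (\<lambda>i. doeblin_kernel M (K i) p C \<epsilon> m \<eta> x\<^sub>0) F"
    and close: "eventually (\<lambda>i. \<forall>f\<in>bfun M. \<forall>c. (\<forall>x\<in>space M. \<bar>f x\<bar> \<le> c) \<longrightarrow> (\<forall>x. \<bar>K i f x - K\<^sub>0 f x\<bar> \<le> \<kappa> i * c)) F"
    and \<kappa>: "(\<kappa> \<longlongrightarrow> 0) F"
begin

section \<open>Continuity of the spectral data along the family\<close>

lemma K_uniform:
  assumes f: "f \<in> bfun M"
  shows "uniform_limit UNIV (\<lambda>i. K i f) (K\<^sub>0 f) F"
proof (rule uniform_limitI)
  fix d :: real assume d: "0 < d"
  obtain c where c: "0 \<le> c" "\<And>x. x \<in> space M \<Longrightarrow> \<bar>f x\<bar> \<le> c" using bfun_bound[OF f] by metis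
  have "((\<lambda>i. \<kappa> i * c) \<longlongrightarrow> 0) F" by (rule tendsto_mult_left_zero[OF \<kappa>])
  from order_tendstoD(2)[OF this d] close
  show "\<forall>\<^sub>F i in F. \<forall>x\<in>UNIV. dist (K i f x) (K\<^sub>0 f x) < d"
  proof eventually_elim
    case (elim i)
    show ?case
    proof
      fix x
      have "\<bar>K i f x - K\<^sub>0 f x\<bar> \<le> \<kappa> i * c" using elim(2) f c(2) by blast
      with elim(1) show "dist (K i f x) (K\<^sub>0 f x) < d" unfolding dist_real_def by linarith
    qed
  qed
qed

lemma Kn_uniform:
  assumes f: "f \<in> bfun M"
  shows "uniform_limit (space M) (\<lambda>i. (K i ^^ n) f) ((K\<^sub>0 ^^ n) f) F"
proof (induction n)
  case (Suc n)
  show ?case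
  proof (rule uniform_limitI)
    fix d :: real assume "0 < d"
    then have d: "0 < d / 2" by simp
    show "\<forall>\<^sub>F i in F. \<forall>x\<in>space M. dist ((K i ^^ Suc n) f x) ((K\<^sub>0 ^^ Suc n) f x) < d"
      using uniform_limitD[OF Suc d] uniform_limitD[OF K_uniform[OF K\<^sub>0.Kn_bfun[OF f, of n]] d] fam
    proof eventually_elim
      case (elim i)
      interpret Ki: doeblin_kernel M "K i" p C \<epsilon> m \<eta> x\<^sub>0 by (rule elim(3))
      show ?case
      proof
        fix x assume "x \<in> space M"
        have "\<bar>K i ((K i ^^ n) f) x - K i ((K\<^sub>0 ^^ n) f) x\<bar> \<le> d / 2"
          using elim(1) f by (intro Ki.K_close Ki.Kn_bfun K\<^sub>0.Kn_bfun) (auto simp: dist_real_def less_imp_le)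
        moreover have "\<bar>K i ((K\<^sub>0 ^^ n) f) x - K\<^sub>0 ((K\<^sub>0 ^^ n) f) x\<bar> < d / 2"
          using elim(2) by (simp add: dist_real_def)
        ultimately show "dist ((K i ^^ Suc n) f x) ((K\<^sub>0 ^^ Suc n) f x) < d"
          unfolding dist_real_def funpow.simps o_def by linarith
      qed
    qed
  qed
qed (simp add: uniform_limit_const)

lemma Kn_tendsto: "f \<in> bfun M \<Longrightarrow> x \<in> space M \<Longrightarrow> ((\<lambda>i. (K i ^^ n) f x) \<longlongrightarrow> (K\<^sub>0 ^^ n) f x) F"
  by (rule tendsto_uniform_limitI[OF Kn_uniform])

lemma rate_le: "\<exists>n. c * K\<^sub>0.e n < d" if "0 < d" for c d :: real
proof -
  have "(\<lambda>n. c * K\<^sub>0.e n) \<longlonglongrightarrow> 0"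
    using tendsto_mult_right_zero[OF K\<^sub>0.e_tendsto_0] by blast
  from order_tendstoD(2)[OF this that] show ?thesis
    by (auto simp: eventually_sequentially)
qed

text \<open>The rate \<open>K\<^sub>0.e\<close> is also the rate of every \<open>K i\<close>, since
  it is built from the common constants. So one \<open>n\<close> brings all conditioned expectations
  close to their limits, and at this fixed \<open>n\<close> they converge by
  \<open>Kn_tendsto\<close>.\<close>

lemma qsd_tendsto:
  assumes f: "f \<in> bfun M"
  shows "((\<lambda>i. qsd (K i) x\<^sub>0 f) \<longlongrightarrow> qsd K\<^sub>0 x\<^sub>0 f) F"
proof (rule tendstoI)
  fix d :: real assume "0 < d"
  then have d: "0 < d / 3" by simp
  obtain c where c: "0 \<le> c" "\<And>x. x \<in> space M \<Longrightarrow> \<bar>f x\<bar> \<le> c" using bfun_bound[OF f] by metis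
  obtain n where n: "2 * c * K\<^sub>0.e n < d / 3" using rate_le[OF d] by blast
  have "((\<lambda>i. cond_exp (K i) n f x\<^sub>0) \<longlongrightarrow> cond_exp K\<^sub>0 n f x\<^sub>0) F"
    unfolding cond_exp_def survival_def using f K\<^sub>0.Z_nz[OF K\<^sub>0.x\<^sub>0, of n]
    by (intro tendsto_divide Kn_tendsto) (auto simp: survival_def)
  from tendstoD[OF this d] fam show "\<forall>\<^sub>F i in F. dist (qsd (K i) x\<^sub>0 f) (qsd K\<^sub>0 x\<^sub>0 f) < d"
  proof eventually_elim
    case (elim i)
    interpret Ki: doeblin_kernel M "K i" p C \<epsilon> m \<eta> x\<^sub>0 by (rule elim(2))
    have "\<bar>cond_exp (K i) n f x\<^sub>0 - qsd (K i) x\<^sub>0 f\<bar> \<le> 2 * c * K\<^sub>0.e n"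
      using Ki.r_rate[OF f c(2) Ki.x\<^sub>0, of n] by simp
    moreover have "\<bar>cond_exp K\<^sub>0 n f x\<^sub>0 - qsd K\<^sub>0 x\<^sub>0 f\<bar> \<le> 2 * c * K\<^sub>0.e n"
      using K\<^sub>0.r_rate[OF f c(2) K\<^sub>0.x\<^sub>0, of n] by simp
    ultimately show ?case using n elim(1) unfolding dist_real_def by linarith
  qed
qed

lemma eigval_tendsto: "((\<lambda>i. eigval (K i) x\<^sub>0) \<longlongrightarrow> eigval K\<^sub>0 x\<^sub>0) F"
proof (rule tendstoI)
  fix d :: real assume "0 < d"
  then have d: "0 < d / 2" by simp
  \<comment> \<open>In the eigenvalue, \<open>qsd\<close> of \<open>K i 1\<close>, functional and
    argument both move; the argument is first replaced by \<open>K\<^sub>0 1\<close>.\<close>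
  have b: "K\<^sub>0 (\<lambda>_. 1) \<in> bfun M" by auto
  show "\<forall>\<^sub>F i in F. dist (eigval (K i) x\<^sub>0) (eigval K\<^sub>0 x\<^sub>0) < d"
    using tendstoD[OF qsd_tendsto[OF b] d] uniform_limitD[OF K_uniform[OF bfun_const, of 1] d] fam
  proof eventually_elim
    case (elim i)
    interpret Ki: doeblin_kernel M "K i" p C \<epsilon> m \<eta> x\<^sub>0 by (rule elim(3))
    have b': "K i (\<lambda>_. 1) \<in> bfun M" by auto
    have "\<bar>qsd (K i) x\<^sub>0 (\<lambda>x. K i (\<lambda>_. 1) x - K\<^sub>0 (\<lambda>_. 1) x)\<bar> \<le> d / 2"
      using elim(2) b b' by (intro Ki.\<nu>_abs_le bfun_diff) (auto simp: dist_real_def less_imp_le)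
    then have "\<bar>qsd (K i) x\<^sub>0 (K i (\<lambda>_. 1)) - qsd (K i) x\<^sub>0 (K\<^sub>0 (\<lambda>_. 1))\<bar> \<le> d / 2"
      using Ki.\<nu>_diff[OF b' b] by simp
    then show ?case using elim(1) unfolding eigval_def dist_real_def by linarith
  qed
qed

lemma eigfun_uniform: "uniform_limit (space M) (\<lambda>i. eigfun (K i) x\<^sub>0) (eigfun K\<^sub>0 x\<^sub>0) F"
proof (rule uniform_limitI)
  fix d :: real assume "0 < d"
  then have d: "0 < d / 3" by simp
  obtain n where n: "2 * C\<^sup>2 * K\<^sub>0.e n < d / 3" using rate_le[OF d] by blast
  have "uniform_limit (space M) (\<lambda>i x. survival (K i) n x / eigval (K i) x\<^sub>0 ^ n)
      (\<lambda>x. survival K\<^sub>0 n x / eigval K\<^sub>0 x\<^sub>0 ^ n) F"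
  proof (rule uniform_lim_divide[where b = "eigval K\<^sub>0 x\<^sub>0 ^ n"])
    show "uniform_limit (space M) (\<lambda>i. survival (K i) n) (survival K\<^sub>0 n) F"
      unfolding survival_def by (rule Kn_uniform) simp
    show "uniform_limit (space M) (\<lambda>i x. eigval (K i) x\<^sub>0 ^ n) (\<lambda>x. eigval K\<^sub>0 x\<^sub>0 ^ n) F"
      using tendsto_power[OF eigval_tendsto, of n]
      by (auto simp: uniform_limit_iff tendsto_iff)
    show "bounded (survival K\<^sub>0 n ` space M)"
      using K\<^sub>0.Z_le_1 K\<^sub>0.Z_pos by (auto intro!: boundedI[of _ 1] simp: abs_of_pos)
  qed auto
  from uniform_limitD[OF this d] fam
  show "\<forall>\<^sub>F i in F. \<forall>x\<in>space M. dist (eigfun (K i) x\<^sub>0 x) (eigfun K\<^sub>0 x\<^sub>0 x) < d"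
  proof eventually_elim
    case (elim i)
    interpret Ki: doeblin_kernel M "K i" p C \<epsilon> m \<eta> x\<^sub>0 by (rule elim(2))
    show ?case
    proof
      fix x assume x: "x \<in> space M"
      show "dist (eigfun (K i) x\<^sub>0 x) (eigfun K\<^sub>0 x\<^sub>0 x) < d"
        using bspec[OF elim(1) x] n Ki.h_rate[OF x, of n] K\<^sub>0.h_rate[OF x, of n]
        unfolding dist_real_def by linarith
    qed
  qed
qed

lemma qsd_square_tendsto:
  "((\<lambda>i. qsd (K i) x\<^sub>0 (\<lambda>x. (eigfun (K i) x\<^sub>0 x)\<^sup>2)) \<longlongrightarrow> qsd K\<^sub>0 x\<^sub>0 (\<lambda>x. (eigfun K\<^sub>0 x\<^sub>0 x)\<^sup>2)) F"
proof (rule tendstoI)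
  fix d :: real assume "0 < d"
  then have d: "0 < d / 2" "0 < d / (4 * C)" using K\<^sub>0.C_ge_1 by auto
  have b: "(\<lambda>x. (eigfun K\<^sub>0 x\<^sub>0 x)\<^sup>2) \<in> bfun M" by auto
  show "\<forall>\<^sub>F i in F. dist (qsd (K i) x\<^sub>0 (\<lambda>x. (eigfun (K i) x\<^sub>0 x)\<^sup>2)) (qsd K\<^sub>0 x\<^sub>0 (\<lambda>x. (eigfun K\<^sub>0 x\<^sub>0 x)\<^sup>2)) < d"
    using tendstoD[OF qsd_tendsto[OF b] d(1)] uniform_limitD[OF eigfun_uniform d(2)] fam
  proof eventually_elim
    case (elim i)
    interpret Ki: doeblin_kernel M "K i" p C \<epsilon> m \<eta> x\<^sub>0 by (rule elim(3))
    let ?h = "eigfun (K i) x\<^sub>0" and ?g = "eigfun K\<^sub>0 x\<^sub>0"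
    have b': "(\<lambda>x. (?h x)\<^sup>2) \<in> bfun M" by auto
    have "\<bar>qsd (K i) x\<^sub>0 (\<lambda>x. (?h x)\<^sup>2 - (?g x)\<^sup>2)\<bar> \<le> d / 2"
    proof (intro Ki.\<nu>_abs_le bfun_diff b b')
      fix x assume x: "x \<in> space M"
      have "\<bar>(?h x)\<^sup>2 - (?g x)\<^sup>2\<bar> = \<bar>?h x - ?g x\<bar> * \<bar>?h x + ?g x\<bar>"
        by (simp add: abs_mult[symmetric] power2_eq_square algebra_simps)
      also have "\<dots> \<le> d / (4 * C) * (2 * C)"
      proof (rule mult_mono)
        show "\<bar>?h x - ?g x\<bar> \<le> d / (4 * C)" using elim(2) x by (auto simp: dist_real_def less_imp_le)
        show "\<bar>?h x + ?g x\<bar> \<le> 2 * C"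
          using Ki.h_bounds(2)[OF x] K\<^sub>0.h_bounds(2)[OF x] Ki.h_pos[OF x] K\<^sub>0.h_pos[OF x] by simp
      qed (use d in auto)
      also have "\<dots> = d / 2" using K\<^sub>0.C_ge_1 by (simp add: field_simps)
      finally show "\<bar>(?h x)\<^sup>2 - (?g x)\<^sup>2\<bar> \<le> d / 2" .
    qed
    then have "\<bar>qsd (K i) x\<^sub>0 (\<lambda>x. (?h x)\<^sup>2) - qsd (K i) x\<^sub>0 (\<lambda>x. (?g x)\<^sup>2)\<bar> \<le> d / 2"
      using Ki.\<nu>_diff[OF b' b] by simp
    then show ?case using elim(1) unfolding dist_real_def by linarith
  qed
qed


text \<open>\<open>n\<close> is the coefficient of the small solution \<open>u\<close> along the
  eigenfunction, and \<open>U\<close> is its supremum. Errors are controlled in powers of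
  \<open>U\<close>, whereas the scalar equation is one for \<open>n\<close>; \<open>U_least\<close>
  closes the gap, since near proportionality to the eigenfunction bounds the least upper bound
  \<open>U\<close> by a multiple of \<open>n\<close>. The condition \<open>sup_crit\<close> makes
  \<open>(real b * L i - 1) * n i\<close> nonnegative, so that it cannot cancel a large
  \<open>1 - s i\<close>.\<close>

theorem near_critical:
  fixes u :: "'i \<Rightarrow> 'a \<Rightarrow> real" and s U :: "'i \<Rightarrow> real" and b :: nat
  defines "n \<equiv> \<lambda>i. qsd (K i) x\<^sub>0 (u i)" and "L \<equiv> \<lambda>i. eigval (K i) x\<^sub>0"
  assumes b: "1 < b" and crit: "real b * eigval K\<^sub>0 x\<^sub>0 = 1"
    and sup_crit: "eventually (\<lambda>i. 1 \<le> real b * L i) F"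
    and s: "eventually (\<lambda>i. 0 \<le> s i \<and> s i \<le> 1) F"
    and u: "eventually (\<lambda>i. u i \<in> bfun M \<and> (\<forall>x\<in>space M. 0 \<le> u i x \<and> u i x \<le> U i)) F"
    and U_least: "eventually (\<lambda>i. 0 < U i \<and> (\<forall>c. (\<forall>x\<in>space M. u i x \<le> c) \<longrightarrow> U i \<le> c)) F"
    and U: "(U \<longlongrightarrow> 0) F"
    and fp: "eventually (\<lambda>i. \<forall>x\<in>space M. u i x = 1 - s i * (1 - K i (u i) x) ^ b) F"
  shows "uniform_limit (space M) (\<lambda>i x. u i x / n i) (eigfun K\<^sub>0 x\<^sub>0) F"
    and "eventually (\<lambda>i. 0 < n i \<and> n i \<le> U i) F"
    and "((\<lambda>i. ((1 - s i) + (real b * L i - 1) * n i) / (n i)\<^sup>2) \<longlongrightarrow>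
        real b * (real b - 1) / 2 * (1 / real b)\<^sup>2 * qsd K\<^sub>0 x\<^sub>0 (\<lambda>x. (eigfun K\<^sub>0 x\<^sub>0 x)\<^sup>2)) F"
proof -
  define B where "B = real b"
  define C2 where "C2 = B * (B - 1) / 2"
  define \<delta> where "\<delta> = (\<lambda>i. B * L i - 1)"
  define y where "y = (\<lambda>i x. (1 - K i (u i) x) ^ b)"
  have B: "2 \<le> B" using b by (simp add: B_def)
  have C2: "0 \<le> C2" using B by (simp add: C2_def)
  have C: "1 \<le> C" by (rule K\<^sub>0.C_ge_1)
  have \<delta>0: "(\<delta> \<longlongrightarrow> 0) F"
    using tendsto_diff[OF tendsto_mult_left[OF eigval_tendsto, of B] tendsto_const[of 1]] crit
    by (simp add: \<delta>_def L_def B_def)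
  \<comment> \<open>The bound \<open>B * U i \<le> 1 / 2\<close> keeps \<open>y i\<close> at least
    1/2, so the factor \<open>qsd (y i)\<close> of \<open>1 - s i\<close> in the scalar identity is
    harmless.\<close>
  define good where "good = (\<lambda>i. doeblin_kernel M (K i) p C \<epsilon> m \<eta> x\<^sub>0 \<and> 0 \<le> \<delta> i \<and> 0 \<le> s i \<and> s i \<le> 1 \<and> u i \<in> bfun M \<and>
    (\<forall>x\<in>space M. 0 \<le> u i x \<and> u i x \<le> U i) \<and> 0 < U i \<and> (\<forall>c. (\<forall>x\<in>space M. u i x \<le> c) \<longrightarrow> U i \<le> c) \<and>
    (\<forall>x\<in>space M. u i x = 1 - s i * (1 - K i (u i) x) ^ b) \<and> B * U i \<le> 1 / 2)"
  have "((\<lambda>i. B * U i) \<longlongrightarrow> 0) F" by (rule tendsto_mult_right_zero[OF U])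
  then have "eventually (\<lambda>i. B * U i < 1 / 2) F" by (rule order_tendstoD) simp
  then have good: "eventually good F"
    using fam sup_crit s u U_least fp
    by eventually_elim (simp add: good_def \<delta>_def B_def)
  \<comment> \<open>the scalar identity obtained by applying the left eigenfunctional to the fixed-point equation\<close>
  have basic: "(\<forall>x\<in>space M. 0 \<le> K i (u i) x \<and> K i (u i) x \<le> U i) \<and> U i \<le> 1 \<and>
      1 - B * U i \<le> qsd (K i) x\<^sub>0 (y i) \<and> qsd (K i) x\<^sub>0 (y i) \<le> 1 \<and> n i \<le> U i \<and> 0 \<le> n i \<and>
      \<bar>(1 - s i) * qsd (K i) x\<^sub>0 (y i) + \<delta> i * n i - C2 * qsd (K i) x\<^sub>0 (\<lambda>x. (K i (u i) x)\<^sup>2)\<bar> \<le> B ^ 3 * U i ^ 3 \<and>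
      1 - s i \<le> 2 * (C2 + B ^ 3) * (U i)\<^sup>2"
    if i: "good i" for i
  proof -
    interpret Ki: doeblin_kernel M "K i" p C \<epsilon> m \<eta> x\<^sub>0 using i by (simp add: good_def)
    have u: "u i \<in> bfun M" "\<And>x. x \<in> space M \<Longrightarrow> 0 \<le> u i x" "\<And>x. x \<in> space M \<Longrightarrow> u i x \<le> U i"
      using i by (auto simp: good_def)
    have U: "0 < U i" "B * U i \<le> 1 / 2" "0 \<le> s i" "s i \<le> 1" "0 \<le> \<delta> i" using i by (auto simp: good_def)
    have fx: "\<And>x. x \<in> space M \<Longrightarrow> u i x = 1 - s i * y i x" using i by (auto simp: good_def y_def)
    have U1: "U i \<le> 1" using U B mult_right_mono[of 2 B "U i"] by linarith
    have Ku: "0 \<le> K i (u i) x" "K i (u i) x \<le> U i" for x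
    proof -
      have "K i (\<lambda>_. 0) x \<le> K i (u i) x" using u by (intro Ki.K_mono) auto
      then show "0 \<le> K i (u i) x" using Ki.K_const[of 0 x] by simp
      have "K i (u i) x \<le> K i (\<lambda>_. U i) x" using u by (intro Ki.K_mono) auto
      also have "\<dots> \<le> U i" using Ki.K_const[of "U i" x] Ki.K_one_le[of x] U mult_left_le[of "K i (\<lambda>_. 1) x" "U i"] by simp
      finally show "K i (u i) x \<le> U i" .
    qed
    have Kb [simp]: "K i (u i) \<in> bfun M" using u by auto
    have yb [simp]: "y i \<in> bfun M" unfolding y_def by (intro bfun_power bfun_diff) auto
    have K1: "K i (u i) x \<le> 1" for x using Ku[of x] U1 by linarith
    have ybd: "1 - B * U i \<le> y i x" "y i x \<le> 1" for x
    proof -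
      have "1 - B * U i \<le> 1 - B * K i (u i) x" using Ku[of x] B by simp
      also have "\<dots> \<le> y i x" using one_minus_power_bounds(1)[OF Ku(1)[of x] K1[of x], where b = b] by (simp add: y_def B_def)
      finally show "1 - B * U i \<le> y i x" .
      show "y i x \<le> 1" using Ku[of x] K1[of x] by (simp add: y_def power_le_one)
    qed
    have ny: "1 - B * U i \<le> qsd (K i) x\<^sub>0 (y i)" "qsd (K i) x\<^sub>0 (y i) \<le> 1"
      using Ki.\<nu>_mono[of "\<lambda>_. 1 - B * U i" "y i"] Ki.\<nu>_mono[of "y i" "\<lambda>_. 1"] ybd by (auto simp: Ki.\<nu>_const)
    have nU: "n i \<le> U i" "0 \<le> n i"
      using Ki.\<nu>_mono[of "u i" "\<lambda>_. U i"] Ki.\<nu>_mono[of "\<lambda>_. 0" "u i"] u by (auto simp: Ki.\<nu>_const n_def)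
    have "qsd (K i) x\<^sub>0 (u i) = qsd (K i) x\<^sub>0 (\<lambda>x. 1 - s i * y i x)"
      using fx u by (intro antisym Ki.\<nu>_mono bfun_diff bfun_scale) auto
    also have "\<dots> = 1 - s i * qsd (K i) x\<^sub>0 (y i)"
      using Ki.\<nu>_diff[of "\<lambda>_. 1" "\<lambda>x. s i * y i x"] by (simp add: Ki.\<nu>_const Ki.\<nu>_scale bfun_scale)
    finally have n1: "n i = 1 - s i * qsd (K i) x\<^sub>0 (y i)" by (simp add: n_def)
    define g where "g = (\<lambda>x. 1 - B * K i (u i) x + C2 * (K i (u i) x)\<^sup>2)"
    have gb [simp]: "g \<in> bfun M" unfolding g_def by (intro bfun_add bfun_diff bfun_scale bfun_power) auto
    have "\<bar>qsd (K i) x\<^sub>0 (\<lambda>x. y i x - g x)\<bar> \<le> B ^ 3 * U i ^ 3"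
    proof (intro Ki.\<nu>_abs_le bfun_diff yb gb)
      fix x
      have "y i x \<le> g x" "g x - B ^ 3 * (K i (u i) x) ^ 3 \<le> y i x"
        using one_minus_power_bounds(2,3)[OF Ku(1)[of x] K1[of x], where b = b] by (auto simp: y_def g_def C2_def B_def)
      moreover have "B ^ 3 * (K i (u i) x) ^ 3 \<le> B ^ 3 * U i ^ 3"
        using Ku[of x] B by (intro mult_left_mono power_mono) auto
      moreover have "0 \<le> B ^ 3 * U i ^ 3" using B U by simp
      ultimately show "\<bar>y i x - g x\<bar> \<le> B ^ 3 * U i ^ 3" by linarith
    qed
    moreover have "qsd (K i) x\<^sub>0 (\<lambda>x. y i x - g x) = qsd (K i) x\<^sub>0 (y i) - qsd (K i) x\<^sub>0 g"
      by (simp add: Ki.\<nu>_diff)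
    moreover have "qsd (K i) x\<^sub>0 g = 1 - B * (L i * n i) + C2 * qsd (K i) x\<^sub>0 (\<lambda>x. (K i (u i) x)\<^sup>2)"
    proof -
      have "qsd (K i) x\<^sub>0 g = qsd (K i) x\<^sub>0 (\<lambda>x. 1 - B * K i (u i) x) + qsd (K i) x\<^sub>0 (\<lambda>x. C2 * (K i (u i) x)\<^sup>2)"
        unfolding g_def by (intro Ki.\<nu>_add bfun_diff bfun_scale bfun_power) auto
      also have "qsd (K i) x\<^sub>0 (\<lambda>x. 1 - B * K i (u i) x) = 1 - B * qsd (K i) x\<^sub>0 (K i (u i))"
        using Ki.\<nu>_diff[of "\<lambda>_. 1" "\<lambda>x. B * K i (u i) x"] by (simp add: Ki.\<nu>_const Ki.\<nu>_scale bfun_scale)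
      also have "qsd (K i) x\<^sub>0 (K i (u i)) = L i * n i" unfolding n_def L_def by (rule Ki.\<nu>_K[OF u(1)])
      also have "qsd (K i) x\<^sub>0 (\<lambda>x. C2 * (K i (u i) x)\<^sup>2) = C2 * qsd (K i) x\<^sub>0 (\<lambda>x. (K i (u i) x)\<^sup>2)"
        by (intro Ki.\<nu>_scale bfun_power) auto
      finally show ?thesis .
    qed
    ultimately have n1m: "\<bar>qsd (K i) x\<^sub>0 (y i) - (1 - B * (L i * n i) + C2 * qsd (K i) x\<^sub>0 (\<lambda>x. (K i (u i) x)\<^sup>2))\<bar> \<le> B ^ 3 * U i ^ 3"
      by simp
    have main: "\<bar>(1 - s i) * qsd (K i) x\<^sub>0 (y i) + \<delta> i * n i - C2 * qsd (K i) x\<^sub>0 (\<lambda>x. (K i (u i) x)\<^sup>2)\<bar> \<le> B ^ 3 * U i ^ 3"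
    proof -
      have "s i * qsd (K i) x\<^sub>0 (y i) = 1 - n i" using n1 by simp
      then have "(1 - s i) * qsd (K i) x\<^sub>0 (y i) + \<delta> i * n i - c = qsd (K i) x\<^sub>0 (y i) - (1 - B * (L i * n i) + c)" for c
        by (simp add: \<delta>_def left_diff_distrib)
      then show ?thesis using n1m by simp
    qed
    have sq: "qsd (K i) x\<^sub>0 (\<lambda>x. (K i (u i) x)\<^sup>2) \<le> (U i)\<^sup>2"
    proof -
      have "qsd (K i) x\<^sub>0 (\<lambda>x. (K i (u i) x)\<^sup>2) \<le> qsd (K i) x\<^sub>0 (\<lambda>_. (U i)\<^sup>2)"
        using Ku by (intro Ki.\<nu>_mono bfun_power) (auto intro: power_mono)
      then show ?thesis by (simp add: Ki.\<nu>_const)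
    qed
    have "(1 - s i) * (1 / 2) \<le> (1 - s i) * qsd (K i) x\<^sub>0 (y i)"
      using ny U by (intro mult_left_mono) auto
    also have "\<dots> \<le> C2 * (U i)\<^sup>2 + B ^ 3 * U i ^ 3"
      using main mult_nonneg_nonneg[OF U(5) nU(2)] mult_left_mono[OF sq C2] by linarith
    also have "\<dots> \<le> C2 * (U i)\<^sup>2 + B ^ 3 * (U i)\<^sup>2"
      using U U1 B by (intro add_left_mono mult_left_mono power_decreasing) auto
    finally have "1 - s i \<le> 2 * (C2 + B ^ 3) * (U i)\<^sup>2" by (simp add: algebra_simps)
    then show ?thesis using Ku U1 ny nU main by blast
  qed
  \<comment> \<open>Collects the quadratic errors: the first summand comes from the bound on
    \<open>1 - s i\<close> in \<open>basic\<close>, the second from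
    \<open>C2 \<le> B ^ 2\<close>.\<close>
  define c1 where "c1 = 2 * (C2 + B ^ 3) + B ^ 2"
  have close_eig: "eventually (\<lambda>i. \<forall>x\<in>space M. \<bar>u i x - n i * eigfun (K i) x\<^sub>0 x\<bar> \<le> d * U i) F" if d: "0 < d" for d
  proof -
    \<comment> \<open>\<open>N\<close> is fixed by the spectral gap; only afterwards does the index
      make the telescoping error small.\<close>
    obtain N where N: "4 * C\<^sup>2 * K\<^sub>0.e N < d / 2" using rate_le[OF half_gt_zero[OF d], of "4 * C\<^sup>2"] by blast
    have "((\<lambda>i. real N * C * (c1 * U i + \<delta> i * B / 1 / p)) \<longlongrightarrow> real N * C * (c1 * 0 + 0 * B / 1 / p)) F"
      using K\<^sub>0.p_pos by (intro tendsto_intros U \<delta>0) auto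
    then have "((\<lambda>i. real N * C * (c1 * U i + \<delta> i * B / 1 / p)) \<longlongrightarrow> 0) F" by simp
    from order_tendstoD(2)[OF this, of "d / 2"] d
    have "eventually (\<lambda>i. real N * C * (c1 * U i + \<delta> i * B / 1 / p) < d / 2) F" by simp
    then show ?thesis using good
    proof eventually_elim
      case (elim i)
      interpret Ki: doeblin_kernel M "K i" p C \<epsilon> m \<eta> x\<^sub>0 using elim(2) by (simp add: good_def)
      note bi = basic[OF elim(2)]
      have u: "u i \<in> bfun M" "\<And>x. x \<in> space M \<Longrightarrow> 0 \<le> u i x" "\<And>x. x \<in> space M \<Longrightarrow> u i x \<le> U i" "0 < U i" "0 \<le> \<delta> i" "0 \<le> s i" "s i \<le> 1"
        using elim(2) by (auto simp: good_def)
      have fx: "\<And>x. x \<in> space M \<Longrightarrow> u i x = 1 - s i * y i x" using elim(2) by (auto simp: good_def y_def)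
      show ?case
      proof
        fix x assume x: "x \<in> space M"
        have "\<bar>u i x - n i * eigfun (K i) x\<^sub>0 x\<bar> \<le> 4 * C\<^sup>2 * U i * Ki.e N + real N * C * ((c1 * U i + \<delta> i * B / 1 / p) * U i)"
          unfolding n_def
        proof (rule Ki.near_eigenfunction[OF u(1) _ _ x])
          show "\<bar>u i x\<bar> \<le> U i" if "x \<in> space M" for x using u(2,3)[OF that] by simp
          \<comment> \<open>With \<open>k = K u\<close>, the equation linearizes to
            \<open>u = B * k\<close>, whereas an eigenfunction satisfies \<open>u = k / L\<close>.
            The linearization error is quadratic in \<open>U\<close>, and the difference
            \<open>B * k - k / L\<close> equals \<open>\<delta> * k / L\<close>, hence is
            \<open>o(U)\<close>.\<close>
          show "\<bar>u i x - K i (u i) x / eigval (K i) x\<^sub>0\<bar> \<le> (c1 * U i + \<delta> i * B / 1 / p) * U i" if x: "x \<in> space M" for x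
          proof -
            define k where "k = K i (u i) x"
            have k: "0 \<le> k" "k \<le> U i" "k \<le> 1" using bi x by (auto simp: k_def)
            have y1: "1 - B * k \<le> y i x" "y i x \<le> 1 - B * k + C2 * k\<^sup>2"
              using one_minus_power_bounds(1,2)[of k b] k by (auto simp: y_def k_def B_def C2_def)
            have y2: "0 \<le> y i x" "y i x \<le> 1" using k by (auto simp: y_def k_def intro: power_le_one)
            have "u i x = (1 - y i x) + (1 - s i) * y i x" using fx[OF x] by (simp add: algebra_simps)
            moreover have "0 \<le> (1 - s i) * y i x" using y2 u by simp
            moreover have "(1 - s i) * y i x \<le> 1 - s i" using y2 u by (simp add: mult_left_le)
            moreover have "C2 * k\<^sup>2 \<le> C2 * (U i)\<^sup>2" using k C2 by (intro mult_left_mono power_mono) auto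
            ultimately have "\<bar>u i x - B * k\<bar> \<le> (1 - s i) + C2 * (U i)\<^sup>2" using y1 u by linarith
            also have "\<dots> \<le> 2 * (C2 + B ^ 3) * (U i)\<^sup>2 + B ^ 2 * (U i)\<^sup>2"
            proof (intro add_mono mult_right_mono)
              have "B * (B - 1) / 2 \<le> B * (B * 2) / 2" using B by (intro divide_right_mono mult_left_mono) auto
              then show "C2 \<le> B ^ 2" by (simp add: C2_def power2_eq_square)
            qed (use bi in auto)
            also have "\<dots> = c1 * U i * U i" by (simp add: c1_def algebra_simps power2_eq_square)
            finally have 1: "\<bar>u i x - B * k\<bar> \<le> c1 * U i * U i" .
            have Lp: "p \<le> L i" unfolding L_def by (rule Ki.\<Lambda>_ge_p)
            have "B * k - k / L i = \<delta> i * k / L i"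
              using Lp K\<^sub>0.p_pos by (simp add: \<delta>_def field_simps)
            also have "\<dots> \<le> \<delta> i * U i / p"
              using Lp K\<^sub>0.p_pos k u by (intro frac_le mult_left_mono mult_nonneg_nonneg) auto
            also have "\<dots> \<le> \<delta> i * B / 1 / p * U i"
              using B K\<^sub>0.p_pos u mult_left_mono[of 1 B "\<delta> i * U i / p"] by (simp add: field_simps)
            finally have 2: "B * k - k / L i \<le> \<delta> i * B / 1 / p * U i" .
            have "B * k - k / L i = \<delta> i * k / L i"
              using Lp K\<^sub>0.p_pos by (simp add: \<delta>_def field_simps)
            then have 3: "0 \<le> B * k - k / L i" using Lp K\<^sub>0.p_pos k u by simp
            have "\<bar>u i x - k / L i\<bar> \<le> c1 * U i * U i + \<delta> i * B / 1 / p * U i"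
              using 1 2 3 by linarith
            then show ?thesis by (simp add: k_def L_def algebra_simps)
          qed
        qed
        also have "4 * C\<^sup>2 * U i * Ki.e N \<le> d / 2 * U i"
          using mult_right_mono[OF less_imp_le[OF N], of "U i"] u by (simp add: algebra_simps)
        also have "real N * C * ((c1 * U i + \<delta> i * B / 1 / p) * U i) \<le> d / 2 * U i"
          using mult_right_mono[OF less_imp_le[OF elim(1)], of "U i"] u by (simp add: algebra_simps)
        finally show "\<bar>u i x - n i * eigfun (K i) x\<^sub>0 x\<bar> \<le> d * U i" by (simp add: algebra_simps)
      qed
    qed
  qed
  \<comment> \<open>With \<open>d = 1/2\<close> every value of \<open>u i\<close> is at most
    \<open>n i * C + U i / 2\<close>; since \<open>U i\<close> is the least bound, the last term can
    be absorbed.\<close>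
  have Un: "eventually (\<lambda>i. U i \<le> 2 * C * n i) F"
    using close_eig[of "1/2", simplified] good
  proof eventually_elim
    case (elim i)
    interpret Ki: doeblin_kernel M "K i" p C \<epsilon> m \<eta> x\<^sub>0 using elim(2) by (simp add: good_def)
    have n0: "0 \<le> n i" using basic[OF elim(2)] by simp
    have "U i \<le> n i * C + U i / 2"
    proof -
      have "u i x \<le> n i * C + U i / 2" if x: "x \<in> space M" for x
        using bspec[OF elim(1) x] mult_left_mono[OF Ki.h_bounds(2)[OF x] n0]
          abs_ge_self[of "u i x - n i * eigfun (K i) x\<^sub>0 x"] by argo
      then show ?thesis using elim(2) by (simp add: good_def)
    qed
    moreover have "2 * C * n i = 2 * (n i * C)" by (simp only: ac_simps)
    ultimately show ?case by argo
  qed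
  show pos: "eventually (\<lambda>i. 0 < n i \<and> n i \<le> U i) F"
    using Un good
  proof eventually_elim
    case (elim i)
    have "0 < 2 * C * n i" using elim by (simp add: good_def)
    then show ?case using C basic[OF elim(2)] by (simp add: zero_less_mult_iff)
  qed
  have close_n: "eventually (\<lambda>i. \<forall>x\<in>space M. \<bar>u i x - n i * eigfun (K i) x\<^sub>0 x\<bar> \<le> d * n i) F" if d: "0 < d" for d
  proof -
    have "0 < d / (2 * C)" using d C by simp
    from close_eig[OF this] Un show ?thesis
    proof eventually_elim
      case (elim i)
      have "d / (2 * C) * U i \<le> d / (2 * C) * (2 * C * n i)" using elim(2) d C by (intro mult_left_mono) auto
      also have "\<dots> = d * n i" using C by simp
      finally have le: "d / (2 * C) * U i \<le> d * n i" .
      show ?case using elim(1) order_trans[OF _ le] by blast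
    qed
  qed
  show "uniform_limit (space M) (\<lambda>i x. u i x / n i) (eigfun K\<^sub>0 x\<^sub>0) F"
  proof (rule uniform_limitI)
    fix d :: real assume "0 < d"
    then have d: "0 < d / 2" "0 < d / 2" by auto
    show "\<forall>\<^sub>F i in F. \<forall>x\<in>space M. dist (u i x / n i) (eigfun K\<^sub>0 x\<^sub>0 x) < d"
      using close_n[OF d(1)] uniform_limitD[OF eigfun_uniform d(2)] pos
    proof eventually_elim
      case (elim i)
      show ?case
      proof
        fix x assume x: "x \<in> space M"
        have "u i x / n i - eigfun (K i) x\<^sub>0 x = (u i x - n i * eigfun (K i) x\<^sub>0 x) / n i"
          using elim(3) by (simp add: field_simps)
        then have "\<bar>u i x / n i - eigfun (K i) x\<^sub>0 x\<bar> = \<bar>u i x - n i * eigfun (K i) x\<^sub>0 x\<bar> / n i"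
          using elim(3) by simp
        also have "\<dots> \<le> d / 2" using bspec[OF elim(1) x] elim(3) by (simp add: pos_divide_le_eq)
        finally show "dist (u i x / n i) (eigfun K\<^sub>0 x\<^sub>0 x) < d"
          using bspec[OF elim(2) x] unfolding dist_real_def by linarith
      qed
    qed
  qed
  have sq_lim: "((\<lambda>i. qsd (K i) x\<^sub>0 (\<lambda>x. (K i (u i) x)\<^sup>2) / (n i)\<^sup>2 - (L i)\<^sup>2 * qsd (K i) x\<^sub>0 (\<lambda>x. (eigfun (K i) x\<^sub>0 x)\<^sup>2)) \<longlongrightarrow> 0) F"
  proof (rule tendstoI)
    fix d :: real assume d: "0 < d"
    \<comment> \<open>The cap at 1 bounds \<open>K u / n + L h\<close>, the second factor of the
      difference of squares, by \<open>2 * C + 1\<close>.\<close>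
    define d' where "d' = min 1 (d / (2 * (2 * C + 1)))"
    have d': "0 < d'" "d' \<le> 1" "d' * (2 * C + 1) < d"
    proof -
      have "d' * (2 * C + 1) \<le> d / (2 * (2 * C + 1)) * (2 * C + 1)" using C by (intro mult_right_mono) (auto simp: d'_def)
      also have "\<dots> = d / 2" using C by (simp add: field_simps)
      finally show "d' * (2 * C + 1) < d" using d by simp
    qed (use d C in \<open>auto simp: d'_def\<close>)
    show "\<forall>\<^sub>F i in F. dist (qsd (K i) x\<^sub>0 (\<lambda>x. (K i (u i) x)\<^sup>2) / (n i)\<^sup>2 - (L i)\<^sup>2 * qsd (K i) x\<^sub>0 (\<lambda>x. (eigfun (K i) x\<^sub>0 x)\<^sup>2)) 0 < d"
      using close_n[OF d'(1)] pos good
    proof eventually_elim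
      case (elim i)
      interpret Ki: doeblin_kernel M "K i" p C \<epsilon> m \<eta> x\<^sub>0 using elim(3) by (simp add: good_def)
      have u: "u i \<in> bfun M" using elim(3) by (simp add: good_def)
      let ?h = "eigfun (K i) x\<^sub>0"
      have L: "0 < L i" "L i \<le> 1"
      proof -
        show "0 < L i" by (simp add: L_def)
        show "L i \<le> 1" using Ki.\<nu>_mono[of "K i (\<lambda>_. 1)" "\<lambda>_. 1"] Ki.K_one_le Ki.K_bfun[OF bfun_const, of 1]
          by (simp add: L_def eigval_def Ki.\<nu>_const)
      qed
      have Kb [simp]: "K i (u i) \<in> bfun M" using u by auto
      have bd: "\<bar>(1 / (n i)\<^sup>2) * (K i (u i) x)\<^sup>2 - (L i)\<^sup>2 * (?h x)\<^sup>2\<bar> \<le> d' * (2 * C + 1)" if x: "x \<in> space M" for x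
      proof -
        have "\<bar>K i (u i) x - K i (\<lambda>x. n i * ?h x) x\<bar> \<le> d' * n i"
          using elim(1) u by (intro Ki.K_close bfun_scale) auto
        then have "\<bar>K i (u i) x - n i * (L i * ?h x)\<bar> \<le> d' * n i"
          by (simp add: Ki.K_scale Ki.K_h[OF x] L_def)
        moreover have "K i (u i) x / n i - L i * ?h x = (K i (u i) x - n i * (L i * ?h x)) / n i"
          using elim(2) by (simp add: field_simps)
        ultimately have 1: "\<bar>K i (u i) x / n i - L i * ?h x\<bar> \<le> d'"
          using elim(2) by (simp add: pos_divide_le_eq)
        have Lh: "0 \<le> L i * ?h x" "L i * ?h x \<le> C"
          using L Ki.h_bounds(2)[OF x] Ki.h_pos[OF x] C mult_mono[of "L i" 1 "?h x" C] by auto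
        have "(1 / (n i)\<^sup>2) * (K i (u i) x)\<^sup>2 - (L i)\<^sup>2 * (?h x)\<^sup>2 = (K i (u i) x / n i - L i * ?h x) * (K i (u i) x / n i + L i * ?h x)"
          by (simp add: power2_eq_square algebra_simps)
        also have "\<bar>\<dots>\<bar> \<le> d' * (2 * C + 1)"
          unfolding abs_mult using 1 Lh d' by (intro mult_mono) auto
        finally show ?thesis .
      qed
      have "\<bar>qsd (K i) x\<^sub>0 (\<lambda>x. (1 / (n i)\<^sup>2) * (K i (u i) x)\<^sup>2 - (L i)\<^sup>2 * (?h x)\<^sup>2)\<bar> \<le> d' * (2 * C + 1)"
        using bd by (intro Ki.\<nu>_abs_le bfun_diff bfun_scale bfun_power) auto
      also have "qsd (K i) x\<^sub>0 (\<lambda>x. (1 / (n i)\<^sup>2) * (K i (u i) x)\<^sup>2 - (L i)\<^sup>2 * (?h x)\<^sup>2) =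
          qsd (K i) x\<^sub>0 (\<lambda>x. (1 / (n i)\<^sup>2) * (K i (u i) x)\<^sup>2) - qsd (K i) x\<^sub>0 (\<lambda>x. (L i)\<^sup>2 * (?h x)\<^sup>2)"
        by (intro Ki.\<nu>_diff bfun_scale bfun_power) auto
      also have "qsd (K i) x\<^sub>0 (\<lambda>x. (1 / (n i)\<^sup>2) * (K i (u i) x)\<^sup>2) = (1 / (n i)\<^sup>2) * qsd (K i) x\<^sub>0 (\<lambda>x. (K i (u i) x)\<^sup>2)"
        by (intro Ki.\<nu>_scale bfun_power) auto
      also have "qsd (K i) x\<^sub>0 (\<lambda>x. (L i)\<^sup>2 * (?h x)\<^sup>2) = (L i)\<^sup>2 * qsd (K i) x\<^sub>0 (\<lambda>x. (?h x)\<^sup>2)"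
        by (intro Ki.\<nu>_scale bfun_power) auto
      finally show ?case using d'(3) by (simp add: dist_real_def)
    qed
  qed
  let ?lim = "C2 * (1 / B)\<^sup>2 * qsd K\<^sub>0 x\<^sub>0 (\<lambda>x. (eigfun K\<^sub>0 x\<^sub>0 x)\<^sup>2)"
  have L: "(L \<longlongrightarrow> 1 / B) F"
  proof -
    have "eigval K\<^sub>0 x\<^sub>0 = 1 / B" using crit B by (simp add: B_def field_simps)
    then show ?thesis using eigval_tendsto by (simp add: L_def)
  qed
  have "((\<lambda>i. (qsd (K i) x\<^sub>0 (\<lambda>x. (K i (u i) x)\<^sup>2) / (n i)\<^sup>2 - (L i)\<^sup>2 * qsd (K i) x\<^sub>0 (\<lambda>x. (eigfun (K i) x\<^sub>0 x)\<^sup>2))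
        + (L i)\<^sup>2 * qsd (K i) x\<^sub>0 (\<lambda>x. (eigfun (K i) x\<^sub>0 x)\<^sup>2)) \<longlongrightarrow> 0 + (1 / B)\<^sup>2 * qsd K\<^sub>0 x\<^sub>0 (\<lambda>x. (eigfun K\<^sub>0 x\<^sub>0 x)\<^sup>2)) F"
    by (intro tendsto_intros sq_lim L qsd_square_tendsto)
  then have A: "((\<lambda>i. C2 * (qsd (K i) x\<^sub>0 (\<lambda>x. (K i (u i) x)\<^sup>2) / (n i)\<^sup>2)) \<longlongrightarrow> ?lim) F"
    unfolding mult.assoc by (intro tendsto_mult_left) simp
  \<comment> \<open>The identity in \<open>basic\<close> contains
    \<open>(1 - s i) * qsd (y i)\<close>. Replacing this by \<open>1 - s i\<close> costs a quadratic
    term times \<open>B * U i\<close>, thus one more cubic error, which \<open>Un\<close> makes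
    negligible against \<open>(n i)\<^sup>2\<close>.\<close>
  have "((\<lambda>i. ((1 - s i) + \<delta> i * n i) / (n i)\<^sup>2 - C2 * (qsd (K i) x\<^sub>0 (\<lambda>x. (K i (u i) x)\<^sup>2) / (n i)\<^sup>2)) \<longlongrightarrow> 0) F"
  proof (rule Lim_null_comparison)
    show "((\<lambda>i. (2 * (C2 + B ^ 3) * B + B ^ 3) * (4 * C\<^sup>2) * U i) \<longlongrightarrow> 0) F"
      by (rule tendsto_mult_right_zero[OF U])
    show "\<forall>\<^sub>F i in F. norm (((1 - s i) + \<delta> i * n i) / (n i)\<^sup>2 - C2 * (qsd (K i) x\<^sub>0 (\<lambda>x. (K i (u i) x)\<^sup>2) / (n i)\<^sup>2))
        \<le> (2 * (C2 + B ^ 3) * B + B ^ 3) * (4 * C\<^sup>2) * U i"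
      using Un pos good
    proof eventually_elim
      case (elim i)
      note bi = basic[OF elim(3)]
      define q1 where "q1 = qsd (K i) x\<^sub>0 (\<lambda>x. (K i (u i) x)\<^sup>2)"
      define q2 where "q2 = qsd (K i) x\<^sub>0 (y i)"
      have U: "0 < U i" "s i \<le> 1" using elim(3) by (auto simp: good_def)
      have "(1 - s i) * (1 - q2) \<le> 2 * (C2 + B ^ 3) * (U i)\<^sup>2 * (B * U i)"
        using bi U B by (intro mult_mono) (auto simp: q2_def)
      moreover have "0 \<le> (1 - s i) * (1 - q2)" using bi U by (simp add: q2_def)
      moreover have "\<bar>(1 - s i) * q2 + \<delta> i * n i - C2 * q1\<bar> \<le> B ^ 3 * U i ^ 3"
        using bi by (simp add: q1_def q2_def)
      moreover have "(1 - s i) * q2 = (1 - s i) - (1 - s i) * (1 - q2)" by (simp add: algebra_simps)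
      ultimately have "\<bar>(1 - s i) + \<delta> i * n i - C2 * q1\<bar> \<le> 2 * (C2 + B ^ 3) * (U i)\<^sup>2 * (B * U i) + B ^ 3 * U i ^ 3"
        by linarith
      also have "\<dots> = (2 * (C2 + B ^ 3) * B + B ^ 3) * (U i)\<^sup>2 * U i"
        by (simp add: algebra_simps power2_eq_square power3_eq_cube)
      also have "\<dots> \<le> (2 * (C2 + B ^ 3) * B + B ^ 3) * (2 * C * n i)\<^sup>2 * U i"
        using elim(1) U B C2 by (intro mult_right_mono mult_left_mono power_mono) auto
      finally have "\<bar>(1 - s i) + \<delta> i * n i - C2 * q1\<bar> \<le> (2 * (C2 + B ^ 3) * B + B ^ 3) * (4 * C\<^sup>2) * U i * (n i)\<^sup>2"
        by (simp add: power_mult_distrib algebra_simps)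
      then have "\<bar>(1 - s i) + \<delta> i * n i - C2 * q1\<bar> / (n i)\<^sup>2 \<le> (2 * (C2 + B ^ 3) * B + B ^ 3) * (4 * C\<^sup>2) * U i"
        using elim(2) by (simp add: pos_divide_le_eq)
      moreover have "((1 - s i) + \<delta> i * n i) / (n i)\<^sup>2 - C2 * (q1 / (n i)\<^sup>2) = ((1 - s i) + \<delta> i * n i - C2 * q1) / (n i)\<^sup>2"
        by (simp add: diff_divide_distrib)
      ultimately show ?case by (simp add: q1_def)
    qed
  qed
  from tendsto_add[OF this A]
  show "((\<lambda>i. ((1 - s i) + (real b * L i - 1) * n i) / (n i)\<^sup>2) \<longlongrightarrow>
        real b * (real b - 1) / 2 * (1 / real b)\<^sup>2 * qsd K\<^sub>0 x\<^sub>0 (\<lambda>x. (eigfun K\<^sub>0 x\<^sub>0 x)\<^sup>2)) F"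
    by (simp add: \<delta>_def B_def C2_def)
qed

end

section \<open>The kernel of the walk killed below 1\<close>

text \<open>Continuous approximations converge to \<open>g\<close> only almost everywhere.
  Convolving with the bounded \<open>g\<close> turns their \<open>L1\<close> error on a window into
  a uniform one, and uniform limits preserve continuity.\<close>

lemma convolution_continuous_on:
  fixes g :: "real \<Rightarrow> real"
  assumes [measurable]: "g \<in> borel_measurable borel" and g: "\<And>x. 0 \<le> g x" "\<And>x. g x \<le> D"
    and supp: "\<And>x. x \<notin> {0..1} \<Longrightarrow> g x = 0" and c: "0 < c"
  shows "continuous_on {-R..R} (\<lambda>z. \<integral>x. g (z - c * x) * g x \<partial>lborel)"
proof -
  have "g \<in> borel_measurable lebesgue" by (simp add: measurable_completion)
  then have "g measurable_on UNIV" by (rule lebesgue_measurable_imp_measurable_on) simp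
  then obtain N G where N: "negligible N" and G: "\<And>k. continuous_on UNIV (G k)"
    "\<And>x. x \<notin> N \<Longrightarrow> (\<lambda>k. G k x) \<longlonglongrightarrow> g x"
    by (auto simp: measurable_on_def)
  \<comment> \<open>Clipping to \<open>[0, D]\<close> does not change the limit and supplies the
    domination used below.\<close>
  define H where "H = (\<lambda>k x. max 0 (min D (G k x)))"
  have D: "0 \<le> D" using g[of 0] by linarith
  have H: "0 \<le> H k x" "H k x \<le> D" for k x using D by (auto simp: H_def)
  have Hc: "continuous_on UNIV (H k)" for k unfolding H_def by (intro continuous_intros G)
  then have [measurable]: "H k \<in> borel_measurable borel" for k by (rule borel_measurable_continuous_onI)
  have "AE x in lborel. (\<lambda>k. G k x) \<longlonglongrightarrow> g x"
  proof -
    have "N \<in> null_sets (completion lborel)" using N by (simp add: negligible_iff_null_sets)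
    then obtain N' where "N' \<in> null_sets lborel" "N \<subseteq> N'" by (auto simp: null_sets_completion_iff2)
    then show ?thesis by (intro AE_I'[of N']) (use G(2) in auto)
  qed
  then have AE: "AE x in lborel. (\<lambda>k. H k x) \<longlonglongrightarrow> g x"
  proof eventually_elim
    case (elim x)
    have "(\<lambda>k. H k x) \<longlonglongrightarrow> max 0 (min D (g x))"
      unfolding H_def by (intro tendsto_intros elim)
    then show ?case using g[of x] by simp
  qed
  \<comment> \<open>For \<open>z\<close> in \<open>[-R, R]\<close> and \<open>x\<close> in
    \<open>[0, 1]\<close> the point \<open>z - c * x\<close> stays in this window; for other
    \<open>x\<close> the factor \<open>g x\<close> vanishes.\<close>
  define e where "e = (\<lambda>k. \<integral>t. indicator {-R-c..R} t * \<bar>H k t - g t\<bar> \<partial>lborel)"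
  have e: "e \<longlonglongrightarrow> 0"
  proof -
    have "e \<longlonglongrightarrow> (\<integral>t. 0 \<partial>(lborel :: real measure))"
      unfolding e_def
    proof (rule integral_dominated_convergence[where w = "\<lambda>t. indicator {-R-c..R} t * (2 * D)"])
      show "integrable lborel (\<lambda>t. indicator {-R-c..R} t * (2 * D))"
        by (intro integrable_mult_left) (simp add: integrable_indicator_iff emeasure_lborel_Icc_eq)
      show "AE x in lborel. (\<lambda>k. indicator {-R-c..R} x * \<bar>H k x - g x\<bar>) \<longlonglongrightarrow> 0"
        using AE
      proof eventually_elim
        case (elim x)
        have "(\<lambda>k. indicator {-R-c..R} x * \<bar>H k x - g x\<bar>) \<longlonglongrightarrow> indicator {-R-c..R} x * \<bar>g x - g x\<bar>"
          by (intro tendsto_intros elim)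
        then show ?case by simp
      qed
      show "AE x in lborel. norm (indicator {-R-c..R} x * \<bar>H k x - g x\<bar>) \<le> indicator {-R-c..R} x * (2 * D)" for k
      proof (rule AE_I2)
        fix x
        show "norm (indicator {-R-c..R} x * \<bar>H k x - g x\<bar>) \<le> indicator {-R-c..R} x * (2 * D)"
          using H[of k x] g[of x] by (auto simp: indicator_def abs_le_iff)
      qed
    qed auto
    then show ?thesis by simp
  qed
  have gint: "integrable lborel g"
  proof (rule Bochner_Integration.integrable_bound[of _ "\<lambda>x. indicator {0..1} x * D"])
    show "AE x in lborel. norm (g x) \<le> norm (indicator {0..1} x * D)"
      using g supp D by (intro AE_I2) (auto simp: indicator_def)
  qed (auto intro!: integrable_mult_left simp: integrable_indicator_iff emeasure_lborel_Icc_eq)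
  have int: "integrable lborel (\<lambda>x. f (z - c * x) * g x)"
    if [measurable]: "f \<in> borel_measurable borel" and f: "\<And>x. \<bar>f x\<bar> \<le> A" for f z and A :: real
  proof (rule Bochner_Integration.integrable_bound[of _ "\<lambda>x. A * g x"])
    have "\<bar>f (z - c * x)\<bar> * \<bar>g x\<bar> \<le> \<bar>A\<bar> * \<bar>g x\<bar>" for x
      by (intro mult_right_mono order_trans[OF f abs_ge_self]) auto
    then show "AE x in lborel. norm (f (z - c * x) * g x) \<le> norm (A * g x)"
      by (simp add: abs_mult)
  qed (auto intro: gint)
  define T where "T = (\<lambda>k z. \<integral>x. H k (z - c * x) * g x \<partial>lborel)"
  have Tc: "continuous_on {-R..R} (T k)" for k
  proof (rule continuous_at_imp_continuous_on, rule ballI)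
    fix z
    show "isCont (T k) z"
    proof (rule continuous_at_sequentiallyI)
      fix v :: "nat \<Rightarrow> real" assume v: "v \<longlonglongrightarrow> z"
      show "(\<lambda>n. T k (v n)) \<longlonglongrightarrow> T k z"
        unfolding T_def
      proof (rule integral_dominated_convergence[where w = "\<lambda>x. D * g x"])
        show "AE x in lborel. (\<lambda>n. H k (v n - c * x) * g x) \<longlonglongrightarrow> H k (z - c * x) * g x"
        proof (rule AE_I2)
          fix x
          have "isCont (H k) (z - c * x)" using Hc[of k] by (simp add: continuous_on_eq_continuous_at)
          then show "(\<lambda>n. H k (v n - c * x) * g x) \<longlonglongrightarrow> H k (z - c * x) * g x"
            by (intro tendsto_mult_right isCont_tendsto_compose[of _ "H k"] tendsto_intros v)
        qed
        show "AE x in lborel. norm (H k (v n - c * x) * g x) \<le> D * g x" for n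
          using H g by (intro AE_I2) (auto simp: abs_mult intro!: mult_right_mono)
      qed (use gint in auto)
    qed
  qed
  have "uniform_limit {-R..R} T (\<lambda>z. \<integral>x. g (z - c * x) * g x \<partial>lborel) sequentially"
  proof (rule uniform_limitI)
    fix d :: real assume d: "0 < d"
    have "(\<lambda>k. D / c * e k) \<longlonglongrightarrow> 0" by (rule tendsto_mult_right_zero[OF e])
    from order_tendstoD(2)[OF this d]
    show "\<forall>\<^sub>F k in sequentially. \<forall>z\<in>{-R..R}. dist (T k z) (\<integral>x. g (z - c * x) * g x \<partial>lborel) < d"
    proof eventually_elim
      case (elim k)
      show ?case
      proof
        fix z assume z: "z \<in> {-R..R}"
        define \<phi> where "\<phi> = (\<lambda>t. indicator {-R-c..R} t * \<bar>H k t - g t\<bar>)"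
        have [measurable]: "\<phi> \<in> borel_measurable borel" unfolding \<phi>_def by measurable
        have \<phi>b: "0 \<le> \<phi> t" "\<phi> t \<le> indicator {-R-c..R} t * (2 * D)" for t
          using H[of k t] g[of t] by (auto simp: \<phi>_def indicator_def abs_le_iff)
        have \<phi>i: "integrable lborel \<phi>"
          by (rule Bochner_Integration.integrable_bound[of _ "\<lambda>t. indicator {-R-c..R} t * (2 * D)"])
             (use \<phi>b in \<open>auto intro!: integrable_mult_left AE_I2 order_trans[OF \<phi>b(2)] simp: integrable_indicator_iff emeasure_lborel_Icc_eq\<close>)
        have "T k z - (\<integral>x. g (z - c * x) * g x \<partial>lborel) = (\<integral>x. (H k (z - c * x) - g (z - c * x)) * g x \<partial>lborel)"
          unfolding T_def using int[of "H k" D z] int[of g D z] H g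
          by (subst Bochner_Integration.integral_diff[symmetric]) (auto simp: algebra_simps)
        also have "\<bar>\<dots>\<bar> \<le> (\<integral>x. \<bar>(H k (z - c * x) - g (z - c * x)) * g x\<bar> \<partial>lborel)"
          by (rule integral_abs_bound)
        also have "\<dots> \<le> (\<integral>x. D * \<phi> (z + (- c) * x) \<partial>lborel)"
        proof (rule integral_mono_AE)
          show "integrable lborel (\<lambda>x. D * \<phi> (z + (- c) * x))"
            using lborel_integrable_real_affine[OF \<phi>i, of "-c" z] c by (intro integrable_mult_right) auto
          have "\<bar>H k x - g x\<bar> \<le> 2 * D" for x using H[of k x] g[of x] by (simp add: abs_le_iff)
          then show "integrable lborel (\<lambda>x. \<bar>(H k (z - c * x) - g (z - c * x)) * g x\<bar>)"
            using int[of "\<lambda>x. H k x - g x" "2 * D" z] by (intro integrable_abs) auto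
          show "AE x in lborel. \<bar>(H k (z - c * x) - g (z - c * x)) * g x\<bar> \<le> D * \<phi> (z + - c * x)"
          proof (rule AE_I2)
            fix x
            show "\<bar>(H k (z - c * x) - g (z - c * x)) * g x\<bar> \<le> D * \<phi> (z + - c * x)"
            proof (cases "x \<in> {0..1}")
              case True
              have "c * x \<le> c" "0 \<le> c * x" using True c by (auto simp: mult_left_le)
              then have "z - c * x \<in> {-R-c..R}" using z by auto
              then have "\<phi> (z + - c * x) = \<bar>H k (z - c * x) - g (z - c * x)\<bar>" by (simp add: \<phi>_def)
              then show ?thesis using g[of x] by (simp add: abs_mult mult.commute[of D] mult_left_mono)
            next
              case False
              then show ?thesis using supp[OF False] D \<phi>b(1)[of "z + - c * x"] by simp
            qed
          qed
        qed
        also have "\<dots> = D / c * e k"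
        proof -
          have "(\<integral>x. \<phi> x \<partial>lborel) = \<bar>-c\<bar> *\<^sub>R (\<integral>x. \<phi> (z + (- c) * x) \<partial>lborel)"
            using c by (intro lborel_integral_real_affine) auto
          then have "(\<integral>x. \<phi> (z + (- c) * x) \<partial>lborel) = e k / c"
            using c by (simp add: e_def \<phi>_def field_simps)
          then show ?thesis by simp
        qed
        finally show "dist (T k z) (\<integral>x. g (z - c * x) * g x \<partial>lborel) < d"
          using elim by (simp add: dist_real_def)
      qed
    qed
  qed
  then show ?thesis
    by (rule uniform_limit_theorem[rotated]) (use Tc in auto)
qed

abbreviation state :: "real \<Rightarrow> real measure" where
  "state B \<equiv> restrict_space borel {1..B}"

text \<open>The lower end of the indicator is the killing. The upper end makes the type space
  bounded without cutting anything off: for \<open>b\<close> and \<open>B\<close> at least 2, a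
  label in \<open>[0, 1]\<close> and a mother of value at most \<open>B\<close> give at most
  \<open>1 + B / 2 \<le> B\<close>. The argument \<theta> itself is not restricted.\<close>

definition akern :: "nat \<Rightarrow> real \<Rightarrow> real measure \<Rightarrow> (real \<Rightarrow> real) \<Rightarrow> real \<Rightarrow> real" where
  "akern b B \<rho> f \<theta> = (\<integral>x. indicator {1..B} (x + \<theta> / real b) * f (x + \<theta> / real b) \<partial>\<rho>)"

lemma bfun_state:
  assumes "f \<in> bfun (state B)"
  shows "(\<lambda>y. indicator {1..B} y * f y) \<in> borel_measurable borel"
proof -
  have "(\<lambda>y. indicator {1..B} y *\<^sub>R f y) \<in> borel_measurable borel"
    using bfun_measurable[OF assms] by (subst (asm) borel_measurable_restrict_space_iff) auto
  then show ?thesis by simp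
qed

lemma bfun_stateI:
  assumes "f \<in> borel_measurable borel" "\<And>x. 1 \<le> x \<Longrightarrow> x \<le> B \<Longrightarrow> \<bar>f x\<bar> \<le> c"
  shows "f \<in> bfun (state B)"
  using assms by (intro bfunI[of _ _ c]) (auto simp: space_restrict_space intro: measurable_restrict_space1)

text \<open>The density enters through the Lipschitz bound \<open>lip\<close> only, and
  \<open>p\<close> is merely a lower bound for the mass of the last interval, so that two laws and
  their mixtures satisfy the locale with the same \<open>D\<close> and \<open>p\<close>.\<close>

locale site_law = prob_space \<rho> for \<rho> :: "real measure" +
  fixes b :: nat and B D p :: real
  assumes sets_rho [simp, measurable_cong]: "sets \<rho> = sets borel"
    and AE_unit: "AE x in \<rho>. x \<in> {0..1}"
    and b: "1 < b" and B: "2 \<le> B"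
    and D_pos: "0 < D" and lip: "\<And>a c. a \<le> c \<Longrightarrow> measure \<rho> {a..c} \<le> D * (c - a)"
    and p_pos: "0 < p" and p_le: "p \<le> measure \<rho> {1 - 1 / real b..1}"
begin

abbreviation "K \<equiv> akern b B \<rho>"

section \<open>Positivity and monotonicity of the kernel\<close>

lemma space_rho [simp]: "space \<rho> = UNIV"
  using sets_eq_imp_space_eq[OF sets_rho] by simp

lemma prob_UNIV [simp]: "prob UNIV = 1"
  using prob_space by simp

lemma b_real: "2 \<le> real b" "0 < real b"
  using b by auto

lemma integrand_measurable [measurable]:
  "f \<in> bfun (state B) \<Longrightarrow> (\<lambda>x. indicator {1..B} (x + t) * f (x + t)) \<in> borel_measurable \<rho>"
  using measurable_compose[OF _ bfun_state[of f B], of "\<lambda>x. x + t" \<rho>] by simp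

lemma integrand_bound:
  fixes f :: "real \<Rightarrow> real"
  assumes "\<And>x. x \<in> {1..B} \<Longrightarrow> \<bar>f x\<bar> \<le> c" "0 \<le> c"
  shows "\<bar>indicator {1..B} y * f y\<bar> \<le> c"
  using assms by (cases "y \<in> {1..B}") auto

lemma integrand_integrable:
  assumes "f \<in> bfun (state B)"
  shows "integrable \<rho> (\<lambda>x. indicator {1..B} (x + t) * f (x + t))"
proof -
  obtain c where c: "0 \<le> c" "\<And>x. x \<in> {1..B} \<Longrightarrow> \<bar>f x\<bar> \<le> c"
    using bfun_bound[OF assms] by (auto simp: space_restrict_space)
  show ?thesis
    using integrand_bound[OF c(2,1)] assms
    by (intro integrable_const_bound[where B = c] AE_I2) (auto simp: abs_mult)
qed

lemma K_abs_le:
  assumes "f \<in> bfun (state B)" "\<And>x. x \<in> {1..B} \<Longrightarrow> \<bar>f x\<bar> \<le> c" "0 \<le> c"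
  shows "\<bar>K f \<theta>\<bar> \<le> c"
proof -
  have "\<bar>K f \<theta>\<bar> \<le> (\<integral>x. \<bar>indicator {1..B} (x + \<theta> / real b) * f (x + \<theta> / real b)\<bar> \<partial>\<rho>)"
    unfolding akern_def by (rule integral_abs_bound)
  also have "\<dots> \<le> (\<integral>x. c \<partial>\<rho>)"
    using integrand_bound[OF assms(2,3)]
    by (intro integral_mono integrable_abs integrand_integrable assms(1)) auto
  finally show ?thesis by (simp add: prob_space)
qed

lemma K_measurable: "f \<in> bfun (state B) \<Longrightarrow> K f \<in> borel_measurable borel"
proof -
  assume "f \<in> bfun (state B)"
  note [measurable] = bfun_state[OF this]
  have "(\<lambda>(\<theta>, x). (\<lambda>y. indicator {1..B} y * f y) (x + \<theta> / real b)) \<in> borel_measurable (borel \<Otimes>\<^sub>M \<rho>)"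
    unfolding case_prod_beta by (rule measurable_compose[OF _ bfun_state[OF \<open>f \<in> bfun (state B)\<close>]]) simp
  then show ?thesis
    unfolding akern_def by (intro borel_measurable_lebesgue_integral) (simp add: case_prod_beta)
qed

lemma K_bfun: "f \<in> bfun (state B) \<Longrightarrow> K f \<in> bfun (state B)"
proof -
  assume f: "f \<in> bfun (state B)"
  obtain c where c: "0 \<le> c" "\<And>x. x \<in> {1..B} \<Longrightarrow> \<bar>f x\<bar> \<le> c"
    using bfun_bound[OF f] by (auto simp: space_restrict_space)
  show ?thesis
    using K_abs_le[OF f c(2,1)] by (intro bfun_stateI[where c = c] K_measurable f) auto
qed

lemma K_add: "f \<in> bfun (state B) \<Longrightarrow> g \<in> bfun (state B) \<Longrightarrow> K (\<lambda>x. f x + g x) = (\<lambda>x. K f x + K g x)"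
  unfolding akern_def
  by (rule ext, subst Bochner_Integration.integral_add[symmetric])
     (auto intro!: integrand_integrable simp: distrib_left)

lemma K_scale: "K (\<lambda>x. c * f x) = (\<lambda>x. c * K f x)"
  unfolding akern_def
  by (rule ext, subst integral_mult_right_zero[symmetric]) (simp add: mult.left_commute)

lemma K_mono_AE:
  assumes "f \<in> bfun (state B)" "g \<in> bfun (state B)"
    and "AE x in \<rho>. indicator {1..B} (x + \<theta> / real b) * f (x + \<theta> / real b) \<le> indicator {1..B} (x + \<theta>' / real b) * g (x + \<theta>' / real b)"
  shows "K f \<theta> \<le> K g \<theta>'"
  unfolding akern_def using assms by (intro integral_mono_AE integrand_integrable) auto

lemma K_mono:
  assumes "f \<in> bfun (state B)" "g \<in> bfun (state B)" "\<And>x. x \<in> {1..B} \<Longrightarrow> f x \<le> g x"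
  shows "K f \<theta> \<le> K g \<theta>"
  using assms by (intro K_mono_AE AE_I2) (auto simp: indicator_def)

lemma K_one_le: "K (\<lambda>_. 1) \<theta> \<le> 1"
  using K_abs_le[of "\<lambda>_. 1" 1 \<theta>] by (simp add: abs_le_iff)

lemma upper: "x \<in> {0..1} \<Longrightarrow> \<theta> \<le> B \<Longrightarrow> x + \<theta> / real b \<le> B"
proof -
  assume "x \<in> {0..1}" "\<theta> \<le> B"
  then have "\<theta> / real b \<le> B / real b" using b_real by (intro divide_right_mono) auto
  also have "\<dots> \<le> B / 2" using b_real B by (intro divide_left_mono) auto
  finally show ?thesis using \<open>x \<in> {0..1}\<close> B unfolding atLeastAtMost_iff by linarith
qed

text \<open>Labels in the last interval of length \<open>1 / b\<close> keep every type alive; the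
  lower bounds that are uniform in the type rest on these labels.\<close>

lemma lower: "1 - 1 / real b \<le> x \<Longrightarrow> 1 \<le> \<theta> \<Longrightarrow> 1 \<le> x + \<theta> / real b"
  using divide_right_mono[of 1 \<theta> "real b"] b_real by simp

lemma K_lower:
  assumes f: "f \<in> bfun (state B)" "\<And>x. x \<in> {1..B} \<Longrightarrow> 0 \<le> f x" and \<theta>: "\<theta> \<in> {1..B}"
    and V: "V \<in> sets borel" "V \<subseteq> {1 - 1 / real b..}"
    and c: "\<And>x. x \<in> V \<Longrightarrow> x + \<theta> / real b \<in> {1..B} \<Longrightarrow> c \<le> f (x + \<theta> / real b)" "0 \<le> c"
  shows "c * measure \<rho> V \<le> K f \<theta>"
proof -
  have "c * measure \<rho> V = (\<integral>x. c * indicator V x \<partial>\<rho>)"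
    using V by simp
  also have "\<dots> \<le> K f \<theta>"
    unfolding akern_def
  proof (rule integral_mono_AE)
    show "integrable \<rho> (\<lambda>x. c * indicator V x)"
      using V by (intro integrable_const_bound[where B = c]) (auto simp: indicator_def c)
    show "AE x in \<rho>. c * indicator V x \<le> indicator {1..B} (x + \<theta> / real b) * f (x + \<theta> / real b)"
      using AE_unit
    proof eventually_elim
      case (elim x)
      show ?case
      proof (cases "x \<in> V")
        case True
        then have "x + \<theta> / real b \<in> {1..B}"
          using V \<theta> lower[of x \<theta>] upper[OF elim, of \<theta>] by auto
        then show ?thesis using c(1)[OF True] True by simp
      next
        case False
        then show ?thesis using f(2)[of "x + \<theta> / real b"] by (simp add: indicator_def)
      qed
    qed
  qed (rule integrand_integrable[OF f(1)])
  finally show ?thesis .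
qed

lemma K_one_ge: "\<theta> \<in> {1..B} \<Longrightarrow> p \<le> K (\<lambda>_. 1) \<theta>"
  using K_lower[of "\<lambda>_. 1" \<theta> "{1 - 1 / real b..1}" 1] p_le by auto

text \<open>Coupling with the same label: the larger type has the larger child, and this child
  survives whenever the other does, because \<open>upper\<close> excludes an exit through
  \<open>B\<close>.\<close>

lemma K_nondecreasing:
  assumes f: "f \<in> bfun (state B)" "\<And>x. x \<in> {1..B} \<Longrightarrow> 0 \<le> f x"
    and mono: "\<And>x y. 1 \<le> x \<Longrightarrow> x \<le> y \<Longrightarrow> y \<le> B \<Longrightarrow> f x \<le> f y"
    and \<theta>: "\<theta> \<le> \<theta>'" "\<theta>' \<le> B"
  shows "K f \<theta> \<le> K f \<theta>'"
proof (rule K_mono_AE[OF f(1) f(1)])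
  show "AE x in \<rho>. indicator {1..B} (x + \<theta> / real b) * f (x + \<theta> / real b) \<le> indicator {1..B} (x + \<theta>' / real b) * f (x + \<theta>' / real b)"
    using AE_unit
  proof eventually_elim
    case (elim x)
    have "\<theta> / real b \<le> \<theta>' / real b" using \<theta> b_real by (intro divide_right_mono) auto
    then show ?case
      using upper[OF elim \<theta>(2)] mono[of "x + \<theta> / real b" "x + \<theta>' / real b"] f(2)[of "x + \<theta>' / real b"]
      by (auto simp: indicator_def)
  qed
qed

section \<open>Harnack inequality for the survival probabilities\<close>

lemma Z_bfun: "survival K n \<in> bfun (state B)"
  unfolding survival_def by (induction n) (auto intro: K_bfun)

lemma Z_Suc: "survival K (Suc n) = K (survival K n)"
  by (simp add: survival_def)

lemma Z_nonneg: "\<theta> \<in> {1..B} \<Longrightarrow> 0 \<le> survival K n \<theta>"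
proof (induction n arbitrary: \<theta>)
  case (Suc n)
  have "K (\<lambda>_. 0) \<theta> \<le> K (survival K n) \<theta>" using Suc.IH by (intro K_mono Z_bfun) auto
  then show ?case by (simp add: Z_Suc) (simp add: akern_def)
qed (simp add: survival_def)

lemma Z_nondecreasing: "\<theta> \<le> \<theta>' \<Longrightarrow> 1 \<le> \<theta> \<Longrightarrow> \<theta>' \<le> B \<Longrightarrow> survival K n \<theta> \<le> survival K n \<theta>'"
proof (induction n arbitrary: \<theta> \<theta>')
  case (Suc n)
  then show ?case
    unfolding Z_Suc by (intro K_nondecreasing Z_bfun Z_nonneg) auto
qed (simp add: survival_def)

text \<open>The constant solves \<open>c = c / b + D / (b p)\<close>: one step divides \<open>\<delta>\<close> by \<open>b\<close>, and the perturbed walk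
  survives alone with probability at most \<open>D \<delta> / b\<close>.\<close>

lemma survival_log_lipschitz:
  assumes "1 \<le> \<theta>" "0 \<le> \<delta>" "\<theta> + \<delta> \<le> B"
  shows "survival K n (\<theta> + \<delta>) \<le> exp (D / (p * (real b - 1)) * \<delta>) * survival K n \<theta>"
  using assms
proof (induction n arbitrary: \<theta> \<delta>)
  case 0
  then show ?case using D_pos p_pos b_real by (simp add: survival_def)
next
  case (Suc n)
  define c where "c = D / (p * (real b - 1))"
  let ?Z = "survival K n" and ?b = "real b"
  have c0: "0 \<le> c" using D_pos p_pos b_real by (simp add: c_def)
  have B1: "1 \<in> {1..B}" using B by simp
  have \<theta>B: "\<theta> \<in> {1..B}" using Suc.prems by simp
  define E where "E = exp (c * (\<delta> / ?b))"
  have E1: "1 \<le> E" using c0 Suc.prems b_real by (simp add: E_def)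
  \<comment> \<open>Contains the labels for which the child of \<open>\<theta> + \<delta>\<close>
    topples and the child of \<theta> does not.\<close>
  define J where "J = {1 - \<theta> / ?b - \<delta> / ?b..1 - \<theta> / ?b}"
  have \<delta>b: "0 \<le> \<delta> / ?b" "\<delta> / ?b \<le> \<delta>" using Suc.prems b_real by (auto simp: divide_le_eq mult_le_cancel_left1)
  have "K ?Z (\<theta> + \<delta>) = (\<integral>x. indicator {1..B} (x + (\<theta> + \<delta>) / ?b) * ?Z (x + (\<theta> + \<delta>) / ?b) \<partial>\<rho>)"
    by (simp only: akern_def)
  also have "\<dots> \<le> (\<integral>x. E * (indicator {1..B} (x + \<theta> / ?b) * ?Z (x + \<theta> / ?b)) + E * ?Z 1 * indicator J x \<partial>\<rho>)"
  proof (rule integral_mono_AE)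
    show "integrable \<rho> (\<lambda>x. indicator {1..B} (x + (\<theta> + \<delta>) / ?b) * ?Z (x + (\<theta> + \<delta>) / ?b))"
      by (rule integrand_integrable[OF Z_bfun])
    have "integrable \<rho> (\<lambda>x. E * ?Z 1 * indicator J x)"
      by (intro integrable_const_bound[where B = "\<bar>E * ?Z 1\<bar>"]) (auto simp: J_def indicator_def)
    then show "integrable \<rho> (\<lambda>x. E * (indicator {1..B} (x + \<theta> / ?b) * ?Z (x + \<theta> / ?b)) + E * ?Z 1 * indicator J x)"
      by (rule Bochner_Integration.integrable_add[rotated]) (intro integrable_mult_right integrand_integrable[OF Z_bfun])
    show "AE x in \<rho>. indicator {1..B} (x + (\<theta> + \<delta>) / ?b) * ?Z (x + (\<theta> + \<delta>) / ?b)
        \<le> E * (indicator {1..B} (x + \<theta> / ?b) * ?Z (x + \<theta> / ?b)) + E * ?Z 1 * indicator J x"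
      using AE_unit
    proof eventually_elim
      case (elim x)
      define y where "y = x + \<theta> / ?b"
      have y': "x + (\<theta> + \<delta>) / ?b = y + \<delta> / ?b" by (simp add: y_def add_divide_distrib)
      have yB: "y + \<delta> / ?b \<le> B" using upper[OF elim, of "\<theta> + \<delta>"] Suc.prems by (simp add: y')
      have nn: "0 \<le> E * ?Z 1 * indicator J x" using E1 Z_nonneg[OF B1] by simp
      show ?case
      proof (cases "1 \<le> y")
        case True
        have "?Z (y + \<delta> / ?b) \<le> E * ?Z y"
          using Suc.IH[OF True \<delta>b(1) yB] by (simp add: E_def c_def)
        then show ?thesis using True yB \<delta>b nn unfolding y' y_def[symmetric] by (simp add: indicator_def)
      next
        case False
        show ?thesis
        proof (cases "1 \<le> y + \<delta> / ?b")
          case True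
          have "x \<in> J" using True False by (auto simp: J_def y_def)
          \<comment> \<open>Here \<open>y < 1\<close>, so monotonicity moves the point up to
            \<open>1 + \<delta> / b\<close>, where the induction hypothesis compares it with the
            smallest type.\<close>
          have "?Z (y + \<delta> / ?b) \<le> ?Z (1 + \<delta> / ?b)"
            using False True yB \<delta>b Suc.prems by (intro Z_nondecreasing) auto
          also have "\<dots> \<le> E * ?Z 1"
            using Suc.IH[of 1 "\<delta> / ?b"] \<delta>b Suc.prems by (simp add: E_def c_def)
          finally show ?thesis using True False yB \<open>x \<in> J\<close> unfolding y' y_def[symmetric] by (simp add: indicator_def)
        next
          case False
          then show ?thesis using \<open>\<not> 1 \<le> y\<close> nn unfolding y' y_def[symmetric] by (simp add: indicator_def)
        qed
      qed
    qed
  qed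
  also have "\<dots> = E * K ?Z \<theta> + E * ?Z 1 * measure \<rho> J"
  proof -
    have "integrable \<rho> (\<lambda>x. E * ?Z 1 * indicator J x)"
      by (intro integrable_const_bound[where B = "\<bar>E * ?Z 1\<bar>"]) (auto simp: J_def indicator_def)
    moreover have "integrable \<rho> (\<lambda>x. E * (indicator {1..B} (x + \<theta> / ?b) * ?Z (x + \<theta> / ?b)))"
      by (intro integrable_mult_right integrand_integrable[OF Z_bfun])
    moreover have "K ?Z \<theta> = (\<integral>x. indicator {1..B} (x + \<theta> / ?b) * ?Z (x + \<theta> / ?b) \<partial>\<rho>)"
      by (simp only: akern_def)
    ultimately show ?thesis
      by (simp add: J_def)
  qed
  also have "\<dots> \<le> E * K ?Z \<theta> + E * (K ?Z \<theta> / p) * (D * (\<delta> / ?b))"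
  proof (intro add_left_mono mult_mono)
    \<comment> \<open>With probability at least \<open>p\<close> the child of \<theta> is alive, and
      its type is then at least 1; so \<open>K ?Z \<theta>\<close> controls the value at the
      smallest type.\<close>
    have "?Z 1 * p \<le> ?Z 1 * measure \<rho> {1 - 1 / ?b..1}"
      using p_le Z_nonneg[OF B1] by (intro mult_left_mono) auto
    also have "\<dots> \<le> K ?Z \<theta>"
      using \<theta>B by (intro K_lower Z_bfun Z_nonneg B1) (auto intro!: Z_nondecreasing)
    finally show "?Z 1 \<le> K ?Z \<theta> / p" using p_pos by (simp add: field_simps)
    show "measure \<rho> J \<le> D * (\<delta> / ?b)"
      using lip[of "1 - \<theta> / ?b - \<delta> / ?b" "1 - \<theta> / ?b"] \<delta>b by (simp add: J_def)
  qed (use E1 Z_nonneg[of \<theta> "Suc n"] Z_nonneg[OF B1, of n] \<theta>B p_pos in \<open>auto simp: Z_Suc\<close>)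
  also have "\<dots> = E * (1 + D * \<delta> / (?b * p)) * K ?Z \<theta>"
    using p_pos b_real by (simp add: field_simps)
  also have "\<dots> \<le> E * exp (D * \<delta> / (?b * p)) * K ?Z \<theta>"
    using E1 Z_nonneg[of \<theta> "Suc n"] \<theta>B
    by (intro mult_right_mono mult_left_mono exp_ge_add_one_self) (auto simp: Z_Suc)
  also have "E * exp (D * \<delta> / (?b * p)) = exp (c * \<delta>)"
  proof -
    have "c * (\<delta> / ?b) + D * \<delta> / (?b * p) = c * \<delta>"
      using p_pos b_real by (simp add: c_def field_simps)
    then show ?thesis by (simp add: E_def exp_add[symmetric])
  qed
  finally show ?case by (simp add: Z_Suc c_def)
qed

definition "harnack_const = exp (D / (p * (real b - 1)) * (B - 1))"

text \<open>By monotonicity the extreme pair is \<open>B\<close> and 1, and the Lipschitz bound for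
  the logarithm is used over the whole length \<open>B - 1\<close>.\<close>

lemma Z_harnack:
  assumes "x \<in> {1..B}" "y \<in> {1..B}"
  shows "survival K n x \<le> harnack_const * survival K n y"
proof -
  have "survival K n x \<le> survival K n B"
    using assms by (intro Z_nondecreasing) auto
  also have "\<dots> \<le> harnack_const * survival K n 1"
    using survival_log_lipschitz[of 1 "B - 1" n] B by (simp add: harnack_const_def)
  also have "\<dots> \<le> harnack_const * survival K n y"
    using assms by (intro mult_left_mono Z_nondecreasing) (auto simp: harnack_const_def)
  finally show ?thesis .
qed

end

section \<open>Minorization\<close>

context site_law
begin

lemma K_nn_integral:
  assumes f: "f \<in> bfun (state B)" "\<And>x. x \<in> {1..B} \<Longrightarrow> 0 \<le> f x"
  shows "ennreal (K f \<theta>) = (\<integral>\<^sup>+x. ennreal (indicator {1..B} (x + \<theta> / real b) * f (x + \<theta> / real b)) \<partial>\<rho>)"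
  unfolding akern_def using f
  by (intro nn_integral_eq_integral[symmetric] integrand_integrable AE_I2) (auto simp: indicator_def)

text \<open>A single step has only a bounded density; the convolution of two bounded densities is continuous.\<close>

lemma two_step_density:
  assumes \<phi>: "\<phi> \<in> borel_measurable lborel" "\<rho> = density lborel \<phi>" "AE x in lborel. \<phi> x \<le> ennreal D"
  shows "\<exists>G. (\<forall>R. continuous_on {-R..R} G) \<and> (\<exists>z. 0 < G z) \<and>
    (\<forall>z q. q \<in> {1..B} \<longrightarrow> 0 < G z \<longrightarrow> z + q / (real b)\<^sup>2 \<in> {1..B}) \<and>
    (\<forall>f q. f \<in> bfun (state B) \<longrightarrow> (\<forall>x\<in>{1..B}. 0 \<le> f x) \<longrightarrow> q \<in> {1..B} \<longrightarrow>
       (\<integral>\<^sup>+y. ennreal (indicator {1..B} y * f y) * ennreal (G (y - q / (real b)\<^sup>2)) \<partial>lborel) \<le> ennreal (K (K f) q))"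
proof -
  define E where "E = {1 - 1 / real b..1}"
  \<comment> \<open>The part of the density on labels that keep every type alive, so that two such
    steps stay in the type space. The minimum with \<open>D\<close> turns the almost sure bound into
    one valid everywhere.\<close>
  define g where "g = (\<lambda>x. indicator E x * min D (enn2real (\<phi> x)))"
  define c where "c = 1 / real b"
  have c: "0 < c" using b_real by (simp add: c_def)
  have \<phi>m [measurable]: "\<phi> \<in> borel_measurable borel" using \<phi>(1) by simp
  have gm [measurable]: "g \<in> borel_measurable borel" unfolding g_def E_def by measurable
  have E01: "E \<subseteq> {0..1}" using b_real by (auto simp: E_def field_simps)
  have g0: "0 \<le> g x" "g x \<le> D" for x using D_pos by (auto simp: g_def indicator_def)
  have gE: "g x = 0" if "x \<notin> E" for x using that by (simp add: g_def)
  have gsupp: "g x = 0" if "x \<notin> {0..1}" for x using that E01 gE by blast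
  have g\<phi>: "AE x in lborel. ennreal (g x) = indicator E x * \<phi> x"
    using \<phi>(3)
  proof eventually_elim
    case (elim x)
    then have "enn2real (\<phi> x) \<le> D" using D_pos by (intro enn2real_leI) auto
    moreover have "ennreal (enn2real (\<phi> x)) = \<phi> x"
      using elim by (intro ennreal_enn2real) (auto intro: le_less_trans)
    ultimately show ?case by (simp add: g_def indicator_def)
  qed
  \<comment> \<open>The density belonging to \<open>X2 + X1 / b\<close>, the contribution of two
    labels to the type after two steps, both labels being restricted to \<open>E\<close>. The
    starting type adds only the shift \<open>q / (real b)\<^sup>2\<close>.\<close>
  define G where "G = (\<lambda>z. \<integral>x. g (z - c * x) * g x \<partial>lborel)"
  have gint: "integrable lborel (\<lambda>x. D * g x)"
  proof (rule Bochner_Integration.integrable_bound[of _ "\<lambda>x. indicator {0..1} x * (D * D)"])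
    show "AE x in lborel. norm (D * g x) \<le> norm (indicator {0..1} x * (D * D))"
      using g0 gsupp D_pos by (intro AE_I2) (auto simp: indicator_def intro: mult_left_mono)
  qed (auto intro!: integrable_mult_left simp: integrable_indicator_iff emeasure_lborel_Icc_eq)
  have ggint: "integrable lborel (\<lambda>x. g (z - c * x) * g x)" for z
    by (rule Bochner_Integration.integrable_bound[OF gint])
       (use g0 D_pos in \<open>auto intro!: AE_I2 mult_right_mono simp: abs_mult\<close>)
  have Genn: "ennreal (G z) = (\<integral>\<^sup>+x. ennreal (g (z - c * x)) * ennreal (g x) \<partial>lborel)" for z
    unfolding G_def using g0
    by (subst nn_integral_eq_integral[symmetric]) (auto simp: ggint ennreal_mult)
  have "continuous_on {-R..R} G" for R
    unfolding G_def by (rule convolution_continuous_on[OF gm g0 gsupp c])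
  \<comment> \<open>By Tonelli the total mass of \<open>G\<close> is the square of the mass of
    \<open>E\<close>, which is positive.\<close>
  moreover have "\<exists>z. 0 < G z"
  proof (rule ccontr)
    assume "\<not> (\<exists>z. 0 < G z)"
    then have "ennreal (G z) = 0" for z by (auto simp: ennreal_eq_0_iff not_less)
    then have "0 = (\<integral>\<^sup>+z. \<integral>\<^sup>+x. ennreal (g (z - c * x)) * ennreal (g x) \<partial>lborel \<partial>lborel)"
      by (simp add: Genn)
    also have "\<dots> = (\<integral>\<^sup>+x. \<integral>\<^sup>+z. ennreal (g (z - c * x)) * ennreal (g x) \<partial>lborel \<partial>lborel)"
      by (intro lborel_pair.Fubini') (simp add: case_prod_beta)
    also have "\<dots> = (\<integral>\<^sup>+x. (\<integral>\<^sup>+z. ennreal (g z) \<partial>lborel) * ennreal (g x) \<partial>lborel)"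
    proof (intro nn_integral_cong)
      fix x
      have "(\<integral>\<^sup>+z. ennreal (g z) \<partial>lborel) = (\<integral>\<^sup>+z. ennreal (g (z - c * x)) \<partial>lborel)"
        by (subst nn_integral_real_affine[where c = 1 and t = "- (c * x)"]) auto
      then show "(\<integral>\<^sup>+z. ennreal (g (z - c * x)) * ennreal (g x) \<partial>lborel) = (\<integral>\<^sup>+z. ennreal (g z) \<partial>lborel) * ennreal (g x)"
        by (simp add: nn_integral_multc)
    qed
    also have "\<dots> = (\<integral>\<^sup>+z. ennreal (g z) \<partial>lborel) * (\<integral>\<^sup>+z. ennreal (g z) \<partial>lborel)"
      by (simp add: nn_integral_cmult)
    finally have "(\<integral>\<^sup>+z. ennreal (g z) \<partial>lborel) = 0" by simp
    moreover have "(\<integral>\<^sup>+z. ennreal (g z) \<partial>lborel) = emeasure \<rho> E"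
    proof -
      have "(\<integral>\<^sup>+z. ennreal (g z) \<partial>lborel) = (\<integral>\<^sup>+z. \<phi> z * indicator E z \<partial>lborel)"
        using g\<phi> by (intro nn_integral_cong_AE) (auto simp: mult.commute)
      then show ?thesis using \<phi>(2) by (simp add: emeasure_density E_def)
    qed
    ultimately have "measure \<rho> E = 0" by (simp add: measure_def)
    then show False using p_pos p_le by (simp add: E_def)
  qed
  moreover have "z + q / (real b)\<^sup>2 \<in> {1..B}" if q: "q \<in> {1..B}" and z: "0 < G z" for z q
  proof -
    have "\<exists>x. g (z - c * x) * g x \<noteq> 0"
    proof (rule ccontr)
      assume "\<not> ?thesis"
      then have "(\<lambda>x. g (z - c * x) * g x) = (\<lambda>_. 0)" by blast
      then have "G z = 0" unfolding G_def by (simp only: integral_zero)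
      then show False using z by simp
    qed
    then obtain x where x: "x \<in> E" "z - c * x \<in> E" using gE by fastforce
    have "x + q / real b \<in> {1..B}"
      using x(1) q lower[of x q] upper[of x q] E01 by (auto simp: E_def)
    then have "(z - c * x) + (x + q / real b) / real b \<in> {1..B}"
      using x(2) lower[of "z - c * x" "x + q / real b"] upper[of "z - c * x" "x + q / real b"] E01 by (auto simp: E_def)
    then show ?thesis by (simp add: c_def add_divide_distrib power2_eq_square)
  qed
  moreover have "(\<integral>\<^sup>+y. ennreal (indicator {1..B} y * f y) * ennreal (G (y - q / (real b)\<^sup>2)) \<partial>lborel) \<le> ennreal (K (K f) q)"
    if f: "f \<in> bfun (state B)" "\<forall>x\<in>{1..B}. 0 \<le> f x" and q: "q \<in> {1..B}" for f q
  proof -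
    define F where "F = (\<lambda>y. ennreal (indicator {1..B} y * f y))"
    have Fm [measurable]: "F \<in> borel_measurable borel"
      unfolding F_def using bfun_state[OF f(1)] by measurable
    have Knn: "0 \<le> K f x" for x
      using K_mono[of "\<lambda>_. 0" f x] f by (auto simp: akern_def)
    have low: "(\<integral>\<^sup>+x. ennreal (g x) * h x \<partial>lborel) \<le> (\<integral>\<^sup>+x. h x \<partial>\<rho>)"
      if [measurable]: "h \<in> borel_measurable borel" for h :: "real \<Rightarrow> ennreal"
    proof -
      have "(\<integral>\<^sup>+x. ennreal (g x) * h x \<partial>lborel) \<le> (\<integral>\<^sup>+x. \<phi> x * h x \<partial>lborel)"
        using g\<phi> by (intro nn_integral_mono_AE) (auto simp: indicator_def intro!: mult_right_mono elim!: eventually_mono)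
      also have "\<dots> = (\<integral>\<^sup>+x. h x \<partial>\<rho>)" by (subst \<phi>(2)) (simp add: nn_integral_density)
      finally show ?thesis .
    qed
    have "(\<integral>\<^sup>+y. F y * ennreal (G (y - q / (real b)\<^sup>2)) \<partial>lborel)
      = (\<integral>\<^sup>+y. \<integral>\<^sup>+x. ennreal (g x) * (ennreal (g (y - q / (real b)\<^sup>2 - c * x)) * F y) \<partial>lborel \<partial>lborel)"
      unfolding Genn by (subst nn_integral_cmult[symmetric]) (auto intro!: nn_integral_cong simp: ac_simps)
    also have "\<dots> = (\<integral>\<^sup>+x. \<integral>\<^sup>+y. ennreal (g x) * (ennreal (g (y - q / (real b)\<^sup>2 - c * x)) * F y) \<partial>lborel \<partial>lborel)"
      by (intro lborel_pair.Fubini') (simp add: case_prod_beta)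
    also have "\<dots> = (\<integral>\<^sup>+x. ennreal (g x) * (\<integral>\<^sup>+y. ennreal (g y) * F (y + (x + q / real b) / real b) \<partial>lborel) \<partial>lborel)"
    proof (intro nn_integral_cong)
      fix x
      have "(\<integral>\<^sup>+y. ennreal (g (y - q / (real b)\<^sup>2 - c * x)) * F y \<partial>lborel)
         = (\<integral>\<^sup>+y. ennreal (g y) * F (y + (x + q / real b) / real b) \<partial>lborel)"
        by (subst nn_integral_real_affine[where c = 1 and t = "q / (real b)\<^sup>2 + c * x"])
           (auto intro!: nn_integral_cong simp: c_def add_divide_distrib power2_eq_square ac_simps)
      then show "(\<integral>\<^sup>+y. ennreal (g x) * (ennreal (g (y - q / (real b)\<^sup>2 - c * x)) * F y) \<partial>lborel)
         = ennreal (g x) * (\<integral>\<^sup>+y. ennreal (g y) * F (y + (x + q / real b) / real b) \<partial>lborel)"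
        by (simp add: nn_integral_cmult)
    qed
    also have "\<dots> \<le> (\<integral>\<^sup>+x. ennreal (g x) * ennreal (indicator {1..B} (x + q / real b) * K f (x + q / real b)) \<partial>lborel)"
    proof (intro nn_integral_mono)
      fix x
      show "ennreal (g x) * (\<integral>\<^sup>+y. ennreal (g y) * F (y + (x + q / real b) / real b) \<partial>lborel)
        \<le> ennreal (g x) * ennreal (indicator {1..B} (x + q / real b) * K f (x + q / real b))"
      proof (cases "x \<in> E")
        case True
        then have "x + q / real b \<in> {1..B}"
          using q lower[of x q] upper[of x q] E01 by (auto simp: E_def)
        moreover have "(\<integral>\<^sup>+y. ennreal (g y) * F (y + (x + q / real b) / real b) \<partial>lborel) \<le> ennreal (K f (x + q / real b))"
        proof -
          have "(\<integral>\<^sup>+y. ennreal (g y) * F (y + (x + q / real b) / real b) \<partial>lborel) \<le> (\<integral>\<^sup>+y. F (y + (x + q / real b) / real b) \<partial>\<rho>)"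
            by (rule low) simp
          also have "\<dots> = ennreal (K f (x + q / real b))"
            using K_nn_integral[OF f(1), of "x + q / real b"] f(2) by (simp add: F_def)
          finally show ?thesis .
        qed
        ultimately show ?thesis by (auto intro: mult_left_mono)
      qed (simp add: gE)
    qed
    also have "\<dots> \<le> (\<integral>\<^sup>+x. ennreal (indicator {1..B} (x + q / real b) * K f (x + q / real b)) \<partial>\<rho>)"
    proof (rule low)
      have "(\<lambda>x. indicator {1..B} (x + q / real b) * K f (x + q / real b)) \<in> borel_measurable borel"
        using measurable_compose[OF _ bfun_state[OF K_bfun[OF f(1)]], of "\<lambda>x. x + q / real b" borel] by simp
      then show "(\<lambda>x. ennreal (indicator {1..B} (x + q / real b) * K f (x + q / real b))) \<in> borel_measurable borel"
        by (rule measurable_compose) simp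
    qed
    also have "\<dots> = ennreal (K (K f) q)"
      using K_nn_integral[OF K_bfun[OF f(1)], of q] Knn by simp
    finally show ?thesis by (simp add: F_def)
  qed
  ultimately show ?thesis by (intro exI[of _ G]) auto
qed

text \<open>The density has no lower bound at any prescribed place, so a short charged interval is
  found by covering \<open>[1 - 1/b, 1]\<close> with finitely many intervals of length
  \<open>w\<close>.\<close>

lemma small_interval:
  assumes w: "0 < w"
  shows "\<exists>a. 1 - 1 / real b \<le> a \<and> a \<le> 1 \<and> 0 < measure \<rho> {a..a + w}"
proof (rule ccontr)
  assume neg: "\<not> ?thesis"
  define a where "a = (\<lambda>k. 1 - 1 / real b + real k * w)"
  define N where "N = nat \<lceil>1 / w\<rceil>"
  have "{1 - 1 / real b..1} \<subseteq> (\<Union>k\<in>{k\<in>{..N}. a k \<le> 1}. {a k..a k + w})"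
  proof
    fix x assume x: "x \<in> {1 - 1 / real b..1}"
    define k where "k = nat \<lfloor>(x - (1 - 1 / real b)) / w\<rfloor>"
    define t where "t = (x - (1 - 1 / real b)) / w"
    have t: "0 \<le> t" using x w by (simp add: t_def)
    have k: "real k \<le> t" "t < real k + 1" using t by (auto simp: k_def t_def[symmetric])
    have tw: "t * w = x - (1 - 1 / real b)" using w by (simp add: t_def)
    have "real k * w \<le> t * w" "t * w \<le> (real k + 1) * w" using k w by (auto intro: mult_right_mono)
    then have 1: "a k \<le> x" "x \<le> a k + w" using tw by (auto simp: a_def algebra_simps)
    have "0 \<le> 1 - 1 / real b" using b_real by (simp add: field_simps)
    then have "x - (1 - 1 / real b) \<le> 1" using x unfolding atLeastAtMost_iff by linarith
    then have "t \<le> 1 / w" unfolding t_def using w by (intro divide_right_mono) auto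
    then have "real k \<le> 1 / w" using k by simp
    then have "k \<le> N" unfolding N_def by (simp add: le_nat_iff le_ceiling_iff)
    then show "x \<in> (\<Union>k\<in>{k\<in>{..N}. a k \<le> 1}. {a k..a k + w})" using 1 x by auto
  qed
  then have "measure \<rho> {1 - 1 / real b..1} \<le> measure \<rho> (\<Union>k\<in>{k\<in>{..N}. a k \<le> 1}. {a k..a k + w})"
    by (intro finite_measure_mono) auto
  also have "\<dots> \<le> (\<Sum>k\<in>{k\<in>{..N}. a k \<le> 1}. measure \<rho> {a k..a k + w})"
    by (intro finite_measure_subadditive_finite) auto
  also have "\<dots> = 0"
  proof (intro sum.neutral ballI)
    fix k assume k: "k \<in> {k \<in> {..N}. a k \<le> 1}"
    have "1 - 1 / real b \<le> a k" using w by (simp add: a_def)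
    then have "\<not> 0 < measure \<rho> {a k..a k + w}" using k neg by blast
    then show "measure \<rho> {a k..a k + w} = 0" by (simp add: zero_less_measure_iff)
  qed
  finally show False using p_pos p_le by simp
qed

text \<open>If all labels lie in a short interval then every orbit survives and converges, up to the length of
  the interval, to the fixed point of \<open>\<theta> \<mapsto> a + \<theta> / b\<close>.\<close>

lemma concentration:
  assumes a: "1 - 1 / real b \<le> a" "a \<le> 1" and w: "0 \<le> w" and fp: "qs = a + qs / real b"
    and f: "f \<in> bfun (state B)" "\<And>x. x \<in> {1..B} \<Longrightarrow> 0 \<le> f x"
    and c: "\<And>y. y \<in> {1..B} \<Longrightarrow> \<bar>y - qs\<bar> \<le> 2 * w + R / 2 ^ k \<Longrightarrow> c \<le> f y" "0 \<le> c"
    and \<theta>: "\<theta> \<in> {1..B}" "\<bar>\<theta> - qs\<bar> \<le> 2 * w + R"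
  shows "c * measure \<rho> {a..a + w} ^ k \<le> (K ^^ k) f \<theta>"
  using f c
proof (induction k arbitrary: f c)
  case 0
  then show ?case using \<theta> by simp
next
  case (Suc k)
  let ?V = "{a..a + w}"
  have R: "0 \<le> 2 * w + R" using \<theta>(2) by linarith
  have step: "c * measure \<rho> ?V \<le> K f y" if y: "y \<in> {1..B}" "\<bar>y - qs\<bar> \<le> 2 * w + R / 2 ^ k" for y
  proof (rule K_lower[OF Suc.prems(1,2) y(1)])
    show "c \<le> f (x + y / real b)" if x: "x \<in> ?V" "x + y / real b \<in> {1..B}" for x
    proof (rule Suc.prems(3)[OF x(2)])
      have split: "x + y / real b - qs = (x - a) + (y - qs) / real b" using fp by (simp add: diff_divide_distrib)
      have half: "\<bar>(y - qs) / real b\<bar> \<le> \<bar>y - qs\<bar> / 2"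
        using b_real by (simp only: abs_divide abs_of_nat) (intro divide_left_mono; simp)
      \<comment> \<open>The fixed part \<open>2 * w\<close> of the radius is what the recursion
        reproduces: \<open>w + (2 * w + t) / 2 = 2 * w + t / 2\<close>.\<close>
      have "\<bar>d + e\<bar> \<le> w + (2 * w + t) / 2"
        if "0 \<le> d" "d \<le> w" "\<bar>e\<bar> \<le> s / 2" "s \<le> 2 * w + t" for d e s t :: real
        using that unfolding abs_le_iff by argo
      from this[OF _ _ half y(2), of "x - a"] have "\<bar>x + y / real b - qs\<bar> \<le> w + (2 * w + R / 2 ^ k) / 2"
        using x(1) unfolding split by simp
      then show "\<bar>x + y / real b - qs\<bar> \<le> 2 * w + R / 2 ^ Suc k" by (simp add: field_simps)
    qed
  qed (use a Suc.prems in auto)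
  have "(c * measure \<rho> ?V) * measure \<rho> ?V ^ k \<le> (K ^^ k) (K f) \<theta>"
  proof (rule Suc.IH)
    show "0 \<le> K f x" for x
      using K_mono[of "\<lambda>_. 0" f x] Suc.prems by (auto simp: akern_def)
  qed (use step Suc.prems K_bfun in auto)
  then show ?case by (simp add: funpow_swap1 mult.assoc)
qed

text \<open>All types are first driven, by \<open>k\<close> labels from one short interval, into a
  common neighbourhood of the fixed point \<open>qs\<close>. From there the continuous two-step
  density is bounded below on a common target interval.\<close>

lemma minorization:
  assumes \<phi>: "\<phi> \<in> borel_measurable lborel" "\<rho> = density lborel \<phi>" "AE x in lborel. \<phi> x \<le> ennreal D"
  shows "\<exists>m \<epsilon> j\<^sub>1 j\<^sub>2. 0 < m \<and> 0 < \<epsilon> \<and> 1 \<le> j\<^sub>1 \<and> j\<^sub>1 < j\<^sub>2 \<and> j\<^sub>2 \<le> B \<and>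
    (\<forall>f \<theta>. f \<in> bfun (state B) \<longrightarrow> (\<forall>x\<in>{1..B}. 0 \<le> f x) \<longrightarrow> \<theta> \<in> {1..B} \<longrightarrow>
      \<epsilon> * ((\<integral>y. indicator {j\<^sub>1..j\<^sub>2} y * f y \<partial>lborel) / (j\<^sub>2 - j\<^sub>1)) \<le> (K ^^ m) f \<theta>)"
proof -
  from two_step_density[OF \<phi>] obtain G where Gc: "\<forall>R. continuous_on {-R..R} G" and Gpos: "\<exists>z. 0 < G z"
    and Gst: "\<forall>z q. q \<in> {1..B} \<longrightarrow> 0 < G z \<longrightarrow> z + q / (real b)\<^sup>2 \<in> {1..B}"
    and GK: "\<forall>f q. f \<in> bfun (state B) \<longrightarrow> (\<forall>x\<in>{1..B}. 0 \<le> f x) \<longrightarrow> q \<in> {1..B} \<longrightarrow>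
       (\<integral>\<^sup>+y. ennreal (indicator {1..B} y * f y) * ennreal (G (y - q / (real b)\<^sup>2)) \<partial>lborel) \<le> ennreal (K (K f) q)"
    by - (erule exE, (erule conjE)+, rule that)
  from Gpos obtain z where Gz: "0 < G z" ..
  have G4: "(\<integral>\<^sup>+y. ennreal (indicator {1..B} y * f y) * ennreal (G (y - q / (real b)\<^sup>2)) \<partial>lborel) \<le> ennreal (K (K f) q)"
    if "f \<in> bfun (state B)" "\<And>x. x \<in> {1..B} \<Longrightarrow> 0 \<le> f x" "q \<in> {1..B}" for f q
    using GK that by simp
  note G = Gc[rule_format] Gz Gst[rule_format] G4
  obtain r where r: "0 < r" "\<And>y. \<bar>y - z\<bar> < r \<Longrightarrow> G z / 2 < G y"
  proof -
    have "continuous_on {-(\<bar>z\<bar> + 1)<..<\<bar>z\<bar> + 1} G"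
      by (rule continuous_on_subset[OF G(1)[of "\<bar>z\<bar> + 1"]]) auto
    then have "isCont G z" by (subst (asm) continuous_on_eq_continuous_at) (auto simp: abs_if)
    then have "\<exists>r>0. \<forall>y. dist y z < r \<longrightarrow> dist (G y) (G z) < G z / 2"
      using half_gt_zero[OF G(2)] unfolding continuous_at_eps_delta by blast
    then obtain r where "0 < r" "\<And>y. \<bar>y - z\<bar> < r \<Longrightarrow> \<bar>G y - G z\<bar> < G z / 2" by (auto simp: dist_real_def)
    then show ?thesis by (intro that[of r]) (auto simp: abs_less_iff, smt (verit) field_sum_of_halves)
  qed
  \<comment> \<open>After \<open>k\<close> steps the orbit is within
    \<open>2 * w + B / 2 ^ k \<le> 3 * w = r / 4\<close> of \<open>qs\<close>. The target interval
    has radius \<open>r / 3\<close>, and \<open>r / 4 + r / 3 < r\<close>.\<close>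
  define w where "w = r / 12"
  have w: "0 < w" using r by (simp add: w_def)
  obtain a where a: "1 - 1 / real b \<le> a" "a \<le> 1" "0 < measure \<rho> {a..a + w}" using small_interval[OF w] by blast
  \<comment> \<open>The fixed point of \<open>\<theta> \<mapsto> a + \<theta> / b\<close>; it lies
    in \<open>[1, 2]\<close> because \<open>1 - 1/b \<le> a \<le> 1\<close> and \<open>b\<close> is
    at least 2.\<close>
  define qs where "qs = a * real b / (real b - 1)"
  have fp: "qs = a + qs / real b" using b_real by (simp add: qs_def field_simps)
  have "qs * (real b - 1) = a * real b" using b_real by (simp add: qs_def)
  have qs: "qs \<in> {1..B}"
  proof -
    have "1 * real b \<le> a * real b + 1" using a(1) b_real by (simp add: field_simps)
    then have "1 \<le> qs" unfolding qs_def using b_real by (subst pos_le_divide_eq) auto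
    moreover have "a * real b \<le> 1 * real b" using a(2) b_real by (intro mult_right_mono) auto
    then have "a * real b \<le> 2 * (real b - 1)" using b_real unfolding mult_1 by argo
    then have "qs \<le> 2" unfolding qs_def using b_real by (subst pos_divide_le_eq) auto
    ultimately have "1 \<le> qs" "qs \<le> 2" by auto
    then show ?thesis using B by simp
  qed
  obtain k where k: "B / 2 ^ k \<le> w"
  proof -
    obtain k where "(1 / 2) ^ k < w / B" using real_arch_pow_inv[of "w / B" "1 / 2"] w B by auto
    then show ?thesis using B by (intro that[of k]) (auto simp: field_simps power_one_over)
  qed
  define j\<^sub>1 where "j\<^sub>1 = z - r / 3 + qs / (real b)\<^sup>2"
  define j\<^sub>2 where "j\<^sub>2 = z + r / 3 + qs / (real b)\<^sup>2"
  define \<gamma> where "\<gamma> = G z / 2"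
  define V where "V = measure \<rho> {a..a + w}"
  have J: "y \<in> {1..B}" if "y \<in> {j\<^sub>1..j\<^sub>2}" for y
  proof -
    have "\<bar>(y - qs / (real b)\<^sup>2) - z\<bar> < r" using that r(1) by (auto simp: j\<^sub>1_def j\<^sub>2_def abs_if)
    then have "0 < G (y - qs / (real b)\<^sup>2)" using r(2) G(2) by fastforce
    from G(3)[OF qs this] show ?thesis by simp
  qed
  have j: "1 \<le> j\<^sub>1" "j\<^sub>1 < j\<^sub>2" "j\<^sub>2 \<le> B"
  proof -
    show "j\<^sub>1 < j\<^sub>2" using r by (simp add: j\<^sub>1_def j\<^sub>2_def)
    then show "1 \<le> j\<^sub>1" "j\<^sub>2 \<le> B" using J[of j\<^sub>1] J[of j\<^sub>2] by auto
  qed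
  have main: "(\<gamma> * (\<integral>y. indicator {j\<^sub>1..j\<^sub>2} y * f y \<partial>lborel)) * V ^ k \<le> (K ^^ (k + 2)) f \<theta>"
    if f: "f \<in> bfun (state B)" "\<And>x. x \<in> {1..B} \<Longrightarrow> 0 \<le> f x" and \<theta>: "\<theta> \<in> {1..B}" for f \<theta>
  proof -
    have Knn: "0 \<le> K g x" if "g \<in> bfun (state B)" "\<And>x. x \<in> {1..B} \<Longrightarrow> 0 \<le> g x" for g x
      using K_mono[of "\<lambda>_. 0" g x] that by (auto simp: akern_def)
    define I where "I = (\<integral>y. indicator {j\<^sub>1..j\<^sub>2} y * f y \<partial>lborel)"
    have I0: "0 \<le> I" unfolding I_def
      by (intro integral_nonneg_AE AE_I2) (use f(2) J in \<open>auto simp: indicator_def\<close>)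
    have m: "(\<lambda>y. indicator {j\<^sub>1..j\<^sub>2} y * f y) \<in> borel_measurable borel"
    proof -
      have "(\<lambda>y. indicator {j\<^sub>1..j\<^sub>2} y * f y) = (\<lambda>y. indicator {j\<^sub>1..j\<^sub>2} y * (indicator {1..B} y * f y))"
        using J by (auto simp: indicator_def)
      also have "\<dots> \<in> borel_measurable borel"
        by (intro borel_measurable_times bfun_state[OF f(1)]) auto
      finally show ?thesis .
    qed
    have Ieq: "ennreal I = (\<integral>\<^sup>+y. ennreal (indicator {j\<^sub>1..j\<^sub>2} y * f y) \<partial>lborel)"
    proof -
      obtain c where c: "0 \<le> c" "\<And>x. x \<in> {1..B} \<Longrightarrow> \<bar>f x\<bar> \<le> c"
        using bfun_bound[OF f(1)] by (auto simp: space_restrict_space)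
      have "integrable lborel (\<lambda>y. indicator {j\<^sub>1..j\<^sub>2} y * f y)"
      proof (rule Bochner_Integration.integrable_bound[of _ "\<lambda>y. indicator {j\<^sub>1..j\<^sub>2} y * c"])
        show "integrable lborel (\<lambda>y. indicator {j\<^sub>1..j\<^sub>2} y * c)"
          by (intro integrable_mult_left) (simp add: integrable_indicator_iff emeasure_lborel_Icc_eq)
        show "AE y in lborel. norm (indicator {j\<^sub>1..j\<^sub>2} y * f y) \<le> norm (indicator {j\<^sub>1..j\<^sub>2} y * c)"
          using c J by (intro AE_I2) (auto simp: indicator_def)
      qed (use m in simp)
      then show ?thesis unfolding I_def
        by (intro nn_integral_eq_integral[symmetric] AE_I2) (use f(2) J in \<open>auto simp: indicator_def\<close>)
    qed
    have win: "\<gamma> * I \<le> K (K f) q" if q: "q \<in> {1..B}" "\<bar>q - qs\<bar> \<le> 2 * w + B / 2 ^ k" for q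
    proof -
      have "ennreal (\<gamma> * I) = ennreal \<gamma> * (\<integral>\<^sup>+y. ennreal (indicator {j\<^sub>1..j\<^sub>2} y * f y) \<partial>lborel)"
        unfolding Ieq[symmetric] using I0 G(2) by (intro ennreal_mult) (auto simp: \<gamma>_def)
      also have "\<dots> = (\<integral>\<^sup>+y. ennreal \<gamma> * ennreal (indicator {j\<^sub>1..j\<^sub>2} y * f y) \<partial>lborel)"
        using measurable_compose[OF m measurable_ennreal] by (intro nn_integral_cmult[symmetric]) simp
      also have "\<dots> \<le> (\<integral>\<^sup>+y. ennreal (indicator {1..B} y * f y) * ennreal (G (y - q / (real b)\<^sup>2)) \<partial>lborel)"
      proof (intro nn_integral_mono)
        fix y
        show "ennreal \<gamma> * ennreal (indicator {j\<^sub>1..j\<^sub>2} y * f y) \<le> ennreal (indicator {1..B} y * f y) * ennreal (G (y - q / (real b)\<^sup>2))"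
        proof (cases "y \<in> {j\<^sub>1..j\<^sub>2}")
          case True
          have "\<bar>(q - qs) / (real b)\<^sup>2\<bar> \<le> \<bar>q - qs\<bar> / 1"
            unfolding abs_divide using b_real by (intro frac_le) (auto simp: power2_eq_square intro: order_trans[OF _ mult_mono[of 1 _ 1]])
          also have "\<dots> \<le> r / 4" using q(2) k unfolding w_def div_by_1 by argo
          finally have "\<bar>q / (real b)\<^sup>2 - qs / (real b)\<^sup>2\<bar> \<le> r / 4" by (simp add: diff_divide_distrib)
          moreover have "\<bar>y - qs / (real b)\<^sup>2 - z\<bar> \<le> r / 3" using True unfolding j\<^sub>1_def j\<^sub>2_def atLeastAtMost_iff abs_le_iff by argo
          ultimately have "\<bar>(y - q / (real b)\<^sup>2) - z\<bar> < r" using r(1) unfolding abs_le_iff abs_less_iff by argo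
          then have "\<gamma> \<le> G (y - q / (real b)\<^sup>2)" using r(2) by (auto simp: \<gamma>_def less_imp_le)
          then show ?thesis using True J[OF True] by (simp add: mult.commute[of "ennreal \<gamma>"] mult_left_mono ennreal_leI)
        qed simp
      qed
      also have "\<dots> \<le> ennreal (K (K f) q)" by (rule G(4)[OF f q(1)])
      finally show ?thesis using Knn[OF K_bfun[OF f(1)] Knn[OF f]] by (simp add: ennreal_le_iff)
    qed
    have "(\<gamma> * I) * measure \<rho> {a..a + w} ^ k \<le> (K ^^ k) (K (K f)) \<theta>"
    proof (rule concentration[OF a(1,2) _ fp])
      show "\<bar>\<theta> - qs\<bar> \<le> 2 * w + B" using \<theta> qs w by (auto simp: abs_if)
      show "0 \<le> \<gamma> * I" using G(2) I0 by (simp add: \<gamma>_def)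
    qed (use w win \<theta> f K_bfun Knn in auto)
    also have "(K ^^ k) (K (K f)) = (K ^^ (k + 2)) f"
    proof -
      have "K (K f) = (K ^^ 2) f" by (simp add: numeral_2_eq_2)
      then show ?thesis by (simp only: funpow_add o_def)
    qed
    finally show ?thesis by (simp add: I_def V_def)
  qed
  show ?thesis
  proof (intro exI conjI allI impI)
    show "0 < \<gamma> * V ^ k * (j\<^sub>2 - j\<^sub>1)" using G(2) a(3) j by (simp add: \<gamma>_def V_def)
    show "\<gamma> * V ^ k * (j\<^sub>2 - j\<^sub>1) * ((\<integral>y. indicator {j\<^sub>1..j\<^sub>2} y * f y \<partial>lborel) / (j\<^sub>2 - j\<^sub>1)) \<le> (K ^^ (k + 2)) f \<theta>"
      if "f \<in> bfun (state B)" "\<forall>x\<in>{1..B}. 0 \<le> f x" "\<theta> \<in> {1..B}" for f \<theta>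
      using main[OF that(1) _ that(3)] that(2) j by (simp add: ac_simps)
  qed (use j in auto)
qed

end

section \<open>Recursive description of the avalanche\<close>

text \<open>Restricted to \<open>tree b\<close>, so that the result is a point of the product space
  underlying \<open>tree_law\<close>.\<close>

definition subtree :: "nat \<Rightarrow> nat \<Rightarrow> (nat list \<Rightarrow> real) \<Rightarrow> nat list \<Rightarrow> real" where
  "subtree b i x = (\<lambda>\<sigma>\<in>tree b. x (i # \<sigma>))"

text \<open>In the following two functions \<open>\<theta>\<close> is the total value of the root, whose own label is ignored.\<close>

primrec toppled :: "nat \<Rightarrow> nat \<Rightarrow> real \<Rightarrow> (nat list \<Rightarrow> real) \<Rightarrow> nat" where
  "toppled b 0 \<theta> x = (if 1 \<le> \<theta> then 1 else 0)"
| "toppled b (Suc n) \<theta> x =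
     (if 1 \<le> \<theta> then 1 + (\<Sum>i\<in>{1..b}. toppled b n (x [i] + \<theta> / real b) (subtree b i x)) else 0)"

primrec reaches :: "nat \<Rightarrow> nat \<Rightarrow> real \<Rightarrow> (nat list \<Rightarrow> real) \<Rightarrow> bool" where
  "reaches b 0 \<theta> x \<longleftrightarrow> 1 \<le> \<theta>"
| "reaches b (Suc n) \<theta> x \<longleftrightarrow> 1 \<le> \<theta> \<and> (\<exists>i\<in>{1..b}. reaches b n (x [i] + \<theta> / real b) (subtree b i x))"

lemma tree_Nil [simp]: "[] \<in> tree b"
  by (simp add: tree_def)

lemma tree_Cons [simp]: "i # \<sigma> \<in> tree b \<longleftrightarrow> i \<in> {1..b} \<and> \<sigma> \<in> tree b"
  by (auto simp: tree_def)

lemma tree_append [simp]: "\<sigma> @ \<tau> \<in> tree b \<longleftrightarrow> \<sigma> \<in> tree b \<and> \<tau> \<in> tree b"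
  by (auto simp: tree_def)

lemma tree_butlast: "\<sigma> \<in> tree b \<Longrightarrow> butlast \<sigma> \<in> tree b"
  by (auto simp: tree_def dest: in_set_butlastD)

lemma subtree_upd [simp]: "subtree b i (x([] := y)) = subtree b i x"
  by (auto simp: subtree_def)

lemma toppled_upd [simp]: "toppled b n \<theta> (x([] := y)) = toppled b n \<theta> x"
  by (cases n) auto

lemma reaches_upd [simp]: "reaches b n \<theta> (x([] := y)) = reaches b n \<theta> x"
  by (cases n) auto

lemma toppled_mono: "toppled b n \<theta> x \<le> toppled b (Suc n) \<theta> x"
  by (induction n arbitrary: \<theta> x) (auto intro!: sum_mono)

lemma reaches_Suc: "reaches b (Suc n) \<theta> x \<Longrightarrow> reaches b n \<theta> x"
  by (induction n arbitrary: \<theta> x) auto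

text \<open>A path of toppled sites down to layer \<open>n\<close> has \<open>n + 1\<close> members.
  Together with \<open>not_reaches_toppled\<close> this identifies infinite size with reaching every
  layer.\<close>

lemma reaches_toppled: "reaches b n \<theta> x \<Longrightarrow> n < toppled b n \<theta> x"
proof (induction n arbitrary: \<theta> x)
  case (Suc n)
  then obtain i where i: "i \<in> {1..b}" "reaches b n (x [i] + \<theta> / real b) (subtree b i x)" "1 \<le> \<theta>" by auto
  have "n < toppled b n (x [i] + \<theta> / real b) (subtree b i x)" by (rule Suc.IH[OF i(2)])
  also have "\<dots> \<le> (\<Sum>i\<in>{1..b}. toppled b n (x [i] + \<theta> / real b) (subtree b i x))"
    using i(1) by (intro member_le_sum) auto
  finally show ?case using i(3) by simp
qed auto

text \<open>The number of sites in the layers before \<open>n\<close>: a geometric sum in Horner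
  form.\<close>

primrec layer_bound :: "nat \<Rightarrow> nat \<Rightarrow> nat" where
  "layer_bound b 0 = 0"
| "layer_bound b (Suc n) = 1 + b * layer_bound b n"

lemma not_reaches_toppled: "\<not> reaches b n \<theta> x \<Longrightarrow> toppled b k \<theta> x \<le> layer_bound b n"
proof (induction n arbitrary: \<theta> x k)
  case 0
  then show ?case by (cases k) auto
next
  case (Suc n)
  show ?case
  proof (cases "1 \<le> \<theta>")
    case True
    then have nr: "\<not> reaches b n (x [i] + \<theta> / real b) (subtree b i x)" if "i \<in> {1..b}" for i using Suc.prems that by auto
    show ?thesis
    proof (cases k)
      case (Suc l)
      have "(\<Sum>i\<in>{1..b}. toppled b l (x [i] + \<theta> / real b) (subtree b i x)) \<le> (\<Sum>i\<in>{1..b}. layer_bound b n)"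
        by (intro sum_mono Suc.IH nr)
      then show ?thesis using True Suc by simp
    qed auto
  next
    case False
    then show ?thesis by (cases k) auto
  qed
qed

primrec site_value_rev :: "nat \<Rightarrow> real \<Rightarrow> (nat list \<Rightarrow> real) \<Rightarrow> nat list \<Rightarrow> real" where
  "site_value_rev b \<theta> x [] = \<theta>"
| "site_value_rev b \<theta> x (j # \<tau>) = x (rev \<tau> @ [j]) +
     (if 1 \<le> site_value_rev b \<theta> x \<tau> then site_value_rev b \<theta> x \<tau> / real b else 0)"

text \<open>The value of a site at the time of its layer, by recursion on the reversed address.\<close>

definition site_value :: "nat \<Rightarrow> real \<Rightarrow> (nat list \<Rightarrow> real) \<Rightarrow> nat list \<Rightarrow> real" where
  "site_value b \<theta> x \<sigma> = site_value_rev b \<theta> x (rev \<sigma>)"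

lemma site_value_Nil [simp]: "site_value b \<theta> x [] = \<theta>"
  by (simp add: site_value_def)

lemma site_value_snoc [simp]: "site_value b \<theta> x (\<sigma> @ [j]) = x (\<sigma> @ [j]) +
     (if 1 \<le> site_value b \<theta> x \<sigma> then site_value b \<theta> x \<sigma> / real b else 0)"
  by (simp add: site_value_def)

lemma site_value_nonneg_ge:
  assumes "\<And>\<sigma>. \<sigma> \<in> tree b \<Longrightarrow> 0 \<le> x \<sigma>" "0 \<le> \<theta>" "\<sigma> \<in> tree b"
  shows "0 \<le> site_value b \<theta> x \<sigma> \<and> (\<sigma> \<noteq> [] \<longrightarrow> x \<sigma> \<le> site_value b \<theta> x \<sigma>)"
  using assms(3)
proof (induction \<sigma> rule: rev_induct)
  case (snoc j \<sigma>)
  then show ?case using assms(1)[of "\<sigma> @ [j]"] by auto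
qed (use assms in auto)

section \<open>From the process in time to the values of the sites\<close>

lemma process_before: "t < length \<sigma> \<Longrightarrow> avalanche_process b v x t \<sigma> = x \<sigma>"
  by (induction t) auto

lemma process_at: "avalanche_process b v x (length \<sigma>) \<sigma> = site_value b (x [] + v) x \<sigma>"
proof (induction \<sigma> rule: rev_induct)
  case (snoc j \<sigma>)
  then show ?case using process_before[of "length \<sigma>" "\<sigma> @ [j]" b v x] by simp
qed simp

text \<open>Only the updates at times \<open>length \<sigma> - 1\<close> and
  \<open>length \<sigma>\<close> can change the site; afterwards it is frozen.\<close>

lemma process_after: "avalanche_process b v x (length \<sigma> + Suc t) \<sigma> =
    (if 1 \<le> site_value b (x [] + v) x \<sigma> then 0 else site_value b (x [] + v) x \<sigma>)"
proof (induction t)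
  case 0
  then show ?case using process_at[of b v x \<sigma>] by simp
qed auto

text \<open>The point is that a site cannot become 0 without toppling. At an untoppled site the
  label is replaced by a final value at least as large, so with nonnegative labels a final 0 forces
  the label to be 0 from the start.\<close>

lemma avalanche_set_eq:
  assumes x: "\<And>\<sigma>. \<sigma> \<in> tree b \<Longrightarrow> 0 \<le> x \<sigma>" and v: "0 \<le> v"
  shows "avalanche_set b v x = {\<sigma> \<in> tree b. 1 \<le> site_value b (x [] + v) x \<sigma>}"
proof (intro equalityI subsetI)
  fix \<sigma> assume "\<sigma> \<in> {\<sigma> \<in> tree b. 1 \<le> site_value b (x [] + v) x \<sigma>}"
  then have \<sigma>: "\<sigma> \<in> tree b" "1 \<le> site_value b (x [] + v) x \<sigma>" by auto
  have "avalanche_process b v x (Suc (length \<sigma>)) \<sigma> = 0" using process_after[of b v x \<sigma> 0] \<sigma> by simp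
  moreover have "avalanche_process b v x (length \<sigma>) \<sigma> \<noteq> 0" using process_at[of b v x \<sigma>] \<sigma> by simp
  ultimately show "\<sigma> \<in> avalanche_set b v x" using \<sigma>(1) unfolding avalanche_set_def by blast
next
  fix \<sigma> assume "\<sigma> \<in> avalanche_set b v x"
  then obtain t s where \<sigma>: "\<sigma> \<in> tree b" and st: "s < t" "avalanche_process b v x t \<sigma> = 0" "avalanche_process b v x s \<sigma> \<noteq> 0"
    unfolding avalanche_set_def by blast
  let ?a = "site_value b (x [] + v) x \<sigma>"
  have \<theta>: "0 \<le> x [] + v" using x[of "[]"] v by simp
  note nn = site_value_nonneg_ge[of b x, OF x \<theta> \<sigma>]
  have "1 \<le> ?a"
  proof (rule ccontr)
    assume lt: "\<not> 1 \<le> ?a"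
    have val: "avalanche_process b v x k \<sigma> = (if k < length \<sigma> then x \<sigma> else ?a)" for k
    proof (cases "k \<le> length \<sigma>")
      case True
      then show ?thesis using process_before[of k \<sigma>] process_at[of b v x \<sigma>] by (cases "k = length \<sigma>") auto
    next
      case False
      then have "k = length \<sigma> + Suc (k - length \<sigma> - 1)" by simp
      then show ?thesis using process_after[of b v x \<sigma> "k - length \<sigma> - 1"] lt by simp
    qed
    show False
    proof (cases "t < length \<sigma>")
      case True
      then show False using st val by simp
    next
      case False
      then have a0: "?a = 0" using st val by simp
      then have "s < length \<sigma>" "x \<sigma> \<noteq> 0" using st(3) val[of s] by (auto split: if_splits)
      then show False using nn a0 x[OF \<sigma>] by auto
    qed
  qed
  then show "\<sigma> \<in> {\<sigma> \<in> tree b. 1 \<le> site_value b (x [] + v) x \<sigma>}" using \<sigma> by simp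
qed

lemma site_value_Cons:
  assumes "1 \<le> \<theta>" "i # \<sigma> \<in> tree b"
  shows "site_value b \<theta> x (i # \<sigma>) = site_value b (x [i] + \<theta> / real b) (subtree b i x) \<sigma>"
  using assms(2)
proof (induction \<sigma> rule: rev_induct)
  case Nil
  then show ?case using assms site_value_snoc[of b \<theta> x "[]" i] by simp
next
  case (snoc j \<sigma>)
  then show ?case using site_value_snoc[of b \<theta> x "i # \<sigma>" j] by (simp add: subtree_def)
qed

text \<open>In the process a label equal to 1 topples even below an untoppled mother. Labels
  strictly below 1, which is almost sure for laws with a density, ensure that nothing topples below
  an untoppled root.\<close>

lemma site_value_dead:
  assumes "\<theta> < 1" "\<And>\<sigma>. \<sigma> \<in> tree b \<Longrightarrow> x \<sigma> < 1" "\<sigma> \<in> tree b"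
  shows "site_value b \<theta> x \<sigma> < 1"
  using assms(3) by (induction \<sigma> rule: rev_induct) (use assms in auto)

text \<open>Below a toppled root the toppled sites split by their first letter into the avalanches
  of the subtrees; an untoppled root has none by \<open>site_value_dead\<close>.\<close>

lemma card_toppled:
  assumes "\<And>\<sigma>. \<sigma> \<in> tree b \<Longrightarrow> x \<sigma> < 1"
  shows "finite {\<sigma> \<in> tree b. length \<sigma> \<le> n \<and> 1 \<le> site_value b \<theta> x \<sigma>} \<and>
    card {\<sigma> \<in> tree b. length \<sigma> \<le> n \<and> 1 \<le> site_value b \<theta> x \<sigma>} = toppled b n \<theta> x"
  using assms
proof (induction n arbitrary: \<theta> x)
  case 0
  have "{\<sigma> \<in> tree b. length \<sigma> \<le> 0 \<and> 1 \<le> site_value b \<theta> x \<sigma>} = (if 1 \<le> \<theta> then {[]} else {})"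
    by auto
  then show ?case by simp
next
  case (Suc n)
  show ?case
  proof (cases "1 \<le> \<theta>")
    case False
    then have empty: "{\<sigma> \<in> tree b. length \<sigma> \<le> Suc n \<and> 1 \<le> site_value b \<theta> x \<sigma>} = {}"
      using site_value_dead[of \<theta> b x] Suc.prems by (force simp: not_le)
    show ?thesis unfolding empty using False by simp
  next
    case True
    define S where "S = (\<lambda>i. {\<sigma> \<in> tree b. length \<sigma> \<le> n \<and> 1 \<le> site_value b (x [i] + \<theta> / real b) (subtree b i x) \<sigma>})"
    have IH: "finite (S i) \<and> card (S i) = toppled b n (x [i] + \<theta> / real b) (subtree b i x)" if "i \<in> {1..b}" for i
      unfolding S_def using that by (intro Suc.IH) (auto simp: subtree_def intro: Suc.prems)
    have eq: "{\<sigma> \<in> tree b. length \<sigma> \<le> Suc n \<and> 1 \<le> site_value b \<theta> x \<sigma>} = insert [] (\<Union>i\<in>{1..b}. (#) i ` S i)"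
    proof (intro set_eqI)
      fix \<sigma>
      show "\<sigma> \<in> {\<sigma> \<in> tree b. length \<sigma> \<le> Suc n \<and> 1 \<le> site_value b \<theta> x \<sigma>} \<longleftrightarrow> \<sigma> \<in> insert [] (\<Union>i\<in>{1..b}. (#) i ` S i)"
        using True by (cases \<sigma>) (auto simp: S_def site_value_Cons image_iff)
    qed
    have fin: "finite (\<Union>i\<in>{1..b}. (#) i ` S i)" using IH by auto
    have "card (\<Union>i\<in>{1..b}. (#) i ` S i) = (\<Sum>i\<in>{1..b}. card ((#) i ` S i))"
      using IH by (intro card_UN_disjoint) auto
    also have "\<dots> = (\<Sum>i\<in>{1..b}. toppled b n (x [i] + \<theta> / real b) (subtree b i x))"
      using IH by (intro sum.cong refl) (auto simp: card_image)
    finally show ?thesis unfolding eq using fin True by (simp add: image_iff)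
  qed
qed

lemma avalanche_size_eq:
  assumes x: "\<And>\<sigma>. \<sigma> \<in> tree b \<Longrightarrow> 0 \<le> x \<sigma> \<and> x \<sigma> < 1" and v: "0 \<le> v"
  shows "avalanche_size b v x = (SUP n. of_nat (toppled b n (x [] + v) x))"
proof -
  define A where "A = (\<lambda>n. {\<sigma> \<in> tree b. length \<sigma> \<le> n \<and> 1 \<le> site_value b (x [] + v) x \<sigma>})"
  have "avalanche_set b v x = (\<Union>n. A n)"
    using avalanche_set_eq[of b x v] x v by (auto simp: A_def)
  moreover have "(SUP n. emeasure (count_space UNIV) (A n)) = emeasure (count_space UNIV) (\<Union>n. A n)"
    by (rule SUP_emeasure_incseq) (auto simp: A_def incseq_def)
  moreover have "emeasure (count_space UNIV) (A n) = of_nat (toppled b n (x [] + v) x)" for n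
    using card_toppled[of b x n "x [] + v"] x by (simp add: A_def emeasure_count_space)
  ultimately show ?thesis by (simp add: avalanche_size_def)
qed

locale label_law = prob_space \<rho> for \<rho> :: "real measure" +
  fixes b :: nat
  assumes sets_label [measurable_cong]: "sets \<rho> = sets borel" and b1: "1 < b"
begin

abbreviation "T \<equiv> tree_law b \<rho>"

sublocale T: prob_space T
  unfolding tree_law_def by (intro prob_space_PiM) unfold_locales

section \<open>Integration over the labels of the tree\<close>

lemma component_measurable [measurable (raw)]: "\<sigma> \<in> tree b \<Longrightarrow> (\<lambda>x. x \<sigma>) \<in> borel_measurable T"
  using measurable_component_singleton[of \<sigma> "tree b" "\<lambda>_. \<rho>"]
  by (simp add: tree_law_def cong: measurable_cong_sets[OF refl sets_label])

lemma subtree_measurable [measurable]: "i \<in> {1..b} \<Longrightarrow> subtree b i \<in> T \<rightarrow>\<^sub>M T"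
  unfolding subtree_def tree_law_def by (intro measurable_restrict measurable_component_singleton) auto

lemma subtree_distr:
  assumes "i \<in> {1..b}"
  shows "distr T T (subtree b i) = T"
proof -
  have "distr (PiM (tree b) (\<lambda>_. \<rho>)) (PiM (tree b) (\<lambda>_. \<rho>)) (\<lambda>\<omega>. \<lambda>n\<in>tree b. \<omega> (i # n)) = PiM (tree b) (\<lambda>_. \<rho>)"
    using assms by (intro distr_PiM_reindex[where M = "\<lambda>_. \<rho>" and f = "(#) i"]) (auto, unfold_locales)
  then show ?thesis by (simp add: tree_law_def subtree_def[abs_def])
qed

lemma child_measurable:
  assumes "i \<in> {1..b}"
  shows "(\<lambda>(\<theta>, x). (x [i] + \<theta> / real b, subtree b i x)) \<in> borel \<Otimes>\<^sub>M T \<rightarrow>\<^sub>M borel \<Otimes>\<^sub>M T"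
proof -
  have [measurable]: "(\<lambda>x. x [i]) \<in> borel_measurable T" "subtree b i \<in> T \<rightarrow>\<^sub>M T"
    using assms by (auto intro!: component_measurable subtree_measurable)
  show ?thesis by measurable
qed

lemma toppled_measurable [measurable]:
  "(\<lambda>(\<theta>, x). toppled b n \<theta> x) \<in> borel \<Otimes>\<^sub>M T \<rightarrow>\<^sub>M count_space UNIV"
proof (induction n)
  case (Suc n)
  have [measurable]: "(\<lambda>p. toppled b n (snd p [i] + fst p / real b) (subtree b i (snd p))) \<in> borel \<Otimes>\<^sub>M T \<rightarrow>\<^sub>M count_space UNIV"
    if "i \<in> {1..b}" for i
    using measurable_compose[OF child_measurable[OF that] Suc] by (simp add: case_prod_beta)
  have "(\<lambda>p. if 1 \<le> fst p then 1 + (\<Sum>i\<in>{1..b}. toppled b n (snd p [i] + fst p / real b) (subtree b i (snd p))) else 0)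
     \<in> borel \<Otimes>\<^sub>M T \<rightarrow>\<^sub>M count_space UNIV"
    by measurable
  then show ?case by (simp add: case_prod_beta)
qed simp

lemma reaches_measurable [measurable]:
  "Measurable.pred (borel \<Otimes>\<^sub>M T) (\<lambda>(\<theta>, x). reaches b n \<theta> x)"
proof (induction n)
  case (Suc n)
  have [measurable]: "Measurable.pred (borel \<Otimes>\<^sub>M T) (\<lambda>p. reaches b n (snd p [i] + fst p / real b) (subtree b i (snd p)))"
    if "i \<in> {1..b}" for i
    using measurable_compose[OF child_measurable[OF that] Suc] by (simp add: case_prod_beta)
  have "Measurable.pred (borel \<Otimes>\<^sub>M T) (\<lambda>p. 1 \<le> fst p \<and> (\<exists>i\<in>{1..b}. reaches b n (snd p [i] + fst p / real b) (subtree b i (snd p))))"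
    by measurable
  then show ?case by (simp add: case_prod_beta)
qed simp

text \<open>\<open>H\<close> receives the root value as an explicit argument and, by
  \<open>upd\<close>, ignores the label \<open>x []\<close>. The product law splits off this
  coordinate, so the root label is integrated on its own while the inner integral can again be taken
  over the full tree law.\<close>

lemma root_integral:
  assumes H: "(\<lambda>(\<theta>, x). H \<theta> x) \<in> borel_measurable (borel \<Otimes>\<^sub>M T)"
    and upd: "\<And>\<theta> x y. H \<theta> (x([] := y)) = H \<theta> x"
  shows "(\<integral>\<^sup>+x. H (x [] + v) x \<partial>T) = (\<integral>\<^sup>+y. (\<integral>\<^sup>+x. H (y + v) x \<partial>T) \<partial>\<rho>)"
proof -
  define T' where "T' = PiM (tree b - {[]}) (\<lambda>_. \<rho>)"
  interpret T': prob_space T' unfolding T'_def by (intro prob_space_PiM) unfold_locales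
  have ins: "insert [] (tree b - {[]}) = tree b" by auto
  have T: "T = distr (\<rho> \<Otimes>\<^sub>M T') T (\<lambda>(y, X). X([] := y))"
    using distr_pair_PiM_eq_PiM[of "tree b - {[]}" "\<lambda>_. \<rho>" "[]"] prob_space_axioms
    by (simp add: insert_absorb tree_law_def T'_def)
  have m: "(\<lambda>(y, X). X([] := y)) \<in> \<rho> \<Otimes>\<^sub>M T' \<rightarrow>\<^sub>M T"
    unfolding tree_law_def T'_def using measurable_fun_upd[of "tree b" "tree b - {[]}" "[]" snd "\<rho> \<Otimes>\<^sub>M PiM (tree b - {[]}) (\<lambda>_. \<rho>)" "\<lambda>_. \<rho>" fst]
    by (simp add: case_prod_unfold insert_absorb)
  note [measurable] = H
  have Hm: "(\<lambda>x. H (x [] + v) x) \<in> borel_measurable T"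
    using measurable_compose[OF _ H, of "\<lambda>x. (x [] + v, x)" T] by (simp add: component_measurable)
  have Hm2: "(\<lambda>x. H t x) \<in> borel_measurable T" for t
    using measurable_compose[OF _ H, of "\<lambda>x. (t, x)" T] by simp
  have "(\<integral>\<^sup>+x. H (x [] + v) x \<partial>T) = (\<integral>\<^sup>+p. H (fst p + v) ((snd p)([] := fst p)) \<partial>(\<rho> \<Otimes>\<^sub>M T'))"
    by (subst T) (use m Hm in \<open>simp add: nn_integral_distr case_prod_beta\<close>)
  also have "\<dots> = (\<integral>\<^sup>+y. \<integral>\<^sup>+X. H (y + v) (X([] := y)) \<partial>T' \<partial>\<rho>)"
  proof -
    have "(\<lambda>p. H (fst p + v) ((snd p)([] := fst p))) \<in> borel_measurable (\<rho> \<Otimes>\<^sub>M T')"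
      using measurable_compose[OF m Hm] by (simp add: case_prod_beta)
    then show ?thesis by (subst T'.nn_integral_fst[symmetric]) auto
  qed
  also have "\<dots> = (\<integral>\<^sup>+y. (\<integral>\<^sup>+x. H (y + v) x \<partial>T) \<partial>\<rho>)"
  proof (intro nn_integral_cong)
    fix y
    have "(\<integral>\<^sup>+x. H (y + v) x \<partial>T) = (\<integral>\<^sup>+p. H (y + v) ((snd p)([] := fst p)) \<partial>(\<rho> \<Otimes>\<^sub>M T'))"
      by (subst T) (use m Hm2 in \<open>simp add: nn_integral_distr case_prod_beta\<close>)
    also have "\<dots> = (\<integral>\<^sup>+z. \<integral>\<^sup>+X. H (y + v) (X([] := z)) \<partial>T' \<partial>\<rho>)"
    proof -
      have "(\<lambda>p. H (y + v) ((snd p)([] := fst p))) \<in> borel_measurable (\<rho> \<Otimes>\<^sub>M T')"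
        using measurable_compose[OF m Hm2] by (simp add: case_prod_beta)
      then show ?thesis by (subst T'.nn_integral_fst[symmetric]) auto
    qed
    also have "\<dots> = (\<integral>\<^sup>+X. H (y + v) (X([] := y)) \<partial>T')"
      by (simp add: upd emeasure_space_1)
    finally show "(\<integral>\<^sup>+X. H (y + v) (X([] := y)) \<partial>T') = (\<integral>\<^sup>+x. H (y + v) x \<partial>T)" ..
  qed
  finally show ?thesis .
qed

text \<open>Under the push-forward by \<open>subtree b i\<close>, which preserves the tree law, the
  label of child \<open>i\<close> becomes the root label.\<close>

lemma child_integral:
  assumes H: "(\<lambda>(\<theta>, x). H \<theta> x) \<in> borel_measurable (borel \<Otimes>\<^sub>M T)"
    and upd: "\<And>\<theta> x y. H \<theta> (x([] := y)) = H \<theta> x" and i: "i \<in> {1..b}"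
  shows "(\<integral>\<^sup>+x. H (x [i] + t) (subtree b i x) \<partial>T) = (\<integral>\<^sup>+y. (\<integral>\<^sup>+x. H (y + t) x \<partial>T) \<partial>\<rho>)"
proof -
  have Hm: "(\<lambda>x. H (x [] + t) x) \<in> borel_measurable T"
    using measurable_compose[OF _ H, of "\<lambda>x. (x [] + t, x)" T] by (simp add: component_measurable)
  have "(\<integral>\<^sup>+x. H (x [] + t) x \<partial>T) = (\<integral>\<^sup>+x. H (x [] + t) x \<partial>distr T T (subtree b i))"
    by (simp add: subtree_distr[OF i])
  also have "\<dots> = (\<integral>\<^sup>+x. H (x [i] + t) (subtree b i x) \<partial>T)"
    by (subst nn_integral_distr) (use Hm subtree_measurable[OF i] in \<open>auto simp: subtree_def\<close>)
  finally show ?thesis using root_integral[OF H upd] by simp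
qed

text \<open>The factor of child \<open>i\<close> depends only on labels whose address begins with
  \<open>i\<close>. These blocks are disjoint, hence independent, and all factors have the same
  integral.\<close>

lemma children_integral:
  assumes H: "(\<lambda>(\<theta>, x). H \<theta> x :: ennreal) \<in> borel_measurable (borel \<Otimes>\<^sub>M T)"
    and upd: "\<And>\<theta> x y. H \<theta> (x([] := y)) = H \<theta> x"
  shows "(\<integral>\<^sup>+x. (\<Prod>i\<in>{1..b}. H (x [i] + t) (subtree b i x)) \<partial>T) = (\<integral>\<^sup>+y. (\<integral>\<^sup>+x. H (y + t) x \<partial>T) \<partial>\<rho>) ^ b"
proof -
  have id: "distr T T (\<lambda>x. \<lambda>\<sigma>\<in>tree b. x \<sigma>) = T"
    using distr_PiM_reindex[of "tree b" "\<lambda>_. \<rho>" "\<lambda>\<sigma>. \<sigma>" "tree b"] prob_space_axioms by (simp add: tree_law_def)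
  have comp: "distr T \<rho> (\<lambda>x. x \<sigma>) = \<rho>" if "\<sigma> \<in> tree b" for \<sigma>
    using distr_PiM_component[of "tree b" "\<lambda>_. \<rho>" \<sigma>] that prob_space_axioms by (simp add: tree_law_def)
  have rv: "(\<lambda>x. x \<sigma>) \<in> T \<rightarrow>\<^sub>M \<rho>" if "\<sigma> \<in> tree b" for \<sigma>
    using that by (simp add: tree_law_def measurable_component_singleton)
  have ne: "tree b \<noteq> {}" using tree_Nil[of b] by blast
  have ind: "T.indep_vars (\<lambda>_. \<rho>) (\<lambda>\<sigma> x. x \<sigma>) (tree b)"
  proof (subst T.indep_vars_iff_distr_eq_PiM')
    have "PiM (tree b) (\<lambda>i. distr T \<rho> (\<lambda>x. x i)) = PiM (tree b) (\<lambda>_. \<rho>)"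
      by (intro PiM_cong refl comp)
    then show "distr T (PiM (tree b) (\<lambda>_. \<rho>)) (\<lambda>x. \<lambda>\<sigma>\<in>tree b. x \<sigma>) = PiM (tree b) (\<lambda>i. distr T \<rho> (\<lambda>x. x i))"
      using id by (simp add: tree_law_def)
  qed (use rv ne in auto)
  define J where "J = (\<lambda>i. (#) i ` tree b)"
  have indJ: "T.indep_vars (\<lambda>i. PiM (J i) (\<lambda>_. \<rho>)) (\<lambda>i x. restrict (\<lambda>\<sigma>. x \<sigma>) (J i)) {1..b}"
    by (rule T.indep_vars_restrict[OF ind]) (auto simp: J_def disjoint_family_on_def)
  define Y where "Y = (\<lambda>i \<omega>. H (\<omega> [i] + t) (\<lambda>\<sigma>\<in>tree b. \<omega> (i # \<sigma>)))"
  have Ym: "Y i \<in> borel_measurable (PiM (J i) (\<lambda>_. \<rho>))" for i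
  proof -
    have 1: "(\<lambda>\<omega>. \<omega> [i]) \<in> PiM (J i) (\<lambda>_. \<rho>) \<rightarrow>\<^sub>M \<rho>" by (rule measurable_component_singleton) (auto simp: J_def)
    then have 1: "(\<lambda>\<omega>. \<omega> [i] + t) \<in> borel_measurable (PiM (J i) (\<lambda>_. \<rho>))"
      by (intro borel_measurable_add) (simp_all cong: measurable_cong_sets[OF refl sets_label])
    have 2: "(\<lambda>\<omega>. \<lambda>\<sigma>\<in>tree b. \<omega> (i # \<sigma>)) \<in> PiM (J i) (\<lambda>_. \<rho>) \<rightarrow>\<^sub>M T"
      unfolding tree_law_def by (intro measurable_restrict measurable_component_singleton) (auto simp: J_def)
    show ?thesis unfolding Y_def using measurable_compose[OF measurable_Pair[OF 1 2] H] by simp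
  qed
  have "T.indep_vars (\<lambda>_. borel) (\<lambda>i x. Y i (restrict (\<lambda>\<sigma>. x \<sigma>) (J i))) {1..b}"
    by (rule T.indep_vars_compose2[OF indJ]) (rule Ym)
  moreover have "Y i (restrict (\<lambda>\<sigma>. x \<sigma>) (J i)) = H (x [i] + t) (subtree b i x)" for i x
    by (auto simp: Y_def J_def subtree_def cong: restrict_cong intro!: arg_cong[where f = "H _"])
  ultimately have "T.indep_vars (\<lambda>_. borel) (\<lambda>i x. H (x [i] + t) (subtree b i x)) {1..b}" by simp
  then have "(\<integral>\<^sup>+x. (\<Prod>i\<in>{1..b}. H (x [i] + t) (subtree b i x)) \<partial>T) = (\<Prod>i\<in>{1..b}. \<integral>\<^sup>+x. H (x [i] + t) (subtree b i x) \<partial>T)"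
    by (intro T.indep_vars_nn_integral) auto
  also have "\<dots> = (\<Prod>i\<in>{1..b}. \<integral>\<^sup>+y. (\<integral>\<^sup>+x. H (y + t) x \<partial>T) \<partial>\<rho>)"
    by (intro prod.cong refl child_integral H upd)
  finally show ?thesis by simp
qed

text \<open>The cardinality is the integral of an indicator against counting measure on the
  countable set of addresses, so measurability is needed only for one address at a time.\<close>

lemma avalanche_size_measurable [measurable]: "avalanche_size b v \<in> borel_measurable T"
proof -
  have proc: "(\<lambda>x. avalanche_process b v x t \<sigma>) \<in> borel_measurable T" if "\<sigma> \<in> tree b" for t \<sigma>
    using that
  proof (induction t arbitrary: \<sigma>)
    case 0
    then show ?case by (cases "\<sigma> = []") (auto intro!: component_measurable borel_measurable_add)
  next
    case (Suc t)
    note [measurable] = Suc.IH[OF Suc.prems] Suc.IH[OF tree_butlast[OF Suc.prems]]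
    show ?case by simp
  qed
  have pr: "Measurable.pred T (\<lambda>x. \<sigma> \<in> avalanche_set b v x)" for \<sigma>
  proof (cases "\<sigma> \<in> tree b")
    case True
    note [measurable] = proc[OF True]
    show ?thesis using True by (simp add: avalanche_set_def)
  qed (simp add: avalanche_set_def)
  have "(\<lambda>x. \<integral>\<^sup>+\<sigma>. indicator (avalanche_set b v x) \<sigma> \<partial>count_space UNIV) \<in> borel_measurable T"
  proof (rule sigma_finite_measure.borel_measurable_nn_integral)
    show "sigma_finite_measure (count_space (UNIV :: nat list set))"
      by (rule sigma_finite_measure_count_space_countable) simp
    show "(\<lambda>(x, \<sigma>). indicator (avalanche_set b v x) \<sigma> :: ennreal) \<in> borel_measurable (T \<Otimes>\<^sub>M count_space UNIV)"
    proof -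
      have "(\<lambda>(\<sigma>, x). indicator (avalanche_set b v x) \<sigma> :: ennreal) \<in> borel_measurable (count_space UNIV \<Otimes>\<^sub>M T)"
        by (rule measurable_pair_measure_countable1) (use pr in \<open>simp_all add: indicator_def\<close>)
      from measurable_pair_swap[OF this] show ?thesis by (simp add: case_prod_beta)
    qed
  qed
  then show ?thesis by (simp add: avalanche_size_def[abs_def])
qed

end

section \<open>A Tauberian theorem\<close>

text \<open>Half the integral of \<open>g (exp (- u)) * exp (- u) * u powr (- 1/2)\<close> over
  positive \<open>u\<close>, the limit functional of Karamata's theorem for exponent 1/2. The
  substitution \<open>u = t\<^sup>2\<close> reduces it to Gaussian integrals.\<close>

definition karamata_integral :: "(real \<Rightarrow> real) \<Rightarrow> real" where
  "karamata_integral g = (\<integral>t. indicator {0..} t * (g (exp (- t\<^sup>2)) * exp (- t\<^sup>2)) \<partial>lborel)"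

lemma karamata_integrable:
  assumes "continuous_on UNIV g" "\<And>x. 0 \<le> x \<Longrightarrow> x \<le> 1 \<Longrightarrow> \<bar>g x\<bar> \<le> A"
  shows "integrable lborel (\<lambda>t. indicator {0..} t * (g (exp (- t\<^sup>2)) * exp (- t\<^sup>2)) :: real)"
proof (rule Bochner_Integration.integrable_bound)
  have [measurable]: "g \<in> borel_measurable borel" using assms(1) by (rule borel_measurable_continuous_onI)
  show "integrable lborel (\<lambda>t::real. A * (indicator {0..} t *\<^sub>R exp (- t\<^sup>2)))"
    using gaussian_moment_0 by (intro integrable_mult_right) (simp add: has_bochner_integral_iff)
  show "(\<lambda>t. indicator {0..} t * (g (exp (- t\<^sup>2)) * exp (- t\<^sup>2))) \<in> borel_measurable lborel" by simp
  have "\<bar>g (exp (- t\<^sup>2))\<bar> * exp (- t\<^sup>2) \<le> \<bar>A\<bar> * exp (- t\<^sup>2)" for t :: real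
    using assms(2)[of "exp (- t\<^sup>2)"] by (intro mult_right_mono) auto
  then show "AE t in lborel. norm (indicator {0..} t * (g (exp (- t\<^sup>2)) * exp (- t\<^sup>2))) \<le> norm (A * (indicator {0..} t *\<^sub>R exp (- t\<^sup>2)))"
    by (intro AE_I2) (auto simp: abs_mult indicator_def)
qed

lemma karamata_integral_monomial: "karamata_integral (\<lambda>x. x ^ k) = sqrt pi / 2 / sqrt (real (Suc k))"
proof -
  define c where "c = sqrt (real (Suc k))"
  have c: "0 < c" "c\<^sup>2 = real (Suc k)" by (auto simp: c_def)
  have eq: "indicator {0..} (0 + c * t) *\<^sub>R exp (- (0 + c * t)\<^sup>2) = indicator {0..} t * (exp (- t\<^sup>2) ^ k * exp (- t\<^sup>2))" for t :: real
  proof -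
    have "exp (- (c * t)\<^sup>2) = exp (- t\<^sup>2) ^ k * exp (- t\<^sup>2)"
      by (simp add: power_mult_distrib c exp_of_nat_mult[symmetric] exp_add[symmetric] algebra_simps)
    moreover have "indicator {0..} (c * t) = (indicator {0..} t :: real)"
      using c by (auto simp: indicator_def zero_le_mult_iff)
    ultimately show ?thesis by simp
  qed
  have "sqrt pi / 2 = (\<integral>t. indicator {0..} t *\<^sub>R exp (- t\<^sup>2) \<partial>lborel)"
    using gaussian_moment_0 by (simp add: has_bochner_integral_iff)
  also have "\<dots> = \<bar>c\<bar> *\<^sub>R (\<integral>t. indicator {0..} (0 + c * t) *\<^sub>R exp (- (0 + c * t)\<^sup>2) \<partial>lborel)"
    using c by (intro lborel_integral_real_affine) auto
  also have "\<dots> = c * karamata_integral (\<lambda>x. x ^ k)"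
    unfolding eq karamata_integral_def using c by simp
  finally show ?thesis using c by (simp add: c_def field_simps)
qed

locale karamata =
  fixes a :: "nat \<Rightarrow> real" and c :: real
  assumes a_nonneg: "0 \<le> a n" and a_decseq: "decseq a"
    and a_series: "((\<lambda>s. sqrt (1 - s) * (\<Sum>n. a n * s ^ n)) \<longlongrightarrow> c) (at_left 1)"
begin

text \<open>Karamata's device: \<open>g\<close> is a test function on the Abel sum. A
  \<open>g\<close> supported away from 0 and 1 cuts out a window of indices \<open>n\<close> of
  order \<open>1 / (1 - s)\<close>.\<close>

definition W :: "(real \<Rightarrow> real) \<Rightarrow> real \<Rightarrow> real" where
  "W g s = sqrt (1 - s) * (\<Sum>n. a n * s ^ n * g (s ^ n))"

lemma W_summable:
  assumes "0 < s" "s < 1" "\<And>x. 0 \<le> x \<Longrightarrow> x \<le> 1 \<Longrightarrow> \<bar>g x\<bar> \<le> A"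
  shows "summable (\<lambda>n. a n * s ^ n * g (s ^ n))"
proof (rule summable_comparison_test')
  show "summable (\<lambda>n. a 0 * A * s ^ n)"
    using assms by (intro summable_mult summable_geometric) auto
  show "norm (a n * s ^ n * g (s ^ n)) \<le> a 0 * A * s ^ n" if "n \<ge> 0" for n
  proof -
    have "\<bar>g (s ^ n)\<bar> \<le> A" using assms by (intro assms(3)) (auto intro: power_le_one)
    moreover have "a n \<le> a 0" using a_decseq by (simp add: decseq_def)
    ultimately have "a n * \<bar>g (s ^ n)\<bar> \<le> a 0 * A" using a_nonneg by (intro mult_mono) auto
    then have "a n * \<bar>g (s ^ n)\<bar> * s ^ n \<le> a 0 * A * s ^ n" using assms by (intro mult_right_mono) auto
    then show ?thesis using a_nonneg[of n] assms by (simp add: abs_mult power_abs mult.assoc mult.commute[of "s ^ n"])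
  qed
qed

lemma near_1: "eventually (\<lambda>s::real. 0 < s \<and> s < 1) (at_left 1)"
  using eventually_at_left_field[of "\<lambda>s. 0 < s \<and> s < 1" 1] zero_less_one by blast

text \<open>The series for \<open>x ^ k\<close> at \<open>s\<close> is the plain Abel sum at
  \<open>s ^ Suc k\<close>, and \<open>1 - s ^ Suc k\<close> is \<open>1 - s\<close> times a factor
  tending to \<open>Suc k\<close>.\<close>

lemma W_monomial: "(W (\<lambda>x. x ^ k) \<longlongrightarrow> c / sqrt (real (Suc k))) (at_left 1)"
proof -
  define f where "f = (\<lambda>s. sqrt (1 - s) * (\<Sum>n. a n * s ^ n))"
  have lim: "filterlim (\<lambda>s::real. s ^ Suc k) (at_left 1) (at_left 1)"
  proof (rule filterlim_at_withinI)
    have "((\<lambda>s::real. s ^ Suc k) \<longlongrightarrow> 1 ^ Suc k) (at_left 1)" by (intro tendsto_intros)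
    then show "((\<lambda>s::real. s ^ Suc k) \<longlongrightarrow> 1) (at_left 1)" by simp
    show "eventually (\<lambda>s::real. s ^ Suc k \<in> {..<1} - {1}) (at_left 1)"
      using near_1 by eventually_elim (auto simp: power_Suc_less_one simp del: power_Suc)
  qed
  have "((\<lambda>s. f (s ^ Suc k) * (1 / sqrt (\<Sum>i<Suc k. s ^ i))) \<longlongrightarrow> c * (1 / sqrt (\<Sum>i<Suc k. 1 ^ i))) (at_left 1)"
    by (intro tendsto_intros filterlim_compose[OF a_series[folded f_def] lim]) simp
  then have "((\<lambda>s. f (s ^ Suc k) * (1 / sqrt (\<Sum>i<Suc k. s ^ i))) \<longlongrightarrow> c / sqrt (real (Suc k))) (at_left 1)"
    by simp
  moreover have "eventually (\<lambda>s. f (s ^ Suc k) * (1 / sqrt (\<Sum>i<Suc k. s ^ i)) = W (\<lambda>x. x ^ k) s) (at_left 1)"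
    using near_1
  proof eventually_elim
    case (elim s)
    have "0 < (\<Sum>i<Suc k. s ^ i)" using elim by (intro sum_pos) auto
    moreover have "1 - s ^ Suc k = (1 - s) * (\<Sum>i<Suc k. s ^ i)"
      by (rule one_diff_power_eq)
    ultimately have e1: "sqrt (1 - s ^ Suc k) * (1 / sqrt (\<Sum>i<Suc k. s ^ i)) = sqrt (1 - s)"
      by (simp add: real_sqrt_mult del: power_Suc sum.lessThan_Suc)
    have e2: "(\<lambda>n. a n * (s ^ Suc k) ^ n) = (\<lambda>n. a n * s ^ n * (s ^ n) ^ k)"
    proof
      fix n
      have "(s ^ Suc k) ^ n = s ^ (n + n * k)" by (simp only: power_mult[symmetric] mult_Suc mult.commute[of k])
      then show "a n * (s ^ Suc k) ^ n = a n * s ^ n * (s ^ n) ^ k" by (simp only: power_add power_mult mult.assoc)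
    qed
    have aux: "y * X * R = z * X" if "y * R = z" for y X R z :: real
      using that by (simp add: ac_simps)
    show ?case unfolding f_def W_def e2 by (rule aux[OF e1])
  qed
  ultimately show ?thesis by (rule Lim_transform_eventually)
qed

lemma W_add:
  assumes "0 < s" "s < 1" "\<And>x. 0 \<le> x \<Longrightarrow> x \<le> 1 \<Longrightarrow> \<bar>g x\<bar> \<le> A" "\<And>x. 0 \<le> x \<Longrightarrow> x \<le> 1 \<Longrightarrow> \<bar>h x\<bar> \<le> A'"
  shows "W (\<lambda>x. g x + h x) s = W g s + W h s"
proof -
  have g: "summable (\<lambda>n. a n * s ^ n * g (s ^ n))" by (rule W_summable[OF assms(1,2)]) (rule assms(3))
  have h: "summable (\<lambda>n. a n * s ^ n * h (s ^ n))" by (rule W_summable[OF assms(1,2)]) (rule assms(4))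
  show ?thesis by (simp only: W_def distrib_left suminf_add[OF g h, symmetric])
qed

lemma W_cmult:
  assumes "0 < s" "s < 1" "\<And>x. 0 \<le> x \<Longrightarrow> x \<le> 1 \<Longrightarrow> \<bar>g x\<bar> \<le> A"
  shows "W (\<lambda>x. d * g x) s = d * W g s"
proof -
  have g: "summable (\<lambda>n. a n * s ^ n * g (s ^ n))" by (rule W_summable[OF assms(1,2)]) (rule assms(3))
  show ?thesis using suminf_mult[OF g, of d] by (simp add: W_def mult.left_commute)
qed

text \<open>The factor \<open>2 / sqrt pi\<close> makes the value on the constant 1 equal to
  \<open>c\<close>.\<close>

abbreviation "L g \<equiv> c * (2 / sqrt pi) * karamata_integral g"

lemma polynomial_bounded: "\<exists>A. \<forall>x. 0 \<le> x \<longrightarrow> x \<le> 1 \<longrightarrow> \<bar>\<Sum>i\<in>I. q i * x ^ i\<bar> \<le> (A::real)"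
proof (intro exI allI impI)
  fix x :: real assume "0 \<le> x" "x \<le> 1"
  then show "\<bar>\<Sum>i\<in>I. q i * x ^ i\<bar> \<le> (\<Sum>i\<in>I. \<bar>q i\<bar>)"
    by (intro order_trans[OF sum_abs] sum_mono) (auto simp: abs_mult power_abs intro!: mult_left_le power_le_one)
qed

lemma W_polynomial: "(W (\<lambda>x. \<Sum>i\<in>{..k}. q i * x ^ i) \<longlongrightarrow> L (\<lambda>x. \<Sum>i\<in>{..k}. q i * x ^ i)) (at_left 1)"
proof -
  have mono: "(W (\<lambda>x. d * x ^ j) \<longlongrightarrow> L (\<lambda>x. d * x ^ j)) (at_left 1)" for d j
  proof -
    have l1: "((\<lambda>s. d * W (\<lambda>x. x ^ j) s) \<longlongrightarrow> d * (c / sqrt (real (Suc j)))) (at_left 1)"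
      by (intro tendsto_intros W_monomial)
    have l2: "eventually (\<lambda>s. d * W (\<lambda>x. x ^ j) s = W (\<lambda>x. d * x ^ j) s) (at_left 1)"
      using near_1 by eventually_elim (rule W_cmult[symmetric, where A = 1]; auto simp: power_abs intro: power_le_one)
    have l3: "L (\<lambda>x. d * x ^ j) = d * (c / sqrt (real (Suc j)))"
    proof -
      have "karamata_integral (\<lambda>x. d * x ^ j) = d * karamata_integral (\<lambda>x. x ^ j)"
        unfolding karamata_integral_def
        by (subst integral_mult_right_zero[symmetric]) (simp add: ac_simps)
      then show ?thesis by (simp add: karamata_integral_monomial)
    qed
    show ?thesis unfolding l3 by (rule Lim_transform_eventually[OF l1 l2])
  qed
  show ?thesis
  proof (induction k)
    case 0
    then show ?case using mono[of "q 0" 0] by simp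
  next
    case (Suc k)
    obtain A where A: "\<And>x. 0 \<le> x \<Longrightarrow> x \<le> 1 \<Longrightarrow> \<bar>\<Sum>i\<in>{..k}. q i * x ^ i\<bar> \<le> (A::real)" using polynomial_bounded by metis
    have m: "\<bar>q (Suc k) * x ^ Suc k\<bar> \<le> \<bar>q (Suc k)\<bar>" if "0 \<le> x" "x \<le> 1" for x
      unfolding abs_mult using that by (intro mult_left_le) (auto simp: power_abs simp del: power_Suc intro: power_le_one)
    have l1: "((\<lambda>s. W (\<lambda>x. \<Sum>i\<in>{..k}. q i * x ^ i) s + W (\<lambda>x. q (Suc k) * x ^ Suc k) s) \<longlongrightarrow>
       L (\<lambda>x. \<Sum>i\<in>{..k}. q i * x ^ i) + L (\<lambda>x. q (Suc k) * x ^ Suc k)) (at_left 1)"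
      by (intro tendsto_add Suc mono)
    have l2: "eventually (\<lambda>s. W (\<lambda>x. \<Sum>i\<in>{..k}. q i * x ^ i) s + W (\<lambda>x. q (Suc k) * x ^ Suc k) s
       = W (\<lambda>x. \<Sum>i\<in>{..Suc k}. q i * x ^ i) s) (at_left 1)"
      using near_1
    proof eventually_elim
      case (elim s)
      then show ?case using W_add[OF _ _ A m, of s] by (simp del: power_Suc)
    qed
    have "karamata_integral (\<lambda>x. \<Sum>i\<in>{..Suc k}. q i * x ^ i) =
        karamata_integral (\<lambda>x. \<Sum>i\<in>{..k}. q i * x ^ i) + karamata_integral (\<lambda>x. q (Suc k) * x ^ Suc k)"
    proof -
      have "integrable lborel (\<lambda>t. indicator {0..} t * ((\<Sum>i\<in>{..k}. q i * exp (- t\<^sup>2) ^ i) * exp (- t\<^sup>2)) :: real)"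
        by (rule karamata_integrable[OF _ A]) (auto intro!: continuous_intros)
      moreover have "integrable lborel (\<lambda>t. indicator {0..} t * ((q (Suc k) * exp (- t\<^sup>2) ^ Suc k) * exp (- t\<^sup>2)) :: real)"
        by (rule karamata_integrable[OF _ m]) (auto intro!: continuous_intros)
      ultimately show ?thesis
        unfolding karamata_integral_def
        by (subst Bochner_Integration.integral_add[symmetric]) (auto simp: algebra_simps)
    qed
    then have l3: "L (\<lambda>x. \<Sum>i\<in>{..k}. q i * x ^ i) + L (\<lambda>x. q (Suc k) * x ^ Suc k) = L (\<lambda>x. \<Sum>i\<in>{..Suc k}. q i * x ^ i)"
      by (simp only: distrib_left)
    show ?case unfolding l3[symmetric] by (rule Lim_transform_eventually[OF l1 l2])
  qed
qed

text \<open>Weierstrass approximation on \<open>[0, 1]\<close>. As the coefficients are nonnegative,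
  an error \<open>e\<close> in \<open>g\<close> changes \<open>W\<close> by at most \<open>e\<close>
  times \<open>W\<close> of the constant 1, which tends to \<open>c\<close> and so stays below
  \<open>c + 1\<close>.\<close>

lemma W_continuous:
  assumes g: "continuous_on UNIV g"
  shows "(W g \<longlongrightarrow> L g) (at_left 1)"
proof (rule tendstoI)
  fix d :: real assume d: "0 < d"
  have c0: "0 \<le> c"
  proof (rule tendsto_lowerbound[OF a_series])
    show "eventually (\<lambda>s. 0 \<le> sqrt (1 - s) * (\<Sum>n. a n * s ^ n)) (at_left 1)"
      using near_1
    proof eventually_elim
      case (elim s)
      have "summable (\<lambda>n. a n * s ^ n)" using W_summable[of s "\<lambda>_. 1" 1] elim by simp
      then show ?case using elim a_nonneg by (intro mult_nonneg_nonneg suminf_nonneg) auto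
    qed
  qed simp
  define e where "e = d / 3 / (c + 1)"
  have e: "0 < e" using d c0 by (simp add: e_def)
  have "c + 1 \<noteq> 0" using c0 by linarith
  then have ec: "e * (c + 1) = d / 3" unfolding e_def by (rule nonzero_eq_divide_eq[THEN iffD1]) simp
  have "continuous_on {0..1} g" using g continuous_on_subset by blast
  then obtain P where P: "real_polynomial_function P" "\<And>x. x \<in> {0..1} \<Longrightarrow> \<bar>g x - P x\<bar> < e"
    using Stone_Weierstrass_real_polynomial_function[of "{0..1}" g e] e by auto
  then obtain q k where Pq: "P = (\<lambda>x. \<Sum>i\<le>k. q i * x ^ i)" by (auto simp: real_polynomial_function_iff_sum)
  obtain A where A: "\<And>x. 0 \<le> x \<Longrightarrow> x \<le> 1 \<Longrightarrow> \<bar>P x\<bar> \<le> A" using polynomial_bounded unfolding Pq by metis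
  have gP: "\<bar>g x - P x\<bar> \<le> e" if "0 \<le> x" "x \<le> 1" for x using P(2)[of x] that by auto
  have Pc: "continuous_on UNIV P" unfolding Pq by (intro continuous_intros)
  have gA: "\<bar>g x\<bar> \<le> A + e" if "0 \<le> x" "x \<le> 1" for x using A[OF that] gP[OF that] by linarith
  have Wdiff: "\<bar>W g s - W P s\<bar> \<le> e * W (\<lambda>_. 1) s" if s: "0 < s" "s < 1" for s
  proof -
    have "W g s = W (\<lambda>x. P x + (g x - P x)) s" by simp
    also have "\<dots> = W P s + W (\<lambda>x. g x - P x) s" by (rule W_add[OF s A gP])
    finally have "W g s - W P s = W (\<lambda>x. g x - P x) s" by simp
    also have "\<bar>\<dots>\<bar> \<le> sqrt (1 - s) * (\<Sum>n. \<bar>a n * s ^ n * (g (s ^ n) - P (s ^ n))\<bar>)"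
    proof -
      have "summable (\<lambda>n. \<bar>a n * s ^ n * (g (s ^ n) - P (s ^ n))\<bar>)"
        using W_summable[of s "\<lambda>x. \<bar>g x - P x\<bar>" e] s gP a_nonneg by (simp add: abs_mult power_abs)
      from mult_left_mono[OF summable_rabs[OF this], of "sqrt (1 - s)"]
      have "sqrt (1 - s) * \<bar>\<Sum>n. a n * s ^ n * (g (s ^ n) - P (s ^ n))\<bar> \<le> sqrt (1 - s) * (\<Sum>n. \<bar>a n * s ^ n * (g (s ^ n) - P (s ^ n))\<bar>)"
        using s by simp
      moreover have "\<bar>sqrt (1 - s) * y\<bar> = sqrt (1 - s) * \<bar>y\<bar>" for y using s by (simp add: abs_mult)
      ultimately show ?thesis unfolding W_def by (simp only:)
    qed
    also have "\<dots> \<le> sqrt (1 - s) * (\<Sum>n. e * (a n * s ^ n * 1))"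
    proof (intro mult_left_mono suminf_le)
      show "\<bar>a n * s ^ n * (g (s ^ n) - P (s ^ n))\<bar> \<le> e * (a n * s ^ n * 1)" for n
      proof -
        have "\<bar>g (s ^ n) - P (s ^ n)\<bar> \<le> e" using s by (intro gP) (auto intro: power_le_one)
        then have "(a n * s ^ n) * \<bar>g (s ^ n) - P (s ^ n)\<bar> \<le> (a n * s ^ n) * e"
          using a_nonneg s by (intro mult_left_mono) auto
        then show ?thesis using a_nonneg s by (simp add: abs_mult power_abs mult.commute)
      qed
      show "summable (\<lambda>n. \<bar>a n * s ^ n * (g (s ^ n) - P (s ^ n))\<bar>)"
        using W_summable[of s "\<lambda>x. \<bar>g x - P x\<bar>" e] s gP a_nonneg by (simp add: abs_mult power_abs)
      show "summable (\<lambda>n. e * (a n * s ^ n * 1))"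
        using W_summable[of s "\<lambda>_. 1" 1] s by (intro summable_mult) auto
    qed (use s in simp)
    also have "\<dots> = e * W (\<lambda>_. 1) s"
    proof -
      have "summable (\<lambda>n. a n * s ^ n * 1)" using W_summable[of s "\<lambda>_. 1" 1] s by simp
      from suminf_mult[OF this, of e] show ?thesis by (simp add: W_def)
    qed
    finally show ?thesis .
  qed
  have Ldiff: "\<bar>L g - L P\<bar> \<le> e * c"
  proof -
    define J where "J = (\<lambda>f t. indicator {0..} t * (f (exp (- t\<^sup>2)) * exp (- t\<^sup>2)) :: real)"
    have kJ: "karamata_integral f = (\<integral>t. J f t \<partial>lborel)" for f by (simp only: karamata_integral_def J_def)
    have ig: "integrable lborel (J g)" unfolding J_def by (rule karamata_integrable[OF g gA])
    have iP: "integrable lborel (J P)" unfolding J_def by (rule karamata_integrable[OF Pc A])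
    have i1: "integrable lborel (\<lambda>t. e * J (\<lambda>_. 1) t)"
      unfolding J_def using karamata_integrable[of "\<lambda>_. 1" 1] by (intro integrable_mult_right) simp
    have "karamata_integral g - karamata_integral P = (\<integral>t. J g t - J P t \<partial>lborel)"
      unfolding kJ by (rule Bochner_Integration.integral_diff[symmetric, OF ig iP])
    also have "\<bar>\<dots>\<bar> \<le> (\<integral>t. \<bar>J g t - J P t\<bar> \<partial>lborel)"
      by (rule integral_abs_bound)
    also have "\<dots> \<le> (\<integral>t. e * J (\<lambda>_. 1) t \<partial>lborel)"
    proof (rule integral_mono)
      show "integrable lborel (\<lambda>t. \<bar>J g t - J P t\<bar>)"
        by (intro integrable_abs Bochner_Integration.integrable_diff ig iP)
      show "integrable lborel (\<lambda>t. e * J (\<lambda>_. 1) t)" by (rule i1)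
      fix t :: real
      have "\<bar>g (exp (- t\<^sup>2)) - P (exp (- t\<^sup>2))\<bar> * exp (- t\<^sup>2) \<le> e * exp (- t\<^sup>2)"
        by (rule mult_right_mono[OF gP]) simp_all
      then show "\<bar>J g t - J P t\<bar> \<le> e * J (\<lambda>_. 1) t"
        unfolding J_def by (cases "0 \<le> t") (simp_all add: abs_mult left_diff_distrib[symmetric])
    qed
    also have "\<dots> = e * karamata_integral (\<lambda>x. x ^ 0)"
      by (simp add: kJ)
    also have "\<dots> = e * (sqrt pi / 2)" by (subst karamata_integral_monomial) simp
    finally have *: "\<bar>karamata_integral g - karamata_integral P\<bar> \<le> e * (sqrt pi / 2)" .
    have "L g - L P = c * (2 / sqrt pi) * (karamata_integral g - karamata_integral P)"
      by (simp add: right_diff_distrib)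
    also have "\<bar>\<dots>\<bar> \<le> c * (2 / sqrt pi) * (e * (sqrt pi / 2))"
      unfolding abs_mult using c0 * by (intro mult_mono) auto
    finally show ?thesis by (simp add: mult.commute)
  qed
  have W1: "(W (\<lambda>_. 1) \<longlongrightarrow> c) (at_left 1)" using a_series by (simp add: W_def[abs_def])
  have "eventually (\<lambda>s. W (\<lambda>_. 1) s < c + 1) (at_left 1)" by (rule order_tendstoD[OF W1]) simp
  moreover have "eventually (\<lambda>s. dist (W P s) (L P) < d / 3) (at_left 1)"
    using tendstoD[OF W_polynomial[of q k, folded Pq], of "d/3"] d by simp
  ultimately show "\<forall>\<^sub>F s in at_left 1. dist (W g s) (L g) < d"
    using near_1
  proof eventually_elim
    case (elim s)
    have "e * W (\<lambda>_. 1) s \<le> e * (c + 1)" using elim(1) e by (intro mult_left_mono) auto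
    then have "\<bar>W g s - W P s\<bar> \<le> d / 3" using Wdiff[of s] elim(3) ec by linarith
    moreover have "\<bar>L g - L P\<bar> \<le> d / 3" using Ldiff ec e by (simp add: algebra_simps)
    ultimately show ?case using elim(2) d unfolding dist_real_def abs_le_iff abs_less_iff by argo
  qed
qed

text \<open>For \<open>s = exp (- 1 / N)\<close> one has \<open>s ^ n = exp (- n / N)\<close>, and
  \<open>g\<close> is chosen so that \<open>s ^ n * g (s ^ n)\<close> is \<psi> at
  \<open>sqrt (n / N)\<close>. The square root matches the substitution in
  \<open>karamata_integral\<close>, so the limit is the plain integral of \<psi>. Bounded support
  makes \<open>g\<close> vanish near 0, where its formula is singular.\<close>

lemma window:
  fixes \<psi> :: "real \<Rightarrow> real"
  assumes \<psi>: "continuous_on UNIV \<psi>" and supp: "\<And>t. t \<notin> {\<alpha>..\<beta>} \<Longrightarrow> \<psi> t = 0" and \<alpha>: "0 < \<alpha>"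
  shows "(\<lambda>N. (\<Sum>n. a n * \<psi> (sqrt (real n / real N))) / sqrt (real N)) \<longlonglongrightarrow> c * (2 / sqrt pi) * (\<integral>t. \<psi> t \<partial>lborel)"
proof -
  define g where "g = (\<lambda>x. if x \<le> 0 then 0 else \<psi> (sqrt (- ln x)) / x)"
  have g: "continuous_on UNIV g"
  proof -
    have "continuous_on {0<..} g"
    proof (subst continuous_on_cong[OF refl])
      show "continuous_on {0<..} (\<lambda>x. \<psi> (sqrt (- ln x)) / x)"
        by (intro continuous_intros continuous_on_compose2[OF \<psi>]) auto
    qed (auto simp: g_def)
    moreover have "continuous_on {..<exp (- (\<beta>\<^sup>2 + 1))} g"
    proof (subst continuous_on_cong[OF refl])
      show "continuous_on {..<exp (- (\<beta>\<^sup>2 + 1))} (\<lambda>_. 0 :: real)" by simp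
      fix x assume x: "x \<in> {..<exp (- (\<beta>\<^sup>2 + 1))}"
      show "g x = 0"
      proof (cases "x \<le> 0")
        case False
        then have "ln x < ln (exp (- (\<beta>\<^sup>2 + 1)))" using x by (subst ln_less_cancel_iff) auto
        then have "\<beta>\<^sup>2 < - ln x" by simp
        then have "\<bar>\<beta>\<bar> < sqrt (- ln x)" using real_sqrt_less_mono by fastforce
        then have "sqrt (- ln x) \<notin> {\<alpha>..\<beta>}" by auto
        from supp[OF this] show ?thesis by (simp add: g_def)
      qed (simp add: g_def)
    qed
    ultimately have "continuous_on ({0<..} \<union> {..<exp (- (\<beta>\<^sup>2 + 1))}) g"
      by (intro continuous_on_open_Un) auto
    moreover have "{0<..} \<union> {..<exp (- (\<beta>\<^sup>2 + 1))} = (UNIV :: real set)"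
      by (auto intro: le_less_trans[OF _ exp_gt_zero])
    ultimately show ?thesis by simp
  qed
  have kg: "karamata_integral g = (\<integral>t. \<psi> t \<partial>lborel)"
    unfolding karamata_integral_def
  proof (rule Bochner_Integration.integral_cong[OF refl])
    fix t
    show "indicator {0..} t * (g (exp (- t\<^sup>2)) * exp (- t\<^sup>2)) = \<psi> t"
    proof (cases "0 \<le> t")
      case True
      then show ?thesis by (simp add: g_def)
    next
      case False
      then show ?thesis using supp[of t] \<alpha> by simp
    qed
  qed
  have lim: "filterlim (\<lambda>N::nat. exp (- 1 / real N)) (at_left 1) sequentially"
    by real_asymp
  have "(\<lambda>N. W g (exp (- 1 / real N))) \<longlonglongrightarrow> c * (2 / sqrt pi) * (\<integral>t. \<psi> t \<partial>lborel)"
    using filterlim_compose[OF W_continuous[OF g] lim] by (simp add: kg)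
  moreover have "(\<lambda>N. 1 / (sqrt (1 - exp (- 1 / real N)) * sqrt (real N))) \<longlonglongrightarrow> 1"
    by real_asymp
  ultimately have "(\<lambda>N. W g (exp (- 1 / real N)) * (1 / (sqrt (1 - exp (- 1 / real N)) * sqrt (real N)))) \<longlonglongrightarrow>
      c * (2 / sqrt pi) * (\<integral>t. \<psi> t \<partial>lborel) * 1"
    by (rule tendsto_mult)
  moreover have "eventually (\<lambda>N. W g (exp (- 1 / real N)) * (1 / (sqrt (1 - exp (- 1 / real N)) * sqrt (real N))) =
      (\<Sum>n. a n * \<psi> (sqrt (real n / real N))) / sqrt (real N)) sequentially"
    using eventually_gt_at_top[of 0]
  proof eventually_elim
    case (elim N)
    have "0 < 1 - exp (- 1 / real N)" using elim by simp
    moreover have "exp (- 1 / real N) ^ n * g (exp (- 1 / real N) ^ n) = \<psi> (sqrt (real n / real N))" for n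
      by (simp add: g_def exp_of_nat_mult[symmetric] not_le)
    then have "W g (exp (- 1 / real N)) = sqrt (1 - exp (- 1 / real N)) * (\<Sum>n. a n * \<psi> (sqrt (real n / real N)))"
      by (simp add: W_def mult.assoc)
    ultimately show ?case by simp
  qed
  ultimately show ?thesis unfolding mult_1_right by (rule Lim_transform_eventually)
qed

section \<open>From smooth windows to single coefficients\<close>

definition trapezoid :: "real \<Rightarrow> real \<Rightarrow> real \<Rightarrow> real \<Rightarrow> real \<Rightarrow> real" where
  "trapezoid \<alpha>' \<alpha> \<beta> \<beta>' t = max 0 (min 1 (min ((t - \<alpha>') / (\<alpha> - \<alpha>')) ((\<beta>' - t) / (\<beta>' - \<beta>))))"

lemma trapezoid:
  assumes "\<alpha>' < \<alpha>" "\<alpha> \<le> \<beta>" "\<beta> < \<beta>'"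
  shows "continuous_on UNIV (trapezoid \<alpha>' \<alpha> \<beta> \<beta>')" "0 \<le> trapezoid \<alpha>' \<alpha> \<beta> \<beta>' t" "trapezoid \<alpha>' \<alpha> \<beta> \<beta>' t \<le> 1"
    and "t \<in> {\<alpha>..\<beta>} \<Longrightarrow> trapezoid \<alpha>' \<alpha> \<beta> \<beta>' t = 1" "t \<notin> {\<alpha>'..\<beta>'} \<Longrightarrow> trapezoid \<alpha>' \<alpha> \<beta> \<beta>' t = 0"
    and "\<beta> - \<alpha> \<le> (\<integral>t. trapezoid \<alpha>' \<alpha> \<beta> \<beta>' t \<partial>lborel)" "(\<integral>t. trapezoid \<alpha>' \<alpha> \<beta> \<beta>' t \<partial>lborel) \<le> \<beta>' - \<alpha>'"
proof -
  let ?t = "trapezoid \<alpha>' \<alpha> \<beta> \<beta>'"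
  show c: "continuous_on UNIV ?t" unfolding trapezoid_def using assms by (intro continuous_intros) auto
  show 0: "0 \<le> ?t t" and 1: "?t t \<le> 1" for t by (auto simp: trapezoid_def)
  show in1: "?t t = 1" if "t \<in> {\<alpha>..\<beta>}" for t
    using that assms by (auto simp: trapezoid_def min_def le_divide_eq)
  show out: "?t t = 0" if "t \<notin> {\<alpha>'..\<beta>'}" for t
  proof -
    have "(t - \<alpha>') / (\<alpha> - \<alpha>') \<le> 0 \<or> (\<beta>' - t) / (\<beta>' - \<beta>) \<le> 0"
      using that assms by (auto simp: divide_le_0_iff)
    then have "min 1 (min ((t - \<alpha>') / (\<alpha> - \<alpha>')) ((\<beta>' - t) / (\<beta>' - \<beta>))) \<le> 0"
      by (simp only: min_le_iff_disj) blast
    then show ?thesis unfolding trapezoid_def by (rule max_absorb1)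
  qed
  have lo: "indicator {\<alpha>..\<beta>} t \<le> ?t t" and up: "?t t \<le> indicator {\<alpha>'..\<beta>'} t" for t
    using 0[of t] 1[of t] in1[of t] out[of t] by (auto simp: indicator_def)
  have i: "integrable lborel (indicator {x..y} :: real \<Rightarrow> real)" for x y :: real
    by (simp add: integrable_indicator_iff emeasure_lborel_Icc_eq)
  have it: "integrable lborel ?t"
    by (rule Bochner_Integration.integrable_bound[OF i[of \<alpha>' \<beta>']])
       (use 0 up borel_measurable_continuous_onI[OF c] in \<open>auto intro!: AE_I2\<close>)
  show "\<beta> - \<alpha> \<le> (\<integral>t. ?t t \<partial>lborel)" using integral_mono[OF i it lo] assms by simp
  show "(\<integral>t. ?t t \<partial>lborel) \<le> \<beta>' - \<alpha>'" using integral_mono[OF it i up] assms by simp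
qed

text \<open>For indices from \<open>N\<close> to about \<open>(1 + \<delta>)\<^sup>2 * N\<close>
  monotonicity bounds \<open>a n\<close> by \<open>a N\<close>, so the window sum is at most
  \<open>a N\<close> times the number of indices. The trapezoid lives on
  \<open>[1, 1 + \<delta>]\<close>; its flanks of width \<open>\<delta>\<^sup>2\<close> are of lower
  order than the window.\<close>

lemma window_lower:
  assumes \<delta>: "0 < \<delta>" "\<delta> < 1/2" and x: "x < c * (2 / sqrt pi) * (\<delta> - 2 * \<delta>\<^sup>2)" and c: "0 \<le> c"
  shows "eventually (\<lambda>N. x \<le> a N * sqrt (real N) * ((1 + \<delta>)\<^sup>2 - 1 + 1 / real N)) sequentially"
proof -
  let ?\<psi> = "trapezoid 1 (1 + \<delta>\<^sup>2) (1 + \<delta> - \<delta>\<^sup>2) (1 + \<delta>)"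
  have d2: "0 < \<delta>\<^sup>2" "2 * \<delta>\<^sup>2 \<le> \<delta>" using \<delta> by (auto simp: power2_eq_square)
  note tr = trapezoid[of 1 "1 + \<delta>\<^sup>2" "1 + \<delta> - \<delta>\<^sup>2" "1 + \<delta>"]
  have lim: "(\<lambda>N. (\<Sum>n. a n * ?\<psi> (sqrt (real n / real N))) / sqrt (real N)) \<longlonglongrightarrow> c * (2 / sqrt pi) * (\<integral>t. ?\<psi> t \<partial>lborel)"
    using tr d2 by (intro window[where \<alpha> = 1 and \<beta> = "1 + \<delta>"]) auto
  have "\<delta> - 2 * \<delta>\<^sup>2 \<le> (\<integral>t. ?\<psi> t \<partial>lborel)" using tr(6) d2 by simp
  then have "c * (2 / sqrt pi) * (\<delta> - 2 * \<delta>\<^sup>2) \<le> c * (2 / sqrt pi) * (\<integral>t. ?\<psi> t \<partial>lborel)"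
    using c by (intro mult_left_mono) auto
  then have "x < c * (2 / sqrt pi) * (\<integral>t. ?\<psi> t \<partial>lborel)" using x by linarith
  from order_tendstoD(1)[OF lim this] eventually_gt_at_top[of 0]
  show ?thesis
  proof eventually_elim
    case (elim N)
    let ?J = "{N..nat \<lfloor>(1 + \<delta>)\<^sup>2 * real N\<rfloor>}"
    have zero: "?\<psi> (sqrt (real n / real N)) = 0" if "n \<notin> ?J" for n
    proof (rule tr(5))
      show "sqrt (real n / real N) \<notin> {1..1 + \<delta>}"
      proof
        assume *: "sqrt (real n / real N) \<in> {1..1 + \<delta>}"
        then have "(sqrt (real n / real N))\<^sup>2 \<le> (1 + \<delta>)\<^sup>2" by (intro power_mono) auto
        then have "real n \<le> (1 + \<delta>)\<^sup>2 * real N" using elim(2) by (simp add: pos_divide_le_eq)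
        moreover have "real N \<le> real n" using * elim(2) by (simp add: pos_le_divide_eq)
        ultimately show False using that by (auto simp: le_nat_iff le_floor_iff)
      qed
    qed (use d2 in auto)
    have "(\<Sum>n. a n * ?\<psi> (sqrt (real n / real N))) = (\<Sum>n\<in>?J. a n * ?\<psi> (sqrt (real n / real N)))"
      using zero by (intro suminf_finite) auto
    also have "\<dots> \<le> (\<Sum>n\<in>?J. a N * 1)"
      using a_decseq a_nonneg tr(2,3) d2 by (intro sum_mono mult_mono) (auto simp: decseq_def)
    also have "\<dots> = real (card ?J) * a N" by simp
    also have "\<dots> \<le> (((1 + \<delta>)\<^sup>2 - 1) * real N + 1) * a N"
    proof (intro mult_right_mono a_nonneg)
      have "1 \<le> (1 + \<delta>)\<^sup>2" using \<delta> by (simp add: power2_eq_square algebra_simps)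
      then have "real N \<le> (1 + \<delta>)\<^sup>2 * real N" by (simp add: mult_le_cancel_right1)
      then have 1: "int N \<le> \<lfloor>(1 + \<delta>)\<^sup>2 * real N\<rfloor>" by (simp add: le_floor_iff)
      then have 2: "real (nat \<lfloor>(1 + \<delta>)\<^sup>2 * real N\<rfloor>) \<le> (1 + \<delta>)\<^sup>2 * real N" by (simp add: of_nat_nat)
      have "real (card ?J) = real (nat \<lfloor>(1 + \<delta>)\<^sup>2 * real N\<rfloor>) + 1 - real N" using 1 by (simp add: of_nat_diff)
      then show "real (card ?J) \<le> ((1 + \<delta>)\<^sup>2 - 1) * real N + 1" using 2 by (simp add: algebra_simps)
    qed
    finally have "(\<Sum>n. a n * ?\<psi> (sqrt (real n / real N))) / sqrt (real N) \<le> (((1 + \<delta>)\<^sup>2 - 1) * real N + 1) * a N / sqrt (real N)"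
      by (rule divide_right_mono) simp
    also have "\<dots> = a N * ((((1 + \<delta>)\<^sup>2 - 1) + 1 / real N) * (real N / sqrt (real N)))"
      using elim(2) by (simp add: field_simps)
    also have "real N / sqrt (real N) = sqrt (real N)" by (simp add: real_div_sqrt)
    finally show ?case using elim(1) by (simp add: ac_simps)
  qed
qed

text \<open>The mirror image: for indices from about \<open>(1 - \<delta>)\<^sup>2 * N\<close> to
  \<open>N\<close> each \<open>a n\<close> is at least \<open>a N\<close>. The flanks now lie
  outside \<open>[1 - \<delta>, 1]\<close>, so that the trapezoid is 1 at all counted
  indices.\<close>

lemma window_upper:
  assumes \<delta>: "0 < \<delta>" "\<delta> < 1/2" and x: "c * (2 / sqrt pi) * (\<delta> + 2 * \<delta>\<^sup>2) < x" and c: "0 \<le> c"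
  shows "eventually (\<lambda>N. a N * sqrt (real N) * (1 - (1 - \<delta>)\<^sup>2) \<le> x) sequentially"
proof -
  let ?\<psi> = "trapezoid (1 - \<delta> - \<delta>\<^sup>2) (1 - \<delta>) 1 (1 + \<delta>\<^sup>2)"
  have d2: "0 < \<delta>\<^sup>2" "2 * \<delta>\<^sup>2 < \<delta>" using \<delta> by (auto simp: power2_eq_square)
  note tr = trapezoid[of "1 - \<delta> - \<delta>\<^sup>2" "1 - \<delta>" 1 "1 + \<delta>\<^sup>2"]
  have lim: "(\<lambda>N. (\<Sum>n. a n * ?\<psi> (sqrt (real n / real N))) / sqrt (real N)) \<longlonglongrightarrow> c * (2 / sqrt pi) * (\<integral>t. ?\<psi> t \<partial>lborel)"
    using tr d2 \<delta> by (intro window[where \<alpha> = "1 - \<delta> - \<delta>\<^sup>2" and \<beta> = "1 + \<delta>\<^sup>2"]) auto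
  have "(\<integral>t. ?\<psi> t \<partial>lborel) \<le> \<delta> + 2 * \<delta>\<^sup>2" using tr(7) d2 \<delta> by simp
  then have "c * (2 / sqrt pi) * (\<integral>t. ?\<psi> t \<partial>lborel) \<le> c * (2 / sqrt pi) * (\<delta> + 2 * \<delta>\<^sup>2)"
    using c by (intro mult_left_mono) auto
  then have "c * (2 / sqrt pi) * (\<integral>t. ?\<psi> t \<partial>lborel) < x" using x by linarith
  from order_tendstoD(2)[OF lim this] eventually_gt_at_top[of 0]
  show ?thesis
  proof eventually_elim
    case (elim N)
    let ?J = "{nat \<lceil>(1 - \<delta>)\<^sup>2 * real N\<rceil>..N}"
    let ?I = "{..nat \<lceil>(1 + \<delta>\<^sup>2)\<^sup>2 * real N\<rceil>}"
    have zero: "?\<psi> (sqrt (real n / real N)) = 0" if "n \<notin> ?I" for n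
    proof (rule tr(5))
      show "sqrt (real n / real N) \<notin> {1 - \<delta> - \<delta>\<^sup>2..1 + \<delta>\<^sup>2}"
      proof
        assume *: "sqrt (real n / real N) \<in> {1 - \<delta> - \<delta>\<^sup>2..1 + \<delta>\<^sup>2}"
        then have "(sqrt (real n / real N))\<^sup>2 \<le> (1 + \<delta>\<^sup>2)\<^sup>2" by (intro power_mono) auto
        then have "real n \<le> (1 + \<delta>\<^sup>2)\<^sup>2 * real N" using elim(2) by (simp add: pos_divide_le_eq)
        then show False using that by (auto simp: le_nat_iff le_ceiling_iff)
      qed
    qed (use d2 \<delta> in auto)
    have summ: "summable (\<lambda>n. a n * ?\<psi> (sqrt (real n / real N)))"
      using zero by (intro summable_finite[of ?I]) auto
    have "(1 - (1 - \<delta>)\<^sup>2) * real N * a N \<le> real (card ?J) * a N"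
    proof (intro mult_right_mono a_nonneg)
      have "(1 - \<delta>)\<^sup>2 \<le> 1" using \<delta> by (simp add: power_le_one)
      then have "(1 - \<delta>)\<^sup>2 * real N \<le> real N" by (simp add: mult_le_cancel_right2)
      then have 1: "nat \<lceil>(1 - \<delta>)\<^sup>2 * real N\<rceil> \<le> N" by (simp add: ceiling_le_iff nat_le_iff)
      have "real (nat \<lceil>(1 - \<delta>)\<^sup>2 * real N\<rceil>) \<le> (1 - \<delta>)\<^sup>2 * real N + 1" by (simp add: of_nat_nat)
      then show "(1 - (1 - \<delta>)\<^sup>2) * real N \<le> real (card ?J)" using 1 by (simp add: of_nat_diff algebra_simps)
    qed
    also have "\<dots> = (\<Sum>n\<in>?J. a N * 1)" by simp
    also have "\<dots> \<le> (\<Sum>n\<in>?J. a n * ?\<psi> (sqrt (real n / real N)))"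
    proof (intro sum_mono mult_mono)
      fix n assume n: "n \<in> ?J"
      then show "a N \<le> a n" using a_decseq by (simp add: decseq_def)
      have "(1 - \<delta>)\<^sup>2 * real N \<le> real n" using n by (simp add: nat_le_iff ceiling_le_iff)
      then have "(1 - \<delta>)\<^sup>2 \<le> real n / real N" using elim(2) by (simp add: pos_le_divide_eq)
      then have "1 - \<delta> \<le> sqrt (real n / real N)" using \<delta> by (intro real_le_rsqrt) 
      moreover have "sqrt (real n / real N) \<le> 1" using n elim(2) by simp
      ultimately have "?\<psi> (sqrt (real n / real N)) = 1" using d2 \<delta> by (intro tr(4)) auto
      then show "1 \<le> ?\<psi> (sqrt (real n / real N))" by simp
    qed (use a_nonneg in auto)
    also have "\<dots> \<le> (\<Sum>n. a n * ?\<psi> (sqrt (real n / real N)))"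
      using a_nonneg tr(2) d2 \<delta> by (intro sum_le_suminf summ) auto
    finally have "(1 - (1 - \<delta>)\<^sup>2) * real N * a N / sqrt (real N) \<le> (\<Sum>n. a n * ?\<psi> (sqrt (real n / real N))) / sqrt (real N)"
      by (rule divide_right_mono) simp
    also have "(1 - (1 - \<delta>)\<^sup>2) * real N * a N / sqrt (real N) = a N * ((1 - (1 - \<delta>)\<^sup>2) * (real N / sqrt (real N)))"
      by simp
    also have "real N / sqrt (real N) = sqrt (real N)" by (simp add: real_div_sqrt)
    finally show ?case using elim(1) by (simp add: ac_simps)
  qed
qed

text \<open>A window of length \<delta> in the square-root scale holds about
  \<open>2 * \<delta> * N\<close> indices, so the limit is half of \<open>c * (2 / sqrt pi)\<close>.
  First \<open>N\<close> tends to infinity, then \<delta> to 0.\<close>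

theorem coefficient_asymptotics:
  assumes c: "0 < c"
  shows "(\<lambda>N. a N * sqrt (real N)) \<longlonglongrightarrow> c / sqrt pi"
proof (rule order_tendstoI)
  define C where "C = c * (2 / sqrt pi)"
  have C: "0 < C" using c by (simp add: C_def)
  have Cc: "C * (1 / 2) = c / sqrt pi" by (simp add: C_def)
  show "eventually (\<lambda>N. x < a N * sqrt (real N)) sequentially" if x: "x < c / sqrt pi" for x
  proof -
    have "((\<lambda>\<delta>. C * ((1 - 3 * \<delta>) / (2 + \<delta>))) \<longlongrightarrow> C * ((1 - 3 * 0) / (2 + 0))) (at_right 0)"
      by (intro tendsto_intros) auto
    then have "((\<lambda>\<delta>. C * ((1 - 3 * \<delta>) / (2 + \<delta>))) \<longlongrightarrow> c / sqrt pi) (at_right 0)" using Cc by simp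
    from eventually_conj[OF order_tendstoD(1)[OF this x] eventually_at_right_real[of 0 "1/3"]]
    have "eventually (\<lambda>\<delta>. x < C * ((1 - 3 * \<delta>) / (2 + \<delta>)) \<and> \<delta> \<in> {0<..<1/3}) (at_right 0)" by simp
    from eventually_happens'[OF trivial_limit_at_right_real this] obtain \<delta> where \<delta>: "x < C * ((1 - 3 * \<delta>) / (2 + \<delta>))" "0 < \<delta>" "\<delta> < 1 / 3"
      by auto
    \<comment> \<open>The 3 in place of 2 supplies the strict inequality that
      \<open>window_lower\<close> asks for, without changing the limit as \<delta> tends to
      0.\<close>
    have "C * (\<delta> - 3 * \<delta>\<^sup>2) < C * (\<delta> - 2 * \<delta>\<^sup>2)" using C \<delta> by (intro mult_strict_left_mono) auto
    then have ev: "eventually (\<lambda>N. C * (\<delta> - 3 * \<delta>\<^sup>2) \<le> a N * sqrt (real N) * ((1 + \<delta>)\<^sup>2 - 1 + 1 / real N)) sequentially"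
      using \<delta> c unfolding C_def by (intro window_lower) auto
    have "(\<lambda>N. C * (\<delta> - 3 * \<delta>\<^sup>2) / ((1 + \<delta>)\<^sup>2 - 1 + 1 / real N)) \<longlonglongrightarrow> C * (\<delta> - 3 * \<delta>\<^sup>2) / ((1 + \<delta>)\<^sup>2 - 1 + 0)"
    proof (intro tendsto_intros lim_1_over_n)
      have "(1 + \<delta>)\<^sup>2 - 1 + 0 = \<delta> * (2 + \<delta>)" by (simp add: power2_eq_square algebra_simps)
      then show "(1 + \<delta>)\<^sup>2 - 1 + 0 \<noteq> 0" using \<delta> by simp
    qed
    moreover have "C * (\<delta> - 3 * \<delta>\<^sup>2) / ((1 + \<delta>)\<^sup>2 - 1 + 0) = C * ((1 - 3 * \<delta>) / (2 + \<delta>))"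
    proof -
      have "(1 + \<delta>)\<^sup>2 - 1 + 0 = \<delta> * (2 + \<delta>)" "\<delta> - 3 * \<delta>\<^sup>2 = \<delta> * (1 - 3 * \<delta>)" by (auto simp: power2_eq_square algebra_simps)
      then show ?thesis using \<delta> by simp
    qed
    ultimately have "(\<lambda>N. C * (\<delta> - 3 * \<delta>\<^sup>2) / ((1 + \<delta>)\<^sup>2 - 1 + 1 / real N)) \<longlonglongrightarrow> C * ((1 - 3 * \<delta>) / (2 + \<delta>))" by simp
    from order_tendstoD(1)[OF this \<delta>(1)] ev show ?thesis
    proof eventually_elim
      case (elim N)
      have "(1 + \<delta>)\<^sup>2 - 1 = \<delta> * (2 + \<delta>)" by (simp add: power2_eq_square algebra_simps)
      then have "0 < (1 + \<delta>)\<^sup>2 - 1" using \<delta> by simp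
      then have "0 < (1 + \<delta>)\<^sup>2 - 1 + 1 / real N" by (intro add_pos_nonneg) auto
      then have "C * (\<delta> - 3 * \<delta>\<^sup>2) / ((1 + \<delta>)\<^sup>2 - 1 + 1 / real N) \<le> a N * sqrt (real N)"
        using elim(2) by (subst pos_divide_le_eq) auto
      then show ?case using elim(1) by linarith
    qed
  qed
  show "eventually (\<lambda>N. a N * sqrt (real N) < x) sequentially" if x: "c / sqrt pi < x" for x
  proof -
    have "((\<lambda>\<delta>. C * ((1 + 3 * \<delta>) / (2 - \<delta>))) \<longlongrightarrow> C * ((1 + 3 * 0) / (2 - 0))) (at_right 0)"
      by (intro tendsto_intros) auto
    then have "((\<lambda>\<delta>. C * ((1 + 3 * \<delta>) / (2 - \<delta>))) \<longlongrightarrow> c / sqrt pi) (at_right 0)" using Cc by simp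
    from eventually_conj[OF order_tendstoD(2)[OF this x] eventually_at_right_real[of 0 "1/3"]]
    have "eventually (\<lambda>\<delta>. C * ((1 + 3 * \<delta>) / (2 - \<delta>)) < x \<and> \<delta> \<in> {0<..<1/3}) (at_right 0)" by simp
    from eventually_happens'[OF trivial_limit_at_right_real this] obtain \<delta> where \<delta>: "C * ((1 + 3 * \<delta>) / (2 - \<delta>)) < x" "0 < \<delta>" "\<delta> < 1 / 3"
      by auto
    have "C * (\<delta> + 2 * \<delta>\<^sup>2) < C * (\<delta> + 3 * \<delta>\<^sup>2)" using C \<delta> by (intro mult_strict_left_mono) auto
    then have "eventually (\<lambda>N. a N * sqrt (real N) * (1 - (1 - \<delta>)\<^sup>2) \<le> C * (\<delta> + 3 * \<delta>\<^sup>2)) sequentially"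
      using \<delta> c unfolding C_def by (intro window_upper) auto
    then show ?thesis
    proof eventually_elim
      case (elim N)
      have eq: "1 - (1 - \<delta>)\<^sup>2 = \<delta> * (2 - \<delta>)" "\<delta> + 3 * \<delta>\<^sup>2 = \<delta> * (1 + 3 * \<delta>)" by (auto simp: power2_eq_square algebra_simps)
      have "a N * sqrt (real N) * (2 - \<delta>) * \<delta> \<le> C * (1 + 3 * \<delta>) * \<delta>" using elim unfolding eq by (simp add: ac_simps)
      then have "a N * sqrt (real N) * (2 - \<delta>) \<le> C * (1 + 3 * \<delta>)" using \<delta> by simp
      then have "a N * sqrt (real N) \<le> C * ((1 + 3 * \<delta>) / (2 - \<delta>))" using \<delta> by (simp add: pos_le_divide_eq)
      then show ?case using \<delta>(1) by linarith
    qed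
  qed
qed

end

section \<open>The avalanche as a branching process\<close>

text \<open>Two starts matter. For \<open>s = 1\<close> and \<open>v = 1\<close> the iterates are
  the probabilities, from root value \<theta>, of reaching layer \<open>n\<close>. For
  \<open>v = 1 - s\<close> they are one minus the generating function at \<open>s\<close> of the
  number of toppled sites up to layer \<open>n\<close>.\<close>

primrec branch_iter :: "nat \<Rightarrow> ((real \<Rightarrow> real) \<Rightarrow> real \<Rightarrow> real) \<Rightarrow> real \<Rightarrow> real \<Rightarrow> nat \<Rightarrow> real \<Rightarrow> real" where
  "branch_iter b K s v 0 = (\<lambda>_. v)"
| "branch_iter b K s v (Suc n) = (\<lambda>\<theta>. 1 - s * (1 - K (branch_iter b K s v n) \<theta>) ^ b)"

lemma (in doeblin_kernel) root_survival_tendsto: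
  assumes x: "x \<in> space M"
  shows "(\<lambda>n. root n (Z n x)) \<longlonglongrightarrow> \<Lambda>"
proof -
  have C: "0 < C" using C_ge_1 by simp
  have "(\<lambda>n. root n (Z n x / \<Lambda> ^ n)) \<longlonglongrightarrow> 1"
  proof (rule tendsto_sandwich)
    show "eventually (\<lambda>n. root n (1 / C) \<le> root n (Z n x / \<Lambda> ^ n)) sequentially"
      using eventually_gt_at_top[of 0] by eventually_elim (rule real_root_le_mono, use w_bounds[OF x] in auto)
    show "eventually (\<lambda>n. root n (Z n x / \<Lambda> ^ n) \<le> root n C) sequentially"
      using eventually_gt_at_top[of 0] by eventually_elim (rule real_root_le_mono, use w_bounds[OF x] in auto)
    show "(\<lambda>n. root n (1 / C)) \<longlonglongrightarrow> 1" "(\<lambda>n. root n C) \<longlonglongrightarrow> 1"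
      using C by (auto intro!: LIMSEQ_root_const)
  qed
  from tendsto_mult_left[OF this, of \<Lambda>] have "(\<lambda>n. \<Lambda> * root n (Z n x / \<Lambda> ^ n)) \<longlonglongrightarrow> \<Lambda>" by simp
  moreover have "eventually (\<lambda>n. \<Lambda> * root n (Z n x / \<Lambda> ^ n) = root n (Z n x)) sequentially"
    using eventually_gt_at_top[of 0] by eventually_elim (simp add: real_root_divide real_root_power_cancel)
  ultimately show ?thesis by (rule Lim_transform_eventually)
qed

context site_law
begin

sublocale label_law \<rho> b
  by unfold_locales (use b in auto)

lemma AE_less_1: "AE x in \<rho>. x < 1"
proof -
  have "measure \<rho> {1..1} \<le> 0" using lip[of 1 1] by simp
  then have "emeasure \<rho> {1} = 0" by (simp add: emeasure_eq_measure measure_le_0_iff)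
  then have "AE x in \<rho>. x \<notin> {1}" by (intro AE_not_in) (simp add: null_sets_def)
  with AE_unit show ?thesis by eventually_elim auto
qed

lemma K_tendsto:
  assumes f: "\<And>n. f n \<in> bfun (state B)" "g \<in> bfun (state B)" "\<And>n x. x \<in> {1..B} \<Longrightarrow> \<bar>f n x\<bar> \<le> c"
    and lim: "\<And>x. x \<in> {1..B} \<Longrightarrow> (\<lambda>n. f n x) \<longlonglongrightarrow> g x" and c: "0 \<le> c"
  shows "(\<lambda>n. K (f n) \<theta>) \<longlonglongrightarrow> K g \<theta>"
  unfolding akern_def
proof (rule integral_dominated_convergence[where w = "\<lambda>_. c"])
  show "(\<lambda>x. indicator {1..B} (x + \<theta> / real b) * g (x + \<theta> / real b)) \<in> borel_measurable \<rho>"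
    by (rule integrand_measurable[OF f(2)])
  show "(\<lambda>x. indicator {1..B} (x + \<theta> / real b) * f n (x + \<theta> / real b)) \<in> borel_measurable \<rho>" for n
    by (rule integrand_measurable[OF f(1)])
  show "AE x in \<rho>. (\<lambda>n. indicator {1..B} (x + \<theta> / real b) * f n (x + \<theta> / real b))
      \<longlonglongrightarrow> indicator {1..B} (x + \<theta> / real b) * g (x + \<theta> / real b)"
  proof (rule AE_I2)
    fix x
    show "(\<lambda>n. indicator {1..B} (x + \<theta> / real b) * f n (x + \<theta> / real b))
      \<longlonglongrightarrow> indicator {1..B} (x + \<theta> / real b) * g (x + \<theta> / real b)"
      using lim by (cases "x + \<theta> / real b \<in> {1..B}") auto
  qed
  show "AE x in \<rho>. norm (indicator {1..B} (x + \<theta> / real b) * f n (x + \<theta> / real b)) \<le> c" for n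
    using integrand_bound[OF f(3) c] by (intro AE_I2) auto
qed simp

lemma K_unit:
  assumes "f \<in> bfun (state B)" "\<And>x. x \<in> {1..B} \<Longrightarrow> 0 \<le> f x \<and> f x \<le> 1"
  shows "0 \<le> K f \<theta>" "K f \<theta> \<le> 1"
proof -
  show "0 \<le> K f \<theta>" using K_mono[of "\<lambda>_. 0" f \<theta>] assms by (auto simp: akern_def)
  show "K f \<theta> \<le> 1" using K_mono[of f "\<lambda>_. 1" \<theta>] K_one_le[of \<theta>] assms by auto
qed

section \<open>The iterated branching equation\<close>

lemma iter_bfun:
  assumes "0 \<le> s" "s \<le> 1" "0 \<le> v" "v \<le> 1"
  shows "branch_iter b K s v n \<in> bfun (state B) \<and> (\<forall>\<theta>. 0 \<le> branch_iter b K s v n \<theta> \<and> branch_iter b K s v n \<theta> \<le> 1)"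
proof (induction n)
  case (Suc n)
  note k = K_unit[of "branch_iter b K s v n"]
  have "0 \<le> (1 - K (branch_iter b K s v n) \<theta>) ^ b" "(1 - K (branch_iter b K s v n) \<theta>) ^ b \<le> 1" for \<theta>
    using k[of \<theta>] Suc by (auto intro: power_le_one)
  then have "0 \<le> s * (1 - K (branch_iter b K s v n) \<theta>) ^ b" "s * (1 - K (branch_iter b K s v n) \<theta>) ^ b \<le> 1" for \<theta>
    using assms by (auto intro: mult_le_one)
  moreover have "(\<lambda>\<theta>. 1 - s * (1 - K (branch_iter b K s v n) \<theta>) ^ b) \<in> bfun (state B)"
    using Suc by (intro bfun_diff bfun_scale bfun_power K_bfun) auto
  ultimately show ?case by simp
qed (use assms in auto)

lemma iter_nondecreasing:
  assumes "0 \<le> s" "s \<le> 1" "0 \<le> v" "v \<le> 1" "1 \<le> \<theta>" "\<theta> \<le> \<theta>'" "\<theta>' \<le> B"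
  shows "branch_iter b K s v n \<theta> \<le> branch_iter b K s v n \<theta>'"
  using assms(5-7)
proof (induction n arbitrary: \<theta> \<theta>')
  case (Suc n)
  have i: "branch_iter b K s v n \<in> bfun (state B)" "\<And>\<theta>. 0 \<le> branch_iter b K s v n \<theta> \<and> branch_iter b K s v n \<theta> \<le> 1"
    using iter_bfun[OF assms(1-4)] by auto
  have "K (branch_iter b K s v n) \<theta> \<le> K (branch_iter b K s v n) \<theta>'"
    using Suc by (intro K_nondecreasing i) (use i in auto)
  moreover have "K (branch_iter b K s v n) \<theta>' \<le> 1" using i by (intro K_unit) auto
  ultimately have "(1 - K (branch_iter b K s v n) \<theta>') ^ b \<le> (1 - K (branch_iter b K s v n) \<theta>) ^ b"
    by (intro power_mono) auto
  then show ?case using assms(1) by (simp add: mult_left_mono)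
qed simp

lemma branch_step_mono:
  assumes "f \<in> bfun (state B)" "g \<in> bfun (state B)" "\<And>x. x \<in> {1..B} \<Longrightarrow> f x \<le> g x"
    and "\<And>x. x \<in> {1..B} \<Longrightarrow> 0 \<le> g x \<and> g x \<le> 1" "0 \<le> s"
  shows "1 - s * (1 - K f \<theta>) ^ b \<le> 1 - s * (1 - K g \<theta>) ^ b"
proof -
  have "K f \<theta> \<le> K g \<theta>" using assms by (intro K_mono) auto
  moreover have "K g \<theta> \<le> 1" using assms by (intro K_unit) auto
  ultimately have "(1 - K g \<theta>) ^ b \<le> (1 - K f \<theta>) ^ b" by (intro power_mono) auto
  then show ?thesis using assms(5) by (simp add: mult_left_mono)
qed

text \<open>The constant \<open>1 - s\<close> lies below its image because
  \<open>(1 - K u) ^ b \<le> 1\<close>, and monotonicity of the step propagates this.\<close>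

lemma iter_increasing:
  assumes s: "0 \<le> s" "s \<le> 1"
  shows "branch_iter b K s (1 - s) n \<theta> \<le> branch_iter b K s (1 - s) (Suc n) \<theta>"
proof (induction n arbitrary: \<theta>)
  let ?V = "branch_iter b K s (1 - s)"
  have V: "?V n \<in> bfun (state B)" "0 \<le> ?V n \<theta>" "?V n \<theta> \<le> 1" for n \<theta>
    using iter_bfun[of s "1 - s" n] s by auto
  {
    case 0
    have "0 \<le> K (?V 0) \<theta> \<and> K (?V 0) \<theta> \<le> 1" by (intro conjI K_unit V)
    then have "(1 - K (?V 0) \<theta>) ^ b \<le> 1" by (intro power_le_one) auto
    then have "s * (1 - K (?V 0) \<theta>) ^ b \<le> s" using s by (simp add: mult_left_le)
    then show ?case by simp
  next
    case (Suc n)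
    have "1 - s * (1 - K (?V n) \<theta>) ^ b \<le> 1 - s * (1 - K (?V (Suc n)) \<theta>) ^ b"
      by (rule branch_step_mono) (use Suc V s in \<open>auto simp del: branch_iter.simps\<close>)
    then show ?case by (simp only: branch_iter.simps)
  }
qed

lemma iter_decreasing: "branch_iter b K 1 1 (Suc n) \<theta> \<le> branch_iter b K 1 1 n \<theta>"
proof (induction n arbitrary: \<theta>)
  let ?V = "branch_iter b K 1 1"
  have V: "?V n \<in> bfun (state B)" "0 \<le> ?V n \<theta>" "?V n \<theta> \<le> 1" for n \<theta>
    using iter_bfun[of 1 1 n] by auto
  {
    case 0
    show ?case using V(3)[of "Suc 0" \<theta>] by simp
  next
    case (Suc n)
    have "1 - 1 * (1 - K (?V (Suc n)) \<theta>) ^ b \<le> 1 - 1 * (1 - K (?V n) \<theta>) ^ b"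
      by (rule branch_step_mono) (use Suc V in \<open>auto simp del: branch_iter.simps\<close>)
    then show ?case by (simp only: branch_iter.simps)
  }
qed

text \<open>The children of a toppled root receive the same amount \<open>\<theta> / b\<close>, so their subtrees run independent copies of the process.\<close>

lemma branching:
  assumes H: "\<And>n. (\<lambda>(\<theta>, x). H n \<theta> x :: ennreal) \<in> borel_measurable (borel \<Otimes>\<^sub>M T)"
    and upd: "\<And>n \<theta> x y. H n \<theta> (x([] := y)) = H n \<theta> x"
    and dead: "\<And>n \<theta> x. \<theta> < 1 \<Longrightarrow> H n \<theta> x = 1"
    and H0: "\<And>\<theta> x. 1 \<le> \<theta> \<Longrightarrow> H 0 \<theta> x = ennreal (1 - v)"
    and HS: "\<And>n \<theta> x. 1 \<le> \<theta> \<Longrightarrow> H (Suc n) \<theta> x = ennreal s * (\<Prod>i\<in>{1..b}. H n (x [i] + \<theta> / real b) (subtree b i x))"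
    and s: "0 \<le> s" "s \<le> 1" and v: "0 \<le> v" "v \<le> 1" and t: "t \<le> B - 1"
  shows "(\<integral>\<^sup>+x. H n (x [] + t) x \<partial>T) = ennreal (1 - K (branch_iter b K s v n) (real b * t))"
proof -
  let ?V = "branch_iter b K s v"
  have V: "?V n \<in> bfun (state B)" "0 \<le> ?V n \<theta>" "?V n \<theta> \<le> 1" for n \<theta>
    using iter_bfun[OF s v, of n] by auto
  have KV: "0 \<le> K (?V n) \<theta>" "K (?V n) \<theta> \<le> 1" for n \<theta>
    using V by (auto intro!: K_unit)
  \<comment> \<open>Averages over the label of a site that receives the amount \<open>t\<close>. A
    value below 1 contributes 1, by \<open>dead\<close>; this is why the kernel acts on the deficit
    \<open>?V n\<close> and not on the integral itself.\<close>
  have root: "(\<integral>\<^sup>+y. (\<integral>\<^sup>+x. H n (y + t) x \<partial>T) \<partial>\<rho>) = ennreal (1 - K (?V n) (real b * t))"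
    if site: "\<And>\<theta>. \<theta> \<in> {1..B} \<Longrightarrow> (\<integral>\<^sup>+x. H n \<theta> x \<partial>T) = ennreal (1 - ?V n \<theta>)" and t: "t \<le> B - 1" for n t
  proof -
    have bt: "real b * t / real b = t" using b_real by simp
    have "(\<integral>\<^sup>+y. (\<integral>\<^sup>+x. H n (y + t) x \<partial>T) \<partial>\<rho>) = (\<integral>\<^sup>+y. ennreal (1 - indicator {1..B} (y + t) * ?V n (y + t)) \<partial>\<rho>)"
    proof (rule nn_integral_cong_AE)
      show "AE y in \<rho>. (\<integral>\<^sup>+x. H n (y + t) x \<partial>T) = ennreal (1 - indicator {1..B} (y + t) * ?V n (y + t))"
        using AE_unit
      proof eventually_elim
        case (elim y)
        then have "y + t \<le> B" using t by simp
        then show ?case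
          using site[of "y + t"] dead[of "y + t" n] T.emeasure_space_1
          by (cases "1 \<le> y + t") auto
      qed
    qed
    also have "\<dots> = ennreal (\<integral>y. 1 - indicator {1..B} (y + t) * ?V n (y + t) \<partial>\<rho>)"
      by (intro nn_integral_eq_integral Bochner_Integration.integrable_diff integrand_integrable V AE_I2)
         (auto simp: indicator_def V)
    also have "(\<integral>y. 1 - indicator {1..B} (y + t) * ?V n (y + t) \<partial>\<rho>) = 1 - K (?V n) (real b * t)"
    proof -
      have "K (?V n) (real b * t) = (\<integral>y. indicator {1..B} (y + t) * ?V n (y + t) \<partial>\<rho>)"
        by (simp only: akern_def bt)
      then show ?thesis
        by (subst Bochner_Integration.integral_diff) (auto intro!: integrand_integrable V)
    qed
    finally show ?thesis .
  qed
  have site: "(\<integral>\<^sup>+x. H n \<theta> x \<partial>T) = ennreal (1 - ?V n \<theta>)" if "\<theta> \<in> {1..B}" for n \<theta>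
    using that
  proof (induction n arbitrary: \<theta>)
    case 0
    then show ?case using H0 T.emeasure_space_1 by simp
  next
    case (Suc n)
    have \<theta>: "1 \<le> \<theta>" "\<theta> / real b \<le> B - 1" using Suc.prems upper[of 1 \<theta>] by auto
    have Hm: "(\<lambda>x. \<Prod>i\<in>{1..b}. H n (x [i] + \<theta> / real b) (subtree b i x)) \<in> borel_measurable T"
    proof (rule borel_measurable_prod_ennreal)
      fix i assume "i \<in> {1..b}"
      from measurable_compose[OF child_measurable[OF this] H[of n]] have
        "(\<lambda>p. H n (snd p [i] + fst p / real b) (subtree b i (snd p))) \<in> borel_measurable (borel \<Otimes>\<^sub>M T)"
        by (simp add: case_prod_beta)
      from measurable_compose[OF _ this, of "\<lambda>x. (\<theta>, x)" T]
      show "(\<lambda>x. H n (x [i] + \<theta> / real b) (subtree b i x)) \<in> borel_measurable T" by simp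
    qed
    have "(\<integral>\<^sup>+x. H (Suc n) \<theta> x \<partial>T) = ennreal s * (\<integral>\<^sup>+x. (\<Prod>i\<in>{1..b}. H n (x [i] + \<theta> / real b) (subtree b i x)) \<partial>T)"
      using HS[OF \<theta>(1)] Hm by (simp add: nn_integral_cmult)
    also have "\<dots> = ennreal s * (\<integral>\<^sup>+y. (\<integral>\<^sup>+x. H n (y + \<theta> / real b) x \<partial>T) \<partial>\<rho>) ^ b"
      by (subst children_integral[OF H upd]) simp
    also have "\<dots> = ennreal s * ennreal (1 - K (?V n) (real b * (\<theta> / real b))) ^ b"
      by (subst root[OF Suc.IH \<theta>(2)]) auto
    also have "\<dots> = ennreal (s * (1 - K (?V n) \<theta>) ^ b)"
      using KV[of n \<theta>] s b_real by (simp add: ennreal_mult ennreal_power)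
    finally show ?case by simp
  qed
  have "(\<integral>\<^sup>+x. H n (x [] + t) x \<partial>T) = (\<integral>\<^sup>+y. (\<integral>\<^sup>+x. H n (y + t) x \<partial>T) \<partial>\<rho>)"
    by (rule root_integral[where H = "H n", OF H upd])
  also have "\<dots> = ennreal (1 - K (?V n) (real b * t))" by (rule root[OF site t])
  finally show ?thesis .
qed

section \<open>Generating function, survival and mean of the size\<close>

lemma pgf_toppled:
  assumes s: "0 \<le> s" "s \<le> 1" and t: "t \<le> B - 1"
  shows "(\<integral>\<^sup>+x. ennreal (s ^ toppled b n (x [] + t) x) \<partial>T) = ennreal (1 - K (branch_iter b K s (1 - s) n) (real b * t))"
proof (rule branching[where H = "\<lambda>n \<theta> x. ennreal (s ^ toppled b n \<theta> x)"])
  show "(\<lambda>(\<theta>, x). ennreal (s ^ toppled b n \<theta> x)) \<in> borel_measurable (borel \<Otimes>\<^sub>M T)" for n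
    using measurable_compose[OF toppled_measurable[of n], of "\<lambda>k. ennreal (s ^ k)"] by (simp add: case_prod_beta)
  show "ennreal (s ^ toppled b n \<theta> x) = 1" if "\<theta> < 1" for n \<theta> x
    using that by (cases n) auto
  show "ennreal (s ^ toppled b (Suc n) \<theta> x) = ennreal s * (\<Prod>i\<in>{1..b}. ennreal (s ^ toppled b n (x [i] + \<theta> / real b) (subtree b i x)))"
    if "1 \<le> \<theta>" for n \<theta> x
    using that s by (simp add: power_add power_sum prod_ennreal ennreal_mult[symmetric] prod_nonneg)
qed (use s t in auto)

lemma prob_not_reaches:
  assumes t: "t \<le> B - 1"
  shows "(\<integral>\<^sup>+x. of_bool (\<not> reaches b n (x [] + t) x) \<partial>T) = ennreal (1 - K (branch_iter b K 1 1 n) (real b * t))"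
proof (rule branching[where H = "\<lambda>n \<theta> x. of_bool (\<not> reaches b n \<theta> x)"])
  show "(\<lambda>(\<theta>, x). of_bool (\<not> reaches b n \<theta> x) :: ennreal) \<in> borel_measurable (borel \<Otimes>\<^sub>M T)" for n
    using measurable_compose[OF reaches_measurable[of n], of "\<lambda>k. of_bool (\<not> k) :: ennreal"] by (simp add: case_prod_beta)
  show "of_bool (\<not> reaches b n \<theta> x) = (1 :: ennreal)" if "\<theta> < 1" for n \<theta> x
    using that by (cases n) auto
  show "of_bool (\<not> reaches b (Suc n) \<theta> x) = ennreal 1 * (\<Prod>i\<in>{1..b}. of_bool (\<not> reaches b n (x [i] + \<theta> / real b) (subtree b i x)))"
    if "1 \<le> \<theta>" for n \<theta> x
    using that by (auto simp: prod_zero_iff intro!: prod.neutral[symmetric])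
qed (use t in auto)

text \<open>Many-to-one: layer \<open>j\<close> has \<open>b ^ j\<close> sites, and each topples
  when the walk along its path survives, so from root value \<theta> the mean number in layer
  \<open>j\<close> is \<open>b ^ j * survival K j \<theta>\<close>. The additional \<open>K\<close>
  averages over the root label.\<close>

lemma mean_toppled:
  assumes t: "t \<le> B - 1"
  shows "(\<integral>\<^sup>+x. of_nat (toppled b n (x [] + t) x) \<partial>T) = ennreal (\<Sum>j\<le>n. real b ^ j * K (survival K j) (real b * t))"
proof -
  let ?Z = "survival K"
  let ?H = "\<lambda>n \<theta> x. of_nat (toppled b n \<theta> x) :: ennreal"
  have H: "(\<lambda>(\<theta>, x). ?H n \<theta> x) \<in> borel_measurable (borel \<Otimes>\<^sub>M T)" for n
    using measurable_compose[OF toppled_measurable[of n], of "\<lambda>k. of_nat k :: ennreal"] by (simp add: case_prod_beta)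
  define S where "S = (\<lambda>n \<theta>. \<Sum>j\<le>n. real b ^ j * ?Z j \<theta>)"
  have Z0: "0 \<le> ?Z j \<theta>" if "\<theta> \<in> {1..B}" for j \<theta> using that by (rule Z_nonneg)
  have Sb: "S n \<in> bfun (state B)" for n
    unfolding S_def by (induction n) (auto intro!: bfun_add bfun_scale Z_bfun)
  have S0: "0 \<le> S n \<theta>" if "\<theta> \<in> {1..B}" for n \<theta> unfolding S_def using Z0[OF that] by (intro sum_nonneg) auto
  have KS: "K (S n) \<theta> = (\<Sum>j\<le>n. real b ^ j * K (?Z j) \<theta>)" for n \<theta>
  proof (induction n)
    case (Suc n)
    have "S (Suc n) = (\<lambda>\<theta>. S n \<theta> + real b ^ Suc n * ?Z (Suc n) \<theta>)" by (auto simp: S_def)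
    then have "K (S (Suc n)) \<theta> = K (S n) \<theta> + real b ^ Suc n * K (?Z (Suc n)) \<theta>"
      using K_add[OF Sb bfun_scale[OF Z_bfun], of n "real b ^ Suc n" "Suc n"] K_scale[of "real b ^ Suc n" "?Z (Suc n)"] by simp
    then show ?case using Suc by simp
  qed (simp add: S_def)
  have root: "(\<integral>\<^sup>+y. (\<integral>\<^sup>+x. ?H n (y + t) x \<partial>T) \<partial>\<rho>) = ennreal (K (S n) (real b * t))"
    if site: "\<And>\<theta>. \<theta> \<in> {1..B} \<Longrightarrow> (\<integral>\<^sup>+x. ?H n \<theta> x \<partial>T) = ennreal (S n \<theta>)" and t: "t \<le> B - 1" for n t
  proof -
    have bt: "real b * t / real b = t" using b_real by simp
    have "(\<integral>\<^sup>+y. (\<integral>\<^sup>+x. ?H n (y + t) x \<partial>T) \<partial>\<rho>) = (\<integral>\<^sup>+y. ennreal (indicator {1..B} (y + t) * S n (y + t)) \<partial>\<rho>)"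
    proof (rule nn_integral_cong_AE)
      show "AE y in \<rho>. (\<integral>\<^sup>+x. ?H n (y + t) x \<partial>T) = ennreal (indicator {1..B} (y + t) * S n (y + t))"
        using AE_unit
      proof eventually_elim
        case (elim y)
        then have "y + t \<le> B" using t by simp
        moreover have "toppled b n (y + t) x = 0" if "\<not> 1 \<le> y + t" for x using that by (cases n) auto
        ultimately show ?case using site[of "y + t"] by (cases "1 \<le> y + t") auto
      qed
    qed
    also have "\<dots> = ennreal (K (S n) (real b * t))"
      using K_nn_integral[of "S n" "real b * t", OF Sb S0] by (simp add: bt)
    finally show ?thesis .
  qed
  have site: "(\<integral>\<^sup>+x. ?H n \<theta> x \<partial>T) = ennreal (S n \<theta>)" if "\<theta> \<in> {1..B}" for n \<theta>
    using that
  proof (induction n arbitrary: \<theta>)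
    case 0
    then show ?case using T.emeasure_space_1 by (simp add: S_def survival_def)
  next
    case (Suc n)
    have \<theta>: "1 \<le> \<theta>" "\<theta> / real b \<le> B - 1" using Suc.prems upper[of 1 \<theta>] by auto
    have m: "(\<lambda>x. ?H n (x [i] + \<theta> / real b) (subtree b i x)) \<in> borel_measurable T" if "i \<in> {1..b}" for i
    proof -
      from measurable_compose[OF child_measurable[OF that] H[of n]] have
        "(\<lambda>p. ?H n (snd p [i] + fst p / real b) (subtree b i (snd p))) \<in> borel_measurable (borel \<Otimes>\<^sub>M T)"
        by (simp add: case_prod_beta)
      from measurable_compose[OF _ this, of "\<lambda>x. (\<theta>, x)" T] show ?thesis by simp
    qed
    have "(\<integral>\<^sup>+x. ?H (Suc n) \<theta> x \<partial>T) = (\<integral>\<^sup>+x. 1 + (\<Sum>i\<in>{1..b}. ?H n (x [i] + \<theta> / real b) (subtree b i x)) \<partial>T)"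
      using \<theta>(1) by simp
    also have "\<dots> = 1 + (\<Sum>i\<in>{1..b}. \<integral>\<^sup>+x. ?H n (x [i] + \<theta> / real b) (subtree b i x) \<partial>T)"
    proof -
      have "(\<integral>\<^sup>+x. (\<Sum>i\<in>{1..b}. ?H n (x [i] + \<theta> / real b) (subtree b i x)) \<partial>T)
          = (\<Sum>i\<in>{1..b}. \<integral>\<^sup>+x. ?H n (x [i] + \<theta> / real b) (subtree b i x) \<partial>T)"
        by (rule nn_integral_sum) (rule m)
      moreover have "(\<lambda>x. \<Sum>i\<in>{1..b}. ?H n (x [i] + \<theta> / real b) (subtree b i x)) \<in> borel_measurable T"
        by (rule borel_measurable_sum) (rule m)
      ultimately show ?thesis
        using T.emeasure_space_1 by (subst nn_integral_add) simp_all
    qed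
    also have "\<dots> = 1 + (\<Sum>i\<in>{1..b}. ennreal (K (S n) (real b * (\<theta> / real b))))"
    proof (intro arg_cong2[where f = "(+)"] sum.cong refl)
      fix i assume i: "i \<in> {1..b}"
      have "(\<integral>\<^sup>+x. ?H n (x [i] + \<theta> / real b) (subtree b i x) \<partial>T) = (\<integral>\<^sup>+y. (\<integral>\<^sup>+x. ?H n (y + \<theta> / real b) x \<partial>T) \<partial>\<rho>)"
        by (rule child_integral[OF H _ i]) simp
      also have "\<dots> = ennreal (K (S n) (real b * (\<theta> / real b)))" by (rule root[OF Suc.IH \<theta>(2)])
      finally show "(\<integral>\<^sup>+x. ?H n (x [i] + \<theta> / real b) (subtree b i x) \<partial>T) = ennreal (K (S n) (real b * (\<theta> / real b)))" .
    qed
    also have "\<dots> = ennreal (1 + real b * K (S n) \<theta>)"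
    proof -
      have "K (\<lambda>_. 0) \<theta> \<le> K (S n) \<theta>" using S0 by (intro K_mono Sb) auto
      then have "0 \<le> K (S n) \<theta>" by (simp add: akern_def)
      then show ?thesis using b_real by (simp add: ennreal_mult ennreal_of_nat_eq_real_of_nat)
    qed
    also have "1 + real b * K (S n) \<theta> = S (Suc n) \<theta>"
    proof -
      have "S (Suc n) \<theta> = ?Z 0 \<theta> + (\<Sum>j\<le>n. real b ^ Suc j * ?Z (Suc j) \<theta>)"
        unfolding S_def by (subst sum.atMost_Suc_shift) simp
      then show ?thesis by (simp add: KS Z_Suc sum_distrib_left mult.assoc) (simp add: survival_def)
    qed
    finally show ?case .
  qed
  have "(\<integral>\<^sup>+x. ?H n (x [] + t) x \<partial>T) = (\<integral>\<^sup>+y. (\<integral>\<^sup>+x. ?H n (y + t) x \<partial>T) \<partial>\<rho>)"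
    by (rule root_integral[OF H]) simp
  also have "\<dots> = ennreal (K (S n) (real b * t))" by (rule root[OF site t])
  finally show ?thesis by (simp add: KS)
qed

lemma AE_labels: "AE x in T. \<forall>\<sigma>\<in>tree b. 0 \<le> x \<sigma> \<and> x \<sigma> < 1"
proof -
  have "AE x in T. \<forall>\<sigma>\<in>UNIV. \<sigma> \<in> tree b \<longrightarrow> 0 \<le> x \<sigma> \<and> x \<sigma> < 1"
  proof (subst AE_ball_countable, simp, intro ballI)
    fix \<sigma> :: "nat list"
    have "AE y in \<rho>. 0 \<le> y \<and> y < 1" using AE_unit AE_less_1 by eventually_elim auto
    then have "AE x in T. 0 \<le> x \<sigma> \<and> x \<sigma> < 1" if "\<sigma> \<in> tree b"
      unfolding tree_law_def using that prob_space_axioms by (intro AE_PiM_component) auto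
    then show "AE x in T. \<sigma> \<in> tree b \<longrightarrow> 0 \<le> x \<sigma> \<and> x \<sigma> < 1" by (cases "\<sigma> \<in> tree b") auto
  qed
  then show ?thesis by eventually_elim blast
qed

lemma AE_avalanche_size:
  assumes "0 \<le> v"
  shows "AE x in T. avalanche_size b v x = (SUP n. of_nat (toppled b n (x [] + v) x))"
  using AE_labels by eventually_elim (rule avalanche_size_eq, use assms in auto)

lemma mean_avalanche_size:
  assumes v: "0 \<le> v" "v \<le> B - 1"
  shows "(\<integral>\<^sup>+x. avalanche_size b v x \<partial>T) = (SUP n. ennreal (\<Sum>j\<le>n. real b ^ j * K (survival K j) (real b * v)))"
proof -
  have m: "(\<lambda>x. of_nat (toppled b n (x [] + v) x) :: ennreal) \<in> borel_measurable T" for n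
    using measurable_compose[OF measurable_compose[OF _ toppled_measurable[of n]], of "\<lambda>x. (x [] + v, x)" T "\<lambda>k. of_nat k :: ennreal" borel]
    by (simp add: component_measurable)
  have "(\<integral>\<^sup>+x. avalanche_size b v x \<partial>T) = (\<integral>\<^sup>+x. (SUP n. of_nat (toppled b n (x [] + v) x)) \<partial>T)"
    by (rule nn_integral_cong_AE[OF AE_avalanche_size[OF v(1)]])
  also have "\<dots> = (SUP n. \<integral>\<^sup>+x. of_nat (toppled b n (x [] + v) x) \<partial>T)"
    by (intro nn_integral_monotone_convergence_SUP m incseq_SucI le_funI of_nat_mono toppled_mono)
  finally show ?thesis by (simp add: mean_toppled[OF v(2)])
qed

text \<open>The avalanche is almost surely infinite iff it reaches every layer: reached layers
  contribute at least one site each, and an unreached layer leaves only the finitely many sites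
  before it.\<close>

lemma prob_avalanche_infinite:
  assumes v: "0 \<le> v" "v \<le> B - 1"
  shows "(\<lambda>n. K (branch_iter b K 1 1 n) (real b * v)) \<longlonglongrightarrow> \<P>(x in T. avalanche_size b v x = \<infinity>)"
proof -
  define A where "A = (\<lambda>n. {x \<in> space T. reaches b n (x [] + v) x})"
  have pr: "Measurable.pred T (\<lambda>x. reaches b n (x [] + v) x)" for n
    using measurable_compose[OF _ reaches_measurable[of n], of "\<lambda>x. (x [] + v, x)" T]
    by (simp add: component_measurable)
  then have [measurable]: "A n \<in> sets T" for n unfolding A_def by simp
  have "measure T (A n) = K (branch_iter b K 1 1 n) (real b * v)" for n
  proof -
    have "ennreal (1 - measure T (A n)) = emeasure T (space T - A n)"
      by (simp add: T.emeasure_eq_measure T.prob_compl)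
    also have "\<dots> = (\<integral>\<^sup>+x. indicator (space T - A n) x \<partial>T)" by simp
    also have "\<dots> = (\<integral>\<^sup>+x. of_bool (\<not> reaches b n (x [] + v) x) \<partial>T)"
      by (intro nn_integral_cong) (auto simp: A_def indicator_def)
    also have "\<dots> = ennreal (1 - K (branch_iter b K 1 1 n) (real b * v))" by (rule prob_not_reaches[OF v(2)])
    finally show ?thesis
      using T.prob_le_1 K_unit(2)[of "branch_iter b K 1 1 n" "real b * v"] iter_bfun[of 1 1 n] by (simp add: ennreal_inj)
  qed
  moreover have "(\<lambda>n. measure T (A n)) \<longlonglongrightarrow> measure T (\<Inter>n. A n)"
    by (rule T.finite_Lim_measure_decseq) (auto simp: A_def intro!: decseq_SucI dest: reaches_Suc simp del: reaches.simps)
  moreover have "measure T (\<Inter>n. A n) = \<P>(x in T. avalanche_size b v x = \<infinity>)"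
  proof (rule measure_eq_AE)
    show "AE x in T. x \<in> (\<Inter>n. A n) \<longleftrightarrow> x \<in> {x \<in> space T. avalanche_size b v x = \<infinity>}"
      using AE_avalanche_size[OF v(1)] AE_space
    proof eventually_elim
      case (elim x)
      have "(\<forall>n. reaches b n (x [] + v) x) \<longleftrightarrow> (SUP n. of_nat (toppled b n (x [] + v) x)) = (\<infinity> :: ennreal)"
      proof
        assume r: "\<forall>n. reaches b n (x [] + v) x"
        have "of_nat n \<le> (SUP n. of_nat (toppled b n (x [] + v) x) :: ennreal)" for n
        proof -
          have "n \<le> toppled b n (x [] + v) x" using reaches_toppled[of b n "x [] + v" x] r by simp
          then have "(of_nat n :: ennreal) \<le> of_nat (toppled b n (x [] + v) x)" by (rule of_nat_mono)
          also have "\<dots> \<le> (SUP n. of_nat (toppled b n (x [] + v) x))" by (rule SUP_upper) simp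
          finally show ?thesis .
        qed
        then have "(SUP n. of_nat n) \<le> (SUP n. of_nat (toppled b n (x [] + v) x) :: ennreal)" by (intro SUP_least) auto
        then show "(SUP n. of_nat (toppled b n (x [] + v) x)) = (\<infinity> :: ennreal)"
          by (simp add: ennreal_SUP_of_nat_eq_top top_unique)
      next
        assume inf: "(SUP n. of_nat (toppled b n (x [] + v) x)) = (\<infinity> :: ennreal)"
        show "\<forall>n. reaches b n (x [] + v) x"
        proof (rule ccontr)
          assume "\<not> ?thesis"
          then obtain n where "\<not> reaches b n (x [] + v) x" by blast
          then have "toppled b k (x [] + v) x \<le> layer_bound b n" for k by (rule not_reaches_toppled)
          then have "(SUP k. of_nat (toppled b k (x [] + v) x)) \<le> (of_nat (layer_bound b n) :: ennreal)"
            by (intro SUP_least of_nat_mono)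
          then show False using inf by (simp add: top_unique)
        qed
      qed
      then show ?case using elim by (auto simp: A_def)
    qed
  qed measurable
  ultimately show ?thesis by simp
qed

text \<open>Both sides are \<open>1 - E (s ^ N)\<close> for the size \<open>N\<close>, with
  \<open>s ^ \<infinity> = 0\<close>: the left because
  \<open>(1 - s) * (\<Sum>k<N. s ^ k) = 1 - s ^ N\<close>, the right as a limit of truncated
  generating functions. Working in \<open>ennreal\<close> with suprema over the truncations treats
  infinite sizes along with the finite ones.\<close>

lemma tail_series:
  assumes v: "0 \<le> v" "v \<le> B - 1" and s: "0 < s" "s < 1"
    and u: "\<And>\<theta>. \<theta> \<in> {1..B} \<Longrightarrow> (\<lambda>n. branch_iter b K s (1 - s) n \<theta>) \<longlonglongrightarrow> u \<theta>" "u \<in> bfun (state B)"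
  shows "(1 - s) * (\<Sum>k. \<P>(x in T. of_nat (Suc k) \<le> avalanche_size b v x) * s ^ k) = K u (real b * v)"
proof -
  let ?N = "avalanche_size b v"
  let ?V = "branch_iter b K s (1 - s)"
  have V: "?V n \<in> bfun (state B)" "0 \<le> ?V n \<theta>" "?V n \<theta> \<le> 1" for n \<theta>
    using iter_bfun[of s "1 - s" n] s by auto
  define P where "P = (\<lambda>k. \<P>(x in T. of_nat (Suc k) \<le> ?N x))"
  have P: "0 \<le> P k" "P k \<le> 1" for k by (auto simp: P_def)
  have Pe: "ennreal (P k) = (\<integral>\<^sup>+x. of_bool (of_nat (Suc k) \<le> ?N x) \<partial>T)" for k
  proof -
    have "ennreal (P k) = emeasure T {x \<in> space T. of_nat (Suc k) \<le> ?N x}" by (simp add: P_def T.emeasure_eq_measure)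
    also have "\<dots> = (\<integral>\<^sup>+x. indicator {x \<in> space T. of_nat (Suc k) \<le> ?N x} x \<partial>T)" by simp
    also have "\<dots> = (\<integral>\<^sup>+x. of_bool (of_nat (Suc k) \<le> ?N x) \<partial>T)"
      by (intro nn_integral_cong) (auto simp: indicator_def)
    finally show ?thesis .
  qed
  have summ: "summable (\<lambda>k. (1 - s) * (P k * s ^ k))"
  proof (rule summable_mult, rule summable_comparison_test'[of "\<lambda>k. s ^ k" 0])
    show "summable (\<lambda>k. s ^ k)" using s by (intro summable_geometric) simp
    fix k
    have "P k * s ^ k \<le> 1 * s ^ k" using P[of k] s by (intro mult_right_mono) auto
    then show "norm (P k * s ^ k) \<le> s ^ k" using P[of k] s by (simp add: abs_mult)
  qed
  have tel: "(\<Sum>k<N. (1 - s) * s ^ k) = 1 - s ^ N" for N :: nat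
    using one_diff_power_eq[of s N] by (simp add: sum_distrib_left)
  have AE: "AE x in T. (\<Sum>k. ennreal ((1 - s) * s ^ k) * of_bool (of_nat (Suc k) \<le> ?N x)) = (SUP n. ennreal (1 - s ^ toppled b n (x [] + v) x))"
    using AE_avalanche_size[OF v(1)]
  proof eventually_elim
    case (elim x)
    define N where "N = (\<lambda>n. toppled b n (x [] + v) x)"
    have Nmono: "incseq N" unfolding N_def by (intro incseq_SucI toppled_mono)
    have ge: "of_nat (Suc k) \<le> ?N x \<longleftrightarrow> (\<exists>n. Suc k \<le> N n)" for k
    proof
      assume *: "of_nat (Suc k) \<le> ?N x"
      show "\<exists>n. Suc k \<le> N n"
      proof (rule ccontr)
        assume "\<not> ?thesis"
        then have "(SUP n. of_nat (N n)) \<le> (of_nat k :: ennreal)" by (intro SUP_least of_nat_mono) (auto simp: not_le less_Suc_eq_le)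
        moreover have "of_nat (Suc k) \<le> (SUP n. of_nat (N n) :: ennreal)" using * by (simp only: elim N_def)
        ultimately have "of_nat (Suc k) \<le> (of_nat k :: ennreal)" by (rule order_trans[rotated])
        then show False by (simp only: of_nat_le_iff)
      qed
    next
      assume "\<exists>n. Suc k \<le> N n"
      then obtain n where "Suc k \<le> N n" ..
      then have "(of_nat (Suc k) :: ennreal) \<le> of_nat (N n)" by (rule of_nat_mono)
      also have "\<dots> \<le> ?N x" unfolding elim N_def by (rule SUP_upper) simp
      finally show "of_nat (Suc k) \<le> ?N x" .
    qed
    have ind: "of_bool (of_nat (Suc k) \<le> ?N x) = (SUP n. of_bool (k < N n) :: ennreal)" for k
    proof (cases "\<exists>n. k < N n")
      case True
      then obtain n where n: "k < N n" ..
      have "(SUP n. of_bool (k < N n) :: ennreal) = 1"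
      proof (rule antisym)
        show "(SUP n. of_bool (k < N n) :: ennreal) \<le> 1" by (intro SUP_least) auto
        show "1 \<le> (SUP n. of_bool (k < N n) :: ennreal)" using n by (intro SUP_upper2[of n]) auto
      qed
      then show ?thesis using ge[of k] n by (auto simp: Suc_le_eq)
    next
      case False
      then show ?thesis using ge[of k] by (auto simp: Suc_le_eq)
    qed
    have "(\<Sum>k. ennreal ((1 - s) * s ^ k) * of_bool (of_nat (Suc k) \<le> ?N x)) = (\<Sum>k. SUP n. ennreal ((1 - s) * s ^ k) * of_bool (k < N n))"
      unfolding ind by (simp add: SUP_mult_left_ennreal)
    also have "\<dots> = (SUP n. \<Sum>k. ennreal ((1 - s) * s ^ k) * of_bool (k < N n))"
      by (intro ennreal_suminf_SUP_eq) (auto intro!: mult_left_mono incseq_SucI dest: order.strict_trans2[OF _ incseq_SucD[OF Nmono]])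
    also have "\<dots> = (SUP n. ennreal (1 - s ^ N n))"
    proof (intro SUP_cong refl)
      fix n
      have "(\<Sum>k. ennreal ((1 - s) * s ^ k) * of_bool (k < N n)) = (\<Sum>k<N n. ennreal ((1 - s) * s ^ k) * of_bool (k < N n))"
        by (intro suminf_finite) auto
      also have "\<dots> = (\<Sum>k<N n. ennreal ((1 - s) * s ^ k))" by (intro sum.cong refl) simp
      also have "\<dots> = ennreal (\<Sum>k<N n. (1 - s) * s ^ k)" by (rule sum_ennreal) (use s in simp)
      finally show "(\<Sum>k. ennreal ((1 - s) * s ^ k) * of_bool (k < N n)) = ennreal (1 - s ^ N n)" by (simp only: tel)
    qed
    finally show ?case by (simp add: N_def)
  qed
  have m: "(\<lambda>x. toppled b n (x [] + v) x) \<in> T \<rightarrow>\<^sub>M count_space UNIV" for n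
    using measurable_compose[OF _ toppled_measurable[of n], of "\<lambda>x. (x [] + v, x)" T]
    by (simp add: component_measurable)
  have "ennreal (\<Sum>k. (1 - s) * (P k * s ^ k)) = (\<Sum>k. ennreal ((1 - s) * (P k * s ^ k)))"
  proof (rule suminf_ennreal_eq[symmetric])
    show "(\<lambda>k. (1 - s) * (P k * s ^ k)) sums (\<Sum>k. (1 - s) * (P k * s ^ k))" by (rule summable_sums[OF summ])
    show "0 \<le> (1 - s) * (P k * s ^ k)" for k using s P[of k] by simp
  qed
  also have "\<dots> = (\<Sum>k. \<integral>\<^sup>+x. ennreal ((1 - s) * s ^ k) * of_bool (of_nat (Suc k) \<le> ?N x) \<partial>T)"
  proof (intro suminf_cong)
    fix k
    have "ennreal ((1 - s) * (P k * s ^ k)) = ennreal ((1 - s) * s ^ k) * ennreal (P k)"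
      using s P[of k] by (simp add: ennreal_mult[symmetric] ac_simps)
    also have "\<dots> = (\<integral>\<^sup>+x. ennreal ((1 - s) * s ^ k) * of_bool (of_nat (Suc k) \<le> ?N x) \<partial>T)"
      unfolding Pe by (rule nn_integral_cmult[symmetric]) measurable
    finally show "ennreal ((1 - s) * (P k * s ^ k)) = (\<integral>\<^sup>+x. ennreal ((1 - s) * s ^ k) * of_bool (of_nat (Suc k) \<le> ?N x) \<partial>T)" .
  qed
  also have "\<dots> = (\<integral>\<^sup>+x. (\<Sum>k. ennreal ((1 - s) * s ^ k) * of_bool (of_nat (Suc k) \<le> ?N x)) \<partial>T)"
    by (rule nn_integral_suminf[symmetric]) measurable
  also have "\<dots> = (\<integral>\<^sup>+x. (SUP n. ennreal (1 - s ^ toppled b n (x [] + v) x)) \<partial>T)"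
    by (rule nn_integral_cong_AE[OF AE])
  also have "\<dots> = (SUP n. \<integral>\<^sup>+x. ennreal (1 - s ^ toppled b n (x [] + v) x) \<partial>T)"
  proof (rule nn_integral_monotone_convergence_SUP)
    show "incseq (\<lambda>n x. ennreal (1 - s ^ toppled b n (x [] + v) x))"
      using s by (intro incseq_SucI le_funI ennreal_leI diff_left_mono power_decreasing toppled_mono) auto
    show "(\<lambda>x. ennreal (1 - s ^ toppled b n (x [] + v) x)) \<in> borel_measurable T" for n
      using measurable_compose[OF m[of n], of "\<lambda>k. ennreal (1 - s ^ k)"] by simp
  qed
  also have "\<dots> = (SUP n. ennreal (K (?V n) (real b * v)))"
  proof (intro SUP_cong refl)
    fix n
    have KV: "0 \<le> K (?V n) (real b * v)" "K (?V n) (real b * v) \<le> 1" using V by (auto intro!: K_unit)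
    have "(\<integral>\<^sup>+x. ennreal (1 - s ^ toppled b n (x [] + v) x) \<partial>T) = (\<integral>\<^sup>+x. 1 - ennreal (s ^ toppled b n (x [] + v) x) \<partial>T)"
      using s by (intro nn_integral_cong) (simp add: ennreal_minus[symmetric])
    also have "\<dots> = (\<integral>\<^sup>+x. 1 \<partial>T) - (\<integral>\<^sup>+x. ennreal (s ^ toppled b n (x [] + v) x) \<partial>T)"
    proof (rule nn_integral_diff)
      show "(\<lambda>x. ennreal (s ^ toppled b n (x [] + v) x)) \<in> borel_measurable T"
        using measurable_compose[OF m[of n], of "\<lambda>k. ennreal (s ^ k)"] by simp
      show "(\<integral>\<^sup>+x. ennreal (s ^ toppled b n (x [] + v) x) \<partial>T) \<noteq> \<infinity>"
        using pgf_toppled[of s v n] s v by simp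
      show "AE x in T. ennreal (s ^ toppled b n (x [] + v) x) \<le> 1"
        using s by (intro AE_I2) (auto intro: power_le_one)
    qed simp
    also have "\<dots> = 1 - ennreal (1 - K (?V n) (real b * v))"
      using pgf_toppled[of s v n] s v T.emeasure_space_1 by simp
    also have "\<dots> = ennreal (K (?V n) (real b * v))" using KV ennreal_minus[of "1 - K (?V n) (real b * v)" 1] by simp
    finally show "(\<integral>\<^sup>+x. ennreal (1 - s ^ toppled b n (x [] + v) x) \<partial>T) = ennreal (K (?V n) (real b * v))" .
  qed
  also have "\<dots> = ennreal (K u (real b * v))"
  proof (rule LIMSEQ_unique)
    have mono: "?V n \<theta> \<le> ?V (Suc n) \<theta>" for n \<theta>
      using s by (intro iter_increasing) auto
    have "incseq (\<lambda>n. ennreal (K (?V n) (real b * v)))"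
      by (intro incseq_SucI ennreal_leI K_mono V mono)
    then show "(\<lambda>n. ennreal (K (?V n) (real b * v))) \<longlonglongrightarrow> (SUP n. ennreal (K (?V n) (real b * v)))" by (rule LIMSEQ_SUP)
    show "(\<lambda>n. ennreal (K (?V n) (real b * v))) \<longlonglongrightarrow> ennreal (K u (real b * v))"
      by (intro tendsto_ennrealI K_tendsto[where c = 1] V u) (use V in auto)
  qed
  finally have eq: "ennreal (\<Sum>k. (1 - s) * (P k * s ^ k)) = ennreal (K u (real b * v))" .
  have "0 \<le> u \<theta>" "u \<theta> \<le> 1" if "\<theta> \<in> {1..B}" for \<theta>
    using LIMSEQ_le_const[OF u(1)[OF that]] LIMSEQ_le_const2[OF u(1)[OF that]] V by blast+
  then have "0 \<le> K u (real b * v)" by (intro K_unit u) auto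
  moreover have "0 \<le> (\<Sum>k. (1 - s) * (P k * s ^ k))" using s P by (intro suminf_nonneg summ) auto
  ultimately have "(\<Sum>k. (1 - s) * (P k * s ^ k)) = K u (real b * v)" using eq by (simp add: ennreal_inj)
  moreover have "(\<Sum>k. (1 - s) * (P k * s ^ k)) = (1 - s) * (\<Sum>k. P k * s ^ k)"
    using summ s by (intro suminf_mult) (simp add: summable_cmult_iff)
  ultimately show ?thesis by (simp add: P_def)
qed

end

section \<open>Uniformity along mixtures\<close>

lemma (in site_law) K_nonneg:
  assumes "f \<in> bfun (state B)" "\<And>x. x \<in> {1..B} \<Longrightarrow> 0 \<le> f x"
  shows "0 \<le> K f \<theta>"
proof -
  have "K (\<lambda>_. 0) \<theta> \<le> K f \<theta>" using assms by (intro K_mono) auto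
  then show ?thesis by (simp add: akern_def)
qed

lemma M_flat_density:
  assumes "\<rho> \<in> M_flat b"
  shows "\<exists>D \<phi>. 0 < D \<and> \<phi> \<in> borel_measurable lborel \<and> \<rho> = density lborel \<phi> \<and> (AE x in lborel. \<phi> x \<le> ennreal D)"
proof -
  obtain \<phi> where \<phi>: "\<phi> \<in> borel_measurable lborel" "\<rho> = density lborel \<phi>" "esssup lborel \<phi> < (\<infinity> :: ennreal)"
    using assms by (auto simp: M_flat_def)
  define D where "D = max 1 (enn2real (esssup lborel \<phi>))"
  have "AE x in lborel. \<phi> x \<le> ennreal D"
    using esssup_AE[of \<phi> lborel]
  proof eventually_elim
    case (elim x)
    also have "esssup lborel \<phi> = ennreal (enn2real (esssup lborel \<phi>))"
      using \<phi>(3) by simp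
    also have "\<dots> \<le> ennreal D" by (rule ennreal_leI) (simp add: D_def)
    finally show ?case .
  qed
  moreover have "0 < D" by (simp add: D_def)
  ultimately show ?thesis using \<phi> by blast
qed

lemma site_law_density:
  assumes "\<rho> \<in> M_flat b" "1 < b" "2 \<le> B" "0 < D"
    and \<phi>: "\<phi> \<in> borel_measurable lborel" "\<rho> = density lborel \<phi>" "AE x in lborel. \<phi> x \<le> ennreal D"
    and p: "0 < p" "p \<le> measure \<rho> {1 - 1 / real b..1}"
  shows "site_law \<rho> b B D p"
proof -
  interpret prob_space \<rho> using assms(1) by (simp add: M_flat_def)
  show ?thesis
  proof
    show "sets \<rho> = sets borel" using assms(1) by (simp add: M_flat_def)
    then have ev: "{0..1} \<in> sets \<rho>" by simp
    have "emeasure \<rho> {0..1} = 1" using assms(1) by (simp add: M_flat_def)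
    then have "prob {0..1} = 1" by (simp add: measure_def)
    then show "AE x in \<rho>. x \<in> {0..1}" using AE_in_set_eq_1[OF ev] by blast
    show "measure \<rho> {a..c} \<le> D * (c - a)" if "a \<le> c" for a c
    proof -
      have "emeasure \<rho> {a..c} = (\<integral>\<^sup>+x. \<phi> x * indicator {a..c} x \<partial>lborel)"
        using \<phi>(1,2) by (simp add: emeasure_density)
      also have "\<dots> \<le> (\<integral>\<^sup>+x. ennreal D * indicator {a..c} x \<partial>lborel)"
        using \<phi>(3) by (intro nn_integral_mono_AE) (auto elim!: eventually_mono intro: mult_right_mono)
      also have "\<dots> = ennreal (D * (c - a))"
        using that \<open>0 < D\<close> by (simp add: nn_integral_cmult_indicator ennreal_mult)
      finally show ?thesis using that \<open>0 < D\<close> by (simp add: emeasure_eq_measure)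
    qed
  qed (use assms in auto)
qed

lemma mixture_density:
  assumes "\<phi>' \<in> borel_measurable lborel" "\<phi> \<in> borel_measurable lborel"
  shows "mixture \<alpha> (density lborel \<phi>') (density lborel \<phi>) = density lborel (\<lambda>x. ennreal \<alpha> * \<phi>' x + ennreal (1 - \<alpha>) * \<phi> x)"
proof (rule measure_eqI)
  fix A assume "A \<in> sets (mixture \<alpha> (density lborel \<phi>') (density lborel \<phi>))"
  then have A: "A \<in> sets borel" by simp
  have [measurable]: "\<phi>' \<in> borel_measurable borel" "\<phi> \<in> borel_measurable borel" using assms by auto
  show "emeasure (mixture \<alpha> (density lborel \<phi>') (density lborel \<phi>)) A = emeasure (density lborel (\<lambda>x. ennreal \<alpha> * \<phi>' x + ennreal (1 - \<alpha>) * \<phi> x)) A"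
    using A by (simp add: emeasure_mixture emeasure_density distrib_right nn_integral_add nn_integral_cmult mult.assoc)
qed simp

locale two_laws =
  fixes \<rho> \<rho>' :: "real measure" and b :: nat and B D p :: real and \<phi> \<phi>' :: "real \<Rightarrow> ennreal"
  assumes \<phi>: "\<phi> \<in> borel_measurable lborel" "\<rho> = density lborel \<phi>" "AE x in lborel. \<phi> x \<le> ennreal D"
    and \<phi>': "\<phi>' \<in> borel_measurable lborel" "\<rho>' = density lborel \<phi>'" "AE x in lborel. \<phi>' x \<le> ennreal D"
    and law: "site_law \<rho> b B D p" and law': "site_law \<rho>' b B D p"
begin

sublocale A: site_law \<rho> b B D p by (rule law)
sublocale A': site_law \<rho>' b B D p by (rule law')

abbreviation "\<rho>\<^sub>\<alpha> \<alpha> \<equiv> mixture \<alpha> \<rho>' \<rho>"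

lemma measure_mixture:
  assumes "0 \<le> \<alpha>" "\<alpha> \<le> 1" "S \<in> sets borel"
  shows "emeasure (\<rho>\<^sub>\<alpha> \<alpha>) S = ennreal (\<alpha> * measure \<rho>' S + (1 - \<alpha>) * measure \<rho> S)"
    and "measure (\<rho>\<^sub>\<alpha> \<alpha>) S = \<alpha> * measure \<rho>' S + (1 - \<alpha>) * measure \<rho> S"
proof -
  show 1: "emeasure (\<rho>\<^sub>\<alpha> \<alpha>) S = ennreal (\<alpha> * measure \<rho>' S + (1 - \<alpha>) * measure \<rho> S)"
    using assms by (simp add: emeasure_mixture A.emeasure_eq_measure A'.emeasure_eq_measure ennreal_mult[symmetric] ennreal_plus[symmetric] del: ennreal_plus)
  then show "measure (\<rho>\<^sub>\<alpha> \<alpha>) S = \<alpha> * measure \<rho>' S + (1 - \<alpha>) * measure \<rho> S"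
    using assms by (intro measure_eq_emeasure_eq_ennreal) auto
qed

lemma mixture_law:
  assumes \<alpha>: "0 \<le> \<alpha>" "\<alpha> \<le> 1"
  shows "site_law (\<rho>\<^sub>\<alpha> \<alpha>) b B D p"
proof -
  have sp: "space (\<rho>\<^sub>\<alpha> \<alpha>) = UNIV" using sets_eq_imp_space_eq[OF sets_mixture] by simp
  interpret prob_space "\<rho>\<^sub>\<alpha> \<alpha>"
    by (rule prob_spaceI) (use \<alpha> in \<open>simp add: sp measure_mixture\<close>)
  show ?thesis
  proof
    have "measure \<rho> {0..1} = 1" "measure \<rho>' {0..1} = 1"
      using A.AE_in_set_eq_1[of "{0..1}"] A'.AE_in_set_eq_1[of "{0..1}"] A.AE_unit A'.AE_unit by auto
    then have "measure (\<rho>\<^sub>\<alpha> \<alpha>) {0..1} = 1" using \<alpha> by (simp add: measure_mixture)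
    then show "AE x in \<rho>\<^sub>\<alpha> \<alpha>. x \<in> {0..1}" by (subst AE_in_set_eq_1) auto
    show "measure (\<rho>\<^sub>\<alpha> \<alpha>) {a..c} \<le> D * (c - a)" if "a \<le> c" for a c
    proof -
      have "\<alpha> * measure \<rho>' {a..c} + (1 - \<alpha>) * measure \<rho> {a..c} \<le> \<alpha> * (D * (c - a)) + (1 - \<alpha>) * (D * (c - a))"
        using \<alpha> A.lip[OF that] A'.lip[OF that] by (intro add_mono mult_left_mono) auto
      then show ?thesis using \<alpha> by (simp add: measure_mixture algebra_simps)
    qed
    have "\<alpha> * p + (1 - \<alpha>) * p \<le> \<alpha> * measure \<rho>' {1 - 1 / real b..1} + (1 - \<alpha>) * measure \<rho> {1 - 1 / real b..1}"
      using \<alpha> A.p_le A'.p_le by (intro add_mono mult_left_mono) auto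
    then show "p \<le> measure (\<rho>\<^sub>\<alpha> \<alpha>) {1 - 1 / real b..1}" using \<alpha> by (simp add: measure_mixture algebra_simps)
  qed (use A.b A.B A.D_pos A.p_pos in auto)
qed

text \<open>For nonnegative functions the identity follows in \<open>ennreal\<close> from the
  densities; a bounded \<open>f\<close> is reduced to the nonnegative \<open>f + c\<close> and the
  constant \<open>c\<close>.\<close>

lemma akern_mixture:
  assumes \<alpha>: "0 \<le> \<alpha>" "\<alpha> \<le> 1" and f: "f \<in> bfun (state B)"
  shows "akern b B (\<rho>\<^sub>\<alpha> \<alpha>) f \<theta> = \<alpha> * akern b B \<rho>' f \<theta> + (1 - \<alpha>) * akern b B \<rho> f \<theta>"
proof -
  interpret Al: site_law "\<rho>\<^sub>\<alpha> \<alpha>" b B D p by (rule mixture_law[OF \<alpha>])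
  have nn: "akern b B (\<rho>\<^sub>\<alpha> \<alpha>) g \<theta> = \<alpha> * akern b B \<rho>' g \<theta> + (1 - \<alpha>) * akern b B \<rho> g \<theta>"
    if g: "g \<in> bfun (state B)" "\<And>x. x \<in> {1..B} \<Longrightarrow> 0 \<le> g x" for g
  proof -
    define F where "F = (\<lambda>x. ennreal (indicator {1..B} (x + \<theta> / real b) * g (x + \<theta> / real b)))"
    have Fm [measurable]: "F \<in> borel_measurable borel"
      unfolding F_def by (rule measurable_compose[OF measurable_compose[OF _ bfun_state[OF g(1)]] measurable_ennreal]) simp
    have [measurable]: "\<phi>' \<in> borel_measurable borel" "\<phi> \<in> borel_measurable borel" using \<phi> \<phi>' by auto
    have pos: "0 \<le> akern b B \<rho>' g \<theta>" "0 \<le> akern b B \<rho> g \<theta>" "0 \<le> akern b B (\<rho>\<^sub>\<alpha> \<alpha>) g \<theta>"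
      by (intro A'.K_nonneg A.K_nonneg Al.K_nonneg g; assumption)+
    have "ennreal (akern b B (\<rho>\<^sub>\<alpha> \<alpha>) g \<theta>) = (\<integral>\<^sup>+x. F x \<partial>\<rho>\<^sub>\<alpha> \<alpha>)"
      using Al.K_nn_integral[OF g] by (simp add: F_def)
    also have "\<dots> = ennreal \<alpha> * (\<integral>\<^sup>+x. F x \<partial>\<rho>') + ennreal (1 - \<alpha>) * (\<integral>\<^sup>+x. F x \<partial>\<rho>)"
      unfolding \<phi>(2) \<phi>'(2) mixture_density[OF \<phi>'(1) \<phi>(1)]
      by (simp add: nn_integral_density distrib_right nn_integral_add nn_integral_cmult mult.assoc)
    also have "\<dots> = ennreal \<alpha> * ennreal (akern b B \<rho>' g \<theta>) + ennreal (1 - \<alpha>) * ennreal (akern b B \<rho> g \<theta>)"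
      using A'.K_nn_integral[OF g] A.K_nn_integral[OF g] by (simp add: F_def)
    also have "\<dots> = ennreal (\<alpha> * akern b B \<rho>' g \<theta> + (1 - \<alpha>) * akern b B \<rho> g \<theta>)"
      using \<alpha> pos by (simp add: ennreal_mult[symmetric] ennreal_plus[symmetric] del: ennreal_plus)
    finally show ?thesis using \<alpha> pos by (subst (asm) ennreal_inj) auto
  qed
  obtain c where c: "0 \<le> c" "\<And>x. x \<in> {1..B} \<Longrightarrow> \<bar>f x\<bar> \<le> c"
    using bfun_bound[OF f] by (auto simp: space_restrict_space)
  have cb: "(\<lambda>_. c) \<in> bfun (state B)" by simp
  have fc: "(\<lambda>x. f x + c) \<in> bfun (state B)" using f by auto
  have "0 \<le> f x + c" if "x \<in> {1..B}" for x using c(2)[OF that] by (simp add: abs_le_iff)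
  note nn[OF fc this] nn[OF cb c(1)]
  moreover note fun_cong[OF Al.K_add[OF f cb], of \<theta>] fun_cong[OF A.K_add[OF f cb], of \<theta>] fun_cong[OF A'.K_add[OF f cb], of \<theta>]
  moreover have "X = \<alpha> * Y + (1 - \<alpha>) * Z"
    if "x = \<alpha> * y + (1 - \<alpha>) * z" "x' = \<alpha> * y' + (1 - \<alpha>) * z'" "x = X + x'" "z = Z + z'" "y = Y + y'"
    for X Y Z x y z x' y' z' :: real
    using that by (simp add: algebra_simps)
  ultimately show ?thesis by blast
qed

lemma akern_close:
  assumes \<alpha>: "0 \<le> \<alpha>" "\<alpha> \<le> 1" and f: "f \<in> bfun (state B)" "\<And>x. x \<in> space (state B) \<Longrightarrow> \<bar>f x\<bar> \<le> c"
  shows "\<bar>akern b B (\<rho>\<^sub>\<alpha> \<alpha>) f \<theta> - akern b B \<rho> f \<theta>\<bar> \<le> (2 * \<alpha>) * c"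
proof -
  have c: "\<And>x. x \<in> {1..B} \<Longrightarrow> \<bar>f x\<bar> \<le> c" using f(2) by (simp add: space_restrict_space)
  have c0: "0 \<le> c" using c[of 1] A.B by simp
  have "\<bar>akern b B \<rho>' f \<theta> - akern b B \<rho> f \<theta>\<bar> \<le> 2 * c"
    using A'.K_abs_le[OF f(1) c c0, of \<theta>] A.K_abs_le[OF f(1) c c0, of \<theta>] by linarith
  then have "\<alpha> * \<bar>akern b B \<rho>' f \<theta> - akern b B \<rho> f \<theta>\<bar> \<le> \<alpha> * (2 * c)" using \<alpha> by (intro mult_left_mono) auto
  moreover have "akern b B (\<rho>\<^sub>\<alpha> \<alpha>) f \<theta> - akern b B \<rho> f \<theta> = \<alpha> * (akern b B \<rho>' f \<theta> - akern b B \<rho> f \<theta>)"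
    using akern_mixture[OF \<alpha> f(1)] by (simp add: algebra_simps)
  ultimately show ?thesis using \<alpha> by (simp add: abs_mult)
qed

text \<open>For \<open>\<alpha> \<le> 1 / 2\<close> the mixture dominates half of \<rho>, so each
  step loses at most a factor 2. The minorization of \<rho> thus passes to all these mixtures with
  the same number of steps and the same minorizing functional.\<close>

lemma mixture_power_ge:
  assumes \<alpha>: "0 \<le> \<alpha>" "\<alpha> \<le> 1 / 2" and f: "f \<in> bfun (state B)" "\<And>x. x \<in> {1..B} \<Longrightarrow> 0 \<le> f x"
  shows "x \<in> {1..B} \<Longrightarrow> (1 / 2) ^ n * (akern b B \<rho> ^^ n) f x \<le> (akern b B (\<rho>\<^sub>\<alpha> \<alpha>) ^^ n) f x"
proof (induction n arbitrary: x)
  case (Suc n)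
  interpret Al: site_law "\<rho>\<^sub>\<alpha> \<alpha>" b B D p by (rule mixture_law) (use \<alpha> in auto)
  let ?g = "(akern b B \<rho> ^^ n) f" and ?g' = "(akern b B (\<rho>\<^sub>\<alpha> \<alpha>) ^^ n) f"
  have gb: "?g \<in> bfun (state B) \<and> (\<forall>x\<in>{1..B}. 0 \<le> ?g x)"
  proof (induction n)
    case (Suc n)
    then show ?case by (auto intro!: A.K_bfun A.K_nonneg)
  qed (use f in auto)
  have gb': "?g' \<in> bfun (state B)" by (induction n) (auto intro: f Al.K_bfun)
  have "akern b B (\<rho>\<^sub>\<alpha> \<alpha>) (\<lambda>x. (1 / 2) ^ n * ?g x) x \<le> akern b B (\<rho>\<^sub>\<alpha> \<alpha>) ?g' x"
    using Suc.IH gb gb' by (intro Al.K_mono) auto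
  moreover have "(1 / 2) ^ n * (1 / 2 * A.K ?g x) \<le> akern b B (\<rho>\<^sub>\<alpha> \<alpha>) (\<lambda>x. (1 / 2) ^ n * ?g x) x"
  proof -
    have nn: "0 \<le> A.K ?g x" "0 \<le> A'.K ?g x"
      using gb by (auto intro!: A.K_nonneg A'.K_nonneg)
    have "1 / 2 * A.K ?g x \<le> (1 - \<alpha>) * A.K ?g x" using \<alpha> nn by (intro mult_right_mono) auto
    also have "\<dots> \<le> akern b B (\<rho>\<^sub>\<alpha> \<alpha>) ?g x"
      using \<alpha> nn gb by (subst akern_mixture) auto
    finally have "(1 / 2) ^ n * (1 / 2 * A.K ?g x) \<le> (1 / 2) ^ n * akern b B (\<rho>\<^sub>\<alpha> \<alpha>) ?g x" by (intro mult_left_mono) auto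
    then show ?thesis by (simp only: Al.K_scale)
  qed
  ultimately show ?case by simp
qed simp

end

text \<open>The minorizing functional is the mean under the uniform law on the target
  interval.\<close>

lemma (in site_law) doeblin:
  assumes m: "0 < m" "0 < \<epsilon>" and j: "1 \<le> j\<^sub>1" "j\<^sub>1 < j\<^sub>2" "j\<^sub>2 \<le> B"
    and minor: "\<And>f \<theta>. f \<in> bfun (state B) \<Longrightarrow> (\<And>x. x\<in>{1..B} \<Longrightarrow> 0 \<le> f x) \<Longrightarrow> \<theta> \<in> {1..B} \<Longrightarrow>
      \<epsilon> * ((\<integral>y. indicator {j\<^sub>1..j\<^sub>2} y * f y \<partial>lborel) / (j\<^sub>2 - j\<^sub>1)) \<le> (K ^^ m) f \<theta>"
  shows "doeblin_kernel (state B) K p harnack_const \<epsilon> m (\<lambda>f. (\<integral>y. indicator {j\<^sub>1..j\<^sub>2} y * f y \<partial>lborel) / (j\<^sub>2 - j\<^sub>1)) 1"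
proof -
  have int: "integrable lborel (\<lambda>y. indicator {j\<^sub>1..j\<^sub>2} y * f y)" if f: "f \<in> bfun (state B)" for f :: "real \<Rightarrow> real"
  proof -
    obtain c where c: "0 \<le> c" "\<And>x. x \<in> {1..B} \<Longrightarrow> \<bar>f x\<bar> \<le> c"
      using bfun_bound[OF f] by (auto simp: space_restrict_space)
    show ?thesis
    proof (rule Bochner_Integration.integrable_bound[of _ "\<lambda>y. indicator {j\<^sub>1..j\<^sub>2} y * c"])
      show "integrable lborel (\<lambda>y. indicator {j\<^sub>1..j\<^sub>2} y * c)"
        by (intro integrable_mult_left) (simp add: integrable_indicator_iff emeasure_lborel_Icc_eq)
      have "(\<lambda>y. indicator {j\<^sub>1..j\<^sub>2} y * f y) = (\<lambda>y. indicator {j\<^sub>1..j\<^sub>2} y * (indicator {1..B} y * f y))"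
        using j by (auto simp: indicator_def)
      also have "\<dots> \<in> borel_measurable borel"
        by (intro borel_measurable_times bfun_state[OF f]) auto
      finally show "(\<lambda>y. indicator {j\<^sub>1..j\<^sub>2} y * f y) \<in> borel_measurable lborel" by simp
      show "AE y in lborel. norm (indicator {j\<^sub>1..j\<^sub>2} y * f y) \<le> norm (indicator {j\<^sub>1..j\<^sub>2} y * c)"
        using c j by (intro AE_I2) (auto simp: indicator_def)
    qed
  qed
  have sp: "space (state B) = {1..B}" by (simp add: space_restrict_space)
  show ?thesis
  proof
    show "(\<integral>y. indicator {j\<^sub>1..j\<^sub>2} y * (f y + g y) \<partial>lborel) / (j\<^sub>2 - j\<^sub>1) =
      (\<integral>y. indicator {j\<^sub>1..j\<^sub>2} y * f y \<partial>lborel) / (j\<^sub>2 - j\<^sub>1) + (\<integral>y. indicator {j\<^sub>1..j\<^sub>2} y * g y \<partial>lborel) / (j\<^sub>2 - j\<^sub>1)"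
      if "f \<in> bfun (state B)" "g \<in> bfun (state B)" for f g
      using Bochner_Integration.integral_add[OF int[OF that(1)] int[OF that(2)]] by (simp add: distrib_left add_divide_distrib)
    show "(\<integral>y. indicator {j\<^sub>1..j\<^sub>2} y * f y \<partial>lborel) / (j\<^sub>2 - j\<^sub>1) \<le> (\<integral>y. indicator {j\<^sub>1..j\<^sub>2} y * g y \<partial>lborel) / (j\<^sub>2 - j\<^sub>1)"
      if "f \<in> bfun (state B)" "g \<in> bfun (state B)" "\<And>x. x \<in> space (state B) \<Longrightarrow> f x \<le> g x" for f g
      using that(3) j by (intro divide_right_mono integral_mono int that) (auto simp: sp indicator_def)
    show "(\<integral>y. indicator {j\<^sub>1..j\<^sub>2} y * (c * f y) \<partial>lborel) / (j\<^sub>2 - j\<^sub>1) = c * ((\<integral>y. indicator {j\<^sub>1..j\<^sub>2} y * f y \<partial>lborel) / (j\<^sub>2 - j\<^sub>1))"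
      if "f \<in> bfun (state B)" for c f
    proof -
      have "(\<integral>y. indicator {j\<^sub>1..j\<^sub>2} y * (c * f y) \<partial>lborel) = c * (\<integral>y. indicator {j\<^sub>1..j\<^sub>2} y * f y \<partial>lborel)"
        by (subst integral_mult_right_zero[symmetric]) (simp add: ac_simps)
      then show ?thesis by simp
    qed
    show "\<epsilon> * ((\<integral>y. indicator {j\<^sub>1..j\<^sub>2} y * f y \<partial>lborel) / (j\<^sub>2 - j\<^sub>1)) \<le> (K ^^ m) f x"
      if "f \<in> bfun (state B)" "\<And>x. x \<in> space (state B) \<Longrightarrow> 0 \<le> f x" "x \<in> space (state B)" for f x
      using minor[OF that(1)] that by (simp add: sp)
    show "(K ^^ n) (\<lambda>_. 1) x \<le> harnack_const * (K ^^ n) (\<lambda>_. 1) y" if "x \<in> space (state B)" "y \<in> space (state B)" for x y n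
      using Z_harnack[of x y n] that by (simp add: sp survival_def)
  qed (use K_bfun K_add K_scale K_one_le K_one_ge p_pos m j B in \<open>auto simp: sp intro: K_mono\<close>)
qed

text \<open>\<open>D\<close> is the larger of the two density bounds and \<open>p\<close> the
  smaller of the two masses, which makes the Harnack constant common. The minorization is that of
  \<rho>, weakened by \<open>(1 / 2) ^ m\<close> to cover the mixtures.\<close>

lemma uniform_family:
  assumes b: "1 < b" and B: "2 \<le> B" and \<rho>: "\<rho> \<in> M_flat b" and \<rho>': "\<rho>' \<in> M_flat b"
  shows "\<exists>D p C \<epsilon> m \<eta>. site_law \<rho> b B D p \<and> doeblin_kernel (state B) (akern b B \<rho>) p C \<epsilon> m \<eta> 1 \<and>
    (\<forall>\<alpha>\<in>{0<..1/2}. site_law (mixture \<alpha> \<rho>' \<rho>) b B D p \<and>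
       doeblin_kernel (state B) (akern b B (mixture \<alpha> \<rho>' \<rho>)) p C \<epsilon> m \<eta> 1 \<and>
       (\<forall>f\<in>bfun (state B). \<forall>c. (\<forall>x\<in>space (state B). \<bar>f x\<bar> \<le> c) \<longrightarrow>
          (\<forall>x. \<bar>akern b B (mixture \<alpha> \<rho>' \<rho>) f x - akern b B \<rho> f x\<bar> \<le> (2 * \<alpha>) * c)))"
proof -
  obtain D\<^sub>1 \<phi> where \<phi>: "0 < D\<^sub>1" "\<phi> \<in> borel_measurable lborel" "\<rho> = density lborel \<phi>" "AE x in lborel. \<phi> x \<le> ennreal D\<^sub>1"
    using M_flat_density[OF \<rho>] by blast
  obtain D\<^sub>2 \<phi>' where \<phi>': "0 < D\<^sub>2" "\<phi>' \<in> borel_measurable lborel" "\<rho>' = density lborel \<phi>'" "AE x in lborel. \<phi>' x \<le> ennreal D\<^sub>2"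
    using M_flat_density[OF \<rho>'] by blast
  define D where "D = max D\<^sub>1 D\<^sub>2"
  define p where "p = min (measure \<rho> {1 - 1 / real b..1}) (measure \<rho>' {1 - 1 / real b..1})"
  have D: "0 < D" using \<phi>(1) by (simp add: D_def)
  have p: "0 < p" using \<rho> \<rho>' by (simp add: p_def M_flat_def)
  have le: "ennreal D\<^sub>1 \<le> ennreal D" "ennreal D\<^sub>2 \<le> ennreal D" by (auto simp: D_def intro: ennreal_leI)
  have \<phi>D: "AE x in lborel. \<phi> x \<le> ennreal D" using \<phi>(4) by eventually_elim (use le in auto)
  have \<phi>D': "AE x in lborel. \<phi>' x \<le> ennreal D" using \<phi>'(4) by eventually_elim (use le in auto)
  have l: "site_law \<rho> b B D p" by (rule site_law_density[OF \<rho> b B D \<phi>(2,3) \<phi>D p]) (simp add: p_def)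
  have l': "site_law \<rho>' b B D p" by (rule site_law_density[OF \<rho>' b B D \<phi>'(2,3) \<phi>D' p]) (simp add: p_def)
  interpret two_laws \<rho> \<rho>' b B D p \<phi> \<phi>'
    by (rule two_laws.intro[OF \<phi>(2,3) \<phi>D \<phi>'(2,3) \<phi>D' l l'])
  obtain m \<epsilon> j\<^sub>1 j\<^sub>2 where m: "0 < m" "0 < \<epsilon>" and j: "1 \<le> j\<^sub>1" "j\<^sub>1 < j\<^sub>2" "j\<^sub>2 \<le> B"
    and minor: "\<forall>f \<theta>. f \<in> bfun (state B) \<longrightarrow> (\<forall>x\<in>{1..B}. 0 \<le> f x) \<longrightarrow> \<theta> \<in> {1..B} \<longrightarrow>
      \<epsilon> * ((\<integral>y. indicator {j\<^sub>1..j\<^sub>2} y * f y \<partial>lborel) / (j\<^sub>2 - j\<^sub>1)) \<le> (A.K ^^ m) f \<theta>"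
    using A.minorization[OF \<phi>] by blast
  define \<eta> where "\<eta> = (\<lambda>f. (\<integral>y. indicator {j\<^sub>1..j\<^sub>2} y * f y \<partial>lborel) / (j\<^sub>2 - j\<^sub>1))"
  define \<epsilon>' where "\<epsilon>' = (1 / 2) ^ m * \<epsilon>"
  have \<epsilon>': "0 < \<epsilon>'" using m by (simp add: \<epsilon>'_def)
  have \<eta>0: "0 \<le> \<eta> f" if "\<And>x. x\<in>{1..B} \<Longrightarrow> 0 \<le> f x" for f
    unfolding \<eta>_def using j that by (intro divide_nonneg_nonneg integral_nonneg_AE AE_I2) (auto simp: indicator_def)
  have minor\<alpha>: "\<epsilon>' * \<eta> f \<le> (akern b B (\<rho>\<^sub>\<alpha> \<alpha>) ^^ m) f \<theta>"
    if \<alpha>: "0 \<le> \<alpha>" "\<alpha> \<le> 1 / 2" and f: "f \<in> bfun (state B)" "\<And>x. x\<in>{1..B} \<Longrightarrow> 0 \<le> f x" and \<theta>: "\<theta> \<in> {1..B}" for \<alpha> f \<theta>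
  proof -
    have "(1 / 2) ^ m * (\<epsilon> * \<eta> f) \<le> (1 / 2) ^ m * (A.K ^^ m) f \<theta>"
      using minor f \<theta> unfolding \<eta>_def by (intro mult_left_mono) auto
    also have "\<dots> \<le> (akern b B (\<rho>\<^sub>\<alpha> \<alpha>) ^^ m) f \<theta>" by (rule mixture_power_ge[OF \<alpha> f \<theta>])
    finally show ?thesis by (simp add: \<epsilon>'_def mult.assoc)
  qed
  have minor0: "\<epsilon>' * \<eta> f \<le> (A.K ^^ m) f \<theta>"
    if f: "f \<in> bfun (state B)" "\<And>x. x\<in>{1..B} \<Longrightarrow> 0 \<le> f x" and \<theta>: "\<theta> \<in> {1..B}" for f \<theta>
  proof -
    have "(1 / 2) ^ m * (\<epsilon> * \<eta> f) \<le> 1 * (\<epsilon> * \<eta> f)" using m \<eta>0[OF f(2)] by (intro mult_right_mono power_le_one) auto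
    also have "\<dots> \<le> (A.K ^^ m) f \<theta>" using minor f \<theta> unfolding \<eta>_def by auto
    finally show ?thesis by (simp add: \<epsilon>'_def mult.assoc)
  qed
  have d0: "doeblin_kernel (state B) A.K p A.harnack_const \<epsilon>' m \<eta> 1"
    unfolding \<eta>_def by (rule A.doeblin[OF m(1) \<epsilon>' j minor0[unfolded \<eta>_def]])
  have "site_law (\<rho>\<^sub>\<alpha> \<alpha>) b B D p \<and> doeblin_kernel (state B) (akern b B (\<rho>\<^sub>\<alpha> \<alpha>)) p A.harnack_const \<epsilon>' m \<eta> 1"
    if \<alpha>: "\<alpha> \<in> {0<..1/2}" for \<alpha>
  proof -
    have \<alpha>': "0 \<le> \<alpha>" "\<alpha> \<le> 1" "\<alpha> \<le> 1 / 2" using \<alpha> by auto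
    interpret Al: site_law "\<rho>\<^sub>\<alpha> \<alpha>" b B D p by (rule mixture_law[OF \<alpha>'(1,2)])
    show ?thesis
      unfolding \<eta>_def using Al.site_law_axioms Al.doeblin[OF m(1) \<epsilon>' j minor\<alpha>[OF \<alpha>'(1,3), unfolded \<eta>_def]] by simp
  qed
  moreover have "\<bar>akern b B (\<rho>\<^sub>\<alpha> \<alpha>) f x - A.K f x\<bar> \<le> (2 * \<alpha>) * c"
    if "\<alpha> \<in> {0<..1/2}" "f \<in> bfun (state B)" "\<forall>x\<in>space (state B). \<bar>f x\<bar> \<le> c" for \<alpha> f c x
    using that by (intro akern_close) auto
  ultimately show ?thesis using d0 law by blast
qed

text \<open>Markov property at the first step: given the first label \<open>y\<close>, the rest of
  the walk from \<theta> is the walk from \<open>y + \<theta> / b\<close> driven by the shifted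
  labels.\<close>

lemma (in site_law) Z_prob_eq_survival: "\<theta> \<in> {1..B} \<Longrightarrow> Z_prob b \<rho> n \<theta> = survival K n \<theta>"
proof (induction n arbitrary: \<theta>)
  interpret S: prob_space "PiM {1..} (\<lambda>_::nat. \<rho>)" by (intro prob_space_PiM) unfold_locales
  {
    case 0
    then show ?case using S.prob_space by (simp add: Z_prob_def Q_proc_def survival_def)
  next
    case (Suc n)
    let ?P = "PiM {1::nat..} (\<lambda>_. \<rho>)" and ?P2 = "PiM {2::nat..} (\<lambda>_. \<rho>)"
    interpret P2: prob_space ?P2 by (intro prob_space_PiM) unfold_locales
    define W where "W = (\<lambda>n \<theta> x. \<forall>k\<in>{0..n}. 1 \<le> Q_proc b \<theta> k x)"
    define sh where "sh = (\<lambda>x :: nat \<Rightarrow> real. \<lambda>k\<in>{1..}. x (Suc k))"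
    have Qm: "(\<lambda>p. Q_proc b (fst p) k (snd p)) \<in> borel_measurable (borel \<Otimes>\<^sub>M ?P)" for k
    proof -
      have [measurable]: "(\<lambda>x. x i) \<in> borel_measurable ?P" if "i \<in> {1..}" for i
        by (subst measurable_cong_sets[OF refl sets_rho[symmetric]]) (rule measurable_component_singleton[OF that])
      show ?thesis unfolding Q_proc_def by measurable
    qed
    have Wm: "Measurable.pred (borel \<Otimes>\<^sub>M ?P) (\<lambda>p. W n (fst p) (snd p))" for n
      unfolding W_def using Qm by measurable
    have Wm1: "Measurable.pred ?P (W n \<theta>)" for n \<theta>
      using measurable_compose[OF _ Wm[of n], of "\<lambda>x. (\<theta>, x)" ?P] by simp
    have Zn: "ennreal (Z_prob b \<rho> n \<theta>) = (\<integral>\<^sup>+x. of_bool (W n \<theta> x) \<partial>?P)" for n \<theta>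
    proof -
      have "ennreal (Z_prob b \<rho> n \<theta>) = emeasure ?P {x \<in> space ?P. W n \<theta> x}"
        unfolding Z_prob_def W_def by (rule S.emeasure_eq_measure[symmetric])
      also have "\<dots> = (\<integral>\<^sup>+x. indicator {x \<in> space ?P. W n \<theta> x} x \<partial>?P)"
        using Wm1[of n \<theta>] by (intro nn_integral_indicator[symmetric]) simp
      also have "\<dots> = (\<integral>\<^sup>+x. of_bool (W n \<theta> x) \<partial>?P)" by (intro nn_integral_cong) (auto simp: indicator_def)
      finally show ?thesis .
    qed
    have Q_Suc: "Q_proc b \<theta> (Suc k) (X(1 := y)) = Q_proc b (y + \<theta> / real b) k (sh X)" for k X y \<theta>
    proof -
      have "(\<Sum>j = 1..Suc k. (X(1 := y)) j / real b ^ (Suc k - j)) = y / real b ^ k + (\<Sum>j = 2..Suc k. X j / real b ^ (Suc k - j))"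
        by (subst sum.atLeast_Suc_atMost) (auto intro!: sum.cong simp: numeral_2_eq_2)
      also have "(\<Sum>j = 2..Suc k. X j / real b ^ (Suc k - j)) = (\<Sum>j = 1..k. X (Suc j) / real b ^ (k - j))"
        using sum.shift_bounds_cl_Suc_ivl[of "\<lambda>j. X j / real b ^ (Suc k - j)" 1 k] by (simp add: numeral_2_eq_2)
      also have "\<dots> = (\<Sum>j = 1..k. sh X j / real b ^ (k - j))" by (intro sum.cong) (auto simp: sh_def)
      finally show ?thesis by (simp add: Q_proc_def add_divide_distrib)
    qed
    have W_Suc: "W (Suc n) \<theta> (X(1 := y)) \<longleftrightarrow> 1 \<le> \<theta> \<and> W n (y + \<theta> / real b) (sh X)" for X y \<theta>
    proof -
      have "W (Suc n) \<theta> (X(1 := y)) \<longleftrightarrow> 1 \<le> Q_proc b \<theta> 0 (X(1 := y)) \<and> (\<forall>k\<in>{0..n}. 1 \<le> Q_proc b \<theta> (Suc k) (X(1 := y)))"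
        unfolding W_def by (auto simp: Ball_def) (metis le_SucE not0_implies_Suc Suc_le_mono zero_le)+
      then show ?thesis unfolding Q_Suc W_def by (simp add: Q_proc_def)
    qed
    have "insert 1 {2..} = {1::nat..}" by auto
    then have D: "?P = distr (\<rho> \<Otimes>\<^sub>M ?P2) ?P (\<lambda>(y, X). X(1 := y))"
      using distr_pair_PiM_eq_PiM[of "{2..}" "\<lambda>_. \<rho>" "1::nat"] prob_space_axioms by simp
    have Dm: "(\<lambda>(y, X). X(1 := y)) \<in> \<rho> \<Otimes>\<^sub>M ?P2 \<rightarrow>\<^sub>M ?P"
    proof -
      have "(\<lambda>p. (snd p)(1 := fst p)) \<in> \<rho> \<Otimes>\<^sub>M ?P2 \<rightarrow>\<^sub>M PiM {1::nat..} (\<lambda>_. \<rho>)"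
        by (rule measurable_fun_upd[where J = "{2..}"]) auto
      then show ?thesis by (simp add: case_prod_unfold)
    qed
    have shD: "distr ?P2 ?P sh = ?P"
      unfolding sh_def using distr_PiM_reindex[of "{2..}" "\<lambda>_. \<rho>" Suc "{1..}"] prob_space_axioms by auto
    have shm: "sh \<in> ?P2 \<rightarrow>\<^sub>M ?P"
      unfolding sh_def by (intro measurable_restrict measurable_component_singleton) auto
    have Wo: "(\<lambda>x. of_bool (W n \<theta> x) :: ennreal) \<in> borel_measurable ?P" for n \<theta>
      using measurable_compose[OF Wm1[of n \<theta>], of "of_bool :: bool \<Rightarrow> ennreal" borel] by simp
    have "ennreal (Z_prob b \<rho> (Suc n) \<theta>) = (\<integral>\<^sup>+p. of_bool (W (Suc n) \<theta> ((snd p)(1 := fst p))) \<partial>(\<rho> \<Otimes>\<^sub>M ?P2))"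
      unfolding Zn by (subst D, subst nn_integral_distr[OF Dm]) (use Wo in \<open>auto simp: case_prod_beta\<close>)
    also have "\<dots> = (\<integral>\<^sup>+y. \<integral>\<^sup>+X. of_bool (W (Suc n) \<theta> (X(1 := y))) \<partial>?P2 \<partial>\<rho>)"
    proof -
      have "(\<lambda>p. of_bool (W (Suc n) \<theta> ((snd p)(1 := fst p))) :: ennreal) \<in> borel_measurable (\<rho> \<Otimes>\<^sub>M ?P2)"
        using measurable_compose[OF Dm Wo[of "Suc n" \<theta>]] by (simp add: case_prod_beta)
      then show ?thesis by (subst P2.nn_integral_fst[symmetric]) auto
    qed
    also have "\<dots> = (\<integral>\<^sup>+y. ennreal (indicator {1..B} (y + \<theta> / real b) * survival K n (y + \<theta> / real b)) \<partial>\<rho>)"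
    proof (rule nn_integral_cong_AE)
      show "AE y in \<rho>. (\<integral>\<^sup>+X. of_bool (W (Suc n) \<theta> (X(1 := y))) \<partial>?P2) = ennreal (indicator {1..B} (y + \<theta> / real b) * survival K n (y + \<theta> / real b))"
        using AE_unit
      proof eventually_elim
        case (elim y)
        have "(\<integral>\<^sup>+X. of_bool (W (Suc n) \<theta> (X(1 := y))) \<partial>?P2) = (\<integral>\<^sup>+X. of_bool (W n (y + \<theta> / real b) (sh X)) \<partial>?P2)"
        proof -
          have "W (Suc n) \<theta> (X(1 := y)) = W n (y + \<theta> / real b) (sh X)" for X
            using Suc.prems by (subst W_Suc) auto
          then show ?thesis by (simp only:)
        qed
        also have "\<dots> = (\<integral>\<^sup>+X. of_bool (W n (y + \<theta> / real b) X) \<partial>distr ?P2 ?P sh)"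
          by (subst nn_integral_distr[OF shm]) (use Wo in auto)
        also have "\<dots> = ennreal (Z_prob b \<rho> n (y + \<theta> / real b))" by (simp only: shD Zn)
        also have "\<dots> = ennreal (indicator {1..B} (y + \<theta> / real b) * survival K n (y + \<theta> / real b))"
        proof (cases "1 \<le> y + \<theta> / real b")
          case True
          then show ?thesis using Suc.IH[of "y + \<theta> / real b"] upper[OF elim, of \<theta>] Suc.prems by simp
        next
          case False
          then have "\<not> W n (y + \<theta> / real b) X" for X unfolding W_def by (auto simp: Q_proc_def intro!: bexI[of _ 0])
          then have "ennreal (Z_prob b \<rho> n (y + \<theta> / real b)) = 0" by (simp add: Zn)
          then show ?thesis using False by simp
        qed
        finally show ?case .
      qed
    qed
    also have "\<dots> = ennreal (survival K (Suc n) \<theta>)"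
      using K_nn_integral[of "survival K n" \<theta>, OF Z_bfun Z_nonneg] by (simp add: Z_Suc)
    finally have "ennreal (Z_prob b \<rho> (Suc n) \<theta>) = ennreal (survival K (Suc n) \<theta>)" .
    then show ?case using Z_nonneg[OF Suc.prems, of "Suc n"] by (simp add: ennreal_inj Z_prob_def)
  }
qed

text \<open>The description asks for one limit for all \<open>\<theta> \<ge> 1\<close>, while a
  fixed \<open>B\<close> covers only \<open>\<theta> \<le> B\<close>. Type spaces for different
  \<open>B\<close> share the point 1, where the limit does not involve \<open>B\<close>, so their
  eigenvalues agree.\<close>

lemma zz_eq_eigval:
  assumes "\<And>B. 2 \<le> B \<Longrightarrow> \<exists>D p C \<epsilon> m \<eta>. site_law \<rho> b B D p \<and> doeblin_kernel (state B) (akern b B \<rho>) p C \<epsilon> m \<eta> 1"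
    and "2 \<le> B"
  shows "zz b \<rho> = eigval (akern b B \<rho>) 1"
proof -
  have lim: "(\<lambda>n. root n (Z_prob b \<rho> n \<theta>)) \<longlonglongrightarrow> eigval (akern b B' \<rho>) 1" if B': "2 \<le> B'" and \<theta>: "\<theta> \<in> {1..B'}" for B' \<theta>
  proof -
    obtain D p C \<epsilon> m \<eta> where "site_law \<rho> b B' D p" and d: "doeblin_kernel (state B') (akern b B' \<rho>) p C \<epsilon> m \<eta> 1"
      using assms(1)[OF B'] by blast
    then interpret site_law \<rho> b B' D p by simp
    interpret Dk: doeblin_kernel "state B'" "akern b B' \<rho>" p C \<epsilon> m \<eta> 1 by (rule d)
    show ?thesis using Dk.root_survival_tendsto[of \<theta>] \<theta> by (simp add: Z_prob_eq_survival space_restrict_space)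
  qed
  have all: "(\<lambda>n. root n (Z_prob b \<rho> n \<theta>)) \<longlonglongrightarrow> eigval (akern b B \<rho>) 1" if "1 \<le> \<theta>" for \<theta>
  proof -
    have "(\<lambda>n. root n (Z_prob b \<rho> n \<theta>)) \<longlonglongrightarrow> eigval (akern b (max B \<theta>) \<rho>) 1"
      using that assms(2) by (intro lim) auto
    moreover have "eigval (akern b (max B \<theta>) \<rho>) 1 = eigval (akern b B \<rho>) 1"
      using that assms(2) by (intro LIMSEQ_unique[OF lim[of "max B \<theta>" 1] lim[of B 1]]) auto
    ultimately show ?thesis by simp
  qed
  show ?thesis
    unfolding zz_def
  proof (rule the_equality)
    show "\<forall>\<theta>\<ge>1. (\<lambda>n. root n (Z_prob b \<rho> n \<theta>)) \<longlonglongrightarrow> eigval (akern b B \<rho>) 1" using all by simp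
    show "z = eigval (akern b B \<rho>) 1" if "\<forall>\<theta>\<ge>1. (\<lambda>n. root n (Z_prob b \<rho> n \<theta>)) \<longlonglongrightarrow> z" for z
      using LIMSEQ_unique[OF that[rule_format, of 1] all[of 1]] by simp
  qed
qed

section \<open>Extinction and survival\<close>

lemma (in doeblin_family) K_apply_tendsto:
  assumes f: "eventually (\<lambda>i. f i \<in> bfun M) F" and g: "g \<in> bfun M" and lim: "uniform_limit (space M) f g F"
  shows "((\<lambda>i. K i (f i) x) \<longlongrightarrow> K\<^sub>0 g x) F"
proof (rule tendstoI)
  fix d :: real assume "0 < d"
  then have d: "0 < d / 2" by simp
  show "\<forall>\<^sub>F i in F. dist (K i (f i) x) (K\<^sub>0 g x) < d"
    using f uniform_limitD[OF lim d] uniform_limitD[OF K_uniform[OF g] d] fam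
  proof eventually_elim
    case (elim i)
    interpret Ki: doeblin_kernel M "K i" p C \<epsilon> m \<eta> x\<^sub>0 by (rule elim(4))
    have "\<bar>K i (f i) x - K i g x\<bar> \<le> d / 2"
      using elim(1,2) g by (intro Ki.K_close) (auto simp: dist_real_def less_imp_le)
    moreover have "\<bar>K i g x - K\<^sub>0 g x\<bar> < d / 2" using elim(3) by (simp add: dist_real_def)
    ultimately show ?case unfolding dist_real_def by linarith
  qed
qed

lemma (in doeblin_kernel) e_antimono: "n \<le> k \<Longrightarrow> e k \<le> e n"
  using q_nonneg q_less_1 by (auto simp: e_def intro!: power_decreasing div_le_mono)

text \<open>Here \<open>B\<close> stands for the branching number. With
  \<open>y = B * \<Lambda>\<close> the summand is \<open>y ^ j\<close> times a sequence converging
  to \<open>K h x\<close>, and this is Abel's theorem with an explicit error: the first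
  \<open>N\<close> terms are bounded crudely, the others through \<open>e N\<close>.\<close>

lemma (in doeblin_kernel) abel_sum:
  assumes b: "0 \<le> B" "B * \<Lambda> < 1"
  shows "summable (\<lambda>j. B ^ j * K (Z j) x)"
    and "\<bar>(1 - B * \<Lambda>) * (\<Sum>j. B ^ j * K (Z j) x) - K h x\<bar> \<le> 2 * C\<^sup>2 * ((1 - B * \<Lambda>) * real N + e N)"
proof -
  define y where "y = B * \<Lambda>"
  have y: "0 \<le> y" "y < 1" using b by (auto simp: y_def)
  define \<kappa> where "\<kappa> = (\<lambda>j. K (Z j) x / \<Lambda> ^ j)"
  have tm: "B ^ j * K (Z j) x = y ^ j * \<kappa> j" for j by (simp add: y_def \<kappa>_def power_mult_distrib)
  have e1: "e j \<le> 1" for j using q_nonneg q_less_1 by (simp add: e_def power_le_one)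
  have close: "\<bar>\<kappa> j - K h x\<bar> \<le> 2 * C\<^sup>2 * e j" for j
  proof -
    have "\<bar>K (\<lambda>x. (1 / \<Lambda> ^ j) * Z j x) x - K h x\<bar> \<le> 2 * C\<^sup>2 * e j"
      using h_rate by (intro K_close bfun_scale) auto
    moreover have "K (\<lambda>x. (1 / \<Lambda> ^ j) * Z j x) x = (1 / \<Lambda> ^ j) * K (Z j) x"
      by (rule fun_cong[OF K_scale[OF Z_bfun]])
    ultimately show ?thesis by (simp add: \<kappa>_def)
  qed
  have bd: "\<bar>\<kappa> j - K h x\<bar> \<le> 2 * C\<^sup>2 * ((if j < N then 1 else 0) + e N)" for j N
  proof -
    have "e j \<le> (if j < N then 1 else 0) + e N" using e1[of j] e_antimono[of N j] e_nonneg[of N] by auto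
    then show ?thesis using close[of j] C_ge_1 by (smt (verit, best) mult_left_mono zero_le_power2)
  qed
  have sy: "summable (\<lambda>j. y ^ j)" using y by (intro summable_geometric) simp
  have sd: "summable (\<lambda>j. y ^ j * (\<kappa> j - K h x))"
  proof (rule summable_comparison_test'[of "\<lambda>j. y ^ j * (2 * C\<^sup>2)" 0])
    show "summable (\<lambda>j. y ^ j * (2 * C\<^sup>2))" by (rule summable_mult2[OF sy])
    fix j
    have "\<bar>\<kappa> j - K h x\<bar> \<le> 2 * C\<^sup>2" using close[of j] mult_left_mono[OF e1[of j], of "2 * C\<^sup>2"] by simp
    then show "norm (y ^ j * (\<kappa> j - K h x)) \<le> y ^ j * (2 * C\<^sup>2)"
      using y by (simp add: abs_mult power_abs mult_left_mono)
  qed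
  have dec: "y ^ j * \<kappa> j = y ^ j * (\<kappa> j - K h x) + y ^ j * K h x" for j by (simp add: algebra_simps)
  show "summable (\<lambda>j. B ^ j * K (Z j) x)"
    unfolding tm by (subst dec) (intro summable_add sd summable_mult2 sy)
  have "(\<Sum>j. B ^ j * K (Z j) x) = (\<Sum>j. y ^ j * (\<kappa> j - K h x)) + (\<Sum>j. y ^ j * K h x)"
    unfolding tm by (subst dec) (rule suminf_add[symmetric, OF sd summable_mult2[OF sy]])
  also have "(\<Sum>j. y ^ j * K h x) = K h x / (1 - y)"
    using suminf_mult2[OF sy, of "K h x"] suminf_geometric[of y] y by simp
  finally have "(1 - y) * (\<Sum>j. B ^ j * K (Z j) x) - K h x = (1 - y) * (\<Sum>j. y ^ j * (\<kappa> j - K h x))"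
    using y by (simp add: field_simps)
  also have "\<bar>\<dots>\<bar> \<le> (1 - y) * (\<Sum>j. 2 * C\<^sup>2 * ((if j < N then 1 else 0) + y ^ j * e N))"
  proof -
    have s1: "summable (\<lambda>j. (if j < N then 1 else 0) :: real)" by (rule summable_finite[of "{..<N}"]) auto
    have s2: "summable (\<lambda>j. 2 * C\<^sup>2 * ((if j < N then 1 else 0) + y ^ j * e N))"
      by (intro summable_mult summable_add s1 summable_mult2 sy)
    have le: "\<bar>y ^ j * (\<kappa> j - K h x)\<bar> \<le> 2 * C\<^sup>2 * ((if j < N then 1 else 0) + y ^ j * e N)" for j
    proof -
      have yj: "0 \<le> y ^ j" "y ^ j \<le> 1" using y by (auto intro: power_le_one)
      have "\<bar>y ^ j * (\<kappa> j - K h x)\<bar> \<le> y ^ j * (2 * C\<^sup>2 * ((if j < N then 1 else 0) + e N))"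
        unfolding abs_mult using yj bd[of j N] by (intro mult_mono) auto
      also have "\<dots> = 2 * C\<^sup>2 * (y ^ j * (if j < N then 1 else 0) + y ^ j * e N)" by (simp add: algebra_simps)
      also have "\<dots> \<le> 2 * C\<^sup>2 * ((if j < N then 1 else 0) + y ^ j * e N)"
        using yj by (intro mult_left_mono add_right_mono) auto
      finally show ?thesis .
    qed
    have sa: "summable (\<lambda>j. \<bar>y ^ j * (\<kappa> j - K h x)\<bar>)"
      by (rule summable_comparison_test'[OF s2, of 0]) (use le in auto)
    have "\<bar>\<Sum>j. y ^ j * (\<kappa> j - K h x)\<bar> \<le> (\<Sum>j. \<bar>y ^ j * (\<kappa> j - K h x)\<bar>)" by (rule summable_rabs[OF sa])
    also have "\<dots> \<le> (\<Sum>j. 2 * C\<^sup>2 * ((if j < N then 1 else 0) + y ^ j * e N))" by (rule suminf_le[OF le sa s2])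
    finally show ?thesis using y by (simp add: abs_mult mult_left_mono)
  qed
  also have "(\<Sum>j. 2 * C\<^sup>2 * ((if j < N then 1 else 0) + y ^ j * e N)) = 2 * C\<^sup>2 * (real N + e N / (1 - y))"
  proof -
    have s1: "(\<lambda>j. (if j < N then 1 else 0) :: real) sums real N"
      using sums_finite[of "{..<N}" "\<lambda>j. if j < N then 1 else 0 :: real"] by simp
    have s2: "(\<lambda>j. y ^ j * e N) sums (1 / (1 - y) * e N)"
      using geometric_sums[of y] y by (intro sums_mult2) simp
    from sums_mult[OF sums_add[OF s1 s2], of "2 * C\<^sup>2"] show ?thesis by (simp add: sums_iff)
  qed
  also have "(1 - y) * (2 * C\<^sup>2 * (real N + e N / (1 - y))) = 2 * C\<^sup>2 * ((1 - y) * real N + e N)"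
    using y by (simp add: field_simps)
  finally show "\<bar>(1 - B * \<Lambda>) * (\<Sum>j. B ^ j * K (Z j) x) - K h x\<bar> \<le> 2 * C\<^sup>2 * ((1 - B * \<Lambda>) * real N + e N)"
    by (simp add: y_def)
qed

lemma (in doeblin_family) subcritical_mean:
  assumes b: "0 \<le> B" and crit: "B * eigval K\<^sub>0 x\<^sub>0 = 1" and sub: "eventually (\<lambda>i. B * eigval (K i) x\<^sub>0 < 1) F"
  shows "((\<lambda>i. (1 - B * eigval (K i) x\<^sub>0) * (\<Sum>j. B ^ j * K i (survival (K i) j) x)) \<longlongrightarrow> K\<^sub>0 (eigfun K\<^sub>0 x\<^sub>0) x) F"
proof (rule tendstoI)
  fix d :: real assume "0 < d"
  then have d: "0 < d / 3" by simp
  obtain N where N: "2 * C\<^sup>2 * K\<^sub>0.e N < d / 3" using rate_le[OF d] by blast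
  have "((\<lambda>i. 2 * C\<^sup>2 * ((1 - B * eigval (K i) x\<^sub>0) * real N)) \<longlongrightarrow> 2 * C\<^sup>2 * ((1 - B * eigval K\<^sub>0 x\<^sub>0) * real N)) F"
    by (intro tendsto_intros eigval_tendsto)
  then have "((\<lambda>i. 2 * C\<^sup>2 * ((1 - B * eigval (K i) x\<^sub>0) * real N)) \<longlongrightarrow> 0) F" using crit by simp
  note small = order_tendstoD(2)[OF this d]
  have "eventually (\<lambda>i. eigfun (K i) x\<^sub>0 \<in> bfun M) F"
    using fam by eventually_elim (rule doeblin_kernel.h_bfun)
  from small sub tendstoD[OF K_apply_tendsto[OF this K\<^sub>0.h_bfun eigfun_uniform] d, of x] fam
  show "\<forall>\<^sub>F i in F. dist ((1 - B * eigval (K i) x\<^sub>0) * (\<Sum>j. B ^ j * K i (survival (K i) j) x)) (K\<^sub>0 (eigfun K\<^sub>0 x\<^sub>0) x) < d"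
  proof eventually_elim
    case (elim i)
    interpret Ki: doeblin_kernel M "K i" p C \<epsilon> m \<eta> x\<^sub>0 by (rule elim(4))
    have "\<bar>(1 - B * eigval (K i) x\<^sub>0) * (\<Sum>j. B ^ j * K i (survival (K i) j) x) - K i (eigfun (K i) x\<^sub>0) x\<bar>
        \<le> 2 * C\<^sup>2 * ((1 - B * eigval (K i) x\<^sub>0) * real N) + 2 * C\<^sup>2 * K\<^sub>0.e N"
      using Ki.abel_sum(2)[OF b elim(2), of x N] by (simp add: distrib_left)
    then show ?case using elim(1,3) N unfolding dist_real_def by linarith
  qed
qed

definition branch_limit :: "nat \<Rightarrow> ((real \<Rightarrow> real) \<Rightarrow> real \<Rightarrow> real) \<Rightarrow> real \<Rightarrow> real \<Rightarrow> real \<Rightarrow> real" where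
  "branch_limit b K s v \<theta> = lim (\<lambda>n. branch_iter b K s v n \<theta>)"

text \<open>The iteration is monotone from either start, upwards from \<open>1 - s\<close> and
  downwards from 1, hence convergent; dominated convergence in the kernel gives the fixed-point
  equation.\<close>

lemma (in site_law) branch_limit:
  assumes s: "0 \<le> s" "s \<le> 1" and v: "v = 1 - s \<or> s = 1 \<and> v = 1"
  defines "u \<equiv> branch_limit b K s v"
  shows "(\<lambda>n. branch_iter b K s v n \<theta>) \<longlonglongrightarrow> u \<theta>" "u \<in> bfun (state B)" "0 \<le> u \<theta>" "u \<theta> \<le> 1"
    and "u \<theta> = 1 - s * (1 - K u \<theta>) ^ b" "1 \<le> \<theta> \<Longrightarrow> \<theta> \<le> B \<Longrightarrow> u \<theta> \<le> u B"
proof -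
  let ?V = "branch_iter b K s v"
  have v01: "0 \<le> v" "v \<le> 1" using s v by auto
  have V: "?V n \<in> bfun (state B)" "0 \<le> ?V n \<theta>" "?V n \<theta> \<le> 1" for n \<theta>
    using iter_bfun[OF s v01, of n] by auto
  show lim: "(\<lambda>n. ?V n \<theta>) \<longlonglongrightarrow> u \<theta>" for \<theta>
  proof -
    have "monoseq (\<lambda>n. ?V n \<theta>)"
      using v
    proof
      assume "v = 1 - s"
      then have "incseq (\<lambda>n. ?V n \<theta>)" by (intro incseq_SucI) (simp only: iter_increasing[OF s])
      then show ?thesis by (simp add: monoseq_iff)
    next
      assume "s = 1 \<and> v = 1"
      then have "decseq (\<lambda>n. ?V n \<theta>)" by (intro decseq_SucI) (simp only: iter_decreasing)
      then show ?thesis by (simp add: monoseq_iff)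
    qed
    moreover have "Bseq (\<lambda>n. ?V n \<theta>)" using V by (intro BseqI'[of _ 1]) auto
    ultimately have "convergent (\<lambda>n. ?V n \<theta>)" by (rule Bseq_monoseq_convergent[rotated])
    then show ?thesis by (simp add: u_def branch_limit_def convergent_LIMSEQ_iff)
  qed
  show ub: "u \<in> bfun (state B)"
    by (rule bfun_lim[OF V(1) lim, of 1]) (use V in auto)
  show "0 \<le> u \<theta>" "u \<theta> \<le> 1" for \<theta>
    using LIMSEQ_le_const[OF lim] LIMSEQ_le_const2[OF lim] V by blast+
  show "u \<theta> = 1 - s * (1 - K u \<theta>) ^ b" for \<theta>
  proof (rule LIMSEQ_unique[OF LIMSEQ_Suc[OF lim]])
    show "(\<lambda>n. ?V (Suc n) \<theta>) \<longlonglongrightarrow> 1 - s * (1 - K u \<theta>) ^ b"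
      unfolding branch_iter.simps
      by (intro tendsto_intros K_tendsto[where c = 1] V ub lim) (use V in auto)
  qed
  show "u \<theta> \<le> u B" if "1 \<le> \<theta>" "\<theta> \<le> B"
    using iter_nondecreasing[OF s v01 that(1) that(2)] by (intro LIMSEQ_le[OF lim lim]) auto
qed

text \<open>The quadratic coefficient is 1 instead of \<open>b * (b - 1) / 2\<close>, in exchange
  for the absence of a cubic error. It is thus effective on all of \<open>[0, 1]\<close>, where the
  survival probability is not yet known to be small.\<close>

lemma power_one_minus_lower:
  fixes x :: real
  assumes "0 \<le> x" "x \<le> 1" "2 \<le> b"
  shows "1 - real b * x + x\<^sup>2 \<le> (1 - x) ^ b"
  using assms(3)
proof (induction b rule: dec_induct)
  case base
  show ?case by (simp add: power2_eq_square algebra_simps)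
next
  case (step n)
  have "1 - real (Suc n) * x + x\<^sup>2 \<le> (1 - x) * (1 - real n * x + x\<^sup>2)"
  proof -
    have "x * x\<^sup>2 \<le> 1 * x\<^sup>2" using assms by (intro mult_right_mono) auto
    also have "\<dots> \<le> real n * x\<^sup>2" using step by (intro mult_right_mono) auto
    finally show ?thesis by (simp add: algebra_simps power2_eq_square)
  qed
  also have "\<dots> \<le> (1 - x) * (1 - x) ^ n" using step assms by (intro mult_left_mono) auto
  finally show ?case by simp
qed

text \<open>Applying \<nu> to \<open>g \<le> b * K g - (K g)\<^sup>2\<close> cancels the linear
  terms at criticality and leaves \<open>\<nu> ((K g)\<^sup>2) \<le> 0\<close>, whence
  \<open>\<nu> g \<le> 0\<close>. Iterating \<open>g \<le> b * K g\<close> bounds \<open>g\<close>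
  by rescaled powers of \<open>K\<close>, which tend to \<open>\<nu> g * h\<close>.\<close>

lemma extinction:
  assumes law: "site_law \<rho> b B D p" and dk: "doeblin_kernel (state B) (akern b B \<rho>) p C \<epsilon> m \<eta> 1"
    and crit: "real b * eigval (akern b B \<rho>) 1 = 1"
  shows "(\<lambda>n. branch_iter b (akern b B \<rho>) 1 1 n B) \<longlonglongrightarrow> 0"
proof -
  interpret S: site_law \<rho> b B D p by (rule law)
  interpret d: doeblin_kernel "state B" "akern b B \<rho>" p C \<epsilon> m \<eta> 1 by (rule dk)
  have sp: "space (state B) = {1..B}" by (simp add: space_restrict_space)
  define g where "g = branch_limit b S.K 1 1"
  note L = S.branch_limit[of 1 1, folded g_def, simplified]
  have g: "g \<in> bfun (state B)" "0 \<le> g \<theta>" "g \<theta> \<le> 1" for \<theta> using L(2,3,4) by auto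
  have Kg: "0 \<le> S.K g \<theta>" "S.K g \<theta> \<le> 1" for \<theta> using g by (auto intro!: S.K_unit)
  have Kgb: "S.K g \<in> bfun (state B)" using g by (auto intro: S.K_bfun)
  have le: "g \<theta> \<le> real b * S.K g \<theta> - (S.K g \<theta>)\<^sup>2" for \<theta>
    using L(5)[of \<theta>] power_one_minus_lower[OF Kg, of b \<theta>] S.b by simp
  have crit': "real b = 1 / d.\<Lambda>" using crit by (simp add: field_simps)
  have bK: "d.\<nu> (\<lambda>\<theta>. real b * S.K g \<theta>) = d.\<nu> g"
    using d.\<nu>_scale[OF Kgb, of "real b"] d.\<nu>_K[OF g(1)] crit by simp
  have "d.\<nu> g \<le> d.\<nu> (\<lambda>\<theta>. real b * S.K g \<theta> - (S.K g \<theta>)\<^sup>2)"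
    using g Kgb le by (intro d.\<nu>_mono bfun_diff bfun_scale bfun_power) auto
  also have "\<dots> = d.\<nu> g - d.\<nu> (\<lambda>\<theta>. (S.K g \<theta>)\<^sup>2)"
    using Kgb bK by (subst d.\<nu>_diff) auto
  finally have sq: "d.\<nu> (\<lambda>\<theta>. (S.K g \<theta>)\<^sup>2) \<le> 0" by simp
  have "d.\<nu> (S.K g) \<le> \<delta>" if \<delta>: "0 < \<delta>" for \<delta>
  proof -
    \<comment> \<open>Replaces Cauchy-Schwarz: a nonnegative number is either at most \<delta> or at
      most its square divided by \<delta>.\<close>
    have "S.K g \<theta> \<le> \<delta> + (1 / \<delta>) * (S.K g \<theta>)\<^sup>2" for \<theta>
    proof (cases "S.K g \<theta> \<le> \<delta>")
      case True
      have "0 \<le> (1 / \<delta>) * (S.K g \<theta>)\<^sup>2" using \<delta> by simp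
      then show ?thesis using True by linarith
    next
      case False
      then have "\<delta> * S.K g \<theta> \<le> (S.K g \<theta>)\<^sup>2" unfolding power2_eq_square using Kg by (intro mult_right_mono) auto
      then have "S.K g \<theta> \<le> (1 / \<delta>) * (S.K g \<theta>)\<^sup>2" using \<delta> by (simp add: field_simps)
      then show ?thesis using \<delta> by linarith
    qed
    then have "d.\<nu> (S.K g) \<le> d.\<nu> (\<lambda>\<theta>. \<delta> + (1 / \<delta>) * (S.K g \<theta>)\<^sup>2)"
      using Kgb by (intro d.\<nu>_mono bfun_add bfun_scale bfun_power) auto
    also have "\<dots> = \<delta> + (1 / \<delta>) * d.\<nu> (\<lambda>\<theta>. (S.K g \<theta>)\<^sup>2)"
    proof -
      have "d.\<nu> (\<lambda>\<theta>. \<delta> + (1 / \<delta>) * (S.K g \<theta>)\<^sup>2) = d.\<nu> (\<lambda>_. \<delta>) + d.\<nu> (\<lambda>\<theta>. (1 / \<delta>) * (S.K g \<theta>)\<^sup>2)"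
        by (intro d.\<nu>_add bfun_const bfun_scale bfun_power Kgb)
      then show ?thesis by (simp only: d.\<nu>_const d.\<nu>_scale[OF bfun_power[OF Kgb]])
    qed
    also have "\<dots> \<le> \<delta>" using sq \<delta> by (simp add: mult_le_0_iff divide_le_0_iff)
    finally show ?thesis .
  qed
  then have "d.\<nu> (S.K g) \<le> 0" by (rule field_le_epsilon[of _ 0, simplified])
  then have \<nu>g: "d.\<nu> g \<le> 0" using d.\<nu>_K[OF g(1)] d.\<Lambda>_pos by (simp add: mult_le_0_iff)
  have iter: "g \<theta> \<le> (S.K ^^ n) g \<theta> / d.\<Lambda> ^ n" if "\<theta> \<in> {1..B}" for n \<theta>
    using that
  proof (induction n arbitrary: \<theta>)
    case (Suc n)
    have "g \<theta> \<le> real b * S.K g \<theta>" using le[of \<theta>] by (smt (verit) zero_le_power2)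
    also have "S.K g \<theta> \<le> S.K (\<lambda>\<theta>. (1 / d.\<Lambda> ^ n) * (S.K ^^ n) g \<theta>) \<theta>"
      using Suc.IH g by (intro S.K_mono bfun_scale d.Kn_bfun) auto
    then have "real b * S.K g \<theta> \<le> real b * S.K (\<lambda>\<theta>. (1 / d.\<Lambda> ^ n) * (S.K ^^ n) g \<theta>) \<theta>" by (intro mult_left_mono) auto
    also have "\<dots> = (S.K ^^ Suc n) g \<theta> / d.\<Lambda> ^ Suc n" unfolding S.K_scale crit' by simp
    finally show ?case .
  qed simp
  have "g B \<le> 0"
  proof (rule LIMSEQ_le_const)
    have "(\<lambda>n. 4 * C\<^sup>2 * 1 * d.e n) \<longlonglongrightarrow> 4 * C\<^sup>2 * 1 * 0" by (intro tendsto_intros d.e_tendsto_0)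
    then show "(\<lambda>n. 4 * C\<^sup>2 * 1 * d.e n) \<longlonglongrightarrow> 0" by simp
    show "\<exists>N. \<forall>n\<ge>N. g B \<le> 4 * C\<^sup>2 * 1 * d.e n"
    proof (intro exI allI impI)
      fix n
      have B: "B \<in> space (state B)" using S.B by (simp add: sp)
      have "\<bar>(S.K ^^ n) g B / d.\<Lambda> ^ n - d.\<nu> g * d.h B\<bar> \<le> 4 * C\<^sup>2 * 1 * d.e n"
        using g by (intro d.Kn_rate B) auto
      moreover have "d.\<nu> g * d.h B \<le> 0" using \<nu>g d.h_pos[OF B] by (simp add: mult_le_0_iff)
      moreover have "g B \<le> (S.K ^^ n) g B / d.\<Lambda> ^ n" using S.B by (intro iter) auto
      ultimately show "g B \<le> 4 * C\<^sup>2 * 1 * d.e n" by linarith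
    qed
  qed
  then have "g B = 0" using g(2)[of B] by simp
  then show ?thesis using L(1)[of B] by simp
qed

text \<open>In probabilistic terms: either the avalanche reaches layer \<open>n\<close>, or its size
  is at most the number of sites before layer \<open>n\<close>, and
  \<open>1 - s ^ k \<le> k * (1 - s)\<close>. This transfers extinction at \<open>s = 1\<close> to
  smallness of the solution for \<open>s\<close> near 1.\<close>

lemma (in site_law) pgf_deficit_small:
  assumes s: "0 \<le> s" "s \<le> 1"
  shows "\<theta> \<in> {1..B} \<Longrightarrow> branch_limit b K s (1 - s) \<theta> \<le> branch_iter b K 1 1 n \<theta> + (\<Sum>i<n. real b ^ i) * (1 - s)"
proof (induction n arbitrary: \<theta>)
  let ?u = "branch_limit b K s (1 - s)" and ?a = "branch_iter b K 1 1"
  note L = branch_limit[OF s disjI1[OF refl]]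
  have a: "?a n \<in> bfun (state B)" "0 \<le> ?a n \<theta>" "?a n \<theta> \<le> 1" for n \<theta> using iter_bfun[of 1 1 n] by auto
  {
    case 0
    then show ?case using L(4) by simp
  next
    case (Suc n)
    define c where "c = (\<Sum>i<n. real b ^ i)"
    have c: "0 \<le> c" by (simp add: c_def sum_nonneg)
    have Ku: "0 \<le> K ?u \<theta>" "K ?u \<theta> \<le> 1" using L(2-4) by (auto intro!: K_unit)
    have Ka: "0 \<le> K (?a n) \<theta>" "K (?a n) \<theta> \<le> 1" using a by (auto intro!: K_unit)
    have "K ?u \<theta> \<le> K (\<lambda>\<theta>. ?a n \<theta> + c * (1 - s) * 1) \<theta>"
      using Suc.IH by (intro K_mono L(2) bfun_add a) (auto simp: c_def)
    also have "\<dots> = K (?a n) \<theta> + c * (1 - s) * K (\<lambda>_. 1) \<theta>"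
      using K_add[OF a(1)[of n] bfun_const, of "c * (1 - s) * 1"] K_scale[of "c * (1 - s)" "\<lambda>_. 1"] by simp
    also have "\<dots> \<le> K (?a n) \<theta> + c * (1 - s)"
      using K_one_le[of \<theta>] c s by (simp add: mult_left_le)
    finally have le: "K ?u \<theta> \<le> K (?a n) \<theta> + c * (1 - s)" .
    have pw: "(1 - K (?a n) \<theta>) ^ b - (1 - K ?u \<theta>) ^ b \<le> real b * (c * (1 - s))"
    proof (cases "K ?u \<theta> \<le> K (?a n) \<theta>")
      case True
      then have "(1 - K (?a n) \<theta>) ^ b \<le> (1 - K ?u \<theta>) ^ b" using Ka by (intro power_mono) auto
      moreover have "0 \<le> real b * (c * (1 - s))" using c s by simp
      ultimately show ?thesis by linarith
    next
      case False
      have "norm ((1 - K (?a n) \<theta>) ^ b - (1 - K ?u \<theta>) ^ b) \<le> real b * norm ((1 - K (?a n) \<theta>) - (1 - K ?u \<theta>))"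
        using Ku Ka by (intro norm_power_diff) auto
      also have "\<dots> \<le> real b * (c * (1 - s))" using le False by (intro mult_left_mono) auto
      finally show ?thesis by simp
    qed
    have "?u \<theta> = 1 - (1 - K ?u \<theta>) ^ b + (1 - s) * (1 - K ?u \<theta>) ^ b"
      using L(5)[of \<theta>] by (simp add: algebra_simps)
    also have "\<dots> \<le> 1 - (1 - K ?u \<theta>) ^ b + (1 - s)"
      using Ku s by (simp add: mult_left_le power_le_one)
    also have "\<dots> \<le> 1 - (1 - K (?a n) \<theta>) ^ b + real b * (c * (1 - s)) + (1 - s)" using pw by linarith
    also have "\<dots> = ?a (Suc n) \<theta> + (\<Sum>i<Suc n. real b ^ i) * (1 - s)"
    proof -
      have "(\<Sum>i<Suc n. real b ^ i) = 1 + real b * c"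
        unfolding c_def by (subst sum.lessThan_Suc_shift) (simp add: sum_distrib_left)
      then show ?thesis by (simp add: algebra_simps)
    qed
    finally show ?case .
  }
qed

text \<open>Along \<open>\<delta> * h\<close> the linear part of the equation gains the factor
  \<open>b * \<Lambda> > 1\<close>, which beats the quadratic loss once \<delta> is small.\<close>

lemma (in doeblin_kernel) subsolution:
  assumes b: "1 < b" and sup: "1 < real b * \<Lambda>"
  shows "\<exists>\<delta>>0. (\<forall>x\<in>space M. \<delta> * h x \<le> 1) \<and> (\<forall>x\<in>space M. \<delta> * h x \<le> 1 - (1 - K (\<lambda>x. \<delta> * h x) x) ^ b)"
proof -
  define c where "c = real b * (real b - 1) / 2"
  have b2: "2 \<le> real b" using b by simp
  have c: "0 < c" using b2 by (simp add: c_def)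
  \<comment> \<open>The first entry keeps \<open>\<delta> * h\<close> at most 1; the second makes
    \<open>c * y\<close>, the relative quadratic loss, at most \<open>b * \<Lambda> - 1\<close>.
    Both use \<open>h \<le> C\<close>.\<close>
  define \<delta> where "\<delta> = min (1 / C) ((real b * \<Lambda> - 1) / (c * C))"
  have \<delta>: "0 < \<delta>" using C_ge_1 c sup by (simp add: \<delta>_def)
  have \<Lambda>1: "\<Lambda> \<le> 1"
    using \<nu>_mono[of "K (\<lambda>_. 1)" "\<lambda>_. 1"] K_one_le K_bfun[OF bfun_const, of 1] by (simp add: eigval_def \<nu>_const)
  have \<delta>C: "\<delta> * C \<le> 1" using C_ge_1 by (simp add: \<delta>_def min_def field_simps)
  have \<delta>c: "c * (\<delta> * C) \<le> real b * \<Lambda> - 1"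
  proof -
    have "\<delta> \<le> (real b * \<Lambda> - 1) / (c * C)" by (simp add: \<delta>_def)
    then show ?thesis using c C_ge_1 by (simp add: field_simps)
  qed
  have le: "\<delta> * h x \<le> 1" if "x \<in> space M" for x
  proof -
    have "\<delta> * h x \<le> \<delta> * C" using \<delta> h_bounds(2)[OF that] by (intro mult_left_mono) auto
    then show ?thesis using \<delta>C by simp
  qed
  moreover have "\<delta> * h x \<le> 1 - (1 - K (\<lambda>x. \<delta> * h x) x) ^ b" if x: "x \<in> space M" for x
  proof -
    define y where "y = \<Lambda> * (\<delta> * h x)"
    have Kx: "K (\<lambda>x. \<delta> * h x) x = y" using K_h[OF x] by (simp add: K_scale y_def)
    have dh: "0 < \<delta> * h x" "\<delta> * h x \<le> 1" using \<delta> h_pos[OF x] le[OF x] by auto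
    have y: "0 \<le> y" "y \<le> \<delta> * h x" "y \<le> 1"
    proof -
      show "0 \<le> y" using dh by (simp add: y_def)
      show 1: "y \<le> \<delta> * h x" unfolding y_def using mult_right_mono[OF \<Lambda>1, of "\<delta> * h x"] dh by simp
      show "y \<le> 1" using 1 dh by linarith
    qed
    have "y \<le> \<delta> * C" by (rule order_trans[OF y(2) mult_left_mono[OF h_bounds(2)[OF x]]]) (use \<delta> in simp)
    then have "c * y \<le> real b * \<Lambda> - 1" using \<delta>c mult_left_mono[of y "\<delta> * C" c] c by linarith
    then have "(c * y) * y \<le> (real b * \<Lambda> - 1) * y" using y by (intro mult_right_mono) auto
    also have "\<dots> \<le> (real b * \<Lambda> - 1) * (\<delta> * h x)" using y sup by (intro mult_left_mono) auto
    finally have "\<delta> * h x \<le> real b * y - c * y\<^sup>2" by (simp add: y_def algebra_simps power2_eq_square)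
    also have "\<dots> \<le> 1 - (1 - y) ^ b" using one_minus_power_bounds(2)[OF y(1,3), of b] by (simp add: c_def)
    finally show ?thesis by (simp add: Kx)
  qed
  ultimately show ?thesis using \<delta> by blast
qed

text \<open>The iteration starts at 1, above the subsolution, and monotonicity of the step keeps it
  above.\<close>

lemma survival_positive:
  assumes law: "site_law \<rho> b B D p" and dk: "doeblin_kernel (state B) (akern b B \<rho>) p C \<epsilon> m \<eta> 1"
    and sup: "1 < real b * eigval (akern b B \<rho>) 1"
  shows "0 < branch_limit b (akern b B \<rho>) 1 1 B"
proof -
  interpret S: site_law \<rho> b B D p by (rule law)
  interpret d: doeblin_kernel "state B" "akern b B \<rho>" p C \<epsilon> m \<eta> 1 by (rule dk)
  have sp: "space (state B) = {1..B}" by (simp add: space_restrict_space)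
  obtain \<delta> where \<delta>: "0 < \<delta>" "\<And>x. x \<in> {1..B} \<Longrightarrow> \<delta> * d.h x \<le> 1"
    "\<And>x. x \<in> {1..B} \<Longrightarrow> \<delta> * d.h x \<le> 1 - (1 - S.K (\<lambda>x. \<delta> * d.h x) x) ^ b"
    using d.subsolution[OF S.b sup] by (auto simp: sp)
  have dh0: "0 \<le> \<delta> * d.h x" if "x \<in> {1..B}" for x using \<delta>(1) d.h_pos[of x] that by (simp add: sp)
  have "\<delta> * d.h x \<le> branch_iter b S.K 1 1 n x" if "x \<in> {1..B}" for n x
    using that
  proof (induction n arbitrary: x)
    case (Suc n)
    have i: "branch_iter b S.K 1 1 n \<in> bfun (state B)" "\<And>\<theta>. 0 \<le> branch_iter b S.K 1 1 n \<theta> \<and> branch_iter b S.K 1 1 n \<theta> \<le> 1"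
      using S.iter_bfun[of 1 1 n] by auto
    have "1 - 1 * (1 - S.K (\<lambda>x. \<delta> * d.h x) x) ^ b \<le> 1 - 1 * (1 - S.K (branch_iter b S.K 1 1 n) x) ^ b"
      using Suc.IH i by (intro S.branch_step_mono bfun_scale) auto
    then show ?case using \<delta>(3)[OF Suc.prems] by simp
  qed (use \<delta> in simp)
  then have "\<delta> * d.h B \<le> branch_limit b S.K 1 1 B"
    using S.B by (intro LIMSEQ_le_const[OF S.branch_limit(1)[of 1 1]]) auto
  moreover have "0 < \<delta> * d.h B" using \<delta>(1) d.h_pos[of B] S.B by (simp add: sp)
  ultimately show ?thesis by linarith
qed

text \<open>The error obeys \<open>c' = b * (c + k)\<close>: the kernel passes \<open>c\<close> on,
  the change of law adds \<open>k\<close>, and the \<open>b\<close>-th power multiplies by at most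
  \<open>b\<close>. Growth in \<open>n\<close> is harmless because \<open>n\<close> is fixed before
  the law varies.\<close>

lemma iter_perturbation:
  assumes law: "site_law \<rho> b B D p" and law': "site_law \<rho>' b B D p"
    and close: "\<And>f c x. f \<in> bfun (state B) \<Longrightarrow> (\<And>x. x \<in> space (state B) \<Longrightarrow> \<bar>f x\<bar> \<le> c) \<Longrightarrow> \<bar>akern b B \<rho>' f x - akern b B \<rho> f x\<bar> \<le> k * c"
  shows "\<theta> \<in> {1..B} \<Longrightarrow> \<bar>branch_iter b (akern b B \<rho>') 1 1 n \<theta> - branch_iter b (akern b B \<rho>) 1 1 n \<theta>\<bar> \<le> (\<Sum>i<n. real b ^ Suc i) * k"
proof (induction n arbitrary: \<theta>)
  interpret S: site_law \<rho> b B D p by (rule law)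
  interpret S': site_law \<rho>' b B D p by (rule law')
  let ?a = "branch_iter b S.K 1 1" and ?a' = "branch_iter b S'.K 1 1"
  have a: "?a n \<in> bfun (state B)" "0 \<le> ?a n \<theta>" "?a n \<theta> \<le> 1" for n \<theta> using S.iter_bfun[of 1 1 n] by auto
  have a': "?a' n \<in> bfun (state B)" "0 \<le> ?a' n \<theta>" "?a' n \<theta> \<le> 1" for n \<theta> using S'.iter_bfun[of 1 1 n] by auto
  {
    case 0
    then show ?case by simp
  next
    case (Suc n)
    define c where "c = (\<Sum>i<n. real b ^ Suc i) * k"
    have Ka: "0 \<le> S.K (?a n) \<theta>" "S.K (?a n) \<theta> \<le> 1" using a by (auto intro!: S.K_unit)
    have Ka': "0 \<le> S'.K (?a' n) \<theta>" "S'.K (?a' n) \<theta> \<le> 1" using a' by (auto intro!: S'.K_unit)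
    have db: "(\<lambda>x. ?a' n x - ?a n x) \<in> bfun (state B)" using a a' by (intro bfun_diff) auto
    have c0: "0 \<le> c" using Suc.IH[of 1] S.B unfolding c_def by (smt (verit) atLeastAtMost_iff)
    have "\<bar>S'.K (\<lambda>x. ?a' n x - ?a n x) \<theta>\<bar> \<le> c"
      using Suc.IH c0 by (intro S'.K_abs_le db) (auto simp: c_def)
    moreover have "S'.K (\<lambda>x. ?a' n x - ?a n x) \<theta> = S'.K (?a' n) \<theta> - S'.K (?a n) \<theta>"
      using fun_cong[OF S'.K_add[OF a'(1)[of n] bfun_scale[OF a(1)[of n], of "-1"]], of \<theta>]
        fun_cong[OF S'.K_scale[of "-1" "?a n"], of \<theta>] by simp
    moreover have "\<bar>S'.K (?a n) \<theta> - S.K (?a n) \<theta>\<bar> \<le> k * 1"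
      by (rule close) (use a in auto)
    ultimately have d: "\<bar>S'.K (?a' n) \<theta> - S.K (?a n) \<theta>\<bar> \<le> c + k" by linarith
    have "norm ((1 - S.K (?a n) \<theta>) ^ b - (1 - S'.K (?a' n) \<theta>) ^ b) \<le> real b * norm ((1 - S.K (?a n) \<theta>) - (1 - S'.K (?a' n) \<theta>))"
      using Ka Ka' by (intro norm_power_diff) auto
    also have "\<dots> \<le> real b * (c + k)" using d by (intro mult_left_mono) (auto simp: abs_minus_commute)
    finally have "\<bar>?a' (Suc n) \<theta> - ?a (Suc n) \<theta>\<bar> \<le> real b * (c + k)" by simp
    also have "\<dots> = (\<Sum>i<Suc n. real b ^ Suc i) * k"
    proof -
      have "(\<Sum>i<Suc n. real b ^ Suc i) = real b + real b * (\<Sum>i<n. real b ^ Suc i)"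
        by (subst sum.lessThan_Suc_shift) (simp add: sum_distrib_left)
      then show ?thesis by (simp add: c_def algebra_simps)
    qed
    finally show ?case .
  }
qed

section \<open>The three regimes\<close>

text \<open>Shows that \<open>K h\<close> is positive wherever \<open>K 1\<close> is, also off the
  type space.\<close>

lemma (in doeblin_kernel) K_one_le_K_h: "K (\<lambda>_. 1) x \<le> C * K h x"
proof -
  have "K (\<lambda>_. 1 / C) x \<le> K h x" using h_bounds(1) by (intro K_mono) auto
  then show ?thesis using K_const[of "1 / C" x] C_ge_1 by (simp add: field_simps)
qed

lemma (in doeblin_kernel) h_square_pos: "0 < \<nu> (\<lambda>x. (h x)\<^sup>2)"
proof -
  have "\<nu> (\<lambda>_. (1 / C)\<^sup>2) \<le> \<nu> (\<lambda>x. (h x)\<^sup>2)"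
    using h_bounds(1) C_ge_1 by (intro \<nu>_mono bfun_power bfun_const h_bfun power_mono) auto
  moreover have "0 < (1 / C)\<^sup>2" using C_ge_1 by simp
  ultimately show ?thesis unfolding \<nu>_const by (rule less_le_trans[rotated])
qed

text \<open>First \<open>n\<close> makes \<open>a n\<close> small, then the filter makes
  \<open>r n\<close> small. With \<open>a n\<close> the critical probability of reaching layer
  \<open>n\<close>, this turns extinction into smallness of the nearby solutions.\<close>

lemma tendsto_zero_double:
  fixes U :: "'a \<Rightarrow> real"
  assumes a: "a \<longlonglongrightarrow> 0" and r: "\<And>n :: nat. (r n \<longlongrightarrow> 0) F"
    and U: "\<And>n. eventually (\<lambda>i. 0 \<le> U i \<and> U i \<le> a n + r n i) F"
  shows "(U \<longlongrightarrow> 0) F"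
proof (rule tendstoI)
  fix d :: real assume "0 < d"
  then have d: "0 < d / 2" by simp
  obtain n where n: "a n < d / 2"
    using eventually_happens[OF order_tendstoD(2)[OF a d]] by auto
  from order_tendstoD(2)[OF r[of n] d] U[of n] show "\<forall>\<^sub>F i in F. dist (U i) 0 < d"
    by eventually_elim (use n in \<open>simp add: dist_real_def\<close>)
qed

lemma mixture_family:
  assumes "1 < b" "2 \<le> B" "\<rho> \<in> M_flat b" "\<rho>' \<in> M_flat b"
  obtains D p C \<epsilon> m \<eta> where "site_law \<rho> b B D p"
    and "doeblin_family (state B) (akern b B \<rho>) p C \<epsilon> m \<eta> 1 (\<lambda>\<alpha>. akern b B (mixture \<alpha> \<rho>' \<rho>)) (at_right 0) (\<lambda>\<alpha>. 2 * \<alpha>)"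
    and "\<forall>\<alpha>\<in>{0<..1/2}. site_law (mixture \<alpha> \<rho>' \<rho>) b B D p \<and>
       doeblin_kernel (state B) (akern b B (mixture \<alpha> \<rho>' \<rho>)) p C \<epsilon> m \<eta> 1 \<and>
       (\<forall>f\<in>bfun (state B). \<forall>c. (\<forall>x\<in>space (state B). \<bar>f x\<bar> \<le> c) \<longrightarrow>
          (\<forall>x. \<bar>akern b B (mixture \<alpha> \<rho>' \<rho>) f x - akern b B \<rho> f x\<bar> \<le> (2 * \<alpha>) * c))"
proof -
  obtain D p C \<epsilon> m \<eta> where l: "site_law \<rho> b B D p" and d: "doeblin_kernel (state B) (akern b B \<rho>) p C \<epsilon> m \<eta> 1"
    and f: "\<forall>\<alpha>\<in>{0<..1/2}. site_law (mixture \<alpha> \<rho>' \<rho>) b B D p \<and>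
       doeblin_kernel (state B) (akern b B (mixture \<alpha> \<rho>' \<rho>)) p C \<epsilon> m \<eta> 1 \<and>
       (\<forall>f\<in>bfun (state B). \<forall>c. (\<forall>x\<in>space (state B). \<bar>f x\<bar> \<le> c) \<longrightarrow>
          (\<forall>x. \<bar>akern b B (mixture \<alpha> \<rho>' \<rho>) f x - akern b B \<rho> f x\<bar> \<le> (2 * \<alpha>) * c))"
    using uniform_family[OF assms] by - ((erule exE)+, (erule conjE)+, rule that)
  have ev: "\<forall>\<^sub>F \<alpha> in at_right 0. \<alpha> \<in> {0<..1/2::real}"
    by (rule eventually_mono[OF eventually_at_right_real[of 0 "1/2"]]) auto
  have fam: "doeblin_family (state B) (akern b B \<rho>) p C \<epsilon> m \<eta> 1 (\<lambda>\<alpha>. akern b B (mixture \<alpha> \<rho>' \<rho>)) (at_right 0) (\<lambda>\<alpha>. 2 * \<alpha>)"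
  proof (intro doeblin_family.intro d doeblin_family_axioms.intro)
    show "\<forall>\<^sub>F \<alpha> in at_right 0. doeblin_kernel (state B) (akern b B (mixture \<alpha> \<rho>' \<rho>)) p C \<epsilon> m \<eta> 1"
      using ev by eventually_elim (use f in blast)
    show "\<forall>\<^sub>F \<alpha> in at_right 0. \<forall>f\<in>bfun (state B). \<forall>c. (\<forall>x\<in>space (state B). \<bar>f x\<bar> \<le> c) \<longrightarrow>
          (\<forall>x. \<bar>akern b B (mixture \<alpha> \<rho>' \<rho>) f x - akern b B \<rho> f x\<bar> \<le> (2 * \<alpha>) * c)"
      using ev by eventually_elim (use f in blast)
    show "((\<lambda>\<alpha>::real. 2 * \<alpha>) \<longlongrightarrow> 0) (at_right 0)" by (auto intro!: tendsto_eq_intros)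
  qed
  show thesis
    by (rule that[OF l fam f])
qed

lemma zz_mixture_eigval:
  assumes "1 < b" "2 \<le> B" "\<rho> \<in> M_flat b" "\<rho>' \<in> M_flat b" "\<alpha> \<in> {0<..1/2}"
  shows "zz b (mixture \<alpha> \<rho>' \<rho>) = eigval (akern b B (mixture \<alpha> \<rho>' \<rho>)) 1"
proof (rule zz_eq_eigval[OF _ assms(2)])
  fix B :: real assume "2 \<le> B"
  from uniform_family[OF assms(1) this assms(3,4)] assms(5)
  show "\<exists>D p C \<epsilon> m \<eta>. site_law (mixture \<alpha> \<rho>' \<rho>) b B D p \<and> doeblin_kernel (state B) (akern b B (mixture \<alpha> \<rho>' \<rho>)) p C \<epsilon> m \<eta> 1"
    by blast
qed

lemma zz_M_flat_eigval:
  assumes "1 < b" "2 \<le> B" "\<rho> \<in> M_flat b"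
  shows "zz b \<rho> = eigval (akern b B \<rho>) 1"
proof (rule zz_eq_eigval[OF _ assms(2)])
  fix B :: real assume "2 \<le> B"
  from uniform_family[OF assms(1) this assms(3,3)]
  show "\<exists>D p C \<epsilon> m \<eta>. site_law \<rho> b B D p \<and> doeblin_kernel (state B) (akern b B \<rho>) p C \<epsilon> m \<eta> 1"
    by blast
qed

text \<open>The kernel mass at \<open>b v\<close> is the probability that the root topples; for
  \<open>v > 1 - x_star \<rho>\<close> it dominates the mass of some charged interval
  \<open>[y, 1]\<close> with \<open>y > 1 - v\<close>.\<close>

lemma kernel_mass_pos:
  assumes "\<rho> \<in> M_flat b" "site_law \<rho> b B D p" and v: "1 - x_star \<rho> < v" "v \<le> B - 1"
  shows "0 < akern b B \<rho> (\<lambda>_. 1) (real b * v)"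
proof -
  interpret S: site_law \<rho> b B D p by fact
  have "measure \<rho> {0..1} = 1" using assms(1) by (simp add: M_flat_def measure_def)
  then have ne: "{y \<in> {0..1}. measure \<rho> {y..1} > 0} \<noteq> {}"
    by (intro ex_in_conv[THEN iffD1] exI[of _ 0]) simp
  have lt: "1 - v < Sup {y \<in> {0..1}. measure \<rho> {y..1} > 0}" using v(1) by (simp add: x_star_def)
  from less_cSupD[OF ne lt] obtain y where y: "1 - v < y" "0 < measure \<rho> {y..1}" by auto
  have "measure \<rho> {y..1} = (\<integral>x. indicator {y..1} x \<partial>\<rho>)" by simp
  also have "\<dots> \<le> (\<integral>x. indicator {1..B} (x + v) * 1 \<partial>\<rho>)"
  proof (rule integral_mono)
    show "integrable \<rho> (\<lambda>x. indicator {1..B} (x + v) * 1 :: real)"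
      by (rule S.integrand_integrable[OF bfun_const])
    show "integrable \<rho> (indicator {y..1} :: real \<Rightarrow> real)" by (simp add: S.emeasure_eq_measure)
  qed (use y(1) v(2) in \<open>simp add: indicator_def\<close>)
  also have "\<dots> = akern b B \<rho> (\<lambda>_. 1) (real b * v)" using S.b by (simp add: akern_def)
  finally show ?thesis using y(2) by linarith
qed

lemma x_star_le_1: "\<rho> \<in> M_flat b \<Longrightarrow> x_star \<rho> \<le> 1"
proof -
  assume "\<rho> \<in> M_flat b"
  then have "measure \<rho> {0..1} = 1" by (simp add: M_flat_def measure_def)
  then have "{y \<in> {0..1}. measure \<rho> {y..1} > 0} \<noteq> {}"
    by (intro ex_in_conv[THEN iffD1] exI[of _ 0]) simp
  then show ?thesis unfolding x_star_def by (rule cSup_least) simp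
qed

text \<open>The constant arises from
  \<open>k / (1 - b * \<Lambda>) = (k / b) / (1 / b - \<Lambda>)\<close>.\<close>

lemma subcritical_asymptotics:
  assumes b: "1 < b" and B: "2 \<le> B" and \<rho>: "\<rho> \<in> M_flat b" "\<rho>' \<in> M_flat b"
    and crit: "zz b \<rho> = 1 / real b" and sub: "\<And>\<alpha>. \<alpha> \<in> {0<..1/2} \<Longrightarrow> zz b (mixture \<alpha> \<rho>' \<rho>) < 1 / real b"
    and v: "0 \<le> v" "v \<le> B - 1"
  defines "k \<equiv> akern b B \<rho> (eigfun (akern b B \<rho>) 1) (real b * v)"
  assumes k: "0 < k"
  shows "\<forall>\<^sub>F \<alpha> in at_right 0. (\<integral>\<^sup>+x. avalanche_size b v x \<partial>tree_law b (mixture \<alpha> \<rho>' \<rho>)) < \<infinity>"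
    and "(\<lambda>\<alpha>. enn2real (\<integral>\<^sup>+x. avalanche_size b v x \<partial>tree_law b (mixture \<alpha> \<rho>' \<rho>)))
      \<sim>[at_right 0] (\<lambda>\<alpha>. k / real b / (1 / real b - zz b (mixture \<alpha> \<rho>' \<rho>)))"
proof -
  obtain D p C \<epsilon> m \<eta> where law: "site_law \<rho> b B D p"
    and fam: "doeblin_family (state B) (akern b B \<rho>) p C \<epsilon> m \<eta> 1 (\<lambda>\<alpha>. akern b B (mixture \<alpha> \<rho>' \<rho>)) (at_right 0) (\<lambda>\<alpha>. 2 * \<alpha>)"
    and f: "\<forall>\<alpha>\<in>{0<..1/2}. site_law (mixture \<alpha> \<rho>' \<rho>) b B D p \<and>
       doeblin_kernel (state B) (akern b B (mixture \<alpha> \<rho>' \<rho>)) p C \<epsilon> m \<eta> 1 \<and>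
       (\<forall>f\<in>bfun (state B). \<forall>c. (\<forall>x\<in>space (state B). \<bar>f x\<bar> \<le> c) \<longrightarrow>
          (\<forall>x. \<bar>akern b B (mixture \<alpha> \<rho>' \<rho>) f x - akern b B \<rho> f x\<bar> \<le> (2 * \<alpha>) * c))"
    by (rule mixture_family[OF b B \<rho>])
  have law': "site_law (mixture \<alpha> \<rho>' \<rho>) b B D p"
    and dk: "doeblin_kernel (state B) (akern b B (mixture \<alpha> \<rho>' \<rho>)) p C \<epsilon> m \<eta> 1"
    if "\<alpha> \<in> {0<..1/2}" for \<alpha>
    using f that by auto
  interpret fam: doeblin_family "state B" "akern b B \<rho>" p C \<epsilon> m \<eta> 1 "\<lambda>\<alpha>. akern b B (mixture \<alpha> \<rho>' \<rho>)" "at_right 0" "\<lambda>\<alpha>. 2 * \<alpha>"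
    by (rule fam)
  define K where "K = (\<lambda>\<alpha>. akern b B (mixture \<alpha> \<rho>' \<rho>))"
  define G where "G = (\<lambda>\<alpha>. \<Sum>j. real b ^ j * K \<alpha> (survival (K \<alpha>) j) (real b * v))"
  have ev: "\<forall>\<^sub>F \<alpha> in at_right 0. \<alpha> \<in> {0<..1/2::real}"
    by (rule eventually_mono[OF eventually_at_right_real[of 0 "1/2"]]) auto
  have zz: "zz b (mixture \<alpha> \<rho>' \<rho>) = eigval (K \<alpha>) 1" if "\<alpha> \<in> {0<..1/2}" for \<alpha>
    unfolding K_def by (rule zz_mixture_eigval[OF b B \<rho> that])
  have sub': "real b * eigval (K \<alpha>) 1 < 1" if "\<alpha> \<in> {0<..1/2}" for \<alpha>
    using sub[OF that] zz[OF that] b by (simp add: field_simps)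
  have mean: "(\<integral>\<^sup>+x. avalanche_size b v x \<partial>tree_law b (mixture \<alpha> \<rho>' \<rho>)) = ennreal (G \<alpha>) \<and> 0 \<le> G \<alpha>"
    if \<alpha>: "\<alpha> \<in> {0<..1/2}" for \<alpha>
  proof -
    interpret S: site_law "mixture \<alpha> \<rho>' \<rho>" b B D p by (rule law'[OF \<alpha>])
    interpret d: doeblin_kernel "state B" "akern b B (mixture \<alpha> \<rho>' \<rho>)" p C \<epsilon> m \<eta> 1 by (rule dk[OF \<alpha>])
    define t where "t = (\<lambda>j. real b ^ j * S.K (survival S.K j) (real b * v))"
    have st: "summable t" using d.abel_sum(1)[of "real b" "real b * v"] sub'[OF \<alpha>] by (simp add: t_def K_def)
    have t0: "0 \<le> t j" for j
      unfolding t_def by (intro mult_nonneg_nonneg S.K_nonneg d.Z_bfun) (auto intro!: less_imp_le d.Z_pos simp: space_restrict_space)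
    have "(\<lambda>n. ennreal (\<Sum>j\<le>n. t j)) \<longlonglongrightarrow> (SUP n. ennreal (\<Sum>j\<le>n. t j))"
      by (rule LIMSEQ_SUP) (use t0 in \<open>auto intro!: incseq_SucI ennreal_leI\<close>)
    moreover have "(\<lambda>n. ennreal (\<Sum>j\<le>n. t j)) \<longlonglongrightarrow> ennreal (suminf t)"
      using summable_LIMSEQ'[OF st] by (rule tendsto_ennrealI)
    ultimately have "(SUP n. ennreal (\<Sum>j\<le>n. t j)) = ennreal (suminf t)" by (rule LIMSEQ_unique)
    then show ?thesis
      using S.mean_avalanche_size[OF v] suminf_nonneg[OF st t0] by (simp add: t_def G_def K_def)
  qed
  show "\<forall>\<^sub>F \<alpha> in at_right 0. (\<integral>\<^sup>+x. avalanche_size b v x \<partial>tree_law b (mixture \<alpha> \<rho>' \<rho>)) < \<infinity>"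
    using ev by eventually_elim (simp add: mean)
  have "((\<lambda>\<alpha>. (1 - real b * eigval (K \<alpha>) 1) * G \<alpha>) \<longlongrightarrow> k) (at_right 0)"
    unfolding G_def K_def k_def
  proof (rule fam.subcritical_mean)
    show "real b * eigval (akern b B \<rho>) 1 = 1" using zz_M_flat_eigval[OF b B \<rho>(1)] crit b by (simp add: field_simps)
    show "\<forall>\<^sub>F i in at_right 0. real b * eigval (akern b B (mixture i \<rho>' \<rho>)) 1 < 1"
      using ev by eventually_elim (use sub' in \<open>simp add: K_def\<close>)
  qed simp
  from tendsto_divide[OF this tendsto_const[of k]] k
  have lim: "((\<lambda>\<alpha>. (1 - real b * eigval (K \<alpha>) 1) * G \<alpha> / k) \<longlongrightarrow> 1) (at_right 0)" by simp
  show "(\<lambda>\<alpha>. enn2real (\<integral>\<^sup>+x. avalanche_size b v x \<partial>tree_law b (mixture \<alpha> \<rho>' \<rho>)))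
      \<sim>[at_right 0] (\<lambda>\<alpha>. k / real b / (1 / real b - zz b (mixture \<alpha> \<rho>' \<rho>)))"
  proof (rule asymp_equivI', rule Lim_transform_eventually[OF lim])
    show "\<forall>\<^sub>F \<alpha> in at_right 0. (1 - real b * eigval (K \<alpha>) 1) * G \<alpha> / k =
      enn2real (\<integral>\<^sup>+x. avalanche_size b v x \<partial>tree_law b (mixture \<alpha> \<rho>' \<rho>)) / (k / real b / (1 / real b - zz b (mixture \<alpha> \<rho>' \<rho>)))"
      using ev
    proof eventually_elim
      case (elim \<alpha>)
      show ?case using mean[OF elim] zz[OF elim] sub'[OF elim] k b by (simp add: field_simps)
    qed
  qed
qed

text \<open>For \<open>s = 1\<close> the expansion reads
  \<open>(b * L - 1) / n \<rightarrow> c\<close>, and the survival probability is \<open>K u\<close>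
  at \<open>b v\<close>, asymptotically \<open>n * k\<close>. So it behaves like
  \<open>(b * L - 1) * k / c\<close>, which is \<open>(L - 1 / b) * (b * k / c)\<close>.\<close>

lemma supercritical_asymptotics:
  assumes b: "1 < b" and B: "2 \<le> B" and \<rho>: "\<rho> \<in> M_flat b" "\<rho>' \<in> M_flat b"
    and crit: "zz b \<rho> = 1 / real b" and sup: "\<And>\<alpha>. \<alpha> \<in> {0<..1/2} \<Longrightarrow> 1 / real b < zz b (mixture \<alpha> \<rho>' \<rho>)"
    and v: "0 \<le> v" "v \<le> B - 1"
  defines "k \<equiv> akern b B \<rho> (eigfun (akern b B \<rho>) 1) (real b * v)"
    and "c \<equiv> real b * (real b - 1) / 2 * (1 / real b)\<^sup>2 * qsd (akern b B \<rho>) 1 (\<lambda>x. (eigfun (akern b B \<rho>) 1 x)\<^sup>2)"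
  assumes k: "0 < k"
  shows "(\<lambda>\<alpha>. \<P>(x in tree_law b (mixture \<alpha> \<rho>' \<rho>). avalanche_size b v x = \<infinity>))
      \<sim>[at_right 0] (\<lambda>\<alpha>. (zz b (mixture \<alpha> \<rho>' \<rho>) - 1 / real b) * (real b * k / c))"
proof -
  obtain D p C \<epsilon> m \<eta> where law: "site_law \<rho> b B D p"
    and fam: "doeblin_family (state B) (akern b B \<rho>) p C \<epsilon> m \<eta> 1 (\<lambda>\<alpha>. akern b B (mixture \<alpha> \<rho>' \<rho>)) (at_right 0) (\<lambda>\<alpha>. 2 * \<alpha>)"
    and f: "\<forall>\<alpha>\<in>{0<..1/2}. site_law (mixture \<alpha> \<rho>' \<rho>) b B D p \<and>
       doeblin_kernel (state B) (akern b B (mixture \<alpha> \<rho>' \<rho>)) p C \<epsilon> m \<eta> 1 \<and>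
       (\<forall>f\<in>bfun (state B). \<forall>c. (\<forall>x\<in>space (state B). \<bar>f x\<bar> \<le> c) \<longrightarrow>
          (\<forall>x. \<bar>akern b B (mixture \<alpha> \<rho>' \<rho>) f x - akern b B \<rho> f x\<bar> \<le> (2 * \<alpha>) * c))"
    by (rule mixture_family[OF b B \<rho>])
  have law': "site_law (mixture \<alpha> \<rho>' \<rho>) b B D p"
    and dk: "doeblin_kernel (state B) (akern b B (mixture \<alpha> \<rho>' \<rho>)) p C \<epsilon> m \<eta> 1"
    if "\<alpha> \<in> {0<..1/2}" for \<alpha>
    using f that by auto
  interpret fam: doeblin_family "state B" "akern b B \<rho>" p C \<epsilon> m \<eta> 1 "\<lambda>\<alpha>. akern b B (mixture \<alpha> \<rho>' \<rho>)" "at_right 0" "\<lambda>\<alpha>. 2 * \<alpha>"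
    by (rule fam)
  have d0: "doeblin_kernel (state B) (akern b B \<rho>) p C \<epsilon> m \<eta> 1" by unfold_locales
  have sp: "space (state B) = {1..B}" by (simp add: space_restrict_space)
  define K where "K = (\<lambda>\<alpha>. akern b B (mixture \<alpha> \<rho>' \<rho>))"
  define L where "L = (\<lambda>\<alpha>. eigval (K \<alpha>) 1)"
  define u where "u = (\<lambda>\<alpha>. branch_limit b (K \<alpha>) 1 1)"
  define n where "n = (\<lambda>\<alpha>. qsd (K \<alpha>) 1 (u \<alpha>))"
  have ev: "\<forall>\<^sub>F \<alpha> in at_right 0. \<alpha> \<in> {0<..1/2::real}"
    by (rule eventually_mono[OF eventually_at_right_real[of 0 "1/2"]]) auto
  have zz: "zz b (mixture \<alpha> \<rho>' \<rho>) = L \<alpha>" if "\<alpha> \<in> {0<..1/2}" for \<alpha>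
    unfolding L_def K_def by (rule zz_mixture_eigval[OF b B \<rho> that])
  have sup': "1 < real b * L \<alpha>" if "\<alpha> \<in> {0<..1/2}" for \<alpha>
    using sup[OF that] zz[OF that] b by (simp add: field_simps)
  have crit': "real b * eigval (akern b B \<rho>) 1 = 1"
    using zz_M_flat_eigval[OF b B \<rho>(1)] crit b by (simp add: field_simps)
  have u: "u \<alpha> \<in> bfun (state B)" "0 \<le> u \<alpha> \<theta>" "u \<alpha> \<theta> = 1 - 1 * (1 - K \<alpha> (u \<alpha>) \<theta>) ^ b"
      "\<theta> \<in> {1..B} \<Longrightarrow> u \<alpha> \<theta> \<le> u \<alpha> B" "0 < u \<alpha> B"
    and P: "\<P>(x in tree_law b (mixture \<alpha> \<rho>' \<rho>). avalanche_size b v x = \<infinity>) = K \<alpha> (u \<alpha>) (real b * v)"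
    and decr: "u \<alpha> B \<le> branch_iter b (K \<alpha>) 1 1 N B"
    if \<alpha>: "\<alpha> \<in> {0<..1/2}" for \<alpha> \<theta> N
  proof -
    interpret S: site_law "mixture \<alpha> \<rho>' \<rho>" b B D p by (rule law'[OF \<alpha>])
    show "u \<alpha> \<in> bfun (state B)" "0 \<le> u \<alpha> \<theta>" "u \<alpha> \<theta> = 1 - 1 * (1 - K \<alpha> (u \<alpha>) \<theta>) ^ b"
      "\<theta> \<in> {1..B} \<Longrightarrow> u \<alpha> \<theta> \<le> u \<alpha> B"
      using S.branch_limit(2)[of 1 1] S.branch_limit(3-6)[of 1 1 \<theta>] by (auto simp: u_def K_def)
    show "0 < u \<alpha> B" using survival_positive[OF law'[OF \<alpha>] dk[OF \<alpha>]] sup'[OF \<alpha>] by (simp add: u_def K_def L_def)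
    have i: "branch_iter b S.K 1 1 n \<in> bfun (state B)" "\<And>\<theta>. 0 \<le> branch_iter b S.K 1 1 n \<theta> \<and> branch_iter b S.K 1 1 n \<theta> \<le> 1" for n
      using S.iter_bfun[of 1 1 n] by auto
    have "(\<lambda>n. S.K (branch_iter b S.K 1 1 n) (real b * v)) \<longlonglongrightarrow> S.K (branch_limit b S.K 1 1) (real b * v)"
      using i S.branch_limit(1,2)[of 1 1] by (intro S.K_tendsto[where c = 1]) auto
    from LIMSEQ_unique[OF S.prob_avalanche_infinite[OF v] this]
    show "\<P>(x in tree_law b (mixture \<alpha> \<rho>' \<rho>). avalanche_size b v x = \<infinity>) = K \<alpha> (u \<alpha>) (real b * v)"
      by (simp add: u_def K_def)
    have "decseq (\<lambda>n. branch_iter b S.K 1 1 n B)" by (intro decseq_SucI S.iter_decreasing)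
    from decseq_ge[OF this S.branch_limit(1)[of 1 1]]
    show "u \<alpha> B \<le> branch_iter b (K \<alpha>) 1 1 N B" by (simp add: u_def K_def)
  qed
  \<comment> \<open>The expansion presupposes small solutions. Survival is at most the probability
    of reaching layer \<open>N\<close>, which is near the critical one for small \<alpha>, and that
    one tends to 0 with \<open>N\<close>.\<close>
  have U0: "((\<lambda>\<alpha>. u \<alpha> B) \<longlongrightarrow> 0) (at_right 0)"
  proof (rule tendsto_zero_double[OF extinction[OF law d0 crit']])
    show "((\<lambda>\<alpha>::real. (\<Sum>i<N. real b ^ Suc i) * (2 * \<alpha>)) \<longlongrightarrow> 0) (at_right 0)" for N
      by (auto intro!: tendsto_eq_intros)
    fix N
    show "\<forall>\<^sub>F \<alpha> in at_right 0. 0 \<le> u \<alpha> B \<and> u \<alpha> B \<le> branch_iter b (akern b B \<rho>) 1 1 N B + (\<Sum>i<N. real b ^ Suc i) * (2 * \<alpha>)"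
      using ev
    proof eventually_elim
      case (elim \<alpha>)
      have "\<bar>branch_iter b (K \<alpha>) 1 1 N B - branch_iter b (akern b B \<rho>) 1 1 N B\<bar> \<le> (\<Sum>i<N. real b ^ Suc i) * (2 * \<alpha>)"
        unfolding K_def using B by (intro iter_perturbation[OF law law'[OF elim]]) (use f elim in auto)
      then show ?case using decr[OF elim, of N] u(2)[OF elim, of B] by linarith
    qed
  qed
  have e1: "\<forall>\<^sub>F \<alpha> in at_right 0. 1 \<le> real b * eigval (akern b B (mixture \<alpha> \<rho>' \<rho>)) 1"
    using ev by eventually_elim (use sup' in \<open>auto simp: L_def K_def less_imp_le\<close>)
  have e2: "\<forall>\<^sub>F \<alpha> in at_right 0. (0::real) \<le> 1 \<and> (1::real) \<le> 1" by simp
  have e3: "\<forall>\<^sub>F \<alpha> in at_right 0. u \<alpha> \<in> bfun (state B) \<and> (\<forall>x\<in>space (state B). 0 \<le> u \<alpha> x \<and> u \<alpha> x \<le> u \<alpha> B)"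
    using ev by eventually_elim (use u(1,2,4) sp in auto)
  have e4: "\<forall>\<^sub>F \<alpha> in at_right 0. 0 < u \<alpha> B \<and> (\<forall>c. (\<forall>x\<in>space (state B). u \<alpha> x \<le> c) \<longrightarrow> u \<alpha> B \<le> c)"
    using ev by eventually_elim (use u(5) sp B in auto)
  have e5: "\<forall>\<^sub>F \<alpha> in at_right 0. \<forall>x\<in>space (state B). u \<alpha> x = 1 - 1 * (1 - akern b B (mixture \<alpha> \<rho>' \<rho>) (u \<alpha>) x) ^ b"
    using ev by eventually_elim (use u(3) in \<open>simp add: K_def\<close>)
  note nc = fam.near_critical[where s = "\<lambda>_. 1" and u = u and U = "\<lambda>\<alpha>. u \<alpha> B", OF b crit' e1 e2 e3 e4 U0 e5, folded c_def]
  have npos: "\<forall>\<^sub>F \<alpha> in at_right 0. 0 < n \<alpha>"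
    using nc(2) by eventually_elim (simp add: n_def K_def)
  have "((\<lambda>\<alpha>. akern b B (mixture \<alpha> \<rho>' \<rho>) (\<lambda>x. u \<alpha> x / n \<alpha>) (real b * v)) \<longlongrightarrow> k) (at_right 0)"
    unfolding k_def
  proof (rule fam.K_apply_tendsto[OF _ fam.K\<^sub>0.h_bfun])
    show "uniform_limit (space (state B)) (\<lambda>\<alpha> x. u \<alpha> x / n \<alpha>) (eigfun (akern b B \<rho>) 1) (at_right 0)"
      using nc(1) by (simp add: n_def K_def)
    show "\<forall>\<^sub>F \<alpha> in at_right 0. (\<lambda>x. u \<alpha> x / n \<alpha>) \<in> bfun (state B)"
      using ev
    proof eventually_elim
      case (elim \<alpha>)
      show ?case using bfun_scale[OF u(1)[OF elim], of "1 / n \<alpha>"] by simp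
    qed
  qed
  moreover have "((\<lambda>\<alpha>. (real b * L \<alpha> - 1) * n \<alpha> / (n \<alpha>)\<^sup>2) \<longlongrightarrow> c) (at_right 0)"
    using nc(3) by (simp add: n_def K_def L_def)
  ultimately have lim: "((\<lambda>\<alpha>. akern b B (mixture \<alpha> \<rho>' \<rho>) (\<lambda>x. u \<alpha> x / n \<alpha>) (real b * v) / ((real b * L \<alpha> - 1) * n \<alpha> / (n \<alpha>)\<^sup>2 * (k / c))) \<longlongrightarrow> k / (c * (k / c))) (at_right 0)"
  proof (intro tendsto_intros)
    show "c * (k / c) \<noteq> 0" using k fam.K\<^sub>0.h_square_pos b by (simp add: c_def)
  qed
  have c: "0 < c" using fam.K\<^sub>0.h_square_pos b by (simp add: c_def)
  have lim1: "((\<lambda>\<alpha>. akern b B (mixture \<alpha> \<rho>' \<rho>) (\<lambda>x. u \<alpha> x / n \<alpha>) (real b * v) / ((real b * L \<alpha> - 1) * n \<alpha> / (n \<alpha>)\<^sup>2 * (k / c))) \<longlongrightarrow> 1) (at_right 0)"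
    using lim c k by simp
  show ?thesis
  proof (rule asymp_equivI', rule Lim_transform_eventually[OF lim1])
    show "\<forall>\<^sub>F \<alpha> in at_right 0. akern b B (mixture \<alpha> \<rho>' \<rho>) (\<lambda>x. u \<alpha> x / n \<alpha>) (real b * v) / ((real b * L \<alpha> - 1) * n \<alpha> / (n \<alpha>)\<^sup>2 * (k / c)) =
      \<P>(x in tree_law b (mixture \<alpha> \<rho>' \<rho>). avalanche_size b v x = \<infinity>) / ((zz b (mixture \<alpha> \<rho>' \<rho>) - 1 / real b) * (real b * k / c))"
      using ev npos
    proof eventually_elim
      case (elim \<alpha>)
      interpret S: site_law "mixture \<alpha> \<rho>' \<rho>" b B D p by (rule law'[OF elim(1)])
      have "S.K (\<lambda>x. u \<alpha> x / n \<alpha>) (real b * v) = S.K (u \<alpha>) (real b * v) / n \<alpha>"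
        using fun_cong[OF S.K_scale[of "1 / n \<alpha>" "u \<alpha>"], of "real b * v"] by simp
      then show ?case
        unfolding P[OF elim(1)] zz[OF elim(1)]
        using elim(2) sup'[OF elim(1)] k c b by (simp add: K_def field_simps power2_eq_square)
    qed
  qed
qed


lemma critical_constants:
  assumes b: "1 < b" and B: "2 \<le> B" and \<rho>: "\<rho> \<in> M_flat b"
  shows "0 < real b * (real b - 1) / 2 * (1 / real b)\<^sup>2 * qsd (akern b B \<rho>) 1 (\<lambda>x. (eigfun (akern b B \<rho>) 1 x)\<^sup>2)"
    and "0 \<le> akern b B \<rho> (eigfun (akern b B \<rho>) 1) \<theta>"
    and "1 - x_star \<rho> < v \<Longrightarrow> v \<le> B - 1 \<Longrightarrow> 0 < akern b B \<rho> (eigfun (akern b B \<rho>) 1) (real b * v)"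
proof -
  obtain D p C \<epsilon> m \<eta> where law: "site_law \<rho> b B D p" and dk: "doeblin_kernel (state B) (akern b B \<rho>) p C \<epsilon> m \<eta> 1"
    using uniform_family[OF b B \<rho> \<rho>] by blast
  interpret S: site_law \<rho> b B D p by (rule law)
  interpret d: doeblin_kernel "state B" "akern b B \<rho>" p C \<epsilon> m \<eta> 1 by (rule dk)
  show "0 < real b * (real b - 1) / 2 * (1 / real b)\<^sup>2 * qsd (akern b B \<rho>) 1 (\<lambda>x. (eigfun (akern b B \<rho>) 1 x)\<^sup>2)"
    using d.h_square_pos b by simp
  show "0 \<le> akern b B \<rho> (eigfun (akern b B \<rho>) 1) \<theta>"
    using d.h_pos by (intro S.K_nonneg d.h_bfun) (auto simp: space_restrict_space intro: less_imp_le)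
  assume "1 - x_star \<rho> < v" "v \<le> B - 1"
  from kernel_mass_pos[OF \<rho> law this] d.K_one_le_K_h[of "real b * v"]
  have "0 < C * akern b B \<rho> (eigfun (akern b B \<rho>) 1) (real b * v)" by linarith
  then show "0 < akern b B \<rho> (eigfun (akern b B \<rho>) 1) (real b * v)"
    using d.C_ge_1 by (simp add: zero_less_mult_iff)
qed

text \<open>With \<open>b * \<Lambda> = 1\<close> the expansion reads
  \<open>(1 - s) / n\<^sup>2 \<rightarrow> c\<close>. Hence \<open>1 - s\<close> times the tail
  series is about \<open>k * n\<close>, that is \<open>k * sqrt ((1 - s) / c)\<close>; division by
  \<open>sqrt (1 - s)\<close> gives the hypothesis of the Tauberian theorem with constant
  \<open>k / sqrt c\<close>.\<close>

lemma critical_asymptotics: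
  assumes b: "1 < b" and B: "2 \<le> B" and \<rho>: "\<rho> \<in> M_flat b"
    and crit: "zz b \<rho> = 1 / real b" and v: "0 \<le> v" "v \<le> B - 1"
  defines "k \<equiv> akern b B \<rho> (eigfun (akern b B \<rho>) 1) (real b * v)"
    and "c \<equiv> real b * (real b - 1) / 2 * (1 / real b)\<^sup>2 * qsd (akern b B \<rho>) 1 (\<lambda>x. (eigfun (akern b B \<rho>) 1 x)\<^sup>2)"
  shows "(\<lambda>n. \<P>(x in tree_law b \<rho>. of_nat n \<le> avalanche_size b v x))
      \<sim>[at_top] (\<lambda>n. k / sqrt c / sqrt pi / real n powr (1 / 2))"
proof -
  obtain D p C \<epsilon> m \<eta> where law: "site_law \<rho> b B D p" and dk: "doeblin_kernel (state B) (akern b B \<rho>) p C \<epsilon> m \<eta> 1"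
    using uniform_family[OF b B \<rho> \<rho>] by blast
  interpret S: site_law \<rho> b B D p by (rule law)
  \<comment> \<open>The kernel does not move here; the index is the argument of the generating
    function.\<close>
  have fam: "doeblin_family (state B) S.K p C \<epsilon> m \<eta> 1 (\<lambda>_ :: real. S.K) (at_left 1) (\<lambda>_. 0)"
    by (intro doeblin_family.intro dk doeblin_family_axioms.intro) (simp_all add: dk)
  interpret fam: doeblin_family "state B" S.K p C \<epsilon> m \<eta> 1 "\<lambda>_ :: real. S.K" "at_left 1" "\<lambda>_. 0"
    by (rule fam)
  have sp: "space (state B) = {1..B}" by (simp add: space_restrict_space)
  have c: "0 < c" unfolding c_def by (rule critical_constants(1)[OF b B \<rho>])
  have k: "0 \<le> k" unfolding k_def by (rule critical_constants(2)[OF b B \<rho>])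
  have crit': "real b * eigval S.K 1 = 1"
    using zz_M_flat_eigval[OF b B \<rho>] crit b by (simp add: field_simps)
  define u where "u = (\<lambda>s. branch_limit b S.K s (1 - s))"
  define P where "P = (\<lambda>k. \<P>(x in S.T. of_nat (Suc k) \<le> avalanche_size b v x))"
  have u: "u s \<in> bfun (state B)" "0 \<le> u s \<theta>" "u s \<theta> \<le> 1" "u s \<theta> = 1 - s * (1 - S.K (u s) \<theta>) ^ b"
      "\<theta> \<in> {1..B} \<Longrightarrow> u s \<theta> \<le> u s B" "0 < u s B"
    and series: "(1 - s) * (\<Sum>k. P k * s ^ k) = S.K (u s) (real b * v)"
    if s: "0 < s" "s < 1" for s \<theta>
  proof -
    have s': "0 \<le> s" "s \<le> 1" using s by auto
    note L = S.branch_limit[OF s' disjI1[OF refl]]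
    show "u s \<in> bfun (state B)" "0 \<le> u s \<theta>" "u s \<theta> \<le> 1" "u s \<theta> = 1 - s * (1 - S.K (u s) \<theta>) ^ b"
      "\<theta> \<in> {1..B} \<Longrightarrow> u s \<theta> \<le> u s B"
      unfolding u_def using L(2-6) by auto
    have "incseq (\<lambda>n. branch_iter b S.K s (1 - s) n B)" by (intro incseq_SucI S.iter_increasing s')
    from incseq_le[OF this L(1), of 0] show "0 < u s B" using s by (simp add: u_def)
    show "(1 - s) * (\<Sum>k. P k * s ^ k) = S.K (u s) (real b * v)"
      unfolding P_def u_def by (rule S.tail_series[OF v s L(1,2)])
  qed
  have [measurable]: "{x \<in> space S.T. of_nat n \<le> avalanche_size b v x} \<in> sets S.T" for n by measurable
  have P0: "0 \<le> P n" for n by (simp add: P_def)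
  have dec: "decseq P"
    unfolding P_def
  proof (intro decseq_SucI S.T.finite_measure_mono subsetI)
    fix n x assume "x \<in> {x \<in> space S.T. of_nat (Suc (Suc n)) \<le> avalanche_size b v x}"
    moreover have "(of_nat (Suc n) :: ennreal) \<le> of_nat (Suc (Suc n))" by (rule of_nat_mono) simp
    ultimately show "x \<in> {x \<in> space S.T. of_nat (Suc n) \<le> avalanche_size b v x}"
      by (blast intro: order_trans)
  qed simp
  have P1: "P n \<le> 1" for n unfolding P_def by simp
  show ?thesis
  proof (cases "k = 0")
    \<comment> \<open>Asymptotic equivalence to 0 means eventual equality with 0, so the tails must
      vanish for positive \<open>n\<close>. They do, because \<open>k = 0\<close> forces the kernel
      mass at \<open>b v\<close> to be 0: the root almost surely does not topple.\<close>
    case True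
    have s: "(0::real) < 1 / 2" "(1::real) / 2 < 1" by auto
    have "S.K (u (1/2)) (real b * v) \<le> S.K (\<lambda>_. 1) (real b * v)"
      using u(1,3)[OF s] by (intro S.K_mono bfun_const) auto
    also have "\<dots> \<le> 0" using fam.K\<^sub>0.K_one_le_K_h[of "real b * v"] True by (simp add: k_def)
    finally have "(1 - 1 / 2) * (\<Sum>k. P k * (1/2) ^ k) \<le> 0" unfolding series[OF s] .
    then have "(\<Sum>k. P k * (1/2) ^ k) \<le> 0" by (simp add: mult_le_0_iff)
    moreover have sm: "summable (\<lambda>k. P k * (1/2) ^ k)"
      by (rule summable_comparison_test'[OF summable_geometric[of "1/2 :: real"], of 0])
        (use P0 P1 in \<open>auto simp: abs_mult mult_left_le_one_le\<close>)
    ultimately have "(\<Sum>k. P k * (1/2) ^ k) = 0" using suminf_nonneg[OF sm] P0 by fastforce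
    then have "P n = 0" for n using suminf_eq_zero_iff[OF sm] P0 by simp
    then have z: "\<P>(x in tree_law b \<rho>. of_nat (Suc n) \<le> avalanche_size b v x) = 0" for n by (simp only: P_def)
    have "\<forall>\<^sub>F n in at_top. \<P>(x in tree_law b \<rho>. of_nat n \<le> avalanche_size b v x) = k / sqrt c / sqrt pi / real n powr (1 / 2)"
      using eventually_gt_at_top[of 0]
    proof eventually_elim
      case (elim n)
      then obtain j where "n = Suc j" by (cases n) auto
      then show ?case by (simp only: z True div_0)
    qed
    then show ?thesis by (rule asymp_equiv_refl_ev)
  next
    case False
    then have k: "0 < k" using k by simp
    define n where "n s = qsd S.K 1 (u s)" for s
    have ev: "\<forall>\<^sub>F s in at_left 1. 0 < s \<and> s < (1::real)"
      by (rule eventually_mono[OF eventually_at_left_real[of 0 1]]) auto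
    have U0: "((\<lambda>s. u s B) \<longlongrightarrow> 0) (at_left 1)"
    proof (rule tendsto_zero_double[OF extinction[OF law dk crit']])
      show "((\<lambda>s::real. (\<Sum>i<N. real b ^ i) * (1 - s)) \<longlongrightarrow> 0) (at_left 1)" for N
        by (auto intro!: tendsto_eq_intros)
      show "\<forall>\<^sub>F s in at_left 1. 0 \<le> u s B \<and> u s B \<le> branch_iter b S.K 1 1 N B + (\<Sum>i<N. real b ^ i) * (1 - s)" for N
        using ev
      proof eventually_elim
        case (elim s)
        show ?case using S.pgf_deficit_small[of s B N] u(2)[of s B] elim B by (simp add: u_def)
      qed
    qed
    have e1: "\<forall>\<^sub>F s in at_left (1::real). 1 \<le> real b * eigval S.K 1" using crit' by simp
    have e2: "\<forall>\<^sub>F s in at_left (1::real). 0 \<le> s \<and> s \<le> 1" using ev by eventually_elim simp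
    have e3: "\<forall>\<^sub>F s in at_left 1. u s \<in> bfun (state B) \<and> (\<forall>x\<in>space (state B). 0 \<le> u s x \<and> u s x \<le> u s B)"
      using ev by eventually_elim (use u(1,2,5) sp in auto)
    have e4: "\<forall>\<^sub>F s in at_left 1. 0 < u s B \<and> (\<forall>c. (\<forall>x\<in>space (state B). u s x \<le> c) \<longrightarrow> u s B \<le> c)"
      using ev by eventually_elim (use u(6) sp B in auto)
    have e5: "\<forall>\<^sub>F s in at_left 1. \<forall>x\<in>space (state B). u s x = 1 - s * (1 - S.K (u s) x) ^ b"
      using ev by eventually_elim (use u(4) in blast)
    note nc = fam.near_critical[where s = "\<lambda>s. s" and u = u and U = "\<lambda>s. u s B", OF b crit' e1 e2 e3 e4 U0 e5, folded c_def n_def]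
    have npos: "\<forall>\<^sub>F s in at_left 1. 0 < n s" using nc(2) by eventually_elim simp
    have "\<forall>\<^sub>F s in at_left 1. (\<lambda>x. u s x / n s) \<in> bfun (state B)"
      using ev
    proof eventually_elim
      case (elim s)
      show ?case using bfun_scale[OF u(1), of s "1 / n s"] elim by simp
    qed
    from fam.K_apply_tendsto[OF this fam.K\<^sub>0.h_bfun nc(1), of "real b * v"]
    have kl: "((\<lambda>s. S.K (\<lambda>x. u s x / n s) (real b * v)) \<longlongrightarrow> k) (at_left 1)" by (simp only: k_def)
    have "((\<lambda>s. (1 - s) / (n s)\<^sup>2) \<longlongrightarrow> c) (at_left 1)" using nc(3) crit' by simp
    from tendsto_divide[OF kl tendsto_real_sqrt[OF this]] c
    have lim: "((\<lambda>s. S.K (\<lambda>x. u s x / n s) (real b * v) / sqrt ((1 - s) / (n s)\<^sup>2)) \<longlongrightarrow> k / sqrt c) (at_left 1)" by simp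
    interpret karamata P "k / sqrt c"
    proof
      show "((\<lambda>s. sqrt (1 - s) * (\<Sum>n. P n * s ^ n)) \<longlongrightarrow> k / sqrt c) (at_left 1)"
      proof (rule Lim_transform_eventually[OF lim])
        show "\<forall>\<^sub>F s in at_left 1. S.K (\<lambda>x. u s x / n s) (real b * v) / sqrt ((1 - s) / (n s)\<^sup>2) = sqrt (1 - s) * (\<Sum>n. P n * s ^ n)"
          using ev npos
        proof eventually_elim
          case (elim s)
          have "S.K (\<lambda>x. u s x / n s) (real b * v) = S.K (u s) (real b * v) / n s"
            using fun_cong[OF S.K_scale[of "1 / n s" "u s"], of "real b * v"] by simp
          also have "\<dots> = (1 - s) * (\<Sum>k. P k * s ^ k) / n s" using series[of s] elim by simp
          finally have "S.K (\<lambda>x. u s x / n s) (real b * v) / sqrt ((1 - s) / (n s)\<^sup>2) =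
              (1 - s) / sqrt (1 - s) * (\<Sum>k. P k * s ^ k)"
            using elim by (simp add: real_sqrt_divide)
          then show ?case using elim by (simp add: real_div_sqrt)
        qed
      qed
    qed (use P0 dec in auto)
    define \<Theta> where "\<Theta> = k / sqrt c / sqrt pi"
    have \<Theta>: "0 < \<Theta>" using k c by (simp add: \<Theta>_def)
    have l1: "(\<lambda>n. P n * sqrt (real n)) \<longlonglongrightarrow> \<Theta>"
      unfolding \<Theta>_def using k c by (intro coefficient_asymptotics) simp
    \<comment> \<open>\<open>P n\<close> is the tail at \<open>n + 1\<close>, so the index is
      shifted before the comparison with the power.\<close>
    have l2: "(\<lambda>n. sqrt (real n + 1) / sqrt (real n)) \<longlonglongrightarrow> 1" by real_asymp
    from tendsto_divide[OF tendsto_mult[OF l1 l2] tendsto_const[of \<Theta>]] \<Theta>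
    have l3: "(\<lambda>n. P n * sqrt (real n) * (sqrt (real n + 1) / sqrt (real n)) / \<Theta>) \<longlonglongrightarrow> 1" by simp
    have "(\<lambda>n. \<P>(x in tree_law b \<rho>. of_nat n \<le> avalanche_size b v x) / (\<Theta> / real n powr (1 / 2))) \<longlonglongrightarrow> 1"
    proof (rule LIMSEQ_imp_Suc, rule Lim_transform_eventually[OF l3])
      show "\<forall>\<^sub>F n in at_top. P n * sqrt (real n) * (sqrt (real n + 1) / sqrt (real n)) / \<Theta> =
          \<P>(x in tree_law b \<rho>. of_nat (Suc n) \<le> avalanche_size b v x) / (\<Theta> / real (Suc n) powr (1 / 2))"
        using eventually_gt_at_top[of 0]
      proof eventually_elim
        case (elim n)
        have "real (Suc n) powr (1 / 2) = sqrt (real n + 1)" by (simp add: powr_half_sqrt add.commute)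
        then show ?case using elim unfolding P_def by (simp del: of_nat_Suc)
      qed
    qed
    then show ?thesis unfolding \<Theta>_def by (rule asymp_equivI')
  qed
qed

theorem theorem4p1:
  fixes b :: nat and \<rho> :: "real measure"
  assumes "b > 1" and "\<rho> \<in> M_flat b" and "zz b \<rho> = zz_crit b"
  shows "\<exists>\<tau> \<T> \<Theta> :: real \<Rightarrow> real.
    (\<forall>v > 1 - x_star \<rho>. \<tau> v > 0 \<and> \<T> v > 0) \<and> (\<forall>v\<ge>0. \<Theta> v \<ge> 0) \<and>
    \<comment> \<open>subcritical perturbations\<close>
    (\<forall>\<rho>' \<in> M_flat b. (\<forall>\<alpha>\<in>{0<..1}. zz b (mixture \<alpha> \<rho>' \<rho>) < zz_crit b) \<longrightarrow>
      (\<forall>v > 1 - x_star \<rho>.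
        (\<forall>\<^sub>F \<alpha> in at_right 0.
          (\<integral>\<^sup>+x. avalanche_size b v x \<partial>tree_law b (mixture \<alpha> \<rho>' \<rho>)) < \<infinity>) \<and>
        (\<lambda>\<alpha>. enn2real (\<integral>\<^sup>+x. avalanche_size b v x \<partial>tree_law b (mixture \<alpha> \<rho>' \<rho>)))
          \<sim>[at_right 0] (\<lambda>\<alpha>. \<tau> v / (zz_crit b - zz b (mixture \<alpha> \<rho>' \<rho>))))) \<and>
    \<comment> \<open>criticality\<close>
    (\<forall>v\<ge>0. (\<lambda>n. \<P>(x in tree_law b \<rho>. avalanche_size b v x \<ge> of_nat n))
        \<sim>[at_top] (\<lambda>n. \<Theta> v / real n powr (1 / 2))) \<and>
    (\<forall>v > 1 - x_star \<rho>. \<Theta> v > 0) \<and>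
    \<comment> \<open>supercritical perturbations\<close>
    (\<forall>\<rho>' \<in> M_flat b. (\<forall>\<alpha>\<in>{0<..1}. zz b (mixture \<alpha> \<rho>' \<rho>) > zz_crit b) \<longrightarrow>
      (\<forall>v > 1 - x_star \<rho>.
        (\<lambda>\<alpha>. \<P>(x in tree_law b (mixture \<alpha> \<rho>' \<rho>). avalanche_size b v x = \<infinity>))
          \<sim>[at_right 0] (\<lambda>\<alpha>. (zz b (mixture \<alpha> \<rho>' \<rho>) - zz_crit b) * \<T> v)))"
proof -
  \<comment> \<open>The root value is at most \<open>1 + v\<close>, so the type space is chosen to
    depend on \<open>v\<close>. The resulting constants involve \<rho> and \<open>v\<close> only and
    thus serve every \<rho>'.\<close>
  define B where "B = (\<lambda>v :: real. max 2 (1 + v))"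
  define k where "k = (\<lambda>v. akern b (B v) \<rho> (eigfun (akern b (B v) \<rho>) 1) (real b * v))"
  define c where "c = (\<lambda>v. real b * (real b - 1) / 2 * (1 / real b)\<^sup>2 *
    qsd (akern b (B v) \<rho>) 1 (\<lambda>x. (eigfun (akern b (B v) \<rho>) 1 x)\<^sup>2))"
  have B: "2 \<le> B v" "v \<le> B v - 1" for v by (auto simp: B_def)
  have c: "0 < c v" for v unfolding c_def by (rule critical_constants(1)[OF assms(1) B(1) assms(2)])
  have k: "0 \<le> k v" for v unfolding k_def by (rule critical_constants(2)[OF assms(1) B(1) assms(2)])
  have k': "0 < k v" "0 \<le> v" if "1 - x_star \<rho> < v" for v
    using critical_constants(3)[OF assms(1) B(1) assms(2) that B(2)] x_star_le_1[OF assms(2)] that by (auto simp: k_def)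
  have crit: "zz b \<rho> = 1 / real b" using assms(3) by (simp add: zz_crit_def)
  show ?thesis
  proof (rule exI[of _ "\<lambda>v. k v / real b"], rule exI[of _ "\<lambda>v. real b * k v / c v"],
      rule exI[of _ "\<lambda>v. k v / sqrt (c v) / sqrt pi"], intro conjI allI impI ballI)
    fix v :: real
    show "0 < k v / real b" "0 < real b * k v / c v" "0 < k v / sqrt (c v) / sqrt pi" if "1 - x_star \<rho> < v"
      using k'[OF that] c[of v] assms(1) by auto
    show "0 \<le> k v / sqrt (c v) / sqrt pi" using k[of v] c[of v] by simp
    show "(\<lambda>n. \<P>(x in tree_law b \<rho>. of_nat n \<le> avalanche_size b v x))
        \<sim>[at_top] (\<lambda>n. k v / sqrt (c v) / sqrt pi / real n powr (1 / 2))" if "0 \<le> v"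
      unfolding k_def c_def by (rule critical_asymptotics[OF assms(1) B(1) assms(2) crit that B(2)])
    fix \<rho>' assume \<rho>': "\<rho>' \<in> M_flat b"
    note sc = assms(1) B(1) assms(2) \<rho>' crit
    {
      assume "\<forall>\<alpha>\<in>{0<..1}. zz b (mixture \<alpha> \<rho>' \<rho>) < zz_crit b" and v: "1 - x_star \<rho> < v"
      then have sub: "zz b (mixture \<alpha> \<rho>' \<rho>) < 1 / real b" if "\<alpha> \<in> {0<..1/2}" for \<alpha>
        using that by (simp add: zz_crit_def)
      note a = subcritical_asymptotics[OF sc sub k'(2)[OF v] B(2) k'(1)[OF v, unfolded k_def]]
      show "\<forall>\<^sub>F \<alpha> in at_right 0. (\<integral>\<^sup>+x. avalanche_size b v x \<partial>tree_law b (mixture \<alpha> \<rho>' \<rho>)) < \<infinity>"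
        by (rule a(1))
      show "(\<lambda>\<alpha>. enn2real (\<integral>\<^sup>+x. avalanche_size b v x \<partial>tree_law b (mixture \<alpha> \<rho>' \<rho>)))
          \<sim>[at_right 0] (\<lambda>\<alpha>. k v / real b / (zz_crit b - zz b (mixture \<alpha> \<rho>' \<rho>)))"
        unfolding k_def zz_crit_def by (rule a(2))
    }
    assume "\<forall>\<alpha>\<in>{0<..1}. zz_crit b < zz b (mixture \<alpha> \<rho>' \<rho>)" and v: "1 - x_star \<rho> < v"
    then have sup: "1 / real b < zz b (mixture \<alpha> \<rho>' \<rho>)" if "\<alpha> \<in> {0<..1/2}" for \<alpha>
      using that by (simp add: zz_crit_def)
    show "(\<lambda>\<alpha>. \<P>(x in tree_law b (mixture \<alpha> \<rho>' \<rho>). avalanche_size b v x = \<infinity>))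
        \<sim>[at_right 0] (\<lambda>\<alpha>. (zz b (mixture \<alpha> \<rho>' \<rho>) - zz_crit b) * (real b * k v / c v))"
      unfolding k_def c_def zz_crit_def
      by (rule supercritical_asymptotics[OF sc sup k'(2)[OF v] B(2) k'(1)[OF v, unfolded k_def]])
  qed
qed

end
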